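(* Let $F$ be a field. A (not necessarily associative) $F$-algebra $A$ is semiassociative if and only if it is a form of a skew matrix algebra, i.e. if and only if there are a separable field extension $E/F$, an integer $n\ge 1$ and a reduced skew set $c$ of degree $n$ over $E$ such that $E\otimes_F A\cong M_n(E;c)$.
   Context: Algebras are unital. The associator is $(x,y,z)=(xy)z-x(yz)$; the nucleus $\mathfrak{N}(A)$ is the set of $x\in A$ with $(x,A,A)=(A,x,A)=(A,A,x)=0$, an associative subalgebra; the center is $Z(A)=\{x\in\mathfrak{N}(A):xa=ax\text{ for all }a\in A\}$; $A$ is $F$-central if $Z(A)=F$. An étale $F$-algebra is a finite direct product of finite separable field extensions of $F$. A module over an associative ring is minimally faithful if it is faithful and has no faithful proper section (quotient of submodules). A finite dimensional $F$-central algebra $A$ is semiassociative if there is an étale $F$-subalgebra $K\subseteq\mathfrak{N}(A)$ (containing $1_A$) such that $A$ is minimally faithful (equivalently, faithful and cyclic) as a $K\otimes_F K$-module via $(k\otimes k')a=kak'$. A reduced skew set of degree $n$ over a field $E$ is a family $c=(c_{ijk})_{1\le i,j,k\le n}$ of elements of $E$ (zeros allowed) with $c_{iij}=c_{ijj}=1$ for all $i,j$. The skew matrix algebra $M_n(E;c)$ is the $E$-algebra with basis $\{e_{ij}\}_{1\le i,j\le n}$ and multiplication $e_{ij}e_{k\ell}=\delta_{jk}c_{ij\ell}e_{i\ell}$. An $F$-algebra $A$ is a form of $A'$ if $E\otimes_F A\cong A'$ for some separable field extension $E/F$. *)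

theory Defs
  imports "HOL-Algebra.Algebra"
begin

section \<open>Nonassociative algebras\<close>

text \<open>
  The record type \<^typ>\<open>('f, 'a) module\<close> carries a multiplication and a unit besides the module
  operations, so it also serves as the signature of a (unital, not necessarily associative)
  algebra over a ring \<open>F\<close>.
\<close>

locale nonassoc_algebra = module F A for F (structure) and A (structure) +
  assumes one_closed: "\<one>\<^bsub>A\<^esub> \<in> carrier A"
    and mult_closed: "\<lbrakk>x \<in> carrier A; y \<in> carrier A\<rbrakk> \<Longrightarrow> x \<otimes>\<^bsub>A\<^esub> y \<in> carrier A"
    and one_mult: "x \<in> carrier A \<Longrightarrow> \<one>\<^bsub>A\<^esub> \<otimes>\<^bsub>A\<^esub> x = x"
    and mult_one: "x \<in> carrier A \<Longrightarrow> x \<otimes>\<^bsub>A\<^esub> \<one>\<^bsub>A\<^esub> = x"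
    and distrib_right: "\<lbrakk>x \<in> carrier A; y \<in> carrier A; z \<in> carrier A\<rbrakk> \<Longrightarrow>
      (x \<oplus>\<^bsub>A\<^esub> y) \<otimes>\<^bsub>A\<^esub> z = x \<otimes>\<^bsub>A\<^esub> z \<oplus>\<^bsub>A\<^esub> y \<otimes>\<^bsub>A\<^esub> z"
    and distrib_left: "\<lbrakk>x \<in> carrier A; y \<in> carrier A; z \<in> carrier A\<rbrakk> \<Longrightarrow>
      z \<otimes>\<^bsub>A\<^esub> (x \<oplus>\<^bsub>A\<^esub> y) = z \<otimes>\<^bsub>A\<^esub> x \<oplus>\<^bsub>A\<^esub> z \<otimes>\<^bsub>A\<^esub> y"
    and smult_mult: "\<lbrakk>r \<in> carrier F; x \<in> carrier A; y \<in> carrier A\<rbrakk> \<Longrightarrow>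
      (r \<odot>\<^bsub>A\<^esub> x) \<otimes>\<^bsub>A\<^esub> y = r \<odot>\<^bsub>A\<^esub> (x \<otimes>\<^bsub>A\<^esub> y)"
    and mult_smult: "\<lbrakk>r \<in> carrier F; x \<in> carrier A; y \<in> carrier A\<rbrakk> \<Longrightarrow>
      x \<otimes>\<^bsub>A\<^esub> (r \<odot>\<^bsub>A\<^esub> y) = r \<odot>\<^bsub>A\<^esub> (x \<otimes>\<^bsub>A\<^esub> y)"

definition associator :: "('a, 'm) ring_scheme \<Rightarrow> 'a \<Rightarrow> 'a \<Rightarrow> 'a \<Rightarrow> 'a" where
  "associator A x y z = (x \<otimes>\<^bsub>A\<^esub> y) \<otimes>\<^bsub>A\<^esub> z \<ominus>\<^bsub>A\<^esub> x \<otimes>\<^bsub>A\<^esub> (y \<otimes>\<^bsub>A\<^esub> z)"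

definition nucleus :: "('a, 'm) ring_scheme \<Rightarrow> 'a set" where
  "nucleus A = {x \<in> carrier A. \<forall>a \<in> carrier A. \<forall>b \<in> carrier A.
     associator A x a b = \<zero>\<^bsub>A\<^esub> \<and> associator A a x b = \<zero>\<^bsub>A\<^esub> \<and> associator A a b x = \<zero>\<^bsub>A\<^esub>}"

definition nonassoc_center :: "('a, 'm) ring_scheme \<Rightarrow> 'a set" where
  "nonassoc_center A = {x \<in> nucleus A. \<forall>a \<in> carrier A. x \<otimes>\<^bsub>A\<^esub> a = a \<otimes>\<^bsub>A\<^esub> x}"

text \<open>\<open>Z(A) = F\<close>: the structure map \<open>r \<mapsto> r \<cdot> 1\<close> identifies \<open>F\<close> with the center. In particular
  the zero algebra is not central.\<close>

definition central_algebra :: "('f, 'm) ring_scheme \<Rightarrow> ('f, 'a) module \<Rightarrow> bool" where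
  "central_algebra F A \<longleftrightarrow> bij_betw (\<lambda>r. r \<odot>\<^bsub>A\<^esub> \<one>\<^bsub>A\<^esub>) (carrier F) (nonassoc_center A)"

definition finite_dimensional :: "('f, 'm) ring_scheme \<Rightarrow> ('f, 'a) module \<Rightarrow> bool" where
  "finite_dimensional F M \<longleftrightarrow> (\<exists>S. finite S \<and> S \<subseteq> carrier M \<and>
     (\<forall>x \<in> carrier M. \<exists>a \<in> S \<rightarrow> carrier F. x = (\<Oplus>\<^bsub>M\<^esub> s \<in> S. a s \<odot>\<^bsub>M\<^esub> s)))"

definition unital_subalgebra ::
    "('f, 'm) ring_scheme \<Rightarrow> 'a set \<Rightarrow> ('f, 'a) module \<Rightarrow> bool" where
  "unital_subalgebra F K A \<longleftrightarrow> submodule K F A \<and> \<one>\<^bsub>A\<^esub> \<in> K \<and>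
     (\<forall>x \<in> K. \<forall>y \<in> K. x \<otimes>\<^bsub>A\<^esub> y \<in> K)"

definition algebra_isos ::
    "('f, 'm) ring_scheme \<Rightarrow> ('f, 'a) module \<Rightarrow> ('f, 'b) module \<Rightarrow> ('a \<Rightarrow> 'b) set" where
  "algebra_isos F A B = {h. bij_betw h (carrier A) (carrier B) \<and> h \<one>\<^bsub>A\<^esub> = \<one>\<^bsub>B\<^esub> \<and>
     (\<forall>x \<in> carrier A. \<forall>y \<in> carrier A.
        h (x \<oplus>\<^bsub>A\<^esub> y) = h x \<oplus>\<^bsub>B\<^esub> h y \<and> h (x \<otimes>\<^bsub>A\<^esub> y) = h x \<otimes>\<^bsub>B\<^esub> h y) \<and>
     (\<forall>r \<in> carrier F. \<forall>x \<in> carrier A. h (r \<odot>\<^bsub>A\<^esub> x) = r \<odot>\<^bsub>B\<^esub> h x)}"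

definition algebra_isomorphic ::
    "('f, 'm) ring_scheme \<Rightarrow> ('f, 'a) module \<Rightarrow> ('f, 'b) module \<Rightarrow> bool" where
  "algebra_isomorphic F A B \<longleftrightarrow> algebra_isos F A B \<noteq> {}"


section \<open>Separable extensions and \'etale algebras\<close>

text \<open>Polynomials are coefficient lists, leading coefficient first, as in
  \<^theory>\<open>HOL-Algebra.Polynomials\<close>.\<close>

definition poly_derivative :: "('a, 'm) ring_scheme \<Rightarrow> 'a list \<Rightarrow> 'a list" where
  "poly_derivative R p =
     ring.normalize R (map (\<lambda>i. add_pow R i (ring.coeff R p i)) (rev [1..<length p]))"

definition separable_poly :: "('a, 'm) ring_scheme \<Rightarrow> 'a set \<Rightarrow> 'a list \<Rightarrow> bool" where
  "separable_poly R K p \<longleftrightarrow> (\<exists>u \<in> carrier (K[X]\<^bsub>R\<^esub>). \<exists>v \<in> carrier (K[X]\<^bsub>R\<^esub>).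
     (u \<otimes>\<^bsub>K[X]\<^bsub>R\<^esub>\<^esub> p) \<oplus>\<^bsub>K[X]\<^bsub>R\<^esub>\<^esub> (v \<otimes>\<^bsub>K[X]\<^bsub>R\<^esub>\<^esub> poly_derivative R p) = \<one>\<^bsub>K[X]\<^bsub>R\<^esub>\<^esub>)"

text \<open>A field extension \<open>E/F\<close> is a commutative \<open>F\<close>-algebra \<open>E\<close> that is a field; \<open>F\<close> embeds by
  \<open>r \<mapsto> r \<cdot> 1\<close>, and \<open>Irr\<close> is the minimal polynomial over the image.\<close>

definition base_image :: "('f, 'm) ring_scheme \<Rightarrow> ('f, 'e) module \<Rightarrow> 'e set" where
  "base_image F E = (\<lambda>r. r \<odot>\<^bsub>E\<^esub> \<one>\<^bsub>E\<^esub>) ` carrier F"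

definition separable_extension :: "('f, 'm) ring_scheme \<Rightarrow> ('f, 'e) module \<Rightarrow> bool" where
  "separable_extension F E \<longleftrightarrow> field F \<and> field E \<and> algebra F E \<and>
     (\<forall>x \<in> carrier E. ring.algebraic E (base_image F E) x \<and>
        separable_poly E (base_image F E) (ring.Irr E (base_image F E) x))"

definition product_algebra :: "nat set \<Rightarrow> (nat \<Rightarrow> ('f, 'a) module) \<Rightarrow> ('f, nat \<Rightarrow> 'a) module" where
  "product_algebra I L =
     \<lparr>carrier = (\<Pi>\<^sub>E i \<in> I. carrier (L i)),
      monoid.mult = (\<lambda>x y. \<lambda>i \<in> I. x i \<otimes>\<^bsub>L i\<^esub> y i), one = (\<lambda>i \<in> I. \<one>\<^bsub>L i\<^esub>),
      ring.zero = (\<lambda>i \<in> I. \<zero>\<^bsub>L i\<^esub>), ring.add = (\<lambda>x y. \<lambda>i \<in> I. x i \<oplus>\<^bsub>L i\<^esub> y i),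
      module.smult = (\<lambda>r x. \<lambda>i \<in> I. r \<odot>\<^bsub>L i\<^esub> x i)\<rparr>"

text \<open>The factors live in the type of \<open>K\<close> itself. This is no restriction: up to isomorphism the
  factors of a product decomposition of \<open>K\<close> are ideals of \<open>K\<close>.\<close>

definition etale_algebra :: "('f, 'm) ring_scheme \<Rightarrow> ('f, 'a) module \<Rightarrow> bool" where
  "etale_algebra F K \<longleftrightarrow> (\<exists>(r :: nat) (L :: nat \<Rightarrow> ('f, 'a) module).
     (\<forall>i < r. separable_extension F (L i) \<and> finite_dimensional F (L i)) \<and>
     algebra_isomorphic F K (product_algebra {..<r} L))"


section \<open>Tensor products of algebras\<close>

text \<open>
  The list \<open>[(b\<^sub>1, c\<^sub>1), \<dots>, (b\<^sub>k, c\<^sub>k)]\<close> stands for the sum of the pure tensors \<open>b\<^sub>i \<otimes> c\<^sub>i\<close>.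
  \<open>B \<otimes>\<^sub>F C\<close> consists of the classes of such lists modulo the congruence generated by commutativity
  of the sum, \<open>F\<close>-balancedness and biadditivity. The free monoid on the pairs replaces the usual
  free group, so \<open>0 \<otimes> c = 0\<close> has to be imposed; then \<open>(- b) \<otimes> c\<close> is the negative of \<open>b \<otimes> c\<close>.
\<close>

inductive tensor_rel ::
    "('f, 'm) ring_scheme \<Rightarrow> ('f, 'b) module \<Rightarrow> ('f, 'c) module \<Rightarrow>
     ('b \<times> 'c) list \<Rightarrow> ('b \<times> 'c) list \<Rightarrow> bool"
  for F B C where
  refl: "xs \<in> lists (carrier B \<times> carrier C) \<Longrightarrow> tensor_rel F B C xs xs"
| sym: "tensor_rel F B C xs ys \<Longrightarrow> tensor_rel F B C ys xs"
| trans: "\<lbrakk>tensor_rel F B C xs ys; tensor_rel F B C ys zs\<rbrakk> \<Longrightarrow> tensor_rel F B C xs zs"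
| append: "\<lbrakk>tensor_rel F B C xs ys; tensor_rel F B C xs' ys'\<rbrakk> \<Longrightarrow>
    tensor_rel F B C (xs @ xs') (ys @ ys')"
| commute: "\<lbrakk>xs \<in> lists (carrier B \<times> carrier C); ys \<in> lists (carrier B \<times> carrier C)\<rbrakk> \<Longrightarrow>
    tensor_rel F B C (xs @ ys) (ys @ xs)"
| add_left: "\<lbrakk>b \<in> carrier B; b' \<in> carrier B; c \<in> carrier C\<rbrakk> \<Longrightarrow>
    tensor_rel F B C [(b \<oplus>\<^bsub>B\<^esub> b', c)] [(b, c), (b', c)]"
| add_right: "\<lbrakk>b \<in> carrier B; c \<in> carrier C; c' \<in> carrier C\<rbrakk> \<Longrightarrow>
    tensor_rel F B C [(b, c \<oplus>\<^bsub>C\<^esub> c')] [(b, c), (b, c')]"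
| balanced: "\<lbrakk>r \<in> carrier F; b \<in> carrier B; c \<in> carrier C\<rbrakk> \<Longrightarrow>
    tensor_rel F B C [(r \<odot>\<^bsub>B\<^esub> b, c)] [(b, r \<odot>\<^bsub>C\<^esub> c)]"
| zero: "c \<in> carrier C \<Longrightarrow> tensor_rel F B C [(\<zero>\<^bsub>B\<^esub>, c)] []"

definition tensor_class ::
    "('f, 'm) ring_scheme \<Rightarrow> ('f, 'b) module \<Rightarrow> ('f, 'c) module \<Rightarrow>
     ('b \<times> 'c) list \<Rightarrow> ('b \<times> 'c) list set" where
  "tensor_class F B C xs = {ys. tensor_rel F B C xs ys}"

definition tensor_list_mult ::
    "('b, 'm) ring_scheme \<Rightarrow> ('c, 'n) ring_scheme \<Rightarrow>
     ('b \<times> 'c) list \<Rightarrow> ('b \<times> 'c) list \<Rightarrow> ('b \<times> 'c) list" where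
  "tensor_list_mult B C xs ys =
     concat (map (\<lambda>(b, c). map (\<lambda>(b', c'). (b \<otimes>\<^bsub>B\<^esub> b', c \<otimes>\<^bsub>C\<^esub> c')) ys) xs)"

text \<open>
  Operations on classes are unions over representatives (as for \<^const>\<open>rcoset_mult\<close>); all
  representatives contribute the same class. The result is an algebra over the left factor, with
  \<open>b' \<cdot> (b \<otimes> c) = b'b \<otimes> c\<close>; for a field extension \<open>E/F\<close> this makes \<open>E \<otimes>\<^sub>F A\<close> an \<open>E\<close>-algebra.
\<close>

definition tensor_algebra ::
    "('f, 'm) ring_scheme \<Rightarrow> ('f, 'b) module \<Rightarrow> ('f, 'c) module \<Rightarrow>
     ('b, ('b \<times> 'c) list set) module" where
  "tensor_algebra F B C =
     \<lparr>carrier = tensor_class F B C ` lists (carrier B \<times> carrier C),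
      monoid.mult = (\<lambda>S T. \<Union>xs \<in> S. \<Union>ys \<in> T. tensor_class F B C (tensor_list_mult B C xs ys)),
      one = tensor_class F B C [(\<one>\<^bsub>B\<^esub>, \<one>\<^bsub>C\<^esub>)],
      ring.zero = tensor_class F B C [],
      ring.add = (\<lambda>S T. \<Union>xs \<in> S. \<Union>ys \<in> T. tensor_class F B C (xs @ ys)),
      module.smult = (\<lambda>b' S. \<Union>xs \<in> S. tensor_class F B C (map (\<lambda>(b, c). (b' \<otimes>\<^bsub>B\<^esub> b, c)) xs))\<rparr>"


section \<open>Minimally faithful modules and semiassociative algebras\<close>

definition faithful_module :: "('r, 'm) ring_scheme \<Rightarrow> ('r, 'a) module \<Rightarrow> bool" where
  "faithful_module R M \<longleftrightarrow>
     (\<forall>r \<in> carrier R. (\<forall>x \<in> carrier M. r \<odot>\<^bsub>M\<^esub> x = \<zero>\<^bsub>M\<^esub>) \<longrightarrow> r = \<zero>\<^bsub>R\<^esub>)"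

text \<open>The section \<open>N / N'\<close> of \<open>M\<close>. The fields \<open>mult\<close> and \<open>one\<close> play no role in a module.\<close>

definition section_module :: "('r, 'a) module \<Rightarrow> 'a set \<Rightarrow> 'a set \<Rightarrow> ('r, 'a set) module" where
  "section_module M N N' =
     \<lparr>carrier = a_rcosets\<^bsub>M\<lparr>carrier := N\<rparr>\<^esub> N', monoid.mult = undefined, one = undefined,
      ring.zero = N', add = set_add M,
      module.smult = (\<lambda>r S. \<Union>x \<in> S. N' +>\<^bsub>M\<^esub> (r \<odot>\<^bsub>M\<^esub> x))\<rparr>"

definition minimally_faithful :: "('r, 'm) ring_scheme \<Rightarrow> ('r, 'a) module \<Rightarrow> bool" where
  "minimally_faithful R M \<longleftrightarrow> module R M \<and> faithful_module R M \<and>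
     (\<forall>N N'. submodule N R M \<and> submodule N' R M \<and> N' \<subseteq> N \<and>
        faithful_module R (section_module M N N') \<longrightarrow> N = carrier M \<and> N' = {\<zero>\<^bsub>M\<^esub>})"

text \<open>\<open>(\<Sum>\<^sub>i k\<^sub>i \<otimes> k'\<^sub>i) a = \<Sum>\<^sub>i k\<^sub>i a k'\<^sub>i\<close> for a list of representatives. For \<open>k, k'\<close> in the nucleus the
  bracketing of \<open>k a k'\<close> is irrelevant.\<close>

definition bimodule_sum :: "('a, 'm) ring_scheme \<Rightarrow> ('a \<times> 'a) list \<Rightarrow> 'a \<Rightarrow> 'a" where
  "bimodule_sum A ts a = foldr (\<lambda>(k, k') s. ((k \<otimes>\<^bsub>A\<^esub> a) \<otimes>\<^bsub>A\<^esub> k') \<oplus>\<^bsub>A\<^esub> s) ts \<zero>\<^bsub>A\<^esub>"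

text \<open>The algebra \<open>A\<close> as a \<open>K \<otimes>\<^sub>F K\<close>-module; all representatives of a tensor act in the same way.\<close>

definition bimodule :: "('f, 'a) module \<Rightarrow> (('a \<times> 'a) list set, 'a) module" where
  "bimodule A =
     \<lparr>carrier = carrier A, monoid.mult = (\<otimes>\<^bsub>A\<^esub>), one = \<one>\<^bsub>A\<^esub>, ring.zero = \<zero>\<^bsub>A\<^esub>, ring.add = (\<oplus>\<^bsub>A\<^esub>),
      module.smult = (\<lambda>t a. the_elem ((\<lambda>ts. bimodule_sum A ts a) ` t))\<rparr>"

definition semiassociative :: "('f, 'm) ring_scheme \<Rightarrow> ('f, 'a) module \<Rightarrow> bool" where
  "semiassociative F A \<longleftrightarrow>
     nonassoc_algebra F A \<and> finite_dimensional F A \<and> central_algebra F A \<and>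
     (\<exists>K. unital_subalgebra F K A \<and> K \<subseteq> nucleus A \<and> etale_algebra F (A\<lparr>carrier := K\<rparr>) \<and>
        minimally_faithful (tensor_algebra F (A\<lparr>carrier := K\<rparr>) (A\<lparr>carrier := K\<rparr>)) (bimodule A))"


section \<open>Skew matrix algebras and forms\<close>

definition reduced_skew_set ::
    "('e, 'm) ring_scheme \<Rightarrow> nat \<Rightarrow> (nat \<Rightarrow> nat \<Rightarrow> nat \<Rightarrow> 'e) \<Rightarrow> bool" where
  "reduced_skew_set E n c \<longleftrightarrow>
     (\<forall>i \<in> {1..n}. \<forall>j \<in> {1..n}. \<forall>k \<in> {1..n}. c i j k \<in> carrier E) \<and>
     (\<forall>i \<in> {1..n}. \<forall>j \<in> {1..n}. c i i j = \<one>\<^bsub>E\<^esub> \<and> c i j j = \<one>\<^bsub>E\<^esub>)"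

text \<open>An element is given by its matrix of coordinates in the basis \<open>e\<^sub>i\<^sub>j\<close>; the multiplication is the
  bilinear extension of \<open>e\<^sub>i\<^sub>j e\<^sub>k\<^sub>l = \<delta>\<^sub>j\<^sub>k c\<^sub>i\<^sub>j\<^sub>l e\<^sub>i\<^sub>l\<close>.\<close>

definition skew_matrix_algebra ::
    "('e, 'm) ring_scheme \<Rightarrow> nat \<Rightarrow> (nat \<Rightarrow> nat \<Rightarrow> nat \<Rightarrow> 'e) \<Rightarrow> ('e, nat \<times> nat \<Rightarrow> 'e) module" where
  "skew_matrix_algebra E n c =
     \<lparr>carrier = {1..n} \<times> {1..n} \<rightarrow>\<^sub>E carrier E,
      monoid.mult = (\<lambda>x y. \<lambda>(i, l) \<in> {1..n} \<times> {1..n}.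
        \<Oplus>\<^bsub>E\<^esub> j \<in> {1..n}. c i j l \<otimes>\<^bsub>E\<^esub> (x (i, j) \<otimes>\<^bsub>E\<^esub> y (j, l))),
      one = (\<lambda>(i, j) \<in> {1..n} \<times> {1..n}. if i = j then \<one>\<^bsub>E\<^esub> else \<zero>\<^bsub>E\<^esub>),
      ring.zero = (\<lambda>p \<in> {1..n} \<times> {1..n}. \<zero>\<^bsub>E\<^esub>),
      ring.add = (\<lambda>x y. \<lambda>p \<in> {1..n} \<times> {1..n}. x p \<oplus>\<^bsub>E\<^esub> y p),
      module.smult = (\<lambda>r x. \<lambda>p \<in> {1..n} \<times> {1..n}. r \<otimes>\<^bsub>E\<^esub> x p)\<rparr>"

text \<open>\<open>A\<close> is an \<open>E/F\<close>-form of \<open>A'\<close>.\<close>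

definition form_over ::
    "('f, 'm) ring_scheme \<Rightarrow> ('f, 'e) module \<Rightarrow> ('f, 'a) module \<Rightarrow> ('e, 'b) module \<Rightarrow> bool" where
  "form_over F E A A' \<longleftrightarrow>
     separable_extension F E \<and> algebra_isomorphic E (tensor_algebra F E A) A'"

text \<open>The existential quantifier over extension fields ranges over the fields with carrier in the
  type given by the first argument.\<close>

definition form_of_skew_matrix_algebra ::
    "'e itself \<Rightarrow> ('f, 'm) ring_scheme \<Rightarrow> ('f, 'a) module \<Rightarrow> bool" where
  "form_of_skew_matrix_algebra T F A \<longleftrightarrow> (\<exists>(E :: ('f, 'e) module) n c.
     n \<ge> 1 \<and> reduced_skew_set E n c \<and> form_over F E A (skew_matrix_algebra E n c))"

text \<open>The type in which algebraic closures are constructed by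
  \<^theory>\<open>HOL-Algebra.Algebraic_Closure\<close>. Every separable extension of a field with
  elements of type \<^typ>\<open>'f\<close> has an isomorphic copy with carrier in this type.\<close>

type_synonym 'f closure_elem = "('f list \<times> nat) multiset \<Rightarrow> 'f"

end

theory Submission
  imports Defs
begin

text \<open>The bridge between the two sides is a coordinate-free form of M_n(E;c). A
  \<open>frame\<close> of an algebra is a finite system of nonzero orthogonal idempotents in the
  nucleus, with sum 1, all of whose corners gMh are one-dimensional. The matrix units e_ii form a
  frame, because c_iij = c_ijj = 1 puts them into the nucleus (\<open>frame_of_skew_iso\<close>).
  Conversely, vectors u_ij spanning the corners, with u_ii = e_i, multiply by a reduced skew set
  (\<open>skew_iso_of_frame\<close>). So A is a form of a skew matrix algebra iff E \<otimes> A has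
  a nonempty frame for some separable E/F.

  Semiassociative algebras acquire frames. Let E be the separable closure of F, M = E \<otimes> A,
  and let g run through the primitive idempotents of E \<otimes> K. Since K is etale, each k in K
  acts on g by a scalar \<chi>_g(k) (\<open>primitive_eigen\<close>), so K \<otimes> K acts on the
  corner gMh through the single character \<chi>_g \<otimes> \<chi>_h. Faithfulness of A makes every
  corner nonzero (\<open>corner_nonzero_of_faithful\<close>), and minimality makes it
  one-dimensional (\<open>corner_one_dimensional\<close>).

  For the converse, enlarge the scalars to an algebraically closed E; a frame survives this
  (\<open>frame_phi\<close>). The difficulty is that K must be defined over F while the frame is
  given only over E. The solution is a Cartan subalgebra argument in the nucleus under the
  commutator. A unital subalgebra B of the nucleus is called \<open>rich\<close> if every nonzero
  idempotent of E \<otimes> B dominates a nonzero idempotent of E \<otimes> B that is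
  \<open>thin\<close>, that is, of rank one relative to the frame. The nucleus is rich
  (\<open>thin_idempotent_exists\<close>), and richness passes from B to the Fitting null component
  of \<open>ad x\<close> for each x in B (\<open>rich_fitting\<close>). Hence in a minimal rich B
  every \<open>ad x\<close> is nilpotent, and Engel's theorem forces the idempotents of E \<otimes>
  B to be central in it (\<open>idempotents_central\<close>). Splitting 1 into orthogonal thin
  idempotents of E \<otimes> B gives a new frame H (\<open>frame_of_thin\<close>) on which B acts by
  scalars. So B is commutative and serves as K (\<open>split_subalgebra_exists\<close>). Minimality
  replaces the choice of a generic element, so finite fields need no separate treatment.

  This K is etale: diagonal action on H makes K von Neumann regular, hence a product of fields, and
  makes minimal polynomials separable (\<open>K_regular\<close>, \<open>separable_relation\<close>,
  \<open>etale_K\<close>). The module A is minimally faithful: if N / N' is faithful, then E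
  \<otimes> N contains every one-dimensional corner gMh and E \<otimes> N' meets none, so N = A and
  N' = 0 (\<open>minimally_faithful_bimodule\<close>). Centrality holds because the center of an
  algebra with a frame consists of scalars (\<open>frame_central\<close>,
  \<open>central_of_frame\<close>).

  Descent from E to F always goes through the slices l \<otimes> id from E \<otimes> A to A, for
  linear functionals l on E, which are axiomatized in the locale \<open>scalar_extension\<close>. A
  basis of the possibly infinite extension E/F is never chosen.\<close>

abbreviation (input) mult_in ("(_ *[_]/ _)" [70, 0, 71] 70) where "x *[A] y \<equiv> x \<otimes>\<^bsub>A\<^esub> y"
abbreviation (input) add_in ("(_ +[_]/ _)" [65, 0, 66] 65) where "x +[A] y \<equiv> x \<oplus>\<^bsub>A\<^esub> y"
abbreviation (input) smult_in ("(_ .[_]/ _)" [70, 0, 71] 70) where "r .[A] x \<equiv> r \<odot>\<^bsub>A\<^esub> x"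
abbreviation (input) minus_in ("(_ -[_]/ _)" [65, 0, 66] 65) where "x -[A] y \<equiv> x \<ominus>\<^bsub>A\<^esub> y"
abbreviation (input) neg_in ("-[_]/ _" [0, 81] 80) where "-[A] x \<equiv> \<ominus>\<^bsub>A\<^esub> x"
abbreviation (input) zero_in ("0[_]") where "0[A] \<equiv> \<zero>\<^bsub>A\<^esub>"
abbreviation (input) one_in ("1[_]") where "1[A] \<equiv> \<one>\<^bsub>A\<^esub>"
abbreviation (input) carrier_in ("(_/ \<in>[_])" [51, 0] 50) where "x \<in>[A] \<equiv> x \<in> carrier A"
abbreviation (input) mop where "mop A \<equiv> (\<otimes>\<^bsub>A\<^esub>)"

section \<open>Linear algebra over carriers\<close>

lemma (in abelian_group) a_inv_zero [simp]: "\<ominus> \<zero> = \<zero>"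
 by (metis a_inv_closed l_zero r_neg zero_closed)

lemma (in abelian_group) a_minus_zero [simp]: "x \<in>[G] ==> x \<ominus> \<zero> = x"
 by (simp add: a_minus_def)

lemma (in abelian_group) a_minus_self [simp]: "x \<in>[G] ==> x \<ominus> x = \<zero>"
 by (simp add: a_minus_def r_neg)

lemma (in abelian_group) a_minus_eq_zero_iff:
 "[|x \<in>[G]; y \<in>[G]|] ==> x \<ominus> y = \<zero> \<longleftrightarrow> x = y"
 by (metis a_inv_closed a_minus_def minus_equality minus_minus r_neg)

lemma (in module) submoduleD:
 assumes "submodule N R M"
 shows "N <= carrier M" and "0[M] \<in> N"
  and "[|x \<in> N; y \<in> N|] ==> x +[M] y \<in> N"
  and "[|r \<in>[R]; x \<in> N|] ==> r .[M] x \<in> N"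
  and "x \<in> N ==> -[M] x \<in> N"
  and "[|x \<in> N; y \<in> N|] ==> x -[M] y \<in> N"
proof -
 note E = submoduleE[OF assms]
 show "N <= carrier M" by (rule E(1))
 show "[|x \<in> N; y \<in> N|] ==> x +[M] y \<in> N" for x y by (rule E(5))
 show "[|r \<in>[R]; x \<in> N|] ==> r .[M] x \<in> N" for r x by (rule E(4))
 show "x \<in> N ==> -[M] x \<in> N" for x by (rule E(3))
 show "[|x \<in> N; y \<in> N|] ==> x -[M] y \<in> N" for x y
  unfolding a_minus_def by (intro E(5) E(3))
 obtain x where "x \<in> N" using E(2) by blast
 with E(5)[OF _ E(3)] have "x +[M] -[M] x \<in> N" by blast
 with \<open>x \<in> N\<close> E(1) show "0[M] \<in> N" by (auto simp: r_neg)
qed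

lemma (in module) finsum_in_submodule:
 assumes "submodule N R M" "finite S" "f \<in> S \<rightarrow> N"
 shows "finsum M f S \<in> N"
 using assms(2,3)
proof (induction S rule: finite_induct)
 case empty
 then show ?case using submoduleD(2)[OF assms(1)] by simp
next
 case (insert s S)
 then have "f \<in> S \<rightarrow> carrier M" "f s \<in>[M]" using submoduleD(1)[OF assms(1)] by auto
 with insert show ?case using submoduleD(3)[OF assms(1)] by (simp add: Pi_iff)
qed

lemma (in module) submodule_zero: "submodule {0[M]} R M"
 by (rule submoduleI) auto

lemma (in module) smult_minus_distr:
 "[|r \<in>[R]; x \<in>[M]; y \<in>[M]|] ==> r .[M] (x -[M] y) = r .[M] x -[M] r .[M] y"
 by (simp add: a_minus_def smult_r_distr smult_r_minus)

definition add_line :: "('f, 'm) ring_scheme => ('f, 'v, 'n) module_scheme => 'v set => 'v => 'v set" where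
 "add_line F V W s = {w +[V] r .[V] s |w r. w \<in> W \<and> r \<in> carrier F}"

lemma (in module) submodule_add_line:
 assumes W: "submodule W R M" and s: "s \<in>[M]"
 shows "submodule (add_line R M W s) R M" "W <= add_line R M W s" "s \<in> add_line R M W s"
proof -
 note D = submoduleD[OF W]
 note DM = subsetD[OF D(1)]
 show "submodule (add_line R M W s) R M"
 proof (rule submoduleI)
  show "add_line R M W s <= carrier M" using DM s by (auto simp: add_line_def)
  have "0[M] = 0[M] +[M] \<zero> .[M] s" using s by simp
  then show "0[M] \<in> add_line R M W s" unfolding add_line_def using D(2) by blast
 next
  fix a assume "a \<in> add_line R M W s"
  then obtain w r where w: "w \<in> W" "r \<in>[R]" "a = w +[M] r .[M] s" by (auto simp: add_line_def)
  then have "-[M] a = -[M] w +[M] (\<ominus> r) .[M] s"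
   using s DM by (simp add: smult_l_minus minus_add)
  then show "-[M] a \<in> add_line R M W s" unfolding add_line_def using D(5) w by blast
 next
  fix a b assume "a \<in> add_line R M W s" "b \<in> add_line R M W s"
  then obtain w r w' r' where w: "w \<in> W" "r \<in>[R]" "a = w +[M] r .[M] s"
   "w' \<in> W" "r' \<in>[R]" "b = w' +[M] r' .[M] s" by (auto simp: add_line_def)
  then have "a +[M] b = (w +[M] w') +[M] (r \<oplus> r') .[M] s"
   using s DM by (simp add: smult_l_distr M.a_ac)
  then show "a +[M] b \<in> add_line R M W s" unfolding add_line_def using D(3) w by blast
 next
  fix c a assume c: "c \<in>[R]" and "a \<in> add_line R M W s"
  then obtain w r where w: "w \<in> W" "r \<in>[R]" "a = w +[M] r .[M] s" by (auto simp: add_line_def)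
  then have "c .[M] a = c .[M] w +[M] (c \<otimes> r) .[M] s"
   using s DM c by (simp add: smult_r_distr smult_assoc1)
  then show "c .[M] a \<in> add_line R M W s" unfolding add_line_def using D(4) w c by blast
 qed
 show "W <= add_line R M W s"
 proof
  fix w assume "w \<in> W"
  then have "w = w +[M] \<zero> .[M] s" using s DM by simp
  then show "w \<in> add_line R M W s" unfolding add_line_def using \<open>w \<in> W\<close> by blast
 qed
 have "s = 0[M] +[M] \<one> .[M] s" using s by simp
 then show "s \<in> add_line R M W s" unfolding add_line_def using D(2) by blast
qed

locale vspace = module F V + field F
 for F :: "('f, 'm) ring_scheme" (structure) and V :: "('f, 'v) module" (structure)
begin

lemma smult_inv_cancel:
 assumes "r \<in>[F]" "r ~= \<zero>" "x \<in>[V]"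
 shows "(inv r) .[V] (r .[V] x) = x" and "r .[V] ((inv r) .[V] x) = x" and "inv r \<in>[F]"
  and "inv r ~= \<zero>"
proof -
 have u: "r \<in> Units F" using assms field_Units by auto
 then show c: "inv r \<in>[F]" by simp
 show "(inv r) .[V] (r .[V] x) = x" "r .[V] ((inv r) .[V] x) = x"
  using assms u c by (simp_all flip: smult_assoc1)
 show "inv r ~= \<zero>" using u assms(1) by (metis R.Units_r_inv R.r_null one_not_zero)
qed

lemma smult_eq_zero:
 "[|r \<in>[F]; x \<in>[V]; r .[V] x = 0[V]|] ==> r = \<zero> \<or> x = 0[V]"
 by (metis smult_inv_cancel(1,3) smult_r_null)

lemma submodule_smult_cancel:
 assumes "submodule N F V" "r \<in>[F]" "r ~= \<zero>" "x \<in>[V]" "r .[V] x \<in> N"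
 shows "x \<in> N"
 using submoduleD(4)[OF assms(1) smult_inv_cancel(3)[OF assms(2,3,4)] assms(5)]
  smult_inv_cancel(1)[OF assms(2,3,4)] by simp

text \<open>The value at \<open>N\<close> counts the steps of a fixed finite flag in which \<open>N\<close> grows.\<close>

lemma height_exists:
 assumes "finite_dimensional F V"
 obtains d :: "'v set => nat" where
  "!!N N'. [|submodule N F V; submodule N' F V; N \<subset> N'|] ==> d N < d N'"
proof -
 \<comment> \<open>\<open>P U\<close> asks for a monotone height that notices every growth of N
   \<inter> U. It is built up by adding one line to U at a time.\<close>
 define P where "P U \<longleftrightarrow> (\<exists>d :: 'v set => nat. \<forall>N N'. submodule N F V \<and> submodule N' F V \<and> N <= N' -->
  d N \<le> d N' \<and> (d N = d N' --> N \<inter> U = N' \<inter> U))" for U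
 have step: "P (add_line F V U s)" if U: "submodule U F V" and PU: "P U" and s: "s \<in>[V]" for U s
 proof -
  obtain d :: "'v set => nat" where
   d0: "\<forall>N N'. submodule N F V \<and> submodule N' F V \<and> N <= N' --> d N \<le> d N' \<and> (d N = d N' --> N \<inter> U = N' \<inter> U)"
   using PU unfolding P_def ..
  have d: "[|submodule N F V; submodule N' F V; N <= N'|] ==> d N \<le> d N'"
   "[|submodule N F V; submodule N' F V; N <= N'; d N = d N'|] ==> N \<inter> U = N' \<inter> U" for N N'
   using d0[rule_format, of N N'] by simp_all
  define U' where "U' = add_line F V U s"
  \<comment> \<open>The extra summand records whether N contains a vector of U + F s outside
    U.\<close>
  define e where "e N = d N + (if N \<inter> U' <= U then 0 else 1)" for N
  note DU = submoduleD[OF U]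
  have "e N \<le> e N' \<and> (e N = e N' --> N \<inter> U' = N' \<inter> U')"
   if N: "submodule N F V" and N': "submodule N' F V" and sub: "N <= N'" for N N'
  proof
   show "e N \<le> e N'" using d(1)[OF N N' sub] sub by (auto simp: e_def)
   show "e N = e N' --> N \<inter> U' = N' \<inter> U'"
   proof
    assume eq: "e N = e N'"
    with d(1)[OF N N' sub] sub have dd: "d N = d N'" by (auto simp: e_def split: if_splits)
    have piv: "N \<inter> U' <= U \<longleftrightarrow> N' \<inter> U' <= U" using eq dd by (auto simp: e_def split: if_splits)
    note int = d(2)[OF N N' sub dd]
    have "N' \<inter> U' <= N"
    proof
     fix y assume y: "y \<in> N' \<inter> U'"
     show "y \<in> N"
     proof (cases "y \<in> U")
      case True
      then show ?thesis using y int by blast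
     next
      case False
      then obtain x where x: "x \<in> N" "x \<in> U'" "x \<notin> U" using piv y by blast
      obtain u r where ur: "u \<in> U" "r \<in>[F]" "x = u +[V] r .[V] s"
       using x by (auto simp: U'_def add_line_def)
      obtain u' r' where ur': "u' \<in> U" "r' \<in>[F]" "y = u' +[V] r' .[V] s"
       using y by (auto simp: U'_def add_line_def)
      have uc: "u \<in>[V]" "u' \<in>[V]" using ur ur' DU(1) by auto
      have r0: "r ~= \<zero>" using ur x(3) s uc by auto
      \<comment> \<open>The multiple of \<open>x\<close> with the same coefficient at
        \<open>s\<close> as \<open>y\<close>, so that their difference falls into U.\<close>
      define q where "q = r' \<otimes> inv r"
      note i = smult_inv_cancel(3)[OF ur(2) r0 s]
      have qc: "q \<in>[F]" using i ur' by (simp add: q_def)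
      have "q \<otimes> r = r'" using i ur(2) ur'(2) r0 by (simp add: q_def R.m_assoc field_Units)
      then have qs: "q .[V] (r .[V] s) = r' .[V] s" using qc ur(2) s by (simp flip: smult_assoc1)
      have "y -[V] q .[V] x = u' -[V] q .[V] u"
       using qc ur ur' s uc qs
       by (simp add: smult_r_distr a_minus_def minus_add M.a_ac M.r_neg2 M.r_neg1)
        (metis M.a_lcomm M.a_inv_closed M.r_neg M.r_zero smult_closed)
      then have "y -[V] q .[V] x \<in> U" using DU(6)[OF ur'(1) DU(4)[OF qc ur(1)]] by simp
      moreover have "y -[V] q .[V] x \<in> N'"
       using submoduleD(6)[OF N'] submoduleD(4)[OF N' qc] x y sub by blast
      ultimately have yN: "y -[V] q .[V] x \<in> N" using int by blast
      have xN: "q .[V] x \<in> N" using submoduleD(4)[OF N qc x(1)] .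
      have "(y -[V] q .[V] x) +[V] q .[V] x = y"
       using submoduleD(1)[OF N'] submoduleD(1)[OF N] y xN
       by (auto simp: a_minus_def M.a_assoc M.l_neg subset_iff)
      then show ?thesis using submoduleD(3)[OF N yN xN] by simp
     qed
    qed
    with sub show "N \<inter> U' = N' \<inter> U'" by blast
   qed
  qed
  then show ?thesis unfolding P_def U'_def[symmetric] by (intro exI[of _ e]) simp
 qed
 have exU: "\<exists>U. submodule U F V \<and> P U \<and> S <= U" if "finite S" "S <= carrier V" for S
  using that
 proof (induction S rule: finite_induct)
  case empty
  have "P {0[V]}" unfolding P_def
  proof (intro exI[of _ "\<lambda>_. 0"] allI impI)
   fix N N' assume "submodule N F V \<and> submodule N' F V \<and> N <= N'"
   then have "0[V] \<in> N" "0[V] \<in> N'" using submoduleD(2) by blast+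
   then show "0 \<le> (0::nat) \<and> (0 = (0::nat) --> N \<inter> {0[V]} = N' \<inter> {0[V]})" by auto
  qed
  then show ?case using submodule_zero by blast
 next
  case (insert s S)
  then obtain U where U: "submodule U F V" "P U" "S <= U" by auto
  have s: "s \<in>[V]" using insert by simp
  show ?case using step[OF U(1,2) s] submodule_add_line[OF U(1) s] U(3) by blast
 qed
 obtain S where S: "finite S" "S <= carrier V"
  and span: "\<forall>x\<in>carrier V. \<exists>a\<in>S \<rightarrow> carrier F. x = (\<Oplus>\<^bsub>V\<^esub>s\<in>S. a s .[V] s)"
  using assms unfolding finite_dimensional_def by blast
 obtain U where U: "submodule U F V" "P U" "S <= U" using exU[OF S] by (elim exE conjE)
 have "carrier V <= U"
 proof
  fix x assume "x \<in>[V]"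
  then obtain a where a: "a \<in> S \<rightarrow> carrier F" "x = (\<Oplus>\<^bsub>V\<^esub>s\<in>S. a s .[V] s)" using span by blast
  show "x \<in> U" unfolding a(2)
   by (rule finsum_in_submodule[OF U(1) S(1)]) (use a U submoduleD(4)[OF U(1)] in auto)
 qed
  obtain d :: "'v set => nat" where
   d0: "\<forall>N N'. submodule N F V \<and> submodule N' F V \<and> N <= N' --> d N \<le> d N' \<and> (d N = d N' --> N \<inter> U = N' \<inter> U)"
   using U(2) unfolding P_def ..
  have d: "[|submodule N F V; submodule N' F V; N <= N'|] ==> d N \<le> d N'"
   "[|submodule N F V; submodule N' F V; N <= N'; d N = d N'|] ==> N \<inter> U = N' \<inter> U" for N N'
   using d0[rule_format, of N N'] by simp_all
 show thesis
 proof
  fix N N' assume N: "submodule N F V" "submodule N' F V" "N \<subset> N'"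
  then have "d N \<le> d N'" using d(1) by blast
  moreover have "N \<inter> U = N" "N' \<inter> U = N'" using submoduleD(1) N(1,2) \<open>carrier V <= U\<close> by blast+
  then have "d N ~= d N'" using d(2)[of N N'] N by blast
  ultimately show "d N < d N'" by simp
 qed
qed

text \<open>Heights are bounded by that of the whole space, so some submodule with \<open>P\<close>
  has greatest height; strict monotonicity makes it maximal. This and
  \<open>minimal_submodule\<close> are the chain conditions used for all later choices.\<close>

lemma maximal_submodule:
 assumes "finite_dimensional F V" and "P N0" and "!!N. P N ==> submodule N F V"
 obtains N where "P N" "!!N'. [|P N'; N <= N'|] ==> N' = N"
proof -
 obtain d :: "'v set => nat" where
  d: "!!N N'. [|submodule N F V; submodule N' F V; N \<subset> N'|] ==> d N < d N'"
  using height_exists[OF assms(1)] by blast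
 have "d N \<le> d (carrier V)" if "P N" for N
  using d[OF assms(3)[OF that] carrier_is_submodule] submoduleD(1)[OF assms(3)[OF that]]
  by (metis less_imp_le order_refl psubsetI)
 then obtain N where N: "P N" "!!N'. P N' ==> d N' \<le> d N"
  using ex_has_greatest_nat[of P N0 d "Suc (d (carrier V))"] assms(2) by (metis le_imp_less_Suc)
 show thesis
 proof (rule that[OF N(1)])
  fix N' assume N': "P N'" "N <= N'"
  then show "N' = N" using d[OF assms(3)[OF N(1)] assms(3)[OF N'(1)]] N(2)[OF N'(1)] by fastforce
 qed
qed

lemma minimal_submodule:
 assumes "finite_dimensional F V" and "P N0" and "!!N. P N ==> submodule N F V"
 obtains N where "P N" "!!N'. [|P N'; N' <= N|] ==> N' = N"
proof -
 obtain d :: "'v set => nat" where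
  d: "!!N N'. [|submodule N F V; submodule N' F V; N \<subset> N'|] ==> d N < d N'"
  using height_exists[OF assms(1)] by blast
 obtain N where N: "P N" "!!N'. P N' ==> d N \<le> d N'"
  using ex_has_least_nat[of P N0 d] assms(2) by metis
 show thesis
 proof (rule that[OF N(1)])
  fix N' assume N': "P N'" "N' <= N"
  then show "N' = N" using d[OF assms(3)[OF N'(1)] assms(3)[OF N(1)]] N(2)[OF N'(1)] by fastforce
 qed
qed

lemma finsum_carrier_update:
 assumes N: "submodule N F V" and "finite S" "f \<in> S \<rightarrow> N"
 shows "finsum (V\<lparr>carrier := N\<rparr>) f S = finsum V f S"
proof -
 interpret VN: module F "V\<lparr>carrier := N\<rparr>" by (rule submodule.submodule_is_module[OF N module_axioms])
 from assms(2,3) show ?thesis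
 proof (induction S rule: finite_induct)
  case (insert s S)
  then have "f \<in> S \<rightarrow> carrier V" "f s \<in>[V]" using submoduleD(1)[OF N] by auto
  with insert show ?case by (simp add: Pi_iff)
 qed simp
qed

text \<open>A maximal finitely spanned submodule of N must be N, since otherwise a line could be
  added to it.\<close>

lemma finite_dimensional_submodule:
 assumes fd: "finite_dimensional F V" and N: "submodule N F V"
 shows "finite_dimensional F (V\<lparr>carrier := N\<rparr>)"
proof -
 define P where "P U \<longleftrightarrow> submodule U F V \<and> U <= N \<and> (\<exists>S. finite S \<and> S <= U \<and>
  U <= {\<Oplus>\<^bsub>V\<^esub>s\<in>S. a s .[V] s |a. a \<in> S \<rightarrow> carrier F})" for U
 have "P {0[V]}" unfolding P_def using submodule_zero submoduleD(2)[OF N] by (auto intro!: exI[of _ "{}"])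
 then obtain U where U: "P U" and mx: "!!U'. [|P U'; U <= U'|] ==> U' = U"
  using maximal_submodule[OF fd, of P] unfolding P_def by blast
 then obtain S where S: "submodule U F V" "U <= N" "finite S" "S <= U"
  "U <= {\<Oplus>\<^bsub>V\<^esub>s\<in>S. a s .[V] s |a. a \<in> S \<rightarrow> carrier F}" unfolding P_def by blast
 have Uc: "U <= carrier V" using submoduleD(1)[OF S(1)] .
 have "N <= U"
 proof
  fix x assume x: "x \<in> N"
  show "x \<in> U"
  proof (rule ccontr)
   assume xU: "x \<notin> U"
   have xc: "x \<in>[V]" using x submoduleD(1)[OF N] by blast
   note L = submodule_add_line[OF S(1) xc]
   have "add_line F V U x <= {\<Oplus>\<^bsub>V\<^esub>s\<in>insert x S. a s .[V] s |a. a \<in> insert x S \<rightarrow> carrier F}"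
   proof
    fix y assume "y \<in> add_line F V U x"
    then obtain u r where u: "u \<in> U" "r \<in>[F]" "y = u +[V] r .[V] x" by (auto simp: add_line_def)
    then obtain a where a: "a \<in> S \<rightarrow> carrier F" "u = (\<Oplus>\<^bsub>V\<^esub>s\<in>S. a s .[V] s)" using S(5) by blast
    have xS: "x \<notin> S" using xU S(4) by blast
    have "(\<Oplus>\<^bsub>V\<^esub>s\<in>insert x S. (a(x := r)) s .[V] s) = r .[V] x +[V] (\<Oplus>\<^bsub>V\<^esub>s\<in>S. (a(x := r)) s .[V] s)"
     using S xS a(1) u(2) xc Uc by (subst M.finsum_insert) (auto simp: Pi_iff)
    also have "(\<Oplus>\<^bsub>V\<^esub>s\<in>S. (a(x := r)) s .[V] s) = u" unfolding a(2)
     using xS a(1) S(4) Uc by (intro M.finsum_cong') (auto simp: Pi_iff)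
    finally have "y = (\<Oplus>\<^bsub>V\<^esub>s\<in>insert x S. (a(x := r)) s .[V] s)"
     using u xc Uc by (auto simp: M.a_comm)
    moreover have "a(x := r) \<in> insert x S \<rightarrow> carrier F" using a(1) u(2) by auto
    ultimately show "y \<in> {\<Oplus>\<^bsub>V\<^esub>s\<in>insert x S. a s .[V] s |a. a \<in> insert x S \<rightarrow> carrier F}" by blast
   qed
   moreover have "add_line F V U x <= N"
    using x S(2) submoduleD(3,4)[OF N] by (auto simp: add_line_def)
   moreover have "finite (insert x S)" "insert x S <= add_line F V U x" using L(2,3) S(3,4) by auto
   ultimately have "P (add_line F V U x)" unfolding P_def
    using L(1) by (intro conjI exI[of _ "insert x S"])
   then show False using mx[OF _ L(2)] L(3) xU by blast
  qed
 qed
 then have UN: "U = N" using S(2) by blast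
 show ?thesis unfolding finite_dimensional_def
 proof (intro exI[of _ S] conjI ballI)
  fix x assume "x \<in> carrier (V\<lparr>carrier := N\<rparr>)"
  then obtain a where a: "a \<in> S \<rightarrow> carrier F" "x = (\<Oplus>\<^bsub>V\<^esub>s\<in>S. a s .[V] s)" using S(5) UN by auto
  have "(\<lambda>s. a s .[V] s) \<in> S \<rightarrow> N" using a(1) S(4) UN submoduleD(4)[OF N] by auto
  then show "\<exists>a\<in>S \<rightarrow> carrier F. x = (\<Oplus>\<^bsub>V\<lparr>carrier := N\<rparr>\<^esub>s\<in>S. a s \<odot>\<^bsub>V\<lparr>carrier := N\<rparr>\<^esub> s)"
   using a finsum_carrier_update[OF N S(3), of "\<lambda>s. a s .[V] s"] by (intro bexI[of _ a]) simp_all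
 qed (use S UN in auto)
qed

end

section \<open>Linear functionals and finite dual bases\<close>

definition functionals :: "('f, 'm) ring_scheme => ('f, 'v) module => ('v => 'f) set" where
 "functionals F V = {l. (\<forall>x\<in>carrier V. l x \<in>[F]) \<and>
  (\<forall>x\<in>carrier V. \<forall>y\<in>carrier V. l (x +[V] y) = l x +[F] l y) \<and>
  (\<forall>r\<in>carrier F. \<forall>x\<in>carrier V. l (r .[V] x) = r *[F] l x)}"

lemma functionalsD:
 assumes "l \<in> functionals F V"
 shows "x \<in>[V] ==> l x \<in>[F]"
  and "[|x \<in>[V]; y \<in>[V]|] ==> l (x +[V] y) = l x +[F] l y"
  and "[|r \<in>[F]; x \<in>[V]|] ==> l (r .[V] x) = r *[F] l x"
 using assms unfolding functionals_def by auto

context vspace begin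

lemma functional_zero: "l \<in> functionals F V ==> l 0[V] = \<zero>"
 using functionalsD(3)[of l F V \<zero> "0[V]"] functionalsD(1)[of l F V "0[V]"] by simp

text \<open>By Zorn there is a submodule W maximal among those avoiding v. Adding any vector outside
  W captures v, so V = W + F v, and the functional reads off the coefficient of v modulo W. No
  finiteness of V is assumed, because this is applied to field extensions of arbitrary
  degree.\<close>

lemma functional_exists:
 assumes v: "v \<in>[V]" "v ~= 0[V]"
 obtains l where "l \<in> functionals F V" "l v = \<one>"
proof -
 define A where "A = {W. submodule W F V \<and> v \<notin> W}"
 have "A ~= {}" using submodule_zero v unfolding A_def by blast
 moreover have "\<Union>C \<in> A" if C: "C ~= {}" "subset.chain A C" for C
 proof -
  have CA: "submodule W F V" "v \<notin> W" if "W \<in> C" for W using C(2) that by (auto simp: A_def subset.chain_def)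
  have "submodule (\<Union>C) F V"
  proof (rule submoduleI)
   fix a b assume "a \<in> \<Union>C" "b \<in> \<Union>C"
   then obtain W W' where W: "W \<in> C" "a \<in> W" "W' \<in> C" "b \<in> W'" by blast
   then have "W <= W' \<or> W' <= W" using C(2) by (auto simp: subset.chain_def)
   then show "a +[V] b \<in> \<Union>C" using W submoduleD(3)[OF CA(1)] by blast
  next
   show "\<Union>C <= carrier V" using submoduleD(1)[OF CA(1)] by (rule Union_least)
   show "0[V] \<in> \<Union>C" using C(1) submoduleD(2)[OF CA(1)] by auto
   show "-[V] a \<in> \<Union>C" if "a \<in> \<Union>C" for a using that submoduleD(5)[OF CA(1)] by auto
   show "r .[V] a \<in> \<Union>C" if "r \<in>[F]" "a \<in> \<Union>C" for r a
    using that submoduleD(4)[OF CA(1)] by auto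
  qed
  then show ?thesis using CA(2) unfolding A_def by blast
 qed
 ultimately obtain W where "W \<in> A" and mx: "!!Y. [|Y \<in> A; W <= Y|] ==> Y = W"
  using subset_Zorn_nonempty[of A] by metis
 then have W: "submodule W F V" "v \<notin> W" by (auto simp: A_def)
 note D = submoduleD[OF W(1)]
 note DV = subsetD[OF D(1)]
 have uniq: "r = r'" if "r \<in>[F]" "r' \<in>[F]" "x \<in>[V]" "x -[V] r .[V] v \<in> W" "x -[V] r' .[V] v \<in> W" for r r' x
 proof (rule ccontr)
  assume ne: "r ~= r'"
  have "(x -[V] r .[V] v) -[V] (x -[V] r' .[V] v) = (r' \<ominus> r) .[V] v"
   using that v by (simp add: a_minus_def smult_l_distr smult_l_minus minus_add M.a_ac M.r_neg2 M.r_neg1)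
  then have "(r' \<ominus> r) .[V] v \<in> W" using D(6) that by metis
  moreover have "r' \<ominus> r ~= \<zero>" using ne that by simp
  moreover have "r' \<ominus> r \<in>[F]" using that by simp
  ultimately show False using submodule_smult_cancel[OF W(1) _ _ v(1)] W(2) by metis
 qed
 have ex: "\<exists>r\<in>carrier F. x -[V] r .[V] v \<in> W" if x: "x \<in>[V]" for x
 proof (cases "x \<in> W")
  case True
  moreover have "x -[V] \<zero> .[V] v = x" using v x by simp
  ultimately show ?thesis using R.zero_closed by metis
 next
  case False
  note L = submodule_add_line[OF W(1) x]
  have "v \<in> add_line F V W x" using mx[OF _ L(2)] L False unfolding A_def by blast
  then obtain w r where w: "w \<in> W" "r \<in>[F]" "v = w +[V] r .[V] x" by (auto simp: add_line_def)
  have wc: "w \<in>[V]" using w DV by blast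
  have r0: "r ~= \<zero>" using w W(2) x wc by auto
  note i = smult_inv_cancel[OF w(2) r0 x]
  have "(inv r) .[V] v = (inv r) .[V] w +[V] x" using w wc i x by (simp add: smult_r_distr)
  then have "x -[V] (inv r) .[V] v = -[V] ((inv r) .[V] w)"
   using i(3) wc x by (simp add: a_minus_def minus_add M.a_lcomm M.r_neg)
    (metis M.a_lcomm M.a_inv_closed M.r_neg M.r_zero smult_closed)
  then show ?thesis using D(4)[OF i(3) w(1)] D(5) i(3) by metis
 qed
 define l where "l x = (THE r. r \<in>[F] \<and> x -[V] r .[V] v \<in> W)" for x
 have lI: "l x = r" if "r \<in>[F]" "x \<in>[V]" "x -[V] r .[V] v \<in> W" for x r
  unfolding l_def using that uniq by blast
 have lc: "l x \<in>[F]" "x -[V] l x .[V] v \<in> W" if "x \<in>[V]" for x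
  using ex[OF that] lI[OF _ that] by auto
 show thesis
 proof (rule that[of l])
  show "l v = \<one>" by (rule lI) (use v D(2) in \<open>auto simp: a_minus_def M.r_neg\<close>)
  show "l \<in> functionals F V" unfolding functionals_def
  proof (intro CollectI conjI ballI)
   fix x y assume xy: "x \<in>[V]" "y \<in>[V]"
   have "(x +[V] y) -[V] (l x \<oplus> l y) .[V] v = (x -[V] l x .[V] v) +[V] (y -[V] l y .[V] v)"
    using xy lc v by (simp add: a_minus_def smult_l_distr minus_add M.a_ac)
   then show "l (x +[V] y) = l x \<oplus> l y" using xy lc D(3) by (intro lI) simp_all
  next
   fix r x assume rx: "r \<in>[F]" "x \<in>[V]"
   have "(r .[V] x) -[V] (r \<otimes> l x) .[V] v = r .[V] (x -[V] l x .[V] v)"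
    using rx lc v by (simp add: smult_assoc1 smult_minus_distr)
   then show "l (r .[V] x) = r \<otimes> l x" using rx lc D(4) by (intro lI) simp_all
  qed (use lc in auto)
 qed
qed

text \<open>The finite-rank operator sending v to the sum of l_i(v) w_i, for a list of pairs (w_i,
  l_i).\<close>

fun dual_sum :: "('v \<times> ('v => 'f)) list => 'v => 'v" where
 "dual_sum [] v = 0[V]"
| "dual_sum ((w, l) # ps) v = l v .[V] w +[V] dual_sum ps v"

lemma dual_sum_linear:
 assumes "ps \<in> lists (carrier V \<times> functionals F V)"
 shows "v \<in>[V] ==> dual_sum ps v \<in>[V]"
  "[|v \<in>[V]; w \<in>[V]|] ==> dual_sum ps (v +[V] w) = dual_sum ps v +[V] dual_sum ps w"
  "[|r \<in>[F]; v \<in>[V]|] ==> dual_sum ps (r .[V] v) = r .[V] dual_sum ps v"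
proof -
 have c: "qs \<in> lists (carrier V \<times> functionals F V) ==> v \<in>[V] ==> dual_sum qs v \<in>[V]" for qs v
  by (induction qs) (auto simp: functionalsD(1)[of _ F V])
 then show "dual_sum ps v \<in>[V]" if "v \<in>[V]" using that assms by simp
 show "[|v \<in>[V]; w \<in>[V]|] ==> dual_sum ps (v +[V] w) = dual_sum ps v +[V] dual_sum ps w"
  using assms
 proof (induction ps)
  case (Cons p ps)
  obtain e l where p: "p = (e, l)" by force
  have cl: "dual_sum ps v \<in>[V]" if "v \<in>[V]" for v
   using c[of ps] Cons that by auto
  show ?case using Cons p cl by (auto simp: functionalsD[of l F V] smult_l_distr M.a_ac)
 qed simp
 show "[|r \<in>[F]; v \<in>[V]|] ==> dual_sum ps (r .[V] v) = r .[V] dual_sum ps v"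
  using assms
 proof (induction ps)
  case (Cons p ps)
  obtain e l where p: "p = (e, l)" by force
  have cl: "dual_sum ps v \<in>[V]" if "v \<in>[V]" for v
   using c[of ps] Cons that by auto
  show ?case using Cons p cl by (auto simp: functionalsD[of l F V] smult_r_distr smult_assoc1)
 qed simp
qed

text \<open>Gram-Schmidt without an inner product: a new vector is replaced by its defect under the
  operator found so far, and a functional with value 1 on a nonzero defect supplies the next
  pair.\<close>

lemma dual_basis:
 assumes "set ws <= carrier V"
 obtains ps where "ps \<in> lists (carrier V \<times> functionals F V)" "!!w. w \<in> set ws ==> dual_sum ps w = w"
 using assms
proof (induction ws arbitrary: thesis)
 case Nil
 show ?case by (rule Nil.prems(1)[of "[]"]) auto
next
 case (Cons w ws)
 obtain ps where ps: "ps \<in> lists (carrier V \<times> functionals F V)" "!!w. w \<in> set ws ==> dual_sum ps w = w"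
  using Cons.IH Cons.prems(2) by auto
 note L = dual_sum_linear[OF ps(1)]
 have w: "w \<in>[V]" and ws: "set ws <= carrier V" using Cons.prems(2) by auto
 define w' where "w' = w -[V] dual_sum ps w"
 have w': "w' \<in>[V]" using w L by (simp add: w'_def)
 show ?case
 proof (cases "w' = 0[V]")
  case True
  then have "dual_sum ps w = w" using w L by (simp add: w'_def M.a_minus_eq_zero_iff)
  then show ?thesis using Cons.prems(1)[OF ps(1)] ps(2) by auto
 next
  case False
  then obtain l where l: "l \<in> functionals F V" "l w' = \<one>" using functional_exists w' by blast
  \<comment> \<open>Evaluating \<open>l\<close> on defects makes the new functional vanish on all
    earlier vectors.\<close>
  define l' where "l' v = l (v -[V] dual_sum ps v)" for v
  have l': "l' \<in> functionals F V" unfolding functionals_def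
  proof (intro CollectI conjI ballI)
   fix x y assume xy: "x \<in>[V]" "y \<in>[V]"
   have "(x +[V] y) -[V] dual_sum ps (x +[V] y) = (x -[V] dual_sum ps x) +[V] (y -[V] dual_sum ps y)"
    using xy L by (simp add: a_minus_def minus_add M.a_ac)
   then show "l' (x +[V] y) = l' x \<oplus> l' y" using xy L functionalsD[OF l(1)] by (simp add: l'_def)
  next
   fix r x assume rx: "r \<in>[F]" "x \<in>[V]"
   then have "r .[V] x -[V] dual_sum ps (r .[V] x) = r .[V] (x -[V] dual_sum ps x)"
    using L by (simp add: smult_minus_distr)
   then show "l' (r .[V] x) = r \<otimes> l' x" using rx L functionalsD[OF l(1)] by (simp add: l'_def)
  qed (use L functionalsD[OF l(1)] in \<open>auto simp: l'_def\<close>)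
  show ?thesis
  proof (rule Cons.prems(1)[of "(w', l') # ps"])
   show "(w', l') # ps \<in> lists (carrier V \<times> functionals F V)" using ps w' l' by auto
   fix v assume v: "v \<in> set (w # ws)"
   show "dual_sum ((w', l') # ps) v = v"
   proof (cases "v \<in> set ws")
    case True
    then have "v -[V] dual_sum ps v = 0[V]" using ps(2) ws by (auto simp: a_minus_def M.r_neg)
    then have "l' v = \<zero>" using functional_zero[OF l(1)] by (simp add: l'_def)
    then show ?thesis using True ps(2) w' ws by auto
   next
    case False
    then have [simp]: "v = w" using v by auto
    have "l' w = \<one>" using l(2) by (simp add: l'_def w'_def)
    then show ?thesis using w w' L by (simp add: w'_def a_minus_def M.a_assoc M.l_neg)
   qed
  qed
 qed
qed

end

section \<open>Polynomials in an operator\<close>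

text \<open>Here polynomials are coefficient lists with the constant coefficient first.\<close>

definition linear_op :: "('f, 'm) ring_scheme => ('f, 'v, 'n) module_scheme => ('v => 'v) => bool" where
 "linear_op F V T \<longleftrightarrow> (\<forall>v\<in>carrier V. T v \<in>[V]) \<and>
  (\<forall>v\<in>carrier V. \<forall>w\<in>carrier V. T (v +[V] w) = T v +[V] T w) \<and>
  (\<forall>r\<in>carrier F. \<forall>v\<in>carrier V. T (r .[V] v) = r .[V] T v)"

primrec pev :: "('f, 'v, 'n) module_scheme => 'f list => ('v => 'v) => 'v => 'v" where
 "pev V [] T v = 0[V]"
| "pev V (a # as) T v = a .[V] v +[V] pev V as T (T v)"

text \<open>The vector P'(T)v, computed by the product rule (a + X p)' = p + X p'. The scalar
  counterpart is \<open>dv\<close>.\<close>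

primrec dev :: "('f, 'v, 'n) module_scheme => 'f list => ('v => 'v) => 'v => 'v" where
 "dev V [] T v = 0[V]"
| "dev V (a # as) T v = pev V as T v +[V] T (dev V as T v)"

primrec sev :: "('f, 'm) ring_scheme => 'f list => 'f => 'f" where
 "sev F [] r = 0[F]"
| "sev F (a # as) r = a +[F] r *[F] sev F as r"

primrec dv :: "('f, 'm) ring_scheme => 'f list => 'f => 'f" where
 "dv F [] r = 0[F]"
| "dv F (a # as) r = sev F as r +[F] r *[F] dv F as r"

text \<open>Horner's scheme for the quotient of P by X - r; the remainder is P(r), see
  \<open>sev_quo\<close>.\<close>

primrec quo :: "('f, 'm) ring_scheme => 'f list => 'f => 'f list" where
 "quo F [] r = []"
| "quo F (a # as) r = (if as = [] then [] else sev F as r # quo F as r)"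

definition shift :: "('f, 'v, 'n) module_scheme => ('v => 'v) => 'f => 'v => 'v" where
 "shift V T r v = T v -[V] r .[V] v"

primrec shifts :: "('f, 'v, 'n) module_scheme => ('v => 'v) => 'f list => 'v => 'v" where
 "shifts V T [] v = v"
| "shifts V T (r # rs) v = shifts V T rs (shift V T r v)"

context cring begin

lemma sev_closed [simp]: "[|set as <= carrier R; r \<in>[R]|] ==> sev R as r \<in>[R]"
 by (induction as) auto

lemma dv_closed [simp]: "[|set as <= carrier R; r \<in>[R]|] ==> dv R as r \<in>[R]"
 by (induction as) auto

lemma quo_closed: "[|set as <= carrier R; r \<in>[R]|] ==> set (quo R as r) <= carrier R"
 by (induction as) auto

lemma quo_monic:
 "[|set as <= carrier R; r \<in>[R]; as ~= []|] ==>
  \<exists>bs. quo R (as @ [\<one>]) r = bs @ [\<one>] \<and> length bs = length as - 1 \<and> set bs <= carrier R"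
proof (induction as)
 case (Cons a as)
 show ?case
 proof (cases "as = []")
  case False
  then obtain bs where "quo R (as @ [\<one>]) r = bs @ [\<one>]" "length bs = length as - 1" "set bs <= carrier R"
   using Cons by auto
  then show ?thesis using False Cons.prems
   by (intro exI[of _ "sev R (as @ [\<one>]) r # bs"]) (auto simp: Suc_diff_Suc)
 qed (use Cons.prems in auto)
qed simp

text \<open>Differentiating P = (X - r) Q + P(r) at r gives Q(r) = P'(r). Thus a double root is a
  root of the quotient.\<close>

lemma sev_quo_root: "[|set as <= carrier R; r \<in>[R]|] ==> sev R (quo R as r) r = dv R as r"
 by (induction as) auto

lemma sev_quo:
 assumes "set as <= carrier R" "r \<in>[R]" "s \<in>[R]"
 shows "sev R as s = (s \<ominus> r) \<otimes> sev R (quo R as r) s \<oplus> sev R as r"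
 using assms
proof (induction as)
 case (Cons a as)
 show ?case
 proof (cases "as = []")
  case False
  have c: "sev R as r \<in>[R]" "sev R (quo R as r) s \<in>[R]" "a \<in>[R]"
   using Cons.prems quo_closed by auto
  have "sev R (a # as) s = a \<oplus> s \<otimes> ((s \<ominus> r) \<otimes> sev R (quo R as r) s \<oplus> sev R as r)"
   using Cons by simp
  also have "\<dots> = (s \<ominus> r) \<otimes> (sev R as r \<oplus> s \<otimes> sev R (quo R as r) s) \<oplus> (a \<oplus> r \<otimes> sev R as r)"
   using c assms by algebra
  finally show ?thesis using False by simp
 qed (use Cons.prems in auto)
qed simp

end

lemma linear_opD:
 assumes "linear_op F V T"
 shows "v \<in>[V] ==> T v \<in>[V]"
  and "[|v \<in>[V]; w \<in>[V]|] ==> T (v +[V] w) = T v +[V] T w"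
  and "[|r \<in>[F]; v \<in>[V]|] ==> T (r .[V] v) = r .[V] T v"
 using assms unfolding linear_op_def by auto

lemma funpow_closed: "(!!v. v \<in> S ==> T v \<in> S) ==> v \<in> S ==> (T ^^ k) v \<in> S"
 by (induction k) auto

section \<open>Powers and polynomials of commuting operators\<close>

context module begin

lemma linear_op_zero:
 assumes "linear_op R M T" shows "T 0[M] = 0[M]"
 using linear_opD(3)[OF assms, of \<zero> "0[M]"] linear_opD(1)[OF assms, of "0[M]"] by simp

lemma linear_op_neg:
 assumes "linear_op R M T" "v \<in>[M]" shows "T (-[M] v) = -[M] T v"
proof -
 have "T (v +[M] -[M] v) = 0[M]" using assms linear_op_zero by (simp add: M.r_neg)
 then have "T v +[M] T (-[M] v) = 0[M]" using assms linear_opD[OF assms(1)] by simp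
 then show ?thesis using linear_opD(1)[OF assms(1)] assms(2) by (metis M.a_inv_closed M.minus_equality M.a_comm)
qed

lemma linear_op_minus:
 assumes "linear_op R M T" "v \<in>[M]" "w \<in>[M]"
 shows "T (v -[M] w) = T v -[M] T w"
 using assms linear_opD[OF assms(1)] linear_op_neg by (simp add: a_minus_def)

lemma linear_op_funpow: "linear_op R M T ==> linear_op R M (T ^^ k)"
 by (induction k) (auto simp: linear_op_def)

lemma linear_op_shift:
 assumes "linear_op R M T" "r \<in>[R]" shows "linear_op R M (shift M T r)"
 using linear_opD[OF assms(1)] assms(2) unfolding linear_op_def shift_def
 by (auto simp: smult_r_distr a_minus_def M.minus_add M.a_ac smult_r_minus simp flip: smult_assoc1)
  (simp add: R.m_comm)

lemma linear_op_diff: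
 assumes "linear_op R M T" "linear_op R M U" shows "linear_op R M (\<lambda>v. T v -[M] U v)"
 using linear_opD[OF assms(1)] linear_opD[OF assms(2)] unfolding linear_op_def
 by (auto simp: smult_r_distr a_minus_def M.minus_add M.a_ac smult_r_minus)

lemma linear_op_finsum:
 assumes "linear_op R M T" "finite S" "f \<in> S \<rightarrow> carrier M"
 shows "T (finsum M f S) = (\<Oplus>\<^bsub>M\<^esub>s\<in>S. T (f s))"
 using assms(2,3)
proof (induction S rule: finite_induct)
 case empty
 then show ?case using linear_op_zero[OF assms(1)] by simp
next
 case (insert s S)
 then have "(\<lambda>s. T (f s)) \<in> S \<rightarrow> carrier M" "T (f s) \<in>[M]" "f \<in> S \<rightarrow> carrier M" "f s \<in>[M]"
  using linear_opD(1)[OF assms(1)] by auto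
 with insert show ?case by (simp add: linear_opD(2)[OF assms(1)] M.finsum_closed)
qed

lemma pev_closed:
 assumes "linear_op R M T" "set as <= carrier R" "v \<in>[M]"
 shows "pev M as T v \<in>[M]"
 using assms(2,3) by (induction as arbitrary: v) (auto simp: linear_opD(1)[OF assms(1)])

lemma pev_commute:
 assumes "linear_op R M T" "linear_op R M U" "!!v. v \<in>[M] ==> T (U v) = U (T v)"
  "set as <= carrier R" "v \<in>[M]"
 shows "pev M as T (U v) = U (pev M as T v)"
 using assms(4,5)
proof (induction as arbitrary: v)
 case Nil
 then show ?case using linear_op_zero[OF assms(2)] by simp
next
 case (Cons a as)
 then show ?case using assms(3) linear_opD[OF assms(2)] linear_opD(1)[OF assms(1)] pev_closed[OF assms(1)]
  by simp
qed

lemma pev_append: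
 assumes "linear_op R M T" "set as <= carrier R" "b \<in>[R]" "v \<in>[M]"
 shows "pev M (as @ [b]) T v = pev M as T v +[M] b .[M] (T ^^ length as) v"
 using assms(2,4)
proof (induction as arbitrary: v)
 case (Cons a as)
 have "(T ^^ length as) v \<in>[M]" if "v \<in>[M]" for v
  using funpow_closed[of "carrier M" T] linear_opD(1)[OF assms(1)] that by blast
 then show ?case using Cons assms(3) pev_closed[OF assms(1)] linear_opD(1)[OF assms(1)]
  by (simp add: M.a_assoc flip: funpow_swap1)
qed (use assms in auto)

lemma pev_eigen:
 assumes "set as <= carrier R" "r \<in>[R]" "v \<in>[M]" "linear_op R M T" "T v = r .[M] v"
 shows "pev M as T v = sev R as r .[M] v"
 using assms(1)
proof (induction as)
 case (Cons a as)
 have c: "set as <= carrier R" "a \<in>[R]" using Cons.prems by auto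
 have "pev M as T (T v) = T (pev M as T v)" using pev_commute[OF assms(4,4)] c assms(3) by blast
 also have "\<dots> = sev R as r .[M] (r .[M] v)"
  using Cons.IH[OF c(1)] assms linear_opD(3)[OF assms(4)] c by simp
 finally have e: "pev M as T (T v) = sev R as r .[M] (r .[M] v)" .
 show ?case unfolding pev.simps sev.simps e using c assms(2,3)
  by (simp add: smult_l_distr R.m_comm flip: smult_assoc1)
qed (use assms in auto)

lemma dev_closed:
 assumes "linear_op R M T" "set as <= carrier R" "v \<in>[M]"
 shows "dev M as T v \<in>[M]"
 using assms(2) by (induction as) (auto simp: linear_opD(1)[OF assms(1)] pev_closed[OF assms(1)] assms(3))

lemma dev_eigen:
 assumes "set as <= carrier R" "r \<in>[R]" "v \<in>[M]" "linear_op R M T" "T v = r .[M] v"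
 shows "dev M as T v = dv R as r .[M] v"
 using assms(1)
proof (induction as)
 case (Cons a as)
 then show ?case using assms linear_opD(3)[OF assms(4)] pev_eigen[OF _ assms(2-5)]
  by (simp add: smult_l_distr R.m_comm flip: smult_assoc1)
qed (use assms in auto)

lemma shift_commute:
 assumes "linear_op R M T" "linear_op R M U" "!!v. v \<in>[M] ==> T (U v) = U (T v)"
  "r \<in>[R]" "v \<in>[M]"
 shows "shift M T r (U v) = U (shift M T r v)"
 using assms linear_op_minus[OF assms(2)] linear_opD[OF assms(1)] linear_opD[OF assms(2)] by (simp add: shift_def)

lemma shift_pow_commute:
 assumes "linear_op R M T" "linear_op R M U" "!!v. v \<in>[M] ==> T (U v) = U (T v)"
  "v \<in>[M]"
 shows "(T ^^ k) (U v) = U ((T ^^ k) v)"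
 using assms(3,4) funpow_closed[of "carrier M" T] linear_opD(1)[OF assms(1)] by (induction k) auto

lemma pow_kill_commute:
 assumes T: "linear_op R M T" and U: "linear_op R M U"
  and "!!v. v \<in>[M] ==> T (U v) = U (T v)" "v \<in>[M]" "(T ^^ k) v = 0[M]"
 shows "(T ^^ k) ((U ^^ i) v) = 0[M]"
proof (induction i)
 case (Suc i)
 have c: "(U ^^ i) v \<in>[M]" using linear_opD(1)[OF linear_op_funpow[OF U]] assms(4) .
 have "(T ^^ k) (U ((U ^^ i) v)) = U ((T ^^ k) ((U ^^ i) v))"
  by (rule shift_pow_commute[OF T U assms(3) c])
 then show ?case using Suc linear_op_zero[OF U] by simp
qed (use assms(5) in simp)

lemma pev_quo:
 assumes "linear_op R M T" "set as <= carrier R" "r \<in>[R]" "v \<in>[M]"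
 shows "pev M as T v = shift M T r (pev M (quo R as r) T v) +[M] sev R as r .[M] v"
 using assms(2)
proof (induction as)
 case Nil
 then show ?case using assms linear_op_zero[OF assms(1)] by (simp add: shift_def a_minus_def)
next
 case (Cons a as)
 note L = linear_opD[OF assms(1)]
 note S = linear_op_shift[OF assms(1,3)]
 have c: "pev M (quo R as r) T v \<in>[M]" "sev R as r \<in>[R]" "pev M as T v \<in>[M]" "a \<in>[R]"
  using Cons.prems assms(3,4) pev_closed[OF assms(1) _ assms(4)] quo_closed by auto
 have c2: "shift M T r (pev M (quo R as r) T v) \<in>[M]" using linear_opD(1)[OF S] c by simp
 show ?case
 proof (cases "as = []")
  case True
  then show ?thesis using assms Cons linear_op_zero[OF assms(1)] by (simp add: shift_def a_minus_def)
 next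
  case False
  have "pev M (a # as) T v = a .[M] v +[M] T (pev M as T v)"
   using pev_commute[OF assms(1,1)] Cons assms by simp
  also have "T (pev M as T v) = T (shift M T r (pev M (quo R as r) T v)) +[M] sev R as r .[M] T v"
   using Cons c c2 L assms by simp
  also have "T (shift M T r (pev M (quo R as r) T v)) = shift M T r (T (pev M (quo R as r) T v))"
   using shift_commute[OF assms(1,1)] assms c by simp
  also have "T (pev M (quo R as r) T v) = pev M (quo R as r) T (T v)"
   using pev_commute[OF assms(1,1)] Cons assms quo_closed by simp
  finally have 1: "pev M (a # as) T v = a .[M] v +[M] (shift M T r (pev M (quo R as r) T (T v)) +[M] sev R as r .[M] T v)" .
  have c3: "pev M (quo R as r) T (T v) \<in>[M]" using Cons assms pev_closed[OF assms(1)] quo_closed L by auto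
  have c4: "shift M T r (pev M (quo R as r) T (T v)) \<in>[M]" using linear_opD(1)[OF S] c3 by simp
  have "shift M T r (pev M (quo R (a # as) r) T v) =
   shift M T r (sev R as r .[M] v) +[M] shift M T r (pev M (quo R as r) T (T v))"
   using False linear_opD[OF S] c c3 assms by simp
  also have "shift M T r (sev R as r .[M] v) = sev R as r .[M] T v -[M] (r \<otimes> sev R as r) .[M] v"
   using c assms L by (simp add: shift_def smult_assoc1)
  finally show ?thesis unfolding 1 using c c3 c4 assms L
   by (simp add: smult_l_distr a_minus_def M.a_ac M.r_neg1 M.r_neg2 M.l_neg)
    (simp add: M.a_lcomm[of "-[M] _"] M.r_neg2 M.r_neg1)?
 qed
qed

lemma nilpotent_last:
 assumes "(T ^^ k) w = 0[M]" "w ~= 0[M]"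
 obtains i where "(T ^^ i) w ~= 0[M]" "T ((T ^^ i) w) = 0[M]"
proof -
 have "\<exists>i. (T ^^ i) w ~= 0[M] \<and> (T ^^ Suc i) w = 0[M]"
 proof (rule ccontr)
  assume "\<not> ?thesis"
  then have "(T ^^ i) w ~= 0[M]" for i using assms(2) by (induction i) auto
  with assms show False by blast
 qed
 then show thesis using that by auto
qed

text \<open>The binomial argument, run as an induction on a + b: one application of S - T splits w
  into S w and T w, and each of these needs one power less of S or of T.\<close>

lemma nilpotent_difference:
 assumes S: "linear_op R M S" and T: "linear_op R M T"
  and comm: "!!v. v \<in>[M] ==> S (T v) = T (S v)"
  and "(S ^^ a) w = 0[M]" "(T ^^ b) w = 0[M]" "w \<in>[M]"
 shows "((\<lambda>v. S v -[M] T v) ^^ (a + b)) w = 0[M]"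
 using assms(4-6)
proof (induction "a + b" arbitrary: a b w)
 case 0
 then show ?case by simp
next
 case (Suc n)
 note D = linear_op_diff[OF S T]
 note L = linear_opD[OF linear_op_funpow[OF D]] linear_op_minus[OF linear_op_funpow[OF D]]
 have w: "S w \<in>[M]" "T w \<in>[M]"
  using linear_opD(1)[OF S] linear_opD(1)[OF T] Suc.prems(3) by simp_all
 have z: "((\<lambda>v. S v -[M] T v) ^^ n) 0[M] = 0[M]" for n using linear_op_zero[OF linear_op_funpow[OF D]] .
 have "((\<lambda>v. S v -[M] T v) ^^ n) (S w) = 0[M]"
 proof (cases a)
  case 0
  then show ?thesis using Suc.prems(1) z linear_op_zero[OF S] by simp
 next
  case (Suc a')
  have "(T ^^ b) (S w) = 0[M]" using shift_pow_commute[OF T S, of w b] comm Suc.prems linear_op_zero[OF S] by auto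
  moreover have "(S ^^ a') (S w) = 0[M]" using Suc Suc.prems by (simp add: funpow_swap1)
  ultimately show ?thesis using Suc.hyps(1)[of a' b "S w"] Suc.hyps(2) Suc w by auto
 qed
 moreover have "((\<lambda>v. S v -[M] T v) ^^ n) (T w) = 0[M]"
 proof (cases b)
  case 0
  then show ?thesis using Suc.prems z linear_op_zero[OF T] by simp
 next
  case (Suc b')
  have "(S ^^ a) (T w) = 0[M]" using shift_pow_commute[OF S T, of w a] comm Suc.prems linear_op_zero[OF T] by auto
  moreover have "(T ^^ b') (T w) = 0[M]" using Suc Suc.prems by (simp add: funpow_swap1)
  ultimately show ?thesis using Suc.hyps(1)[of a b' "T w"] Suc.hyps(2) Suc w by auto
 qed
 ultimately have "((\<lambda>v. S v -[M] T v) ^^ n) (S w -[M] T w) = 0[M]"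
  using L(4) w by (simp add: a_minus_def)
 then show ?case unfolding Suc.hyps(2)[symmetric] by (simp add: funpow_Suc_right del: funpow.simps)
qed

end

context vspace begin

text \<open>With \<open>S = T\<close> and \<open>k = 1\<close> this says that generalized eigenspaces for different eigenvalues
 meet in \<open>0\<close>.\<close>

lemma generalized_eigen_unique:
 assumes S: "linear_op F V S" and T: "linear_op F V T"
  and comm: "!!v. v \<in>[V] ==> S (T v) = T (S v)"
  and r: "r \<in>[F]" "s \<in>[F]" "r ~= s" and w: "w \<in>[V]"
  and wS: "(shift V S r ^^ a) w = 0[V]" and wT: "(shift V T s ^^ b) w = 0[V]"
  and wd: "((\<lambda>v. S v -[V] T v) ^^ k) w = 0[V]"
 shows "w = 0[V]"
proof (rule ccontr)
 assume w0: "w ~= 0[V]"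
 define D where "D v = S v -[V] T v" for v
 note D = linear_op_diff[OF S T, folded D_def]
 note sS = linear_op_shift[OF S r(1)] and sT = linear_op_shift[OF T r(2)]
 note LS = linear_opD[OF S] linear_op_minus[OF S] and LT = linear_opD[OF T] linear_op_minus[OF T]
 have c1: "shift V S r (T v) = T (shift V S r v)" if "v \<in>[V]" for v
  using shift_commute[OF S T comm r(1) that] .
 have c2: "shift V T s (S v) = S (shift V T s v)" if "v \<in>[V]" for v
  using shift_commute[OF T S comm[symmetric] r(2) that] by simp
 have c3: "shift V T s (shift V S r v) = shift V S r (shift V T s v)" if "v \<in>[V]" for v
  using shift_commute[OF T sS c1[symmetric] r(2) that] .
 have c4: "shift V S r (D v) = D (shift V S r v)" if "v \<in>[V]" for v
  using that c1 linear_op_minus[OF sS] LS LT shift_commute[OF S S HOL.refl r(1)] by (simp add: D_def)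
 have c5: "shift V T s (D v) = D (shift V T s v)" if "v \<in>[V]" for v
  using that c2 linear_op_minus[OF sT] LS LT shift_commute[OF T T HOL.refl r(2)] by (simp add: D_def)
 \<comment> \<open>Descend along S - r and then along T - s to a nonzero joint eigenvector
   \<open>w2\<close>. There S - T is the nonzero scalar r - s, which has no vanishing power.\<close>
 obtain i where i: "(shift V S r ^^ i) w ~= 0[V]" "shift V S r ((shift V S r ^^ i) w) = 0[V]"
  using nilpotent_last[OF wS w0] .
 define w1 where "w1 = (shift V S r ^^ i) w"
 have w1: "w1 \<in>[V]" unfolding w1_def using linear_opD(1)[OF linear_op_funpow[OF sS]] w by simp
 have "(shift V T s ^^ b) w1 = 0[V]"
  unfolding w1_def by (rule pow_kill_commute[OF sT sS c3 w wT])
 then obtain j where j: "(shift V T s ^^ j) w1 ~= 0[V]" "shift V T s ((shift V T s ^^ j) w1) = 0[V]"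
  using nilpotent_last i(1) unfolding w1_def by blast
 define w2 where "w2 = (shift V T s ^^ j) w1"
 have w2: "w2 \<in>[V]" unfolding w2_def using linear_opD(1)[OF linear_op_funpow[OF sT]] w1 by simp
 have "(shift V S r ^^ 1) w2 = 0[V]" unfolding w2_def
  by (rule pow_kill_commute[OF sS sT c3[symmetric] w1]) (use i(2) in \<open>unfold w1_def One_nat_def funpow.simps comp_apply id_apply\<close>)
 then have "shift V S r w2 = 0[V]" unfolding One_nat_def funpow.simps comp_apply id_apply .
 then have e1: "S w2 = r .[V] w2" using w2 LS r by (simp add: shift_def M.a_minus_eq_zero_iff)
 have e2: "T w2 = s .[V] w2" using j(2) w2 LT r unfolding w2_def[symmetric]
  by (simp add: shift_def M.a_minus_eq_zero_iff)
 have Dw2: "D w2 = (r \<ominus> s) .[V] w2" using e1 e2 w2 r by (simp add: D_def a_minus_def smult_l_distr smult_l_minus)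
 have "(D ^^ k) w2 = ((r \<ominus> s) [^] k) .[V] w2" for k
  by (induction k) (use w2 r Dw2 linear_opD(3)[OF D] in \<open>auto simp: smult_assoc1\<close>)
 moreover have "(D ^^ k) w2 = 0[V]" unfolding w2_def
 proof (rule pow_kill_commute[OF D sT c5[symmetric] w1])
  show "(D ^^ k) w1 = 0[V]" unfolding w1_def
   by (rule pow_kill_commute[OF D sS c4[symmetric] w wd[folded D_def]])
 qed
 moreover have "(r \<ominus> s) [^] n ~= \<zero>" for n :: nat
 proof (induction n)
  case (Suc n)
  have "r \<ominus> s ~= \<zero>" using r by simp
  then show ?case using integral[of "(r \<ominus> s) [^] n" "r \<ominus> s"] Suc r by auto
 qed simp
 moreover have "w2 ~= 0[V]" using j(1) by (simp add: w2_def)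
 ultimately show False using smult_eq_zero[of "(r \<ominus> s) [^] k" w2] w2 r by auto
qed

end

lemma (in module) linear_op_pev:
 assumes T: "linear_op R M T" and as: "set as <= carrier R"
 shows "linear_op R M (pev M as T)"
 unfolding linear_op_def
proof (intro conjI ballI)
 show "pev M as T v \<in>[M]" if "v \<in>[M]" for v using pev_closed[OF T as that] .
 show "pev M as T (v +[M] w) = pev M as T v +[M] pev M as T w"
  if "v \<in>[M]" "w \<in>[M]" for v w
  using as that
 proof (induction as arbitrary: v w)
  case (Cons a as)
  then show ?case using pev_closed[OF T, of as] linear_opD[OF T] by (simp add: smult_r_distr M.a_ac)
 qed simp
 show "pev M as T (r .[M] v) = r .[M] pev M as T v" if "r \<in>[R]" "v \<in>[M]" for r v
  using as that
 proof (induction as arbitrary: v)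
  case (Cons a as)
  then show ?case using pev_closed[OF T, of as] linear_opD[OF T]
   by (simp add: smult_r_distr R.m_comm flip: smult_assoc1)
 qed simp
qed

context vspace begin

text \<open>On a space where T - r is nilpotent, T - s = (T - r) + (r - s) is a nilpotent plus a
  nonzero scalar, hence onto. The preimage is found recursively: if w1 is a preimage of (T - r)v,
  then (v - w1)/(r - s) is one of v.\<close>

lemma shift_invertible:
 assumes T: "linear_op F V T" and U: "submodule U F V" and TU: "!!u. u \<in> U ==> T u \<in> U"
  and rs: "r \<in>[F]" "s \<in>[F]" "r ~= s"
 shows "[|v \<in> U; (shift V T r ^^ N) v = 0[V]|] ==>
  \<exists>w\<in>U. (shift V T r ^^ N) w = 0[V] \<and> shift V T s w = v"
proof (induction N arbitrary: v)
 case 0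
 then show ?case using submoduleD(2)[OF U] linear_op_zero[OF linear_op_shift[OF T rs(2)]]
  by (intro bexI[of _ "0[V]"]) auto
next
 case (Suc N)
 note L = linear_op_shift[OF T rs(1)] and Ls = linear_op_shift[OF T rs(2)]
 note D = submoduleD[OF U]
 note C = subsetD[OF D(1)]
 define v1 where "v1 = shift V T r v"
 have v1: "v1 \<in> U" unfolding v1_def shift_def using D(4,6) TU rs(1) Suc.prems(1) by simp
 have "(shift V T r ^^ N) v1 = 0[V]"
  using Suc.prems(2) by (simp add: v1_def funpow_Suc_right del: funpow.simps)
 then obtain w1 where w1: "w1 \<in> U" "(shift V T r ^^ N) w1 = 0[V]" "shift V T s w1 = v1"
  using Suc.IH[OF v1] by blast
 define w where "w = (inv (r \<ominus> s)) .[V] (v -[V] w1)"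
 have rs0: "r \<ominus> s \<in>[F]" "r \<ominus> s ~= \<zero>" using rs by auto
 have vc: "v \<in>[V]" "w1 \<in>[V]" using C Suc.prems(1) w1(1) by auto
 note i = smult_inv_cancel[OF rs0]
 have w: "w \<in> U" unfolding w_def using D(4,6) i(3)[OF vc(1)] Suc.prems(1) w1(1) by simp
 have "shift V T s v = v1 +[V] (r \<ominus> s) .[V] v"
  using vc rs linear_opD(1)[OF T]
  by (simp add: v1_def shift_def a_minus_def smult_l_distr smult_l_minus M.a_assoc M.r_neg1)
 then have "shift V T s (v -[V] w1) = (r \<ominus> s) .[V] v"
  using linear_op_minus[OF Ls vc] w1(3) vc rs C[OF v1] by (simp add: a_minus_def M.a_ac M.r_neg2 M.r_neg1 M.r_neg)
 then have "shift V T s w = v"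
  unfolding w_def using linear_opD(3)[OF Ls] i vc by simp
 moreover have "(shift V T r ^^ Suc N) w = 0[V]"
 proof -
  note LN = linear_op_funpow[OF L, of "Suc N"]
  have "(shift V T r ^^ Suc N) w1 = 0[V]" using w1(2) linear_op_zero[OF L] by simp
  then show ?thesis unfolding w_def
   using linear_opD(3)[OF LN] linear_op_minus[OF LN vc] i(3)[OF vc(1)] vc Suc.prems(2) by simp
 qed
 ultimately show ?case using w by blast
qed

text \<open>Decompose (T - s)v by induction and pull the components for eigenvalues other than s
  back along T - s, using \<open>shift_invertible\<close>. What is left of v is a generalized
  eigenvector for s. The invariant submodule U is carried along so that the components stay in
  it.\<close>

lemma generalized_eigen_decomposition:
 assumes T: "linear_op F V T" and U: "submodule U F V" and TU: "!!u. u \<in> U ==> T u \<in> U"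
 shows "[|set rs <= carrier F; v \<in> U; shifts V T rs v = 0[V]|] ==>
  \<exists>w. (\<forall>r\<in>set rs. w r \<in> U \<and> (\<exists>N. (shift V T r ^^ N) (w r) = 0[V])) \<and> v = (\<Oplus>\<^bsub>V\<^esub>r\<in>set rs. w r)"
proof (induction rs arbitrary: v)
 case (Cons s rs)
 note D = submoduleD[OF U]
 note C = subsetD[OF D(1)]
 have s: "s \<in>[F]" and rs: "set rs <= carrier F" using Cons.prems(1) by auto
 note L = linear_op_shift[OF T s]
 define v1 where "v1 = shift V T s v"
 have v1: "v1 \<in> U" unfolding v1_def shift_def using D(4,6) TU s Cons.prems(2) by simp
 obtain w1 where w1: "!!r. r \<in> set rs ==> w1 r \<in> U"
  "!!r. r \<in> set rs ==> \<exists>N. (shift V T r ^^ N) (w1 r) = 0[V]" "v1 = (\<Oplus>\<^bsub>V\<^esub>r\<in>set rs. w1 r)"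
  using Cons.IH[OF rs v1] Cons.prems(3) by (auto simp: v1_def)
 define S where "S = set rs - {s}"
 have "\<exists>u. u \<in> U \<and> (\<exists>N. (shift V T r ^^ N) u = 0[V]) \<and> shift V T s u = w1 r" if r: "r \<in> S" for r
 proof -
  have "r \<in> set rs" "r ~= s" "r \<in>[F]" using r rs by (auto simp: S_def)
  then show ?thesis using shift_invertible[OF T U TU \<open>r \<in>[F]\<close> s \<open>r ~= s\<close> w1(1)] w1(2) by meson
 qed
 then obtain u where u: "!!r. r \<in> S ==> u r \<in> U" "!!r. r \<in> S ==> \<exists>N. (shift V T r ^^ N) (u r) = 0[V]"
  "!!r. r \<in> S ==> shift V T s (u r) = w1 r" by metis
 have fS: "finite S" by (simp add: S_def)
 define us where "us = (\<Oplus>\<^bsub>V\<^esub>r\<in>S. u r)"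
 have usU: "us \<in> U" unfolding us_def using finsum_in_submodule[OF U fS] u(1) by auto
 define u' where "u' = v -[V] us"
 have u'U: "u' \<in> U" using usU Cons.prems(2) D(6) by (simp add: u'_def)
 have "shift V T s us = (\<Oplus>\<^bsub>V\<^esub>r\<in>S. shift V T s (u r))"
  unfolding us_def using linear_op_finsum[OF L fS] u(1) C by auto
 also have "\<dots> = (\<Oplus>\<^bsub>V\<^esub>r\<in>S. w1 r)" using u(3) w1(1) C by (intro M.finsum_cong') (auto simp: S_def)
 finally have sus: "shift V T s us = (\<Oplus>\<^bsub>V\<^esub>r\<in>S. w1 r)" .
 have S1: "(\<Oplus>\<^bsub>V\<^esub>r\<in>S. w1 r) \<in>[V]" using w1(1) C by (intro M.finsum_closed) (auto simp: S_def)
 have "\<exists>N. (shift V T s ^^ N) (shift V T s u') = 0[V]"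
 proof -
  have su: "shift V T s u' = v1 -[V] (\<Oplus>\<^bsub>V\<^esub>r\<in>S. w1 r)"
   unfolding u'_def using linear_op_minus[OF L] C[OF Cons.prems(2)] C[OF usU] sus by (simp add: v1_def)
  show ?thesis
  proof (cases "s \<in> set rs")
   case True
   then have ins: "set rs = insert s S" by (auto simp: S_def)
   have "v1 = w1 s +[V] (\<Oplus>\<^bsub>V\<^esub>r\<in>S. w1 r)"
    unfolding w1(3) ins using fS w1(1) C True by (subst M.finsum_insert) (auto simp: S_def)
   then have "shift V T s u' = w1 s"
    using su S1 C[OF w1(1)[OF True]] by (simp add: a_minus_def M.a_assoc M.r_neg)
   then show ?thesis using w1(2)[OF True] by simp
  next
   case False
   then have "S = set rs" by (auto simp: S_def)
   then have "shift V T s u' = 0[V]" using su w1(3) S1 by simp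
   then show ?thesis by (intro exI[of _ 0]) simp
  qed
 qed
 then have u'N: "\<exists>N. (shift V T s ^^ N) u' = 0[V]" by (metis funpow_Suc_right comp_apply)
 define w where "w r = (if r = s then u' else u r)" for r
 have ins: "set (s # rs) = insert s S" by (auto simp: S_def)
 have "(\<Oplus>\<^bsub>V\<^esub>r\<in>set (s # rs). w r) = u' +[V] (\<Oplus>\<^bsub>V\<^esub>r\<in>S. w r)"
  unfolding ins using fS u(1) u'U C by (subst M.finsum_insert) (auto simp: S_def w_def)
 also have "(\<Oplus>\<^bsub>V\<^esub>r\<in>S. w r) = us"
  unfolding us_def using u(1) C by (intro M.finsum_cong') (auto simp: S_def w_def)
 also have "u' +[V] us = v" using C[OF usU] C[OF Cons.prems(2)] by (simp add: u'_def a_minus_def M.a_assoc M.l_neg)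
 finally have "v = (\<Oplus>\<^bsub>V\<^esub>r\<in>set (s # rs). w r)" by simp
 moreover have "\<forall>r\<in>set (s # rs). w r \<in> U \<and> (\<exists>N. (shift V T r ^^ N) (w r) = 0[V])"
  unfolding ins using u u'U u'N by (auto simp: w_def)
 ultimately show ?case by blast
qed simp

text \<open>\<open>good\<close> is a class of monic polynomials from which roots can be split off.\<close>

lemma shifts_exist:
 assumes T: "linear_op F V T"
  and root: "!!as. [|set as <= carrier F; as ~= []; good (as @ [\<one>])|] ==>
   \<exists>r\<in>carrier F. sev F (as @ [\<one>]) r = \<zero> \<and> good (quo F (as @ [\<one>]) r)"
 shows "[|set as <= carrier F; good (as @ [\<one>]); v \<in>[V]; pev V (as @ [\<one>]) T v = 0[V]|] ==>
  \<exists>rs. set rs <= carrier F \<and> shifts V T rs v = 0[V]"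
proof (induction "length as" arbitrary: as v)
 case 0
 then show ?case using linear_opD(1)[OF T] by (intro exI[of _ "[]"]) simp
next
 case (Suc n)
 then obtain r where r: "r \<in>[F]" "sev F (as @ [\<one>]) r = \<zero>" "good (quo F (as @ [\<one>]) r)"
  using root[of as] by force
 have "as ~= []" using Suc.hyps(2) by auto
 then obtain bs where bs: "quo F (as @ [\<one>]) r = bs @ [\<one>]" "length bs = n" "set bs <= carrier F"
  using R.quo_monic[OF Suc.prems(1) r(1)] Suc.hyps(2) by auto
 note L = linear_op_shift[OF T r(1)]
 have "pev V (bs @ [\<one>]) T (shift V T r v) = shift V T r (pev V (bs @ [\<one>]) T v)"
  using pev_commute[OF T L] shift_commute[OF T T HOL.refl r(1)] bs(3) Suc.prems(3) by auto
 also have "\<dots> = pev V (as @ [\<one>]) T v"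
  using pev_quo[OF T _ r(1) Suc.prems(3), of "as @ [\<one>]"] Suc.prems(1,3) r(2) bs
   linear_opD(1)[OF L pev_closed[OF T _ Suc.prems(3), of "bs @ [\<one>]"]] by simp
 finally obtain rs where "set rs <= carrier F" "shifts V T rs (shift V T r v) = 0[V]"
  using Suc.hyps(1)[of bs "shift V T r v"] bs r(3) Suc.prems(3,4) linear_opD(1)[OF L] by auto
 then show ?case using r(1) by (intro exI[of _ "r # rs"]) simp
qed

lemma submodule_pev_kernel:
 assumes T: "linear_op F V T" and U: "submodule U F V" and TU: "!!u. u \<in> U ==> T u \<in> U"
  and as: "set as <= carrier F"
 shows "submodule {u \<in> U. pev V as T u = 0[V]} F V" "u \<in> {u \<in> U. pev V as T u = 0[V]} ==> T u \<in> {u \<in> U. pev V as T u = 0[V]}"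
proof -
 note D = submoduleD[OF U]
 note C = subsetD[OF D(1)]
 note L = linear_op_pev[OF T as]
 show "submodule {u \<in> U. pev V as T u = 0[V]} F V"
  by (rule submoduleI) (use D C linear_opD[OF L] linear_op_neg[OF L] linear_op_zero[OF L] in auto)
 show "T u \<in> {u \<in> U. pev V as T u = 0[V]}" if "u \<in> {u \<in> U. pev V as T u = 0[V]}"
  using that TU C pev_commute[OF T T HOL.refl as] linear_op_zero[OF T] by auto
qed

text \<open>A generalized eigenvector that is not an eigenvector yields u in the kernel of P(T) with
  z = (T - r)u nonzero and T z = r z. First P(r) z = 0 shows that r is a root. With P = (X - r) Q,
  then 0 = P(T)u = Q(T)z = Q(r) z = P'(r) z, contradicting simplicity of the root.\<close>

lemma eigen_decomposition:
 assumes T: "linear_op F V T" and U: "submodule U F V" and TU: "!!u. u \<in> U ==> T u \<in> U"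
  and as: "set as <= carrier F" and v: "v \<in> U" "pev V as T v = 0[V]"
  and simple: "!!r. [|r \<in>[F]; sev F as r = \<zero>|] ==> dv F as r ~= \<zero>"
  and rs: "set rs <= carrier F" "shifts V T rs v = 0[V]"
 obtains S w where "finite S" "S <= carrier F" "!!r. r \<in> S ==> w r \<in> U"
  "!!r. r \<in> S ==> T (w r) = r .[V] w r" "v = (\<Oplus>\<^bsub>V\<^esub>r\<in>S. w r)"
proof -
 define U' where "U' = {u \<in> U. pev V as T u = 0[V]}"
 note K = submodule_pev_kernel[OF T U TU as, folded U'_def]
 have U'c: "U' <= carrier V" using submoduleD(1)[OF K(1)] .
 obtain w where w: "!!r. r \<in> set rs ==> w r \<in> U'" "!!r. r \<in> set rs ==> \<exists>N. (shift V T r ^^ N) (w r) = 0[V]"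
  "v = (\<Oplus>\<^bsub>V\<^esub>r\<in>set rs. w r)"
  using generalized_eigen_decomposition[OF T K(1) K(2) rs(1) _ rs(2)] v by (auto simp: U'_def)
 have "T (w r) = r .[V] w r" if r: "r \<in> set rs" for r
 proof (rule ccontr)
  assume ne: "T (w r) ~= r .[V] w r"
  have rc: "r \<in>[F]" using r rs(1) by auto
  note L = linear_op_shift[OF T rc]
  have stab: "shift V T r u \<in> U'" if "u \<in> U'" for u
   unfolding shift_def using submoduleD(4,6)[OF K(1)] K(2) rc that by blast
  have stabn: "(shift V T r ^^ i) u \<in> U'" if "u \<in> U'" for u i
   using funpow_closed[of U' "shift V T r"] stab that by blast
  have wc: "w r \<in>[V]" using w(1)[OF r] U'c by blast
  define y where "y = shift V T r (w r)"
  have y0: "y ~= 0[V]" using ne wc rc linear_opD(1)[OF T] by (simp add: y_def shift_def M.a_minus_eq_zero_iff)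
  obtain N where "(shift V T r ^^ N) (w r) = 0[V]" using w(2)[OF r] by blast
  then have "(shift V T r ^^ N) y = 0[V]"
   using linear_op_zero[OF L] by (simp add: y_def flip: funpow_swap1)
  then obtain i where i: "(shift V T r ^^ i) y ~= 0[V]" "shift V T r ((shift V T r ^^ i) y) = 0[V]"
   using nilpotent_last y0 by blast
  define z u where "z = (shift V T r ^^ i) y" and "u = (shift V T r ^^ i) (w r)"
  have zu: "z = shift V T r u" unfolding z_def u_def y_def by (simp add: funpow_swap1)
  have u: "u \<in> U'" "z \<in> U'" unfolding zu using stab stabn w(1)[OF r] by (simp_all add: u_def)
  have zc: "z \<in>[V]" "u \<in>[V]" using u U'c by auto
  have Tz: "T z = r .[V] z" using i(2) zc linear_opD(1)[OF T] rc
   unfolding z_def[symmetric] by (simp add: shift_def M.a_minus_eq_zero_iff)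
  have "sev F as r .[V] z = 0[V]" using pev_eigen[OF as rc zc(1) T Tz] u(2) by (simp add: U'_def)
  then have s0: "sev F as r = \<zero>" using smult_eq_zero[OF _ zc(1)] i(1) as rc unfolding z_def[symmetric] by auto
  note qc = R.quo_closed[OF as rc]
  have pc: "pev V (quo F as r) T u \<in>[V]" using pev_closed[OF T qc zc(2)] .
  have "0[V] = pev V as T u" using u(1) by (simp add: U'_def)
  also have "\<dots> = shift V T r (pev V (quo F as r) T u)"
   using pev_quo[OF T as rc zc(2)] s0 zc linear_opD(1)[OF L pc] by simp
  also have "\<dots> = pev V (quo F as r) T z" unfolding zu
   using pev_commute[OF T L _ qc zc(2)] shift_commute[OF T T HOL.refl rc] by auto
  also have "\<dots> = dv F as r .[V] z" using pev_eigen[OF qc rc zc(1) T Tz] R.sev_quo_root[OF as rc] by simp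
  finally have "dv F as r .[V] z = 0[V]" by simp
  then show False using smult_eq_zero[OF _ zc(1)] simple[OF rc s0] i(1) as rc unfolding z_def[symmetric] by auto
 qed
 then show thesis using that[of "set rs" w] w rs(1) by (auto simp: U'_def)
qed

end

text \<open>The minimal polynomial of v under T, stored without its leading coefficient 1.\<close>

definition minimal_relation ::
  "('f, 'm) ring_scheme => ('f, 'v, 'n) module_scheme => ('v => 'v) => 'v => 'f list => bool" where
 "minimal_relation F V T v as \<longleftrightarrow> set as <= carrier F \<and> pev V (as @ [1[F]]) T v = 0[V] \<and>
  (\<forall>bs. set bs <= carrier F \<and> length bs < length as --> pev V (bs @ [1[F]]) T v ~= 0[V])"

lemma minimal_relation_exists:
 assumes "set as <= carrier F" "pev V (as @ [1[F]]) T v = 0[V]"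
 obtains bs where "minimal_relation F V T v bs"
proof -
 define P where "P bs \<longleftrightarrow> set bs <= carrier F \<and> pev V (bs @ [1[F]]) T v = 0[V]" for bs
 obtain bs where bs: "P bs" "!!cs. P cs ==> length bs \<le> length cs"
  using ex_has_least_nat[of P as length] assms unfolding P_def by metis
 then have "minimal_relation F V T v bs" unfolding minimal_relation_def P_def by (meson not_less)
 then show thesis by (rule that)
qed

text \<open>The spans of v, T v, ..., T^(n-1) v cannot grow strictly forever, since their heights
  would be unbounded. The first stagnation gives the relation.\<close>

lemma (in vspace) relation_exists:
 assumes fd: "finite_dimensional F V" and T: "linear_op F V T" and v: "v \<in>[V]"
 obtains as where "set as <= carrier F" "pev V (as @ [\<one>]) T v = 0[V]"
proof -
 define W where "W = rec_nat {0[V]} (\<lambda>n W. add_line F V W ((T ^^ n) v))"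
 have W0: "W 0 = {0[V]}" and WS: "W (Suc n) = add_line F V (W n) ((T ^^ n) v)" for n by (simp_all add: W_def)
 have Tn: "(T ^^ n) v \<in>[V]" for n using linear_opD(1)[OF linear_op_funpow[OF T] v] .
 have sub: "submodule (W n) F V" for n
  by (induction n) (simp_all add: W0 WS submodule_zero submodule_add_line(1)[OF _ Tn])
 have repr: "w \<in> W n ==> \<exists>as. set as <= carrier F \<and> length as = n \<and> w = pev V as T v" for n w
 proof (induction n arbitrary: w)
  case 0
  then show ?case by (simp add: W0)
 next
  case (Suc n)
  then obtain u r where "u \<in> W n" "r \<in>[F]" "w = u +[V] r .[V] (T ^^ n) v"
   by (auto simp: WS add_line_def)
  moreover obtain as where "set as <= carrier F" "length as = n" "u = pev V as T v"
   using Suc.IH[OF \<open>u \<in> W n\<close>] by blast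
  ultimately show ?case using pev_append[OF T _ _ v, of as r] by (intro exI[of _ "as @ [r]"]) simp
 qed
 obtain d :: "'v set => nat" where
  d: "!!N N'. [|submodule N F V; submodule N' F V; N \<subset> N'|] ==> d N < d N'"
  using height_exists[OF fd] by blast
 have "\<exists>n. (T ^^ n) v \<in> W n"
 proof (rule ccontr)
  assume n: "\<not> ?thesis"
  have "W n \<subset> W (Suc n)" for n
   using submodule_add_line(2,3)[OF sub Tn] n by (auto simp: WS)
  then have lt: "d (W n) < d (W (Suc n))" for n using d[OF sub sub] by blast
  have "n \<le> d (W n)" for n
  proof (induction n)
   case (Suc n)
   then show ?case using lt[of n] by simp
  qed simp
  moreover have "d (W n) \<le> d (carrier V)" for n
   using d[OF sub carrier_is_submodule] submoduleD(1)[OF sub, of n]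
   by (metis less_imp_le order_refl psubsetI)
  ultimately show False by (metis Suc_n_not_le_n le_trans)
 qed
 then obtain n where "(T ^^ n) v \<in> W n" by blast
 then have "-[V] ((T ^^ n) v) \<in> W n" using submoduleD(5)[OF sub] by blast
 then obtain as where as: "set as <= carrier F" "length as = n" "-[V] ((T ^^ n) v) = pev V as T v"
  using repr by blast
 then have "pev V (as @ [\<one>]) T v = 0[V]" using pev_append[OF T as(1) _ v, of \<one>] Tn by (simp flip: as(3) add: M.l_neg)
 then show thesis using that as(1) by blast
qed

section \<open>Tensor products\<close>

declare in_lists_conv_set [simp del] in_listsD [rule del] in_listsI [rule del]

abbreviation "pairs B C \<equiv> lists (carrier B \<times> carrier C)"

lemma map_lists: "[|xs \<in> lists S; !!x. x \<in> S ==> f x \<in> S'|] ==> map f xs \<in> lists S'"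
 by (induction xs rule: list.induct) auto

section \<open>Balanced maps and the universal property of the tensor product\<close>

definition balanced_map ::
 "('f, 'm) ring_scheme => ('f, 'b) module => ('f, 'c) module => ('g, 'n) ring_scheme => ('b => 'c => 'g) => bool" where
 "balanced_map F B C G f \<longleftrightarrow> (\<forall>b\<in>carrier B. \<forall>c\<in>carrier C. f b c \<in>[G]) \<and>
  (\<forall>b\<in>carrier B. \<forall>b'\<in>carrier B. \<forall>c\<in>carrier C. f (b +[B] b') c = f b c +[G] f b' c) \<and>
  (\<forall>b\<in>carrier B. \<forall>c\<in>carrier C. \<forall>c'\<in>carrier C. f b (c +[C] c') = f b c +[G] f b c') \<and>
  (\<forall>r\<in>carrier F. \<forall>b\<in>carrier B. \<forall>c\<in>carrier C. f (r .[B] b) c = f b (r .[C] c))"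

definition tsum :: "('g, 'n) ring_scheme => ('b => 'c => 'g) => ('b \<times> 'c) list => 'g" where
 "tsum G f xs = foldr (\<lambda>(b, c) s. f b c +[G] s) xs 0[G]"

text \<open>The homomorphism on the tensor product induced by a balanced map f; by
  \<open>tsum_rel\<close> the representative chosen does not matter.\<close>

definition tlift :: "('g, 'n) ring_scheme => ('b => 'c => 'g) => ('b \<times> 'c) list set => 'g" where
 "tlift G f S = tsum G f (SOME xs. xs \<in> S)"

lemma tsum_simps [simp]:
 "tsum G f [] = 0[G]" "tsum G f ((b, c) # xs) = f b c +[G] tsum G f xs"
 by (simp_all add: tsum_def)

lemma tsum_closed:
 assumes "abelian_group G" "\<forall>b\<in>carrier B. \<forall>c\<in>carrier C. f b c \<in>[G]" "xs \<in> pairs B C"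
 shows "tsum G f xs \<in>[G]"
proof -
 interpret abelian_group G by fact
 show ?thesis using assms(3) by induction (auto simp: assms(2))
qed

lemma tsum_append:
 assumes "abelian_group G" "\<forall>b\<in>carrier B. \<forall>c\<in>carrier C. f b c \<in>[G]"
  "xs \<in> pairs B C" "ys \<in> pairs B C"
 shows "tsum G f (xs @ ys) = tsum G f xs +[G] tsum G f ys"
proof -
 interpret abelian_group G by fact
 note c = tsum_closed[OF assms(1,2)]
 show ?thesis using assms(3)
 proof (induction xs rule: list.induct)
  case Nil
  then show ?case using c[OF assms(4)] by simp
 next
  case (Cons p xs)
  then have "xs \<in> pairs B C" "fst p \<in>[B]" "snd p \<in>[C]" by auto
  then show ?case using Cons.IH c[of xs] c[OF assms(4)] assms(2) by (cases p) (simp add: a_assoc)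
 qed
qed

lemma tsum_additive:
 assumes "abelian_group G" "\<forall>b\<in>carrier B. \<forall>c\<in>carrier C. f b c \<in>[G]"
  "\<forall>b\<in>carrier B. \<forall>c\<in>carrier C. g b c \<in>[G]" "xs \<in> pairs B C"
 shows "tsum G (\<lambda>b c. f b c +[G] g b c) xs = tsum G f xs +[G] tsum G g xs"
proof -
 interpret abelian_group G by fact
 note c = tsum_closed[OF assms(1,2)] tsum_closed[OF assms(1,3)]
 show ?thesis using assms(4)
 proof induction
  case (Cons p xs)
  then show ?case using c(1)[of xs] c(2)[of xs] assms(2,3) by (auto simp: a_ac)
 qed simp
qed

lemma tsum_hom:
 assumes "abelian_group G" "\<forall>b\<in>carrier B. \<forall>c\<in>carrier C. f b c \<in>[G]" "xs \<in> pairs B C"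
  "!!x y. [|x \<in>[G]; y \<in>[G]|] ==> h (x +[G] y) = h x +[H] h y" "h 0[G] = 0[H]"
 shows "h (tsum G f xs) = tsum H (\<lambda>b c. h (f b c)) xs"
 using assms(3)
proof induction
 case (Cons p xs)
 then show ?case using tsum_closed[OF assms(1,2), of xs] assms(2,4) by auto
qed (simp add: assms(5))

lemma tsum_map: "tsum G f (map (map_prod p q) xs) = tsum G (\<lambda>b c. f (p b) (q c)) xs"
 by (induction xs) auto

lemma tsum_cong:
 "xs \<in> lists (S \<times> T) ==> (!!b c. [|b \<in> S; c \<in> T|] ==> f b c = g b c) ==> tsum G f xs = tsum G g xs"
 by (induction rule: lists.induct) auto

locale tensor_modules = B: module F B + C: module F C
 for F :: "('f, 'm) ring_scheme" and B :: "('f, 'b) module" and C :: "('f, 'c) module"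
begin

abbreviation "rel \<equiv> tensor_rel F B C"
abbreviation "cls \<equiv> tensor_class F B C"

lemma rel_pairs: "rel xs ys ==> xs \<in> pairs B C \<and> ys \<in> pairs B C"
 by (induction rule: tensor_rel.induct) auto

lemma cls_eq: "[|xs \<in> pairs B C; ys \<in> pairs B C|] ==> cls xs = cls ys \<longleftrightarrow> rel xs ys"
 unfolding tensor_class_def by (auto intro: tensor_rel.intros)

lemma cls_eqI: "rel xs ys ==> cls xs = cls ys"
 using cls_eq rel_pairs by blast

lemma mem_cls: "ys \<in> cls xs \<longleftrightarrow> rel xs ys" by (simp add: tensor_class_def)

lemma self_mem_cls: "xs \<in> pairs B C ==> xs \<in> cls xs" by (simp add: mem_cls tensor_rel.refl)

lemma UN_cls:
 assumes "xs \<in> pairs B C" "!!xs'. rel xs xs' ==> f xs' = c"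
 shows "(\<Union>xs'\<in>cls xs. f xs') = c"
 using assms(2) self_mem_cls[OF assms(1)] by (auto simp: mem_cls)

lemma UN_cls2:
 assumes "xs \<in> pairs B C" "ys \<in> pairs B C" "!!xs' ys'. [|rel xs xs'; rel ys ys'|] ==> f xs' ys' = c"
 shows "(\<Union>xs'\<in>cls xs. \<Union>ys'\<in>cls ys. f xs' ys') = c"
 by (intro UN_cls assms)

lemma rel_perm: "[|xs \<in> pairs B C; mset xs = mset ys|] ==> rel xs ys"
proof (induction xs arbitrary: ys rule: list.induct)
 case Nil
 then show ?case using tensor_rel.refl[of "[]"] by simp
next
 case (Cons x xs)
 then have "x \<in> set ys" by (metis list.set_intros(1) mset_eq_setD)
 then obtain us vs where ys: "ys = us @ x # vs" by (meson split_list)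
 then have "mset xs = mset (us @ vs)" using Cons.prems(2) by simp
 then have r: "rel xs (us @ vs)" using Cons.IH Cons.prems(1) by simp
 then have p: "us \<in> pairs B C" "vs \<in> pairs B C" "[x] \<in> pairs B C" using rel_pairs[OF r] Cons.prems(1) by auto
 have "rel ([x] @ xs) ([x] @ (us @ vs))" using r p by (intro tensor_rel.append tensor_rel.refl)
 moreover have "rel (([x] @ us) @ vs) ((us @ [x]) @ vs)"
  using p by (intro tensor_rel.append tensor_rel.refl tensor_rel.commute)
 ultimately have "rel (x # xs) (us @ x # vs)" by (simp add: tensor_rel.trans[of F B C "x # xs" "x # us @ vs"])
 then show ?case unfolding ys .
qed

text \<open>Well-definedness of the induced homomorphism, checked on each generator of the
  congruence. The generator 0 \<otimes> c is respected because f(0, c) = f(0, c) + f(0, c).\<close>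

lemma tsum_rel:
 assumes G: "abelian_group G" and f: "balanced_map F B C G f" and "rel xs ys"
 shows "tsum G f xs = tsum G f ys"
proof -
 interpret G: abelian_group G by fact
 have fc: "\<forall>b\<in>carrier B. \<forall>c\<in>carrier C. f b c \<in>[G]"
  and f1: "!!b b' c. [|b \<in>[B]; b' \<in>[B]; c \<in>[C]|] ==> f (b +[B] b') c = f b c +[G] f b' c"
  and f2: "!!b c c'. [|b \<in>[B]; c \<in>[C]; c' \<in>[C]|] ==> f b (c +[C] c') = f b c +[G] f b c'"
  and f3: "!!r b c. [|r \<in>[F]; b \<in>[B]; c \<in>[C]|] ==> f (r .[B] b) c = f b (r .[C] c)"
  using f unfolding balanced_map_def by auto
 have f0: "f 0[B] c = 0[G]" if "c \<in>[C]" for c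
  using f1[of "0[B]" "0[B]" c] fc that
  by (metis B.M.zero_closed B.M.l_zero G.add.r_cancel_one')
 note ap = tsum_append[OF G fc]
 from assms(3) show ?thesis
 proof induction
  case (append xs ys xs' ys')
  then show ?case using rel_pairs ap by metis
 next
  case (commute xs ys)
  then show ?case using ap tsum_closed[OF G fc] G.a_comm by metis
 qed (auto simp: fc f0 f1 f2 f3)
qed

lemma tlift_cls:
 assumes "abelian_group G" "balanced_map F B C G f" "xs \<in> pairs B C"
 shows "tlift G f (cls xs) = tsum G f xs"
proof -
 have "(SOME ys. ys \<in> cls xs) \<in> cls xs" using self_mem_cls[OF assms(3)] by (rule someI)
 then show ?thesis unfolding tlift_def using tsum_rel[OF assms(1,2)] by (metis mem_cls)
qed

lemma rel_map:
 assumes B': "module F B'" and C': "module F C'"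
  and p: "!!b. b \<in>[B] ==> p b \<in>[B']"
   "!!b b'. [|b \<in>[B]; b' \<in>[B]|] ==> p (b +[B] b') = p b +[B'] p b'"
   "!!r b. [|r \<in>[F]; b \<in>[B]|] ==> p (r .[B] b) = r .[B'] p b"
  and q: "!!c. c \<in>[C] ==> q c \<in>[C']"
   "!!c c'. [|c \<in>[C]; c' \<in>[C]|] ==> q (c +[C] c') = q c +[C'] q c'"
   "!!r c. [|r \<in>[F]; c \<in>[C]|] ==> q (r .[C] c) = r .[C'] q c"
  and "rel xs ys"
 shows "tensor_rel F B' C' (map (map_prod p q) xs) (map (map_prod p q) ys)"
proof -
 interpret B': module F B' by fact
 have m: "map (map_prod p q) xs \<in> pairs B' C'" if "xs \<in> pairs B C" for xs
  using that by (rule map_lists) (use p q in auto)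
 have p0: "p 0[B] = 0[B']" using p(3)[of "0[F]" "0[B]"] p(1)[of "0[B]"] by simp
 from assms(9) show ?thesis
 proof induction
  case (sym xs ys) then show ?case by (metis tensor_rel.sym)
 next
  case (trans xs ys zs) then show ?case by (metis tensor_rel.trans)
 next
  case (zero c) then show ?case using q p0 by (auto intro: tensor_rel.zero)
 qed (auto simp: p q m intro: tensor_rel.refl tensor_rel.append tensor_rel.commute tensor_rel.add_left
   tensor_rel.add_right tensor_rel.balanced)
qed

end

locale tensor = B: algebra F B + C: nonassoc_algebra F C
 for F :: "('f, 'm) ring_scheme" and B :: "('f, 'b) module" and C :: "('f, 'c) module"

sublocale tensor \<subseteq> tensor_modules F B C by unfold_locales

lemma (in algebra) smult_assoc2_right:
 "[|a \<in>[R]; x \<in>[M]; y \<in>[M]|] ==> x *[M] (a .[M] y) = a .[M] (x *[M] y)"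
 by (metis m_comm smult_assoc2 smult_closed)

section \<open>The algebra structure on the tensor product\<close>

context tensor begin

abbreviation "pm x y \<equiv> map_prod (mop B (fst x)) (mop C (snd x)) y"
abbreviation "lm \<equiv> tensor_list_mult B C"
abbreviation "T \<equiv> tensor_algebra F B C"

lemma lm_simps: "lm [] ys = []" "lm (x # xs) ys = map (pm x) ys @ lm xs ys"
 by (auto simp: tensor_list_mult_def split: prod.splits)

lemma pm_closed: "[|x \<in> carrier B \<times> carrier C; ys \<in> pairs B C|] ==> map (pm x) ys \<in> pairs B C"
 by (rule map_lists) (auto simp: C.mult_closed)

lemma lm_closed: "[|xs \<in> pairs B C; ys \<in> pairs B C|] ==> lm xs ys \<in> pairs B C"
proof (induction xs rule: list.induct)
 case (Cons x xs)
 then show ?case using pm_closed[of x ys] by (simp add: lm_simps)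
qed (simp add: lm_simps)

lemma lm_append: "lm (xs @ ys) zs = lm xs zs @ lm ys zs"
 by (induction xs) (auto simp: lm_simps)

lemma mset_lm_Cons: "mset (lm xs (y # ys)) = mset (map (\<lambda>x. pm x y) xs) + mset (lm xs ys)"
 by (induction xs) (auto simp: lm_simps)

lemma mset_lm_append: "mset (lm xs (ys @ zs)) = mset (lm xs ys) + mset (lm xs zs)"
 by (induction xs) (auto simp: lm_simps)

lemma rel_pm: "[|x \<in> carrier B \<times> carrier C; rel ys ys'|] ==> rel (map (pm x) ys) (map (pm x) ys')"
 by (rule rel_map[OF B.module C.module_axioms])
  (auto simp: B.r_distr B.smult_assoc2_right C.mult_closed C.distrib_left C.mult_smult)

lemma rel_pm': "[|y \<in> carrier B \<times> carrier C; rel xs xs'|] ==> rel (map (\<lambda>x. pm x y) xs) (map (\<lambda>x. pm x y) xs')"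
proof -
 assume y: "y \<in> carrier B \<times> carrier C" and r: "rel xs xs'"
 have e: "(\<lambda>x. pm x y) = map_prod (\<lambda>b. b *[B] fst y) (\<lambda>c. c *[C] snd y)" by (auto simp: map_prod_def split: prod.splits)
 show ?thesis unfolding e using y r
  by (intro rel_map[OF B.module C.module_axioms])
   (auto simp: B.l_distr B.smult_assoc2 C.mult_closed C.distrib_right C.smult_mult)
qed

text \<open>The product of classes is well defined, one argument at a time. For the left argument
  the right list is peeled off instead, which lists the terms in a different order and therefore
  calls for \<open>rel_perm\<close>.\<close>

lemma rel_lm:
 assumes "rel xs xs'" "rel ys ys'"
 shows "rel (lm xs ys) (lm xs' ys')"
proof -
 note p = rel_pairs[OF assms(1)] rel_pairs[OF assms(2)]
 have "rel (lm xs ys) (lm xs ys')" if "xs \<in> pairs B C" for xs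
  using that
 proof (induction xs rule: list.induct)
  case Nil then show ?case by (simp add: lm_simps tensor_rel.refl)
 next
  case (Cons x xs)
  then show ?case unfolding lm_simps by (intro tensor_rel.append rel_pm assms) auto
 qed
 moreover have "rel (lm xs ys) (lm xs' ys)" if "ys \<in> pairs B C" for ys
  using that
 proof (induction ys rule: list.induct)
  case Nil
  have "lm xs [] = []" for xs by (induction xs) (auto simp: lm_simps)
  then show ?case by (simp add: tensor_rel.refl)
 next
  case (Cons y ys)
  have 1: "rel (lm zs (y # ys)) (map (\<lambda>x. pm x y) zs @ lm zs ys)" if "zs \<in> pairs B C" for zs
   using that Cons.prems by (intro rel_perm) (auto simp: mset_lm_Cons lm_closed)
  have "rel (map (\<lambda>x. pm x y) xs @ lm xs ys) (map (\<lambda>x. pm x y) xs' @ lm xs' ys)"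
   using Cons by (intro tensor_rel.append rel_pm' assms) auto
  then show ?case using 1[of xs] 1[of xs'] p by (meson tensor_rel.trans tensor_rel.sym)
 qed
 ultimately show ?thesis using p by (meson tensor_rel.trans)
qed

lemma carrier_T: "carrier T = cls ` pairs B C" by (simp add: tensor_algebra_def)

lemma cls_closed [simp]: "xs \<in> pairs B C ==> cls xs \<in>[T]" by (simp add: carrier_T)

lemma carrierE: assumes "z \<in>[T]" obtains xs where "xs \<in> pairs B C" "z = cls xs"
 using assms by (auto simp: carrier_T)

lemma one_T: "1[T] = cls [(1[B], 1[C])]" and zero_T: "0[T] = cls []"
 by (simp_all add: tensor_algebra_def)

lemma add_T: "[|xs \<in> pairs B C; ys \<in> pairs B C|] ==> cls xs +[T] cls ys = cls (xs @ ys)"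
proof -
 assume p: "xs \<in> pairs B C" "ys \<in> pairs B C"
 have 1: "cls (xs' @ ys') = cls (xs @ ys)" if "rel xs xs'" "rel ys ys'" for xs' ys'
  using that by (intro cls_eqI tensor_rel.append) (auto intro: tensor_rel.sym)
 have "cls xs +[T] cls ys = (\<Union>xs'\<in>cls xs. \<Union>ys'\<in>cls ys. cls (xs' @ ys'))" by (simp add: tensor_algebra_def)
 also have "\<dots> = cls (xs @ ys)" by (rule UN_cls2[OF p 1])
 finally show ?thesis .
qed

lemma mult_T: "[|xs \<in> pairs B C; ys \<in> pairs B C|] ==> cls xs *[T] cls ys = cls (lm xs ys)"
proof -
 assume p: "xs \<in> pairs B C" "ys \<in> pairs B C"
 have 1: "cls (lm xs' ys') = cls (lm xs ys)" if "rel xs xs'" "rel ys ys'" for xs' ys'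
  using that by (intro cls_eqI rel_lm) (auto intro: tensor_rel.sym)
 have "cls xs *[T] cls ys = (\<Union>xs'\<in>cls xs. \<Union>ys'\<in>cls ys. cls (lm xs' ys'))" by (simp add: tensor_algebra_def)
 also have "\<dots> = cls (lm xs ys)" by (rule UN_cls2[OF p 1])
 finally show ?thesis .
qed

abbreviation "sm b \<equiv> map (map_prod (mop B b) (\<lambda>c. c))"

lemma sm_closed: "[|b \<in>[B]; xs \<in> pairs B C|] ==> sm b xs \<in> pairs B C"
 by (rule map_lists) auto

lemma rel_sm: "[|b \<in>[B]; rel xs xs'|] ==> rel (sm b xs) (sm b xs')"
 by (rule rel_map[OF B.module C.module_axioms]) (auto simp: B.r_distr B.smult_assoc2_right)

lemma smult_T: "[|b \<in>[B]; xs \<in> pairs B C|] ==> b .[T] cls xs = cls (sm b xs)"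
proof -
 assume p: "b \<in>[B]" "xs \<in> pairs B C"
 have 1: "cls (sm b xs') = cls (sm b xs)" if "rel xs xs'" for xs'
  using that p by (intro cls_eqI rel_sm) (auto intro: tensor_rel.sym)
 have e: "(\<lambda>(b', c). (b *[B] b', c)) = map_prod (mop B b) (\<lambda>c. c)" by auto
 have "b .[T] cls xs = (\<Union>xs'\<in>cls xs. cls (sm b xs'))" by (simp add: tensor_algebra_def e)
 also have "\<dots> = cls (sm b xs)" by (rule UN_cls[OF p(2) 1])
 finally show ?thesis .
qed

lemma rel_cancel: "xs \<in> pairs B C ==> rel (xs @ map (map_prod (a_inv B) (\<lambda>c. c)) xs) []"
proof (induction xs rule: list.induct)
 case Nil then show ?case by (simp add: tensor_rel.refl)
next
 case (Cons x xs)
 obtain b c where x: "x = (b, c)" by force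
 with Cons.prems have bc: "b \<in>[B]" "c \<in>[C]" "xs \<in> pairs B C" by auto
 have p: "map (map_prod (a_inv B) (\<lambda>c. c)) xs \<in> pairs B C" by (rule map_lists[OF bc(3)]) auto
 have "rel [(b, c), (-[B] b, c)] [(b +[B] -[B] b, c)]"
  using bc by (intro tensor_rel.sym[OF tensor_rel.add_left]) auto
 then have "rel [(b, c), (-[B] b, c)] [(0[B], c)]" using bc by (simp add: B.r_neg)
 from tensor_rel.trans[OF this tensor_rel.zero[OF bc(2)]] have 1: "rel [(b, c), (-[B] b, c)] []" .
 have "rel ((x # xs) @ map (map_prod (a_inv B) (\<lambda>c. c)) (x # xs))
   ([(b, c), (-[B] b, c)] @ (xs @ map (map_prod (a_inv B) (\<lambda>c. c)) xs))"
  using bc p by (intro rel_perm) (auto simp: x)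
 moreover have "rel ([(b, c), (-[B] b, c)] @ (xs @ map (map_prod (a_inv B) (\<lambda>c. c)) xs)) ([] @ [])"
  by (rule tensor_rel.append[OF 1 Cons.IH[OF bc(3)]])
 ultimately have "rel ((x # xs) @ map (map_prod (a_inv B) (\<lambda>c. c)) (x # xs)) ([] @ [])" by (rule tensor_rel.trans)
 then show ?case by simp
qed

lemma rel_sm_add: "[|a \<in>[B]; b \<in>[B]; xs \<in> pairs B C|] ==> rel (sm (a +[B] b) xs) (sm a xs @ sm b xs)"
proof (induction xs rule: list.induct)
 case Nil then show ?case by (simp add: tensor_rel.refl)
next
 case (Cons x xs)
 obtain d c where x: "x = (d, c)" by force
 with Cons.prems have bc: "d \<in>[B]" "c \<in>[C]" "xs \<in> pairs B C" by auto
 have "rel ([((a +[B] b) *[B] d, c)] @ sm (a +[B] b) xs) ([(a *[B] d, c), (b *[B] d, c)] @ (sm a xs @ sm b xs))"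
  using Cons bc by (intro tensor_rel.append) (auto simp: B.l_distr intro: tensor_rel.add_left)
 moreover have "rel ([(a *[B] d, c), (b *[B] d, c)] @ (sm a xs @ sm b xs)) (sm a (x # xs) @ sm b (x # xs))"
  using bc Cons.prems sm_closed by (intro rel_perm) (auto simp: x)
 ultimately have "rel ([((a +[B] b) *[B] d, c)] @ sm (a +[B] b) xs) (sm a (x # xs) @ sm b (x # xs))"
  by (rule tensor_rel.trans)
 then show ?case using x by simp
qed

lemma abelian_group_T: "abelian_group T"
proof (rule abelian_groupI)
 fix x y z assume x: "x \<in>[T]" and y: "y \<in>[T]" and z: "z \<in>[T]"
 obtain xs ys zs where l: "xs \<in> pairs B C" "x = cls xs" "ys \<in> pairs B C" "y = cls ys" "zs \<in> pairs B C" "z = cls zs"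
  using x y z by (metis carrierE)
 show "x +[T] y \<in>[T]" using l by (simp add: add_T)
 show "(x +[T] y) +[T] z = x +[T] (y +[T] z)" using l by (simp add: add_T)
 show "x +[T] y = y +[T] x" using l by (simp add: add_T cls_eqI tensor_rel.commute)
 show "0[T] +[T] x = x" using l by (simp add: add_T zero_T)
next
 show "0[T] \<in>[T]" by (simp add: zero_T)
next
 fix x assume "x \<in>[T]"
 then obtain xs where l: "xs \<in> pairs B C" "x = cls xs" by (metis carrierE)
 have p: "map (map_prod (a_inv B) (\<lambda>c. c)) xs \<in> pairs B C" by (rule map_lists[OF l(1)]) auto
 have "rel (map (map_prod (a_inv B) (\<lambda>c. c)) xs @ xs) []"
  using tensor_rel.trans[OF tensor_rel.commute[OF p l(1)] rel_cancel[OF l(1)]] .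
 then have "cls (map (map_prod (a_inv B) (\<lambda>c. c)) xs) +[T] x = 0[T]"
  using l p by (simp add: add_T zero_T cls_eqI)
 then show "\<exists>y\<in>carrier T. y +[T] x = 0[T]"
  using cls_closed[OF p] by (intro bexI)
qed

lemma nonassoc_algebra_T: "nonassoc_algebra B T"
proof -
 have m: "module B T"
 proof (rule moduleI[OF B.M_cring abelian_group_T])
  fix a b x y assume a: "a \<in>[B]" and b: "b \<in>[B]" and x: "x \<in>[T]" and y: "y \<in>[T]"
  obtain xs ys where l: "xs \<in> pairs B C" "x = cls xs" "ys \<in> pairs B C" "y = cls ys"
   using x y by (metis carrierE)
  show "a .[T] x \<in>[T]" using l a sm_closed by (simp add: smult_T)
  show "(a +[B] b) .[T] x = a .[T] x +[T] b .[T] x"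
   using l a b sm_closed by (simp add: smult_T add_T cls_eqI rel_sm_add)
  show "a .[T] (x +[T] y) = a .[T] x +[T] a .[T] y"
   using l a sm_closed by (simp add: smult_T add_T)
  have "sm (a *[B] b) xs = sm a (sm b xs)"
   using l(1) a b by (induction xs rule: list.induct) (auto simp: B.m_assoc)
  then show "(a *[B] b) .[T] x = a .[T] (b .[T] x)"
   using l a b sm_closed[OF b l(1)] by (simp add: smult_T del: map_map)
 next
  fix x assume "x \<in>[T]"
  then obtain xs where l: "xs \<in> pairs B C" "x = cls xs" by (metis carrierE)
  have "sm 1[B] xs = xs" using l(1) by (induction xs rule: list.induct) auto
  then show "1[B] .[T] x = x" using l by (simp add: smult_T)
 qed
 show ?thesis
 proof (intro nonassoc_algebra.intro m nonassoc_algebra_axioms.intro)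
  show "1[T] \<in>[T]" by (simp add: one_T C.one_closed)
 next
  fix x y z assume x: "x \<in>[T]" and y: "y \<in>[T]" and z: "z \<in>[T]"
  obtain xs ys zs where l: "xs \<in> pairs B C" "x = cls xs" "ys \<in> pairs B C" "y = cls ys" "zs \<in> pairs B C" "z = cls zs"
   using x y z by (metis carrierE)
  show "x *[T] y \<in>[T]" using l by (simp add: mult_T lm_closed)
  show "(x +[T] y) *[T] z = x *[T] z +[T] y *[T] z"
   using l by (simp add: add_T mult_T lm_append lm_closed)
  show "z *[T] (x +[T] y) = z *[T] x +[T] z *[T] y"
   using l by (simp add: add_T mult_T lm_closed) (intro cls_eqI rel_perm, auto simp: lm_closed mset_lm_append)
  have "lm [(1[B], 1[C])] xs = xs" using l(1) by (induction xs rule: list.induct) (auto simp: lm_simps C.one_mult)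
  then show "1[T] *[T] x = x" using l by (simp add: one_T mult_T C.one_closed)
  have "lm xs [(1[B], 1[C])] = xs" using l(1) by (induction xs rule: list.induct) (auto simp: lm_simps C.mult_one)
  then show "x *[T] 1[T] = x" using l by (simp add: one_T mult_T C.one_closed)
 next
  fix r x y assume r: "r \<in>[B]" and x: "x \<in>[T]" and y: "y \<in>[T]"
  obtain xs ys where l: "xs \<in> pairs B C" "x = cls xs" "ys \<in> pairs B C" "y = cls ys"
   using x y by (metis carrierE)
  have 1: "map (pm (map_prod (mop B r) (\<lambda>c. c) x)) ys = sm r (map (pm x) ys)"
   "map (pm x) (sm r ys) = sm r (map (pm x) ys)" if "x \<in> carrier B \<times> carrier C" for x
   using l(3) that r
   by (induction ys rule: list.induct) (auto simp: B.m_assoc B.m_lcomm)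
  have "lm (sm r xs) ys = sm r (lm xs ys)" using l(1)
   by (induction xs rule: list.induct) (use 1(1) in \<open>auto simp: lm_simps\<close>)
  then show "(r .[T] x) *[T] y = r .[T] (x *[T] y)"
   using l r sm_closed by (simp add: smult_T mult_T lm_closed)
  have "lm xs (sm r ys) = sm r (lm xs ys)" using l(1)
   by (induction xs rule: list.induct) (use 1(2) in \<open>auto simp: lm_simps simp del: map_map\<close>)
  then show "x *[T] (r .[T] y) = r .[T] (x *[T] y)"
   using l r sm_closed by (simp add: smult_T mult_T lm_closed)
 qed
qed

lemma cring_T:
 assumes "cring C"
 shows "cring T"
proof -
 interpret CC: cring C by fact
 interpret T: nonassoc_algebra B T by (rule nonassoc_algebra_T)
 have comm: "x *[T] y = y *[T] x" if mem: "x \<in>[T]" "y \<in>[T]" for x y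
 proof -
  obtain xs where l12: "xs \<in> pairs B C" "x = cls xs" using carrierE[OF mem(1)] .
  obtain ys where l34: "ys \<in> pairs B C" "y = cls ys" using carrierE[OF mem(2)] .
  note l = l12 l34
  have pc: "pm x y = pm y x" if "x \<in> carrier B \<times> carrier C" "y \<in> carrier B \<times> carrier C" for x y
   using that by (auto simp: B.m_comm CC.m_comm)
  have "mset (lm xs ys) = mset (lm ys xs)" using l(3)
  proof (induction ys rule: list.induct)
   case Nil
   have "lm xs [] = []" for xs by (induction xs) (auto simp: lm_simps)
   then show ?case by (simp add: lm_simps)
  next
   case (Cons y ys)
   have "map (\<lambda>x. pm x y) xs = map (pm y) xs"
    using l(1) Cons.prems by (intro map_cong[OF HOL.refl] pc) (simp_all add: in_lists_conv_set)
   from arg_cong[OF this, of mset] show ?case using Cons by (simp add: mset_lm_Cons lm_simps del: mset_map)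
  qed
  then show ?thesis using l by (simp add: mult_T cls_eqI rel_perm lm_closed)
 qed
 have assoc: "(x *[T] y) *[T] z = x *[T] (y *[T] z)" if mem: "x \<in>[T]" "y \<in>[T]" "z \<in>[T]" for x y z
 proof -
  obtain xs where l12: "xs \<in> pairs B C" "x = cls xs" using carrierE[OF mem(1)] .
  obtain ys where l34: "ys \<in> pairs B C" "y = cls ys" using carrierE[OF mem(2)] .
  obtain zs where l56: "zs \<in> pairs B C" "z = cls zs" using carrierE[OF mem(3)] .
  note l = l12 l34 l56
  have p: "pm (pm x y) z = pm x (pm y z)"
   if "x \<in> carrier B \<times> carrier C" "y \<in> carrier B \<times> carrier C" "z \<in> carrier B \<times> carrier C" for x y z
   using that by (auto simp: B.m_assoc CC.m_assoc)
  have 1: "lm (map (pm x) ys) zs = map (pm x) (lm ys zs)" if x: "x \<in> carrier B \<times> carrier C" for x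
   using l(3)
  proof (induction ys rule: list.induct)
   case (Cons y ys)
   have "map (pm (pm x y)) zs = map (\<lambda>z. pm x (pm y z)) zs"
    using l(5) Cons.prems x by (intro map_cong[OF HOL.refl] p) (simp_all add: in_lists_conv_set)
   then show ?case using Cons by (simp add: lm_simps comp_def)
  qed (simp add: lm_simps)
  have "lm (lm xs ys) zs = lm xs (lm ys zs)" using l(1)
   by (induction xs rule: list.induct) (use 1 in \<open>auto simp: lm_simps lm_append\<close>)
  then show ?thesis using l by (simp add: mult_T lm_closed)
 qed
 show ?thesis
 proof (rule cringI[OF abelian_group_T])
  show "comm_monoid T"
   by (rule comm_monoidI) (rule T.mult_closed T.one_closed T.one_mult comm assoc; assumption)+
 qed (auto simp: T.distrib_right)
qed

end

section \<open>Nonassociative algebras over fields\<close>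

lemma (in abelian_group) a_add_minus_cancel:
 "[|x \<in>[G]; y \<in>[G]|] ==> x \<oplus> (y \<ominus> x) = y"
 by (simp add: a_minus_def a_comm[of y "\<ominus> x"] r_neg2)

locale algebra_over_field = nonassoc_algebra F A + field F
 for F :: "('f, 'm) ring_scheme" (structure) and A :: "('f, 'a) module" (structure)

sublocale algebra_over_field \<subseteq> vspace F A by unfold_locales

context nonassoc_algebra begin

lemma linear_op_left: "x \<in>[A] ==> linear_op F A (mop A x)"
 by (simp add: linear_op_def mult_closed distrib_left mult_smult)

lemma linear_op_right: "x \<in>[A] ==> linear_op F A (\<lambda>y. y *[A] x)"
 by (simp add: linear_op_def mult_closed distrib_right smult_mult)

lemma mult_zero [simp]: "x \<in>[A] ==> x *[A] 0[A] = 0[A]"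
 and zero_mult [simp]: "x \<in>[A] ==> 0[A] *[A] x = 0[A]"
 using linear_op_zero[OF linear_op_left] linear_op_zero[OF linear_op_right] by auto

lemma mult_minus: "[|x \<in>[A]; y \<in>[A]; z \<in>[A]|] ==> x *[A] (y -[A] z) = x *[A] y -[A] x *[A] z"
 and minus_mult: "[|x \<in>[A]; y \<in>[A]; z \<in>[A]|] ==> (y -[A] z) *[A] x = y *[A] x -[A] z *[A] x"
 and mult_neg: "[|x \<in>[A]; y \<in>[A]|] ==> x *[A] (-[A] y) = -[A] (x *[A] y)"
 and neg_mult: "[|x \<in>[A]; y \<in>[A]|] ==> (-[A] y) *[A] x = -[A] (y *[A] x)"
 using linear_op_minus[OF linear_op_left] linear_op_minus[OF linear_op_right]
  linear_op_neg[OF linear_op_left] linear_op_neg[OF linear_op_right] by auto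

declare mult_closed [simp] one_closed [simp] one_mult [simp] mult_one [simp]

lemma nucleus_iff:
 "x \<in> nucleus A \<longleftrightarrow> x \<in>[A] \<and> (\<forall>a\<in>carrier A. \<forall>b\<in>carrier A.
  (x *[A] a) *[A] b = x *[A] (a *[A] b) \<and> (a *[A] x) *[A] b = a *[A] (x *[A] b) \<and>
  (a *[A] b) *[A] x = a *[A] (b *[A] x))"
 unfolding nucleus_def associator_def by (auto simp: a_minus_eq_zero_iff)

lemma nucleus_closed: "x \<in> nucleus A ==> x \<in>[A]"
 by (simp add: nucleus_iff)

lemma nucleus_assoc:
 "[|x \<in> nucleus A; a \<in>[A]; b \<in>[A]|] ==> (x *[A] a) *[A] b = x *[A] (a *[A] b)"
 "[|x \<in> nucleus A; a \<in>[A]; b \<in>[A]|] ==> (a *[A] x) *[A] b = a *[A] (x *[A] b)"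
 "[|x \<in> nucleus A; a \<in>[A]; b \<in>[A]|] ==> (a *[A] b) *[A] x = a *[A] (b *[A] x)"
 by (simp_all add: nucleus_iff)

lemma submodule_nucleus: "submodule (nucleus A) F A"
 by (rule submoduleI)
  (auto simp: nucleus_iff distrib_left distrib_right smult_mult mult_smult mult_neg neg_mult)

lemma one_nucleus: "1[A] \<in> nucleus A"
 by (simp add: nucleus_iff)

lemma nucleus_mult: "[|x \<in> nucleus A; y \<in> nucleus A|] ==> x *[A] y \<in> nucleus A"
proof -
 assume xy: "x \<in> nucleus A" "y \<in> nucleus A"
 note N = nucleus_assoc[OF xy(1)] nucleus_assoc[OF xy(2)] nucleus_closed[OF xy(1)] nucleus_closed[OF xy(2)]
 show ?thesis unfolding nucleus_iff
 proof (intro conjI ballI)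
  fix a b assume ab: "a \<in>[A]" "b \<in>[A]"
  show "((x *[A] y) *[A] a) *[A] b = (x *[A] y) *[A] (a *[A] b)" using N ab by simp
  have 1: "a *[A] (x *[A] y) = (a *[A] x) *[A] y" if "a \<in>[A]" for a using N(2)[OF that N(8)] by simp
  show "(a *[A] (x *[A] y)) *[A] b = a *[A] ((x *[A] y) *[A] b)"
   unfolding 1[OF ab(1)] N(5)[OF mult_closed[OF ab(1) N(7)] ab(2)] N(2)[OF ab(1) mult_closed[OF N(8) ab(2)]]
    N(1)[OF N(8) ab(2)] ..
  show "(a *[A] b) *[A] (x *[A] y) = a *[A] (b *[A] (x *[A] y))"
   unfolding 1[OF mult_closed[OF ab]] 1[OF ab(2)] using N(3)[OF ab] N(6)[OF ab(1) mult_closed[OF ab(2) N(7)]] by simp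
 qed (use N in simp)
qed

lemma finsum_mult_left:
 "[|finite S; f \<in> S \<rightarrow> carrier A; x \<in>[A]|] ==> x *[A] finsum A f S = (\<Oplus>\<^bsub>A\<^esub>s\<in>S. x *[A] f s)"
 and finsum_mult_right:
 "[|finite S; f \<in> S \<rightarrow> carrier A; x \<in>[A]|] ==> finsum A f S *[A] x = (\<Oplus>\<^bsub>A\<^esub>s\<in>S. f s *[A] x)"
 using linear_op_finsum[OF linear_op_left] linear_op_finsum[OF linear_op_right] by auto

lemma finsum_all_zero: "(!!s. s \<in> S ==> f s = 0[A]) ==> finsum A f S = 0[A]"
 by (metis M.finsum_cong' M.finsum_zero Pi_I M.zero_closed)

definition idempotent_system :: "'c set => bool" where
 "idempotent_system G \<longleftrightarrow> finite G \<and> G <= nucleus A \<and> 0[A] \<notin> G \<and>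
  (\<forall>g\<in>G. \<forall>h\<in>G. g *[A] h = (if g = h then g else 0[A])) \<and> (\<Oplus>\<^bsub>A\<^esub>g\<in>G. g) = 1[A]"

lemma idempotent_systemD:
 assumes "idempotent_system G"
 shows "finite G" "g \<in> G ==> g \<in> nucleus A" "g \<in> G ==> g \<in>[A]" "g \<in> G ==> g ~= 0[A]"
  "g \<in> G ==> g *[A] g = g" "[|g \<in> G; h \<in> G; g ~= h|] ==> g *[A] h = 0[A]"
  "(\<Oplus>\<^bsub>A\<^esub>g\<in>G. g) = 1[A]"
 using assms nucleus_closed unfolding idempotent_system_def by auto

lemma idempotent_system_sum:
 assumes G: "idempotent_system G" and z: "z \<in>[A]"
 shows "(\<Oplus>\<^bsub>A\<^esub>g\<in>G. g *[A] z) = z" "(\<Oplus>\<^bsub>A\<^esub>g\<in>G. z *[A] g) = z"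
proof -
 note D = idempotent_systemD[OF G]
 have "z = 1[A] *[A] z" "z = z *[A] 1[A]" using z by simp_all
 then show "(\<Oplus>\<^bsub>A\<^esub>g\<in>G. g *[A] z) = z" "(\<Oplus>\<^bsub>A\<^esub>g\<in>G. z *[A] g) = z"
  using finsum_mult_right[of G "\<lambda>g. g" z] finsum_mult_left[of G "\<lambda>g. g" z] D z by auto
qed

text \<open>Summing one-sided Peirce components over G recovers the element.\<close>

lemma idempotent_system_ext:
 assumes G: "idempotent_system G" and z: "y \<in>[A]" "z \<in>[A]"
 shows "(!!g. g \<in> G ==> g *[A] y = g *[A] z) ==> y = z"
  and "(!!g. g \<in> G ==> y *[A] g = z *[A] g) ==> y = z"
proof -
 note D = idempotent_systemD[OF G]
 show "y = z" if e: "!!g. g \<in> G ==> g *[A] y = g *[A] z"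
 proof -
  have "(\<Oplus>\<^bsub>A\<^esub>g\<in>G. g *[A] y) = (\<Oplus>\<^bsub>A\<^esub>g\<in>G. g *[A] z)"
   by (rule M.finsum_cong'[OF HOL.refl _ e]) (use D(3) z in auto)
  then show ?thesis using idempotent_system_sum(1)[OF G] z by simp
 qed
 show "y = z" if e: "!!g. g \<in> G ==> y *[A] g = z *[A] g"
 proof -
  have "(\<Oplus>\<^bsub>A\<^esub>g\<in>G. y *[A] g) = (\<Oplus>\<^bsub>A\<^esub>g\<in>G. z *[A] g)"
   by (rule M.finsum_cong'[OF HOL.refl _ e]) (use D(3) z in auto)
  then show ?thesis using idempotent_system_sum(2)[OF G] z by simp
 qed
qed

lemma idempotent_system_ext2:
 assumes G: "idempotent_system G" and z: "y \<in>[A]" "z \<in>[A]"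
  and eq: "!!g h. [|g \<in> G; h \<in> G|] ==> (g *[A] y) *[A] h = (g *[A] z) *[A] h"
 shows "y = z"
proof (rule idempotent_system_ext(1)[OF G z])
 fix g assume g: "g \<in> G"
 show "g *[A] y = g *[A] z"
 proof (rule idempotent_system_ext(2)[OF G])
  show "(g *[A] y) *[A] h = (g *[A] z) *[A] h" if "h \<in> G" for h using g that by (rule eq)
 qed (use z idempotent_systemD(3)[OF G g] in simp_all)
qed

end

text \<open>Start from h = 1. If h dominates a g with property Q, then h - g is an idempotent
  orthogonal to g with a strictly smaller right ideal (h - g)A. Induction on the height of hA
  therefore splits h completely.\<close>

lemma (in algebra_over_field) idempotent_system_exists:
 assumes fd: "finite_dimensional F A" and R: "submodule R F A" "R <= nucleus A" "1[A] \<in> R"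
  and dom: "!!h. [|h \<in> R; h *[A] h = h; h ~= 0[A]|] ==>
   \<exists>g\<in>R. Q g \<and> g *[A] g = g \<and> g ~= 0[A] \<and> h *[A] g = g \<and> g *[A] h = g"
 obtains G where "idempotent_system G" "G <= R" "!!g. g \<in> G ==> Q g"
proof -
 obtain d :: "'a set => nat" where
  d: "!!N N'. [|submodule N F A; submodule N' F A; N \<subset> N'|] ==> d N < d N'"
  using height_exists[OF fd] by metis
 note RD = submoduleD[OF R(1)]
 have Rc: "x \<in>[A]" if "x \<in> R" for x using RD(1) that by auto
 have Rn: "x \<in> nucleus A" if "x \<in> R" for x using R(2) that by auto
 define I where "I h = (\<lambda>a. h *[A] a) ` carrier A" for h
 have I: "submodule (I h) F A" if h: "h \<in>[A]" for h
 proof (rule submoduleI)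
  fix a b assume "a \<in> I h" "b \<in> I h"
  then obtain x y where "x \<in>[A]" "y \<in>[A]" "a = h *[A] x" "b = h *[A] y" by (auto simp: I_def)
  then show "a +[A] b \<in> I h" using h by (auto simp: I_def simp flip: distrib_left)
 next
  fix a assume "a \<in> I h"
  then obtain x where "x \<in>[A]" "a = h *[A] x" by (auto simp: I_def)
  then show "-[A] a \<in> I h" using h by (auto simp: I_def simp flip: mult_neg)
 next
  fix r a assume r: "r \<in>[F]" and "a \<in> I h"
  then obtain x where "x \<in>[A]" "a = h *[A] x" by (auto simp: I_def)
  then show "r .[A] a \<in> I h" using h r by (auto simp: I_def simp flip: mult_smult)
 qed (use h in \<open>auto simp: I_def image_iff intro!: bexI[of _ "0[A]"]\<close>)
 have main: "\<exists>G. finite G \<and> G <= R \<and> 0[A] \<notin> G \<and> (\<forall>g\<in>G. \<forall>h\<in>G. g *[A] h = (if g = h then g else 0[A])) \<and>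
   (\<Oplus>\<^bsub>A\<^esub>g\<in>G. g) = h \<and> (\<forall>g\<in>G. Q g \<and> h *[A] g = g \<and> g *[A] h = g)"
  if "h \<in> R" "h *[A] h = h" for h
  using that
 proof (induction "d (I h)" arbitrary: h rule: less_induct)
  case less
  note h = less.prems Rc[OF less.prems(1)] Rn[OF less.prems(1)]
  show ?case
  proof (cases "h = 0[A]")
   case True
   then show ?thesis by (intro exI[of _ "{}"]) auto
  next
   case False
   obtain g where g: "g \<in> R" "Q g" "g *[A] g = g" "g ~= 0[A]" "h *[A] g = g" "g *[A] h = g"
    using dom[OF h(1,2) False] by auto
   note gc = Rc[OF g(1)] Rn[OF g(1)]
   define k where "k = h -[A] g"
   have kR: "k \<in> R" using RD(6) h g by (simp add: k_def)
   note kc = Rc[OF kR] Rn[OF kR]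
   have kg: "k *[A] g = 0[A]" "g *[A] k = 0[A]" and hk: "h *[A] k = k" "k *[A] h = k" and kk: "k *[A] k = k"
    using h g gc by (simp_all add: k_def mult_minus minus_mult)
   have "I k \<subset> I h"
   proof
    show "I k <= I h"
    proof
     fix z assume "z \<in> I k"
     then obtain a where a: "a \<in>[A]" "z = k *[A] a" by (auto simp: I_def)
     then have "z = h *[A] (k *[A] a)" using hk nucleus_assoc(1)[OF h(4) kc(1) a(1)] by simp
     then show "z \<in> I h" using a kc by (auto simp: I_def)
    qed
    have "g \<in> I h" using g(5) gc unfolding I_def by (metis image_eqI)
    moreover have "g \<notin> I k"
    proof
     assume "g \<in> I k"
     then obtain a where a: "a \<in>[A]" "g = k *[A] a" by (auto simp: I_def)
     then have "g *[A] g = 0[A]" using kg kc gc nucleus_assoc(1)[OF gc(2) kc(1) a(1)] by simp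
     then show False using g by simp
    qed
    ultimately show "I k ~= I h" by auto
   qed
   then have "d (I k) < d (I h)" using d[OF I I] kc h by auto
   then obtain G where G: "finite G" "G <= R" "0[A] \<notin> G"
    "!!g h. [|g \<in> G; h \<in> G|] ==> g *[A] h = (if g = h then g else 0[A])" "(\<Oplus>\<^bsub>A\<^esub>g\<in>G. g) = k"
    "!!g. g \<in> G ==> Q g \<and> k *[A] g = g \<and> g *[A] k = g"
    using less.hyps[OF _ kR kk] by metis
   have Gc: "x \<in>[A]" "x \<in> nucleus A" if "x \<in> G" for x using G(2) Rc Rn that by auto
   have gG: "g *[A] x = 0[A]" "x *[A] g = 0[A]" "h *[A] x = x" "x *[A] h = x" if "x \<in> G" for x
   proof -
    have x: "k *[A] x = x" "x *[A] k = x" using G(6)[OF that] by auto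
    note xc = Gc[OF that]
    show "g *[A] x = 0[A]" using nucleus_assoc(1)[OF gc(2) kc(1) xc(1)] x kg xc by simp
    show "x *[A] g = 0[A]" using nucleus_assoc(1)[OF xc(2) kc(1) gc(1)] x kg xc by simp
    show "h *[A] x = x" using nucleus_assoc(1)[OF h(4) kc(1) xc(1)] x hk by simp
    show "x *[A] h = x" using nucleus_assoc(1)[OF xc(2) kc(1) h(3)] x hk by simp
   qed
   have gnG: "g \<notin> G" using gG(1) g(3,4) by auto
   have "(\<Oplus>\<^bsub>A\<^esub>x\<in>insert g G. x) = g +[A] k"
    using G(1,5) gnG gc Gc by (subst M.finsum_insert) auto
   also have "\<dots> = h" using h gc by (simp add: k_def M.a_add_minus_cancel)
   finally have "(\<Oplus>\<^bsub>A\<^esub>x\<in>insert g G. x) = h" .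
   moreover have "\<forall>x\<in>insert g G. \<forall>y\<in>insert g G. x *[A] y = (if x = y then x else 0[A])"
    using G(4) gG(1,2) g(3) gnG by auto
   ultimately show ?thesis using G(1,2,3,6) g gG(3,4) by (intro exI[of _ "insert g G"]) auto
  qed
 qed
 obtain G where G: "finite G" "G <= R" "0[A] \<notin> G"
  "\<forall>g\<in>G. \<forall>h\<in>G. g *[A] h = (if g = h then g else 0[A])" "(\<Oplus>\<^bsub>A\<^esub>g\<in>G. g) = 1[A]"
  "\<forall>g\<in>G. Q g \<and> 1[A] *[A] g = g \<and> g *[A] 1[A] = g"
  using main[OF R(3) one_mult[OF one_closed]] by (elim exE conjE)
 show thesis
 proof (rule that[of G])
  show "idempotent_system G" unfolding idempotent_system_def using G R(2) by auto
 qed (use G in auto)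
qed

section \<open>Extension of scalars\<close>

text \<open>Models M = E \<otimes> A with \<phi>(a) = 1 \<otimes> a and \<open>slice l\<close> = l
  \<otimes> id. Only these properties are axiomatized, so that the same results apply to E \<otimes>
  A itself and to an iterated tensor product. The axiom \<open>span\<close> says, as an induction
  principle, that the elements e \<phi>(a) generate M additively.\<close>

locale scalar_extension =
 A: algebra_over_field F A + M: algebra_over_field E M + FE: algebra F E
 for F :: "('f, 'm) ring_scheme" and A :: "('f, 'a) module"
  and E :: "('f, 'e) module" and M :: "('e, 'v) module" +
 fixes \<phi> :: "'a => 'v" and slice :: "('e => 'f) => 'v => 'a"
 assumes phi_closed [simp]: "a \<in>[A] ==> \<phi> a \<in>[M]"
  and phi_add: "[|a \<in>[A]; b \<in>[A]|] ==> \<phi> (a +[A] b) = \<phi> a +[M] \<phi> b"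
  and phi_mult: "[|a \<in>[A]; b \<in>[A]|] ==> \<phi> (a *[A] b) = \<phi> a *[M] \<phi> b"
  and phi_smult: "[|r \<in>[F]; a \<in>[A]|] ==> \<phi> (r .[A] a) = (r .[E] 1[E]) .[M] \<phi> a"
  and phi_one [simp]: "\<phi> 1[A] = 1[M]"
  and span: "[|z \<in>[M]; P 0[M];
   !!e a z. [|e \<in>[E]; a \<in>[A]; z \<in>[M]; P z|] ==> P (e .[M] \<phi> a +[M] z)|] ==> P z"
  and slice_closed: "[|l \<in> functionals F E; z \<in>[M]|] ==> slice l z \<in>[A]"
  and slice_add: "[|l \<in> functionals F E; y \<in>[M]; z \<in>[M]|] ==>
   slice l (y +[M] z) = slice l y +[A] slice l z"
  and slice_phi: "[|l \<in> functionals F E; e \<in>[E]; a \<in>[A]|] ==> slice l (e .[M] \<phi> a) = l e .[A] a"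

sublocale scalar_extension \<subseteq> FE: vspace F E by unfold_locales

context scalar_extension begin

lemmas span_induct [consumes 1, case_names zero add] = span

abbreviation \<iota> where "\<iota> r \<equiv> r .[E] 1[E]"

lemma iota_mult: "[|r \<in>[F]; e \<in>[E]|] ==> \<iota> r *[E] e = r .[E] e"
 by (simp add: FE.smult_assoc2)

lemma phi_zero [simp]: "\<phi> 0[A] = 0[M]"
 using phi_smult[of "0[F]" "0[A]"] by simp

lemma phi_neg: "a \<in>[A] ==> \<phi> (-[A] a) = -[M] \<phi> a"
 using phi_add[of a "-[A] a"] by (metis A.M.a_inv_closed A.M.r_neg M.M.a_comm M.M.minus_equality phi_closed phi_zero)

lemma phi_minus: "[|a \<in>[A]; b \<in>[A]|] ==> \<phi> (a -[A] b) = \<phi> a -[M] \<phi> b"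
 by (simp add: a_minus_def phi_add phi_neg)

lemma slice_zero [simp]: "l \<in> functionals F E ==> slice l 0[M] = 0[A]"
 using slice_phi[of l "0[E]" "0[A]"] FE.functional_zero[of l] by simp

lemma slice_neg: "[|l \<in> functionals F E; z \<in>[M]|] ==> slice l (-[M] z) = -[A] slice l z"
 using slice_add[of l z "-[M] z"]
 by (metis A.M.a_comm A.M.minus_equality M.M.a_inv_closed M.M.r_neg slice_closed slice_zero)

lemma functional_twist: "[|l \<in> functionals F E; e \<in>[E]|] ==> (\<lambda>x. l (x *[E] e)) \<in> functionals F E"
 unfolding functionals_def by (auto simp: M.R.l_distr FE.smult_assoc2)

lemma slice_smult:
 assumes l: "l \<in> functionals F E" and e: "e \<in>[E]" and z: "z \<in>[M]"
 shows "slice l (e .[M] z) = slice (\<lambda>x. l (x *[E] e)) z"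
 using z
proof (induction rule: span_induct)
 case zero
 then show ?case using functional_twist[OF l e] l e by simp
next
 case (add x a z)
 then show ?case using functional_twist[OF l e] l e
  by (simp add: slice_add slice_phi M.smult_r_distr M.R.m_comm flip: M.smult_assoc1)
qed

lemma unit_functional: obtains l where "l \<in> functionals F E" "l 1[E] = 1[F]"
 using FE.functional_exists[of "1[E]"] M.R.one_closed M.one_not_zero by auto

lemma slice_phi_one: "[|l \<in> functionals F E; a \<in>[A]|] ==> slice l (\<phi> a) = l 1[E] .[A] a"
 using slice_phi[of l "1[E]" a] by simp

lemma phi_inj: "[|a \<in>[A]; b \<in>[A]; \<phi> a = \<phi> b|] ==> a = b"
 by (rule unit_functional) (metis A.smult_one slice_phi_one)

lemma slice_commute:
 assumes l: "l \<in> functionals F E" and z: "z \<in>[M]"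
  and f: "!!a. a \<in>[A] ==> f a \<in>[A]" and g: "linear_op E M g" and fg: "!!a. a \<in>[A] ==> g (\<phi> a) = \<phi> (f a)"
  and f': "linear_op F A f"
 shows "slice l (g z) = f (slice l z)"
 using z
proof (induction rule: span_induct)
 case zero
 then show ?case using l M.linear_op_zero[OF g] A.linear_op_zero[OF f'] by simp
next
 case (add e a z)
 then show ?case using l fg f linear_opD[OF g] linear_opD[OF f']
  by (simp add: slice_add slice_phi slice_closed functionalsD[OF l])
qed

lemma slice_mult_phi:
 assumes "l \<in> functionals F E" "z \<in>[M]" "a \<in>[A]"
 shows "slice l (z *[M] \<phi> a) = slice l z *[A] a" "slice l (\<phi> a *[M] z) = a *[A] slice l z"
 using slice_commute[OF assms(1,2) _ M.linear_op_right[of "\<phi> a"] _ A.linear_op_right[OF assms(3)]]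
  slice_commute[OF assms(1,2) _ M.linear_op_left[of "\<phi> a"] _ A.linear_op_left[OF assms(3)]] assms(3)
 by (simp_all add: phi_mult)

text \<open>The subspace E \<otimes> W of M, described by its slices; \<open>ext_induct\<close>
  recovers the description by generators.\<close>

definition ext :: "'a set => 'v set" where
 "ext W = {z \<in> carrier M. \<forall>l\<in>functionals F E. slice l z \<in> W}"

lemma ext_closed: "z \<in> ext W ==> z \<in>[M]" by (simp add: ext_def)

lemma ext_mono: "W <= W' ==> ext W <= ext W'" by (auto simp: ext_def)

lemma submodule_ext:
 assumes "submodule W F A" shows "submodule (ext W) E M"
proof -
 note D = A.submoduleD[OF assms]
 show ?thesis
  by (rule M.submoduleI)
   (auto simp: ext_def slice_neg slice_add slice_smult functional_twist D(2,3,5))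
qed

lemma phi_ext_iff:
 assumes "submodule W F A" "a \<in>[A]" shows "\<phi> a \<in> ext W \<longleftrightarrow> a \<in> W"
proof
 obtain l where l: "l \<in> functionals F E" "l 1[E] = 1[F]" by (rule unit_functional)
 assume "\<phi> a \<in> ext W"
 then have "slice l (\<phi> a) \<in> W" using l(1) by (simp add: ext_def)
 then show "a \<in> W" using slice_phi_one[OF l(1) assms(2)] l(2) assms(2) by simp
next
 assume "a \<in> W"
 then show "\<phi> a \<in> ext W"
  using assms(2) A.submoduleD(4)[OF assms(1)] by (simp add: ext_def slice_phi_one functionalsD(1)[of _ F E])
qed

text \<open>Only finitely many scalars e occur in a presentation of z. A dual basis for them
  rewrites z as the sum of e_i \<phi>(slice l_i z), so z is generated by its own slices.\<close>

lemma decomposition: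
 assumes "z \<in>[M]"
 obtains ps where "ps \<in> lists (carrier E \<times> functionals F E)"
  "z = foldr (\<lambda>(e, l) s. e .[M] \<phi> (slice l z) +[M] s) ps 0[M]"
proof -
 have lc: "l e \<in>[F]" if "l \<in> functionals F E" "e \<in>[E]" for l e using functionalsD(1)[OF that] .
 define S where "S ps y = foldr (\<lambda>(e, l) s. e .[M] \<phi> (slice l y) +[M] s) ps 0[M]" for ps y
 have Sc: "S ps y \<in>[M]" if "ps \<in> lists (carrier E \<times> functionals F E)" "y \<in>[M]" for ps y
  using that by (induction ps rule: list.induct) (auto simp: S_def slice_closed)
 have S_zero: "S ps 0[M] = 0[M]" if "ps \<in> lists (carrier E \<times> functionals F E)" for ps
  using that by (induction ps rule: list.induct) (auto simp: S_def)
 have S_add: "S ps (e .[M] \<phi> a +[M] y) = FE.dual_sum ps e .[M] \<phi> a +[M] S ps y"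
  if "ps \<in> lists (carrier E \<times> functionals F E)" "e \<in>[E]" "a \<in>[A]" "y \<in>[M]" for ps e a y
  using that(1)
 proof (induction ps rule: list.induct)
  case Nil
  then show ?case using that by (simp add: S_def)
 next
  case (Cons p ps)
  obtain h l where p: "p = (h, l)" by force
  with Cons.prems have c: "h \<in>[E]" "l \<in> functionals F E" "ps \<in> lists (carrier E \<times> functionals F E)" by auto
  note d = FE.dual_sum_linear(1)[OF c(3) that(2)]
  have s: "slice l y \<in>[A]" "l e \<in>[F]" "S ps y \<in>[M]" using slice_closed lc c that Sc by auto
  have "S (p # ps) (e .[M] \<phi> a +[M] y) = h .[M] \<phi> (l e .[A] a +[A] slice l y) +[M] S ps (e .[M] \<phi> a +[M] y)"
   using c that by (simp add: S_def p slice_add slice_phi)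
  also have "h .[M] \<phi> (l e .[A] a +[A] slice l y) = (l e .[E] h) .[M] \<phi> a +[M] h .[M] \<phi> (slice l y)"
  proof -
   have "h *[E] \<iota> (l e) = l e .[E] h" using c s iota_mult[of "l e" h] M.R.m_comm[of h "\<iota> (l e)"] by simp
   then show ?thesis using c s that by (simp add: phi_add phi_smult M.smult_r_distr flip: M.smult_assoc1)
  qed
  finally have e: "S (p # ps) (e .[M] \<phi> a +[M] y) = ((l e .[E] h) .[M] \<phi> a +[M] h .[M] \<phi> (slice l y)) +[M]
    (FE.dual_sum ps e .[M] \<phi> a +[M] S ps y)" unfolding Cons.IH[OF c(3)] .
  have "S (p # ps) y = h .[M] \<phi> (slice l y) +[M] S ps y" by (simp add: S_def p)
  then show ?case unfolding e using c s d that by (simp add: p M.smult_l_distr M.M.a_ac)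
 qed
 \<comment> \<open>The list \<open>ws\<close> collects the scalars of a presentation of z; every
   dual basis fixing these scalars reproduces z.\<close>
 have "\<exists>ws. set ws <= carrier E \<and> (\<forall>ps. ps \<in> lists (carrier E \<times> functionals F E) -->
   (\<forall>w\<in>set ws. FE.dual_sum ps w = w) --> S ps z = z)"
  using assms
 proof (induction rule: span_induct)
  case zero
  then show ?case using S_zero by (intro exI[of _ "[]"]) auto
 next
  case (add e a y)
  then obtain ws where "set ws <= carrier E" "!!ps. [|ps \<in> lists (carrier E \<times> functionals F E);
   \<forall>w\<in>set ws. FE.dual_sum ps w = w|] ==> S ps y = y" by auto
  then show ?case using S_add add by (intro exI[of _ "e # ws"]) auto
 qed
 then obtain ws where ws: "set ws <= carrier E" "!!ps. [|ps \<in> lists (carrier E \<times> functionals F E);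
   \<forall>w\<in>set ws. FE.dual_sum ps w = w|] ==> S ps z = z" by auto
 obtain ps where ps: "ps \<in> lists (carrier E \<times> functionals F E)" "!!w. w \<in> set ws ==> FE.dual_sum ps w = w"
  using FE.dual_basis[OF ws(1)] by metis
 show thesis by (rule that[OF ps(1)]) (use ws(2)[OF ps(1)] ps(2) in \<open>simp add: S_def\<close>)
qed

text \<open>In the formula of \<open>decomposition\<close> all coefficients in A are slices of z,
  hence in W, so \<open>ext W\<close> is the E-span of \<phi>(W).\<close>

lemma ext_induct [consumes 2, case_names zero add]:
 assumes W: "submodule W F A" and z: "z \<in> ext W" and P0: "P 0[M]"
  and step: "!!e a y. [|e \<in>[E]; a \<in> W; a \<in>[A]; y \<in> ext W; y \<in>[M]; P y|] ==> P (e .[M] \<phi> a +[M] y)"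
 shows "P z"
proof -
 note D = A.submoduleD[OF W]
 note De = M.submoduleD[OF submodule_ext[OF W]]
 have zc: "z \<in>[M]" using ext_closed[OF z] .
 obtain ps where ps: "ps \<in> lists (carrier E \<times> functionals F E)"
  "z = foldr (\<lambda>(e, l) s. e .[M] \<phi> (slice l z) +[M] s) ps 0[M]"
  using decomposition[OF zc] .
 have "P (foldr (\<lambda>(e, l) s. e .[M] \<phi> (slice l z) +[M] s) ps 0[M]) \<and>
  foldr (\<lambda>(e, l) s. e .[M] \<phi> (slice l z) +[M] s) ps 0[M] \<in> ext W"
  using ps(1)
 proof (induction ps rule: list.induct)
  case Nil
  then show ?case using P0 De(2) by simp
 next
  case (Cons p ps)
  obtain h l where p: "p = (h, l)" by force
  with Cons.prems have c: "h \<in>[E]" "l \<in> functionals F E" "ps \<in> lists (carrier E \<times> functionals F E)" by auto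
  have s: "slice l z \<in> W" "slice l z \<in>[A]" using z c D(1) by (auto simp: ext_def)
  have "h .[M] \<phi> (slice l z) \<in> ext W" using De(4) c(1) phi_ext_iff[OF W s(2)] s(1) by simp
  then show ?case using Cons.IH[OF c(3)] De(3) step[OF c(1) s] ext_closed by (simp add: p)
 qed
 then show ?thesis using ps(2) by simp
qed

lemma slices_separate:
 assumes "z \<in>[M]" "!!l. l \<in> functionals F E ==> slice l z = 0[A]" shows "z = 0[M]"
proof -
 have "z \<in> ext {0[A]}" using assms by (simp add: ext_def)
 with A.submodule_zero show ?thesis by (induction rule: ext_induct) auto
qed

lemma ext_mult:
 assumes W: "submodule W F A" "submodule W' F A" "submodule W'' F A"
  and m: "!!w w'. [|w \<in> W; w' \<in> W'|] ==> w *[A] w' \<in> W''" and y: "y \<in> ext W" and z: "z \<in> ext W'"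
 shows "y *[M] z \<in> ext W''"
proof -
 note De = M.submoduleD[OF submodule_ext[OF W(3)]]
 have yc: "y \<in>[M]" and zc: "z \<in>[M]" using ext_closed y z by auto
 have 1: "\<phi> w *[M] z \<in> ext W''" if w: "w \<in> W" "w \<in>[A]" for w
  using W(2) z
 proof (induction rule: ext_induct)
  case (add e a y)
  have "\<phi> w *[M] \<phi> a \<in> ext W''"
   using phi_ext_iff[OF W(3), of "w *[A] a"] m w add by (simp add: phi_mult)
  then show ?case using add w De(3,4) by (simp add: M.distrib_left M.mult_smult)
 qed (use w De(2) in simp)
 from W(1) y show ?thesis
 proof (induction rule: ext_induct)
  case (add e a y)
  then show ?case using 1[OF add(2,3)] zc De(3,4) by (simp add: M.distrib_right M.smult_mult)
 qed (use zc De(2) in simp)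
qed

text \<open>Taking kernels commutes with extension of scalars, because slicing intertwines g with f
  (\<open>slice_commute\<close>).\<close>

lemma ext_kernel:
 assumes W: "submodule W F A" and f: "linear_op F A f" and g: "linear_op E M g"
  and fg: "!!a. a \<in>[A] ==> g (\<phi> a) = \<phi> (f a)" and z: "z \<in> ext W" "g z = 0[M]"
 shows "z \<in> ext {w \<in> W. f w = 0[A]}"
proof -
 have "f (slice l z) = 0[A]" if "l \<in> functionals F E" for l
 proof -
  have "slice l (g z) = f (slice l z)"
   by (rule slice_commute[OF that ext_closed[OF z(1)] linear_opD(1)[OF f] g fg f])
  then show ?thesis using z(2) that by simp
 qed
 then show ?thesis using z by (auto simp: ext_def)
qed

lemma ext_eq_iff:
 assumes "submodule W F A" "submodule W' F A" shows "ext W <= ext W' \<longleftrightarrow> W <= W'"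
proof
 assume "ext W <= ext W'"
 then show "W <= W'" using phi_ext_iff assms A.submoduleD(1) by (metis subset_iff)
qed (rule ext_mono)

lemma ext_carrier: "ext (carrier A) = carrier M" by (auto simp: ext_def slice_closed)

text \<open>Associativity conditions are linear in each argument, so one inclusion needs checking on
  generators only. For the other, slicing the associativity relations of z with elements of
  \<phi>(A) gives the same relations for the slices of z.\<close>

lemma ext_nucleus: "ext (nucleus A) = nucleus M"
proof
 have N: "submodule (nucleus A) F A" by (rule A.submodule_nucleus)
 note DN = M.submoduleD[OF M.submodule_nucleus]
 have phiN: "\<phi> w \<in> nucleus M" if w: "w \<in> nucleus A" for w
 proof -
  have wc: "w \<in>[A]" using A.nucleus_closed[OF w] .
  have 1: "(\<phi> w *[M] \<phi> a) *[M] y = \<phi> w *[M] (\<phi> a *[M] y) \<and> (\<phi> a *[M] \<phi> w) *[M] y = \<phi> a *[M] (\<phi> w *[M] y) \<and>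
    (\<phi> a *[M] y) *[M] \<phi> w = \<phi> a *[M] (y *[M] \<phi> w)"
   if a: "a \<in>[A]" and y: "y \<in>[M]" for a y
   using y
  proof (induction rule: span_induct)
   case (add e b y)
   have "\<phi> ((w *[A] a) *[A] b) = \<phi> (w *[A] (a *[A] b))" "\<phi> ((a *[A] w) *[A] b) = \<phi> (a *[A] (w *[A] b))"
    "\<phi> ((a *[A] b) *[A] w) = \<phi> (a *[A] (b *[A] w))"
    using A.nucleus_assoc[OF w a] add by auto
   then show ?case using add a wc
    by (simp add: M.distrib_left M.distrib_right M.mult_smult M.smult_mult phi_mult)
  qed (use a wc in simp)
  have "(\<phi> w *[M] x) *[M] y = \<phi> w *[M] (x *[M] y) \<and> (x *[M] \<phi> w) *[M] y = x *[M] (\<phi> w *[M] y) \<and>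
    (x *[M] y) *[M] \<phi> w = x *[M] (y *[M] \<phi> w)"
   if x: "x \<in>[M]" and y: "y \<in>[M]" for x y
   using x
  proof (induction rule: span_induct)
   case (add e a x)
   then show ?case using 1[OF add(2) y] y wc
    by (simp add: M.distrib_left M.distrib_right M.mult_smult M.smult_mult)
  qed (use y wc in simp)
  then show ?thesis using wc by (simp add: M.nucleus_iff)
 qed
 show "ext (nucleus A) <= nucleus M"
 proof
  fix z assume "z \<in> ext (nucleus A)"
  with N show "z \<in> nucleus M"
   by (induction rule: ext_induct) (use phiN DN(2,3,4) in auto)
 qed
 show "nucleus M <= ext (nucleus A)"
 proof
  fix z assume z: "z \<in> nucleus M"
  have zc: "z \<in>[M]" using M.nucleus_closed[OF z] .
  have "slice l z \<in> nucleus A" if l: "l \<in> functionals F E" for l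
  proof -
   have "(slice l z *[A] a) *[A] b = slice l z *[A] (a *[A] b) \<and> (a *[A] slice l z) *[A] b = a *[A] (slice l z *[A] b) \<and>
    (a *[A] b) *[A] slice l z = a *[A] (b *[A] slice l z)" if ab: "a \<in>[A]" "b \<in>[A]" for a b
   proof -
    have "slice l ((z *[M] \<phi> a) *[M] \<phi> b) = slice l (z *[M] \<phi> (a *[A] b))"
     "slice l ((\<phi> a *[M] z) *[M] \<phi> b) = slice l (\<phi> a *[M] (z *[M] \<phi> b))"
     "slice l (\<phi> (a *[A] b) *[M] z) = slice l (\<phi> a *[M] (\<phi> b *[M] z))"
     using M.nucleus_assoc[OF z] ab by (simp_all add: phi_mult)
    then show ?thesis using l zc ab by (simp add: slice_mult_phi)
   qed
   then show ?thesis using slice_closed[OF l zc] by (simp add: A.nucleus_iff)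
  qed
  then show "z \<in> ext (nucleus A)" using zc by (simp add: ext_def)
 qed
qed

end

text \<open>The concrete tensor product is a model: for a functional l, the map (e, a) to l(e) a is
  balanced, and its lift is the slice.\<close>

lemma tensor_scalar_extension:
 fixes F :: "('f, 'm) ring_scheme" and A :: "('f, 'a) module" and E :: "('f, 'e) module"
 assumes F: "field F" and A: "nonassoc_algebra F A" and E: "field E" "algebra F E"
 shows "scalar_extension F A E (tensor_algebra F E A) (\<lambda>a. tensor_class F E A [(1[E], a)])
  (\<lambda>l. tlift A (\<lambda>e a. l e .[A] a))"
proof -
 interpret A: algebra_over_field F A using A F by (intro algebra_over_field.intro)
 interpret E: field E by fact
 interpret T: tensor F E A using A E by (intro tensor.intro)
 interpret M: algebra_over_field E T.T
  using T.nonassoc_algebra_T E by (intro algebra_over_field.intro)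
 have one: "(1[E], a) \<in> carrier E \<times> carrier A" if "a \<in>[A]" for a using that by simp
 have sm: "e .[T.T] T.cls [(1[E], a)] = T.cls [(e, a)]" if "e \<in>[E]" "a \<in>[A]" for e a
  using that T.smult_T[of e "[(1[E], a)]"] by simp
 have bal: "balanced_map F E A A (\<lambda>e a. l e .[A] a)" if l: "l \<in> functionals F E" for l
  unfolding balanced_map_def
  by (auto simp: functionalsD[OF l] A.smult_l_distr A.smult_r_distr A.R.m_comm simp flip: A.smult_assoc1)
 note tl = T.tlift_cls[OF A.M.abelian_group_axioms bal]
 show ?thesis
 proof (intro scalar_extension.intro scalar_extension_axioms.intro)
  show "algebra_over_field F A" "algebra_over_field E T.T" "algebra F E" by (fact A.algebra_over_field_axioms M.algebra_over_field_axioms E)+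
 next
  fix a b assume ab: "a \<in>[A]" "b \<in>[A]"
  show "T.cls [(1[E], a)] \<in> carrier T.T" using ab by simp
  have "T.cls [(1[E], a +[A] b)] = T.cls ([(1[E], a)] @ [(1[E], b)])"
   using ab by (intro T.cls_eqI) (simp add: tensor_rel.add_right)
  then show "T.cls [(1[E], a +[A] b)] = T.cls [(1[E], a)] +[T.T] T.cls [(1[E], b)]"
   using ab T.add_T[of "[(1[E], a)]" "[(1[E], b)]"] by simp
  show "T.cls [(1[E], a *[A] b)] = T.cls [(1[E], a)] *[T.T] T.cls [(1[E], b)]"
   using ab T.mult_T[of "[(1[E], a)]" "[(1[E], b)]"] by (simp add: T.lm_simps)
 next
  fix r a assume ra: "r \<in>[F]" "a \<in>[A]"
  have "T.cls [(1[E], r .[A] a)] = T.cls [(r .[E] 1[E], a)]"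
   using ra by (intro T.cls_eqI tensor_rel.sym[OF tensor_rel.balanced]) auto
  then show "T.cls [(1[E], r .[A] a)] = (r .[E] 1[E]) .[T.T] T.cls [(1[E], a)]"
   using ra sm by simp
 next
  show "T.cls [(1[E], 1[A])] = 1[T.T]" by (simp add: T.one_T)
 next
  fix z P
  assume z: "z \<in> carrier T.T" and P0: "P 0[T.T]"
   and step: "!!e a z. [|e \<in>[E]; a \<in>[A]; z \<in> carrier T.T; P z|] ==> P (e .[T.T] T.cls [(1[E], a)] +[T.T] z)"
  obtain xs where xs: "xs \<in> pairs E A" "z = T.cls xs" using T.carrierE[OF z] .
  have "P (T.cls xs)" using xs(1)
  proof (induction xs rule: list.induct)
   case Nil
   then show ?case using P0 by (simp add: T.zero_T)
  next
   case (Cons x xs)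
   obtain e a where x: "x = (e, a)" by force
   with Cons.prems have c: "e \<in>[E]" "a \<in>[A]" "xs \<in> pairs E A" by auto
   show ?case using step[OF c(1,2) T.cls_closed[OF c(3)] Cons.IH[OF c(3)]] sm[OF c(1,2)]
    T.add_T[of "[(e, a)]" xs] c by (simp add: x)
  qed
  then show "P z" using xs(2) by simp
 next
  fix l assume l: "l \<in> functionals F E"
  have lc: "\<forall>e\<in>carrier E. \<forall>a\<in>carrier A. l e .[A] a \<in>[A]" using functionalsD(1)[OF l] by simp
  fix y z assume y: "y \<in> carrier T.T" and z: "z \<in> carrier T.T"
  obtain xs where xs: "xs \<in> pairs E A" "y = T.cls xs" using T.carrierE[OF y] .
  obtain zs where zs: "zs \<in> pairs E A" "z = T.cls zs" using T.carrierE[OF z] .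
  show "tlift A (\<lambda>e a. l e .[A] a) y \<in>[A]"
   using tl[OF l xs(1)] tsum_closed[OF A.M.abelian_group_axioms lc xs(1)] xs(2) by simp
  show "tlift A (\<lambda>e a. l e .[A] a) (y +[T.T] z) = tlift A (\<lambda>e a. l e .[A] a) y +[A] tlift A (\<lambda>e a. l e .[A] a) z"
   using tl[OF l xs(1)] tl[OF l zs(1)] tl[OF l, of "xs @ zs"] tsum_append[OF A.M.abelian_group_axioms lc xs(1) zs(1)]
    xs zs T.add_T[OF xs(1) zs(1)] by simp
 next
  fix l e a assume l: "l \<in> functionals F E" and ea: "e \<in>[E]" "a \<in>[A]"
  show "tlift A (\<lambda>e a. l e .[A] a) (e .[T.T] T.cls [(1[E], a)]) = l e .[A] a"
   using sm[OF ea] tl[OF l, of "[(e, a)]"] ea functionalsD(1)[OF l ea(1)] by simp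
 qed
qed

section \<open>Idempotents with one-dimensional corners\<close>

context algebra_over_field begin

text \<open>The coordinate-free version of a skew matrix algebra: G plays the part of the diagonal
  matrix units, and u that of the unit e_ij spanning its corner.\<close>

definition frame :: "'a set => bool" where
 "frame G \<longleftrightarrow> idempotent_system G \<and> (\<forall>g\<in>G. \<forall>h\<in>G. \<exists>u\<in>carrier A. u ~= 0[A] \<and> g *[A] u = u \<and>
  u *[A] h = u \<and> (\<forall>z\<in>carrier A. \<exists>r\<in>carrier F. (g *[A] z) *[A] h = r .[A] u))"

lemma frame_unit:
 assumes "frame G" "g \<in> G" "h \<in> G"
 obtains u where "u \<in>[A]" "u ~= 0[A]" "g *[A] u = u" "u *[A] h = u"
  "!!z. z \<in>[A] ==> \<exists>r\<in>carrier F. (g *[A] z) *[A] h = r .[A] u"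
 using assms unfolding frame_def by metis

lemma frame_system: "frame G ==> idempotent_system G" by (simp add: frame_def)

text \<open>The corner gAg contains g, and it is one-dimensional.\<close>

lemma frame_corner:
 assumes G: "frame G" and g: "g \<in> G" and z: "z \<in>[A]"
 shows "\<exists>r\<in>carrier F. (g *[A] z) *[A] g = r .[A] g"
proof -
 note D = idempotent_systemD[OF frame_system[OF G]]
 obtain u where u: "u \<in>[A]" "!!z. z \<in>[A] ==> \<exists>r\<in>carrier F. (g *[A] z) *[A] g = r .[A] u"
  using frame_unit[OF G g g] by metis
 obtain s where s: "s \<in>[F]" "g = s .[A] u" using u(2)[OF D(3)[OF g]] D(5)[OF g] by auto
 have s0: "s ~= \<zero>" using s D(4)[OF g] u(1) by auto
 obtain r where r: "r \<in>[F]" "(g *[A] z) *[A] g = r .[A] u" using u(2)[OF z] by auto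
 note i = smult_inv_cancel[OF s(1) s0 u(1)]
 have "u = (inv s) .[A] g" using i(1) s(2) by simp
 then have "(g *[A] z) *[A] g = (r \<otimes> inv s) .[A] g"
  using r i(3) D(3)[OF g] by (simp add: smult_assoc1)
 then show ?thesis using r(1) i(3) by auto
qed

text \<open>An element \<open>y\<close> with \<open>yJr = 0\<close> for all \<open>r\<close> outside \<open>S\<close> kills the idempotents of \<open>J\<close>: multiplying
 \<open>y\<close> by \<open>hr\<close> with \<open>r \<in> S\<close> shrinks \<open>S\<close>.\<close>

lemma idempotent_in_ideal:
 assumes G: "idempotent_system G" and J: "J <= nucleus A"
  and Jl: "!!n j. [|n \<in> nucleus A; j \<in> J|] ==> n *[A] j \<in> J" and Jr: "!!n j. [|n \<in> nucleus A; j \<in> J|] ==> j *[A] n \<in> J"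
  and diag: "!!g j. [|g \<in> G; j \<in> J|] ==> (g *[A] j) *[A] g = 0[A]"
  and h: "h \<in> J" "h *[A] h = h"
 shows "h = 0[A]"
proof -
 note D = idempotent_systemD[OF G]
 have Jn: "j \<in> nucleus A" if "j \<in> J" for j using J that by auto
 note hn = Jn[OF h(1)]
 have "y *[A] h = 0[A]" if "finite S" "y \<in> nucleus A"
  "!!r j. [|r \<in> G; r \<notin> S; j \<in> J|] ==> (y *[A] j) *[A] r = 0[A]" for S y
  using that
 proof (induction "card S" arbitrary: S y rule: less_induct)
  case less
  note y = less.prems(2)
  note c = nucleus_closed[OF y] nucleus_closed[OF hn]
  have yh: "y *[A] h \<in> nucleus A" using nucleus_mult[OF y hn] .
  have z: "((y *[A] h) *[A] r) *[A] h = 0[A]" if r: "r \<in> G" for r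
  proof (cases "r \<in> S")
   case False
   then show ?thesis using less.prems(3)[OF r False h(1)] c by simp
  next
   case True
   note rn = D(2)[OF r]
   note rc = D(3)[OF r]
   show ?thesis
   proof (rule less.hyps[of "S - {r}"])
    show "card (S - {r}) < card S" using less.prems(1) True by (meson card_Diff1_less)
    show "(y *[A] h) *[A] r \<in> nucleus A" using nucleus_mult[OF yh rn] .
    fix r' j assume r': "r' \<in> G" "r' \<notin> S - {r}" and j: "j \<in> J"
    note jn = Jn[OF j]
    note cc = c rc nucleus_closed[OF jn] D(3)[OF r'(1)]
    show "(((y *[A] h) *[A] r) *[A] j) *[A] r' = 0[A]"
    proof (cases "r' = r")
     case True
     have "(((y *[A] h) *[A] r) *[A] j) *[A] r = (y *[A] h) *[A] ((r *[A] j) *[A] r)"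
      using y hn rn jn cc by (simp add: nucleus_assoc nucleus_mult)
     then show ?thesis using diag[OF r j] True cc by simp
    next
     case False
     have "(((y *[A] h) *[A] r) *[A] j) *[A] r' = (y *[A] (h *[A] (r *[A] j))) *[A] r'"
      using y hn rn jn cc by (simp add: nucleus_assoc nucleus_mult)
     then show ?thesis using less.prems(3)[OF r'(1) _ Jl[OF hn Jl[OF rn j]]] r'(2) False by simp
    qed
   qed (use less.prems(1) in simp)
  qed
  have "y *[A] h = (y *[A] h) *[A] h" using nucleus_assoc(1)[OF y c(2,2)] h(2) by simp
  also have "\<dots> = (\<Oplus>\<^bsub>A\<^esub>r\<in>G. (y *[A] h) *[A] r) *[A] h"
   using idempotent_system_sum(2)[OF G] c by simp
  also have "\<dots> = (\<Oplus>\<^bsub>A\<^esub>r\<in>G. ((y *[A] h) *[A] r) *[A] h)"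
   using finsum_mult_right[OF D(1)] D(3) c by simp
  also have "\<dots> = 0[A]" by (rule finsum_all_zero) (rule z)
  finally show ?case .
 qed
 from this[of G "1[A]"] D(1) one_nucleus have "1[A] *[A] h = 0[A]" by simp
 then show ?thesis using nucleus_closed[OF hn] by simp
qed

text \<open>The nuclear elements x with xAg = 0 form an ideal J of the nucleus. If rjr = s r with r
  in G and j in J, then s kills a spanning vector u of the corner rAg, so s = 0. Hence
  \<open>idempotent_in_ideal\<close> excludes f from J.\<close>

lemma corner_nonzero_aux:
 assumes G: "frame G" and f: "f \<in> nucleus A" "f *[A] f = f" "f ~= 0[A]" and g: "g \<in> G"
 obtains z where "z \<in>[A]" "(f *[A] z) *[A] g ~= 0[A]"
proof -
 note D = idempotent_systemD[OF frame_system[OF G]]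
 define J where "J = {x \<in> nucleus A. \<forall>z\<in>carrier A. (x *[A] z) *[A] g = 0[A]}"
 have Jn: "j \<in> nucleus A" "j \<in>[A]" "!!z. z \<in>[A] ==> (j *[A] z) *[A] g = 0[A]" if "j \<in> J" for j
  using that nucleus_closed by (auto simp: J_def)
 note gn = D(2)[OF g] D(3)[OF g]
 have "f \<notin> J"
 proof
  assume fJ: "f \<in> J"
  have "f = 0[A]"
  proof (rule idempotent_in_ideal[OF frame_system[OF G], of J])
   show "J <= nucleus A" by (auto simp: J_def)
   fix n j assume n: "n \<in> nucleus A" and j: "j \<in> J"
   note nc = nucleus_closed[OF n]
   have "((n *[A] j) *[A] z) *[A] g = 0[A]" if z: "z \<in>[A]" for z
   proof -
    have "((n *[A] j) *[A] z) *[A] g = n *[A] ((j *[A] z) *[A] g)"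
     using n nc Jn(1,2)[OF j] z gn by (simp add: nucleus_assoc nucleus_mult)
    then show ?thesis using Jn(3)[OF j z] nc by simp
   qed
   then show "n *[A] j \<in> J" using nucleus_mult[OF n Jn(1)[OF j]] by (simp add: J_def)
   have "((j *[A] n) *[A] z) *[A] g = 0[A]" if z: "z \<in>[A]" for z
    using nucleus_assoc(1)[OF Jn(1)[OF j] nc z] Jn(3)[OF j, of "n *[A] z"] nc z by simp
   then show "j *[A] n \<in> J" using nucleus_mult[OF Jn(1)[OF j] n] by (simp add: J_def)
  next
   fix r j assume r: "r \<in> G" and j: "j \<in> J"
   note rn = D(2)[OF r] D(3)[OF r]
   obtain s where s: "s \<in>[F]" "(r *[A] j) *[A] r = s .[A] r" using frame_corner[OF G r Jn(2)[OF j]] by auto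
   obtain u where u: "u \<in>[A]" "u ~= 0[A]" "r *[A] u = u" "u *[A] g = u" using frame_unit[OF G r g] by metis
   have "(((r *[A] j) *[A] r) *[A] u) *[A] g = r *[A] ((j *[A] (r *[A] u)) *[A] g)"
    using rn Jn(1,2)[OF j] u(1) gn by (simp add: nucleus_assoc nucleus_mult)
   then have "s .[A] u = 0[A]" using s u Jn(3)[OF j u(1)] rn gn by (simp add: smult_mult)
   then have "s = \<zero>" using smult_eq_zero[OF s(1) u(1)] u(2) by auto
   then show "(r *[A] j) *[A] r = 0[A]" using s rn by simp
  qed (use fJ f in auto)
  then show False using f by simp
 qed
 then show thesis using f(1) that by (auto simp: J_def)
qed

text \<open>The same ideal argument for J = {x : fAx = 0}. That its diagonal corners vanish now
  follows from fAr being nonzero for r in the frame, which is the previous lemma.\<close>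

lemma corner_nonzero:
 assumes G: "frame G" and f: "f \<in> nucleus A" "f *[A] f = f" "f ~= 0[A]"
  and g: "g \<in> nucleus A" "g *[A] g = g" "g ~= 0[A]"
 obtains z where "z \<in>[A]" "(f *[A] z) *[A] g ~= 0[A]"
proof -
 note D = idempotent_systemD[OF frame_system[OF G]]
 define J where "J = {x \<in> nucleus A. \<forall>z\<in>carrier A. (f *[A] z) *[A] x = 0[A]}"
 have Jn: "j \<in> nucleus A" "j \<in>[A]" "!!z. z \<in>[A] ==> (f *[A] z) *[A] j = 0[A]" if "j \<in> J" for j
  using that nucleus_closed by (auto simp: J_def)
 note fc = nucleus_closed[OF f(1)]
 have "g \<notin> J"
 proof
  assume gJ: "g \<in> J"
  have "g = 0[A]"
  proof (rule idempotent_in_ideal[OF frame_system[OF G], of J])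
   show "J <= nucleus A" by (auto simp: J_def)
   fix n j assume n: "n \<in> nucleus A" and j: "j \<in> J"
   note nc = nucleus_closed[OF n]
   have "(f *[A] z) *[A] (n *[A] j) = 0[A]" if z: "z \<in>[A]" for z
   proof -
    have "(f *[A] z) *[A] (n *[A] j) = (f *[A] (z *[A] n)) *[A] j"
     using n nc Jn(1,2)[OF j] z f(1) fc by (simp add: nucleus_assoc nucleus_mult)
    then show ?thesis using Jn(3)[OF j, of "z *[A] n"] nc z by simp
   qed
   then show "n *[A] j \<in> J" using nucleus_mult[OF n Jn(1)[OF j]] by (simp add: J_def)
   have "(f *[A] z) *[A] (j *[A] n) = 0[A]" if z: "z \<in>[A]" for z
    using nucleus_assoc(2)[OF Jn(1)[OF j] mult_closed[OF fc z] nc] Jn(3)[OF j z] nc by simp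
   then show "j *[A] n \<in> J" using nucleus_mult[OF Jn(1)[OF j] n] by (simp add: J_def)
  next
   fix r j assume r: "r \<in> G" and j: "j \<in> J"
   note rn = D(2)[OF r] D(3)[OF r]
   obtain s where s: "s \<in>[F]" "(r *[A] j) *[A] r = s .[A] r" using frame_corner[OF G r Jn(2)[OF j]] by auto
   obtain z where z: "z \<in>[A]" "(f *[A] z) *[A] r ~= 0[A]" using corner_nonzero_aux[OF G f r] by metis
   have "(f *[A] z) *[A] ((r *[A] j) *[A] r) = ((f *[A] (z *[A] r)) *[A] j) *[A] r"
    using rn Jn(1,2)[OF j] z(1) f(1) fc by (simp add: nucleus_assoc nucleus_mult)
   also have "\<dots> = 0[A]" using Jn(3)[OF j, of "z *[A] r"] z rn by simp
   finally have "s .[A] ((f *[A] z) *[A] r) = 0[A]" using s z rn fc by (simp add: mult_smult)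
   then have "s = \<zero>" using smult_eq_zero[OF s(1), of "(f *[A] z) *[A] r"] z rn fc by simp
   then show "(r *[A] j) *[A] r = 0[A]" using s rn by simp
  qed (use gJ g in auto)
  then show False using g by simp
 qed
 then show thesis using g(1) that by (auto simp: J_def)
qed

text \<open>Elements of rank at most one relative to the frame: they factor through a single q in
  G.\<close>

definition thin :: "'a set => 'a => bool" where
 "thin G t \<longleftrightarrow> (\<exists>x\<in>nucleus A. \<exists>y\<in>nucleus A. \<exists>q\<in>G. t = x *[A] (q *[A] y))"

text \<open>If q y h x q vanished for all nuclear x, y and all q in G, then h would lie in an ideal
  with zero diagonal corners, which contains no nonzero idempotent. So q y h x q = r q with r
  nonzero for some choice, and h x q y h is r times an idempotent below h.\<close>

lemma thin_idempotent_exists: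
 assumes G: "frame G" and h: "h \<in> nucleus A" "h *[A] h = h" "h ~= 0[A]"
 obtains g where "thin G g" "g \<in> nucleus A" "g *[A] g = g" "g ~= 0[A]" "h *[A] g = g" "g *[A] h = g"
proof -
 note D = idempotent_systemD[OF frame_system[OF G]]
 note hc = nucleus_closed[OF h(1)]
 define J where "J = {j \<in> nucleus A. \<forall>x\<in>nucleus A. \<forall>y\<in>nucleus A. \<forall>q\<in>G. q *[A] (y *[A] (j *[A] (x *[A] q))) = 0[A]}"
 have Jn: "j \<in> nucleus A" "j \<in>[A]" if "j \<in> J" for j using that nucleus_closed by (auto simp: J_def)
 have Jz: "q *[A] (y *[A] (j *[A] (x *[A] q))) = 0[A]"
  if "j \<in> J" "x \<in> nucleus A" "y \<in> nucleus A" "q \<in> G" for j x y q using that by (auto simp: J_def)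
 have "h \<notin> J"
 proof
  assume hJ: "h \<in> J"
  have "h = 0[A]"
  proof (rule idempotent_in_ideal[OF frame_system[OF G], of J])
   show "J <= nucleus A" by (auto simp: J_def)
   fix n j assume n: "n \<in> nucleus A" and j: "j \<in> J"
   note nc = nucleus_closed[OF n]
   have "q *[A] (y *[A] ((n *[A] j) *[A] (x *[A] q))) = 0[A]" if x: "x \<in> nucleus A" "y \<in> nucleus A" "q \<in> G" for x y q
    using Jz[OF j x(1) nucleus_mult[OF x(2) n] x(3)] x n Jn[OF j] D(2)[OF x(3)]
    by (simp add: nucleus_assoc nucleus_mult nucleus_closed)
   then show "n *[A] j \<in> J" using nucleus_mult[OF n Jn(1)[OF j]] by (simp add: J_def)
   have "q *[A] (y *[A] ((j *[A] n) *[A] (x *[A] q))) = 0[A]" if x: "x \<in> nucleus A" "y \<in> nucleus A" "q \<in> G" for x y q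
    using Jz[OF j nucleus_mult[OF n x(1)] x(2,3)] x n Jn[OF j] D(2)[OF x(3)]
    by (simp add: nucleus_assoc nucleus_mult nucleus_closed)
   then show "j *[A] n \<in> J" using nucleus_mult[OF Jn(1)[OF j] n] by (simp add: J_def)
  next
   fix q j assume q: "q \<in> G" and j: "j \<in> J"
   show "(q *[A] j) *[A] q = 0[A]"
    using Jz[OF j one_nucleus one_nucleus q] Jn[OF j] D(2,3)[OF q] by (simp add: nucleus_assoc)
  qed (use hJ h in auto)
  then show False using h by simp
 qed
 then obtain x y q where xyq: "x \<in> nucleus A" "y \<in> nucleus A" "q \<in> G"
  and nz: "q *[A] (y *[A] (h *[A] (x *[A] q))) ~= 0[A]" using h(1) by (auto simp: J_def)
 note c = nucleus_closed[OF xyq(1)] nucleus_closed[OF xyq(2)] hc D(3)[OF xyq(3)]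
 note n = xyq(1,2) h(1) D(2)[OF xyq(3)]
 obtain r where r: "r \<in>[F]" "(q *[A] (y *[A] (h *[A] x))) *[A] q = r .[A] q"
  using frame_corner[OF G xyq(3), of "y *[A] (h *[A] x)"] c by auto
 have rq: "q *[A] (y *[A] (h *[A] (x *[A] q))) = r .[A] q"
  using r(2) n c by (simp add: nucleus_assoc nucleus_mult)
 then have r0: "r ~= \<zero>" using nz c by auto
 note i = smult_inv_cancel[OF r(1) r0 c(4)]
 \<comment> \<open>The middle part of p p is q y h x q = r q, hence p p = r p, and dividing by r
   gives an idempotent.\<close>
 define p where "p = (h *[A] x) *[A] (q *[A] (y *[A] h))"
 have pn: "p \<in> nucleus A" using n by (simp add: p_def nucleus_mult)
 note pc = nucleus_closed[OF pn]
 have hp: "h *[A] p = p" and ph: "p *[A] h = p"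
  using n c h(2) nucleus_assoc(1)[OF h(1) hc, symmetric] by (simp_all add: p_def nucleus_assoc nucleus_mult)
 have "p *[A] p = (h *[A] x) *[A] ((q *[A] (y *[A] ((h *[A] h) *[A] (x *[A] q)))) *[A] (y *[A] h))"
  unfolding p_def using n c by (simp add: nucleus_assoc nucleus_mult)
 also have "\<dots> = r .[A] p" unfolding h(2) rq using c r(1) by (simp add: smult_mult mult_smult p_def)
 finally have pp: "p *[A] p = r .[A] p" .
 have "(q *[A] y) *[A] (p *[A] (x *[A] q)) =
   (q *[A] (y *[A] (h *[A] (x *[A] q)))) *[A] (y *[A] (h *[A] (x *[A] q)))"
  unfolding p_def using n c by (simp add: nucleus_assoc nucleus_mult)
 also have "\<dots> = r .[A] (r .[A] q)" unfolding rq using rq c r(1) by (simp add: smult_mult)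
 finally have "p ~= 0[A]" using smult_eq_zero[OF r(1)] r r0 c D(4)[OF xyq(3)] by auto
 define g where "g = (inv r) .[A] p"
 show thesis
 proof (rule that[of g])
  have "g = ((inv r) .[A] (h *[A] x)) *[A] (q *[A] (y *[A] h))"
   using i(3) c by (simp add: g_def p_def smult_mult)
  moreover have "(inv r) .[A] (h *[A] x) \<in> nucleus A" "y *[A] h \<in> nucleus A"
   using n i(3) nucleus_mult submoduleD(4)[OF submodule_nucleus] by auto
  ultimately show "thin G g" using xyq(3) unfolding thin_def by metis
  show "g \<in> nucleus A" using pn i(3) submoduleD(4)[OF submodule_nucleus] by (simp add: g_def)
  show "g *[A] g = g" using pp i pc smult_inv_cancel(1)[OF r(1) r0 pc] by (simp add: g_def smult_mult mult_smult)
  show "g ~= 0[A]" using smult_eq_zero[OF i(3) pc] i(4) \<open>p ~= 0[A]\<close> by (auto simp: g_def)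
  show "h *[A] g = g" "g *[A] h = g" using hp ph i(3) pc hc by (simp_all add: g_def smult_mult mult_smult)
 qed
qed

text \<open>For g = x1 q1 y1 and h = x2 q2 y2 the corner gAh lies in the line through x1 w y2, where
  w spans q1 A q2. It is nonzero by \<open>corner_nonzero\<close>, so it has dimension exactly
  one.\<close>

lemma frame_of_thin:
 assumes G: "frame G" and H: "idempotent_system H" and thin: "!!h. h \<in> H ==> thin G h"
 shows "frame H"
 unfolding frame_def
proof (intro conjI ballI H)
 note DG = idempotent_systemD[OF frame_system[OF G]]
 note D = idempotent_systemD[OF H]
 fix g h assume g: "g \<in> H" and h: "h \<in> H"
 obtain x1 y1 q1 where 1: "x1 \<in> nucleus A" "y1 \<in> nucleus A" "q1 \<in> G" "g = x1 *[A] (q1 *[A] y1)"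
  using thin[OF g] by (auto simp: thin_def)
 obtain x2 y2 q2 where 2: "x2 \<in> nucleus A" "y2 \<in> nucleus A" "q2 \<in> G" "h = x2 *[A] (q2 *[A] y2)"
  using thin[OF h] by (auto simp: thin_def)
 note n = 1(1,2) 2(1,2) DG(2)[OF 1(3)] DG(2)[OF 2(3)]
 note c = n[THEN nucleus_closed]
 obtain w where w: "w \<in>[A]" "!!z. z \<in>[A] ==> \<exists>r\<in>carrier F. (q1 *[A] z) *[A] q2 = r .[A] w"
  using frame_unit[OF G 1(3) 2(3)] by metis
 define u' where "u' = x1 *[A] (w *[A] y2)"
 have u'c: "u' \<in>[A]" using c w by (simp add: u'_def)
 have u': "\<exists>r\<in>carrier F. (g *[A] z) *[A] h = r .[A] u'" if z: "z \<in>[A]" for z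
 proof -
  obtain r where r: "r \<in>[F]" "(q1 *[A] (y1 *[A] (z *[A] x2))) *[A] q2 = r .[A] w"
   using w(2)[of "y1 *[A] (z *[A] x2)"] c z by auto
  have "(g *[A] z) *[A] h = x1 *[A] (((q1 *[A] (y1 *[A] (z *[A] x2))) *[A] q2) *[A] y2)"
   unfolding 1(4) 2(4) using n c z by (simp add: nucleus_assoc nucleus_mult)
  also have "\<dots> = r .[A] u'" unfolding r(2) using r(1) w c by (simp add: u'_def smult_mult mult_smult)
  finally show ?thesis using r(1) by auto
 qed
 obtain z where z: "z \<in>[A]" "(g *[A] z) *[A] h ~= 0[A]"
  using corner_nonzero[OF G D(2)[OF g] D(5)[OF g] D(4)[OF g] D(2)[OF h] D(5)[OF h] D(4)[OF h]] by metis
 obtain s where s: "s \<in>[F]" "(g *[A] z) *[A] h = s .[A] u'" using u'[OF z(1)] by auto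
 have s0: "s ~= \<zero>" using s z u'c by auto
 note i = smult_inv_cancel[OF s(1) s0 u'c]
 define u where "u = (g *[A] z) *[A] h"
 have uu: "u' = (inv s) .[A] u" using i(1) s(2) by (simp add: u_def)
 have uc: "u \<in>[A]" using D(3)[OF g] D(3)[OF h] z by (simp add: u_def)
 show "\<exists>u\<in>carrier A. u ~= 0[A] \<and> g *[A] u = u \<and> u *[A] h = u \<and>
   (\<forall>z\<in>carrier A. \<exists>r\<in>carrier F. (g *[A] z) *[A] h = r .[A] u)"
 proof (intro bexI[of _ u] conjI ballI)
  show "u ~= 0[A]" using z by (simp add: u_def)
  have "g *[A] u = ((g *[A] g) *[A] z) *[A] h" "u *[A] h = (g *[A] z) *[A] (h *[A] h)"
   unfolding u_def using D(2,3)[OF g] D(2,3)[OF h] z(1) by (simp_all add: nucleus_assoc nucleus_mult)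
  then show "g *[A] u = u" "u *[A] h = u" unfolding D(5)[OF g] D(5)[OF h] u_def by auto
  fix z assume "z \<in>[A]"
  then obtain r where "r \<in>[F]" "(g *[A] z) *[A] h = r .[A] u'" using u' by auto
  then have "(g *[A] z) *[A] h = (r \<otimes> inv s) .[A] u" using uu i(3) uc by (simp add: smult_assoc1)
  then show "\<exists>r\<in>carrier F. (g *[A] z) *[A] h = r .[A] u" using \<open>r \<in>[F]\<close> i(3) by auto
 qed (rule uc)
qed

end

section \<open>Commutators in the nucleus\<close>

context nonassoc_algebra begin

definition ad :: "'c => 'c => 'c" where
 "ad x y = x *[A] y -[A] y *[A] x"

lemma ad_closed: "[|x \<in>[A]; y \<in>[A]|] ==> ad x y \<in>[A]"
 by (simp add: ad_def)

lemma linear_op_ad: "x \<in>[A] ==> linear_op F A (ad x)"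
 using linear_op_diff[OF linear_op_left linear_op_right, of x x] by (simp add: ad_def[abs_def])

lemma ad_add_left: "[|x \<in>[A]; y \<in>[A]; z \<in>[A]|] ==> ad (x +[A] y) z = ad x z +[A] ad y z"
 by (simp add: ad_def distrib_left distrib_right a_minus_def minus_add M.a_ac)

lemma ad_smult_left: "[|r \<in>[F]; x \<in>[A]; z \<in>[A]|] ==> ad (r .[A] x) z = r .[A] ad x z"
 by (simp add: ad_def smult_mult mult_smult smult_minus_distr)

lemma ad_self: "x \<in>[A] ==> ad x x = 0[A]"
 by (simp add: ad_def)

lemma ad_neg: "[|x \<in>[A]; y \<in>[A]|] ==> ad x y = -[A] ad y x"
 by (simp add: ad_def a_minus_def minus_add M.a_comm)

lemma ad_mult:
 assumes "x \<in> nucleus A" "y \<in> nucleus A" "z \<in> nucleus A"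
 shows "ad x (y *[A] z) = ad x y *[A] z +[A] y *[A] ad x z"
proof -
 note c = assms[THEN nucleus_closed]
 have "ad x y *[A] z +[A] y *[A] ad x z =
   (x *[A] (y *[A] z) -[A] y *[A] (x *[A] z)) +[A] (y *[A] (x *[A] z) -[A] y *[A] (z *[A] x))"
  using assms c by (simp add: ad_def minus_mult mult_minus nucleus_assoc)
 also have "\<dots> = x *[A] (y *[A] z) -[A] y *[A] (z *[A] x)"
  using c by (simp add: a_minus_def M.a_assoc M.r_neg1)
 finally show ?thesis using assms c by (simp add: ad_def nucleus_assoc)
qed

lemma ad_jacobi:
 assumes "x \<in> nucleus A" "y \<in> nucleus A" "z \<in> nucleus A"
 shows "ad x (ad y z) = ad (ad x y) z +[A] ad y (ad x z)"
proof -
 note c = assms[THEN nucleus_closed]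
 have l: "ad x (ad y z) = ad x (y *[A] z) -[A] ad x (z *[A] y)"
  unfolding ad_def[of y z] using c linear_op_minus[OF linear_op_ad] by simp
 show ?thesis unfolding l ad_mult[OF assms] ad_mult[OF assms(1,3,2)] ad_def[of "ad x y" z] ad_def[of y "ad x z"]
  using c by (simp add: ad_closed a_minus_def minus_add M.a_ac)
qed

lemma ad_nucleus: "[|x \<in> nucleus A; y \<in> nucleus A|] ==> ad x y \<in> nucleus A"
 unfolding ad_def using submoduleD(6)[OF submodule_nucleus] nucleus_mult by simp

lemma ad_pow_zero: "x \<in>[A] ==> (ad x ^^ k) 0[A] = 0[A]"
 using linear_op_zero[OF linear_op_funpow[OF linear_op_ad]] .

lemma ad_pow_mono: "[|x \<in>[A]; (ad x ^^ k) y = 0[A]; k \<le> m|] ==> (ad x ^^ m) y = 0[A]"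
 using ad_pow_zero[of x "m - k"] by (metis comp_apply funpow_add le_add_diff_inverse2)

text \<open>On the nucleus \<open>ad x\<close> is a derivation, so nilpotency exponents add up under
  multiplication. This makes the Fitting null component of \<open>ad x\<close> a subalgebra.\<close>

lemma ad_pow_mult:
 assumes x: "x \<in> nucleus A"
 shows "[|y \<in> nucleus A; z \<in> nucleus A; (ad x ^^ a) y = 0[A]; (ad x ^^ b) z = 0[A]|] ==>
  (ad x ^^ (a + b)) (y *[A] z) = 0[A]"
proof (induction "a + b" arbitrary: a b y z)
 case 0
 then show ?case by (simp add: nucleus_closed)
next
 case (Suc n)
 note xc = nucleus_closed[OF x]
 note L = linear_opD[OF linear_op_funpow[OF linear_op_ad[OF xc]]]
 have c: "y \<in>[A]" "z \<in>[A]" using Suc.prems nucleus_closed by auto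
 have n: "ad x y \<in> nucleus A" "ad x z \<in> nucleus A" using ad_nucleus x Suc.prems by auto
 have 1: "(ad x ^^ n) (ad x y *[A] z) = 0[A]"
 proof (cases a)
  case 0
  then show ?thesis using Suc.prems c linear_op_zero[OF linear_op_ad[OF xc]] ad_pow_zero[OF xc] by simp
 next
  case (Suc a')
  then have "(ad x ^^ a') (ad x y) = 0[A]" using Suc.prems by (simp add: funpow_swap1)
  then show ?thesis using Suc.hyps(1)[of a' b "ad x y" z] Suc.hyps(2) Suc n Suc.prems by auto
 qed
 have 2: "(ad x ^^ n) (y *[A] ad x z) = 0[A]"
 proof (cases b)
  case 0
  then show ?thesis using Suc.prems c linear_op_zero[OF linear_op_ad[OF xc]] ad_pow_zero[OF xc] by simp
 next
  case (Suc b')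
  then have "(ad x ^^ b') (ad x z) = 0[A]" using Suc.prems by (simp add: funpow_swap1)
  then show ?thesis using Suc.hyps(1)[of a b' y "ad x z"] Suc.hyps(2) Suc n Suc.prems by auto
 qed
 have "(ad x ^^ Suc n) (y *[A] z) = (ad x ^^ n) (ad x y *[A] z +[A] y *[A] ad x z)"
  using ad_mult[OF x Suc.prems(1,2)] by (simp add: funpow_swap1)
 also have "\<dots> = 0[A]" using L(2) 1 2 c n nucleus_closed by simp
 finally show ?case using Suc.hyps(2) by simp
qed

lemma submodule_ad_kernel:
 assumes B: "submodule B F A" and x: "x \<in>[A]"
 shows "submodule {y \<in> B. \<exists>k. (ad x ^^ k) y = 0[A]} F A"
proof -
 note D = submoduleD[OF B]
 note C = subsetD[OF D(1)]
 note L = linear_opD[OF linear_op_funpow[OF linear_op_ad[OF x]]]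
 show ?thesis
 proof (rule submoduleI)
  fix a b assume "a \<in> {y \<in> B. \<exists>k. (ad x ^^ k) y = 0[A]}" "b \<in> {y \<in> B. \<exists>k. (ad x ^^ k) y = 0[A]}"
  then obtain j k where jk: "a \<in> B" "b \<in> B" "(ad x ^^ j) a = 0[A]" "(ad x ^^ k) b = 0[A]" by auto
  then have "(ad x ^^ (max j k)) (a +[A] b) = 0[A]"
   using L(2)[OF C C, of a b] ad_pow_mono[OF x jk(3), of "max j k"] ad_pow_mono[OF x jk(4), of "max j k"] by simp
  then show "a +[A] b \<in> {y \<in> B. \<exists>k. (ad x ^^ k) y = 0[A]}" using D(3) jk by auto
 next
  fix a assume "a \<in> {y \<in> B. \<exists>k. (ad x ^^ k) y = 0[A]}"
  then obtain j where "a \<in> B" "(ad x ^^ j) a = 0[A]" by auto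
  then have "(ad x ^^ j) (-[A] a) = 0[A]" using linear_op_neg[OF linear_op_funpow[OF linear_op_ad[OF x]] C] by simp
  then show "-[A] a \<in> {y \<in> B. \<exists>k. (ad x ^^ k) y = 0[A]}" using D(5) \<open>a \<in> B\<close> by auto
 next
  fix r a assume r: "r \<in>[F]" and "a \<in> {y \<in> B. \<exists>k. (ad x ^^ k) y = 0[A]}"
  then obtain j where "a \<in> B" "(ad x ^^ j) a = 0[A]" by auto
  then have "(ad x ^^ j) (r .[A] a) = 0[A]" using L(3)[OF r C] r by simp
  then show "r .[A] a \<in> {y \<in> B. \<exists>k. (ad x ^^ k) y = 0[A]}" using D(4) r \<open>a \<in> B\<close> by auto
 next
  show "{y \<in> B. \<exists>k. (ad x ^^ k) y = 0[A]} <= carrier A" using C by auto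
  show "0[A] \<in> {y \<in> B. \<exists>k. (ad x ^^ k) y = 0[A]}" using D(2) ad_pow_zero[OF x, of 0] by (auto intro!: exI[of _ 0])
 qed
qed

end

text \<open>Engel's theorem for subspaces of \<open>B\<close> closed under commutators, stated for the section \<open>U / W\<close>.\<close>

lemma (in algebra_over_field) engel:
 assumes fd: "finite_dimensional F A" and B: "submodule B F A" "B <= nucleus A"
  and nil: "!!x y. [|x \<in> B; y \<in> B|] ==> \<exists>k. (ad x ^^ k) y = 0[A]"
  and "submodule L F A" "L <= B" "!!x y. [|x \<in> L; y \<in> L|] ==> ad x y \<in> L"
  and "submodule U F A" "U <= B" "submodule W F A" "W \<subset> U"
  and "!!x u. [|x \<in> L; u \<in> U|] ==> ad x u \<in> U" "!!x w. [|x \<in> L; w \<in> W|] ==> ad x w \<in> W"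
 shows "\<exists>u\<in>U - W. \<forall>x\<in>L. ad x u \<in> W"
proof -
 obtain d :: "'a set => nat" where
  d: "!!N N'. [|submodule N F A; submodule N' F A; N \<subset> N'|] ==> d N < d N'"
  using height_exists[OF fd] by metis
 have Bn: "x \<in> nucleus A" "x \<in>[A]" if "x \<in> B" for x using B(2) that nucleus_closed by auto
 show ?thesis using assms(5-)
 proof (induction "d L" arbitrary: L U W rule: less_induct)
  case less
  note L = less.prems(1-3) and U = less.prems(4,5) and W = less.prems(6,7)
  note LU = less.prems(8) and LW = less.prems(9)
  note DL = submoduleD[OF L(1)] and DU = submoduleD[OF U(1)] and DW = submoduleD[OF W(1)]
  have LB: "x \<in> B" if "x \<in> L" for x using L(2) that by auto
  have UB: "x \<in> B" if "x \<in> U" for x using U(2) that by auto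
  show ?case
  proof (cases "L = {0[A]}")
   case True
   obtain u where u: "u \<in> U" "u \<notin> W" using W(2) by auto
   have "ad 0[A] u = 0[A]" using Bn UB[OF u(1)] by (simp add: ad_def)
   then show ?thesis using u True DW(2) by (intro bexI[of _ u]) auto
  next
   case False
   \<comment> \<open>The candidates are the proper Lie subalgebras of L; a maximal one will have
     codimension one.\<close>
   define P where "P H \<longleftrightarrow> submodule H F A \<and> H \<subset> L \<and> (\<forall>x\<in>H. \<forall>y\<in>H. ad x y \<in> H)" for H
   have P0: "P {0[A]}" unfolding P_def using submodule_zero DL(2) False by (auto simp: ad_def)
   have Psub: "submodule N F A" if "P N" for N using that by (simp add: P_def)
   obtain H where H: "P H" and Hmax: "!!H'. [|P H'; H <= H'|] ==> H' = H"
    using maximal_submodule[where P = P, OF fd P0 Psub] by metis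
   have H': "submodule H F A" "H \<subset> L" "!!x y. [|x \<in> H; y \<in> H|] ==> ad x y \<in> H" using H by (auto simp: P_def)
   note DH = submoduleD[OF H'(1)]
   have HL: "x \<in> L" if "x \<in> H" for x using H'(2) that by auto
   have dH: "d H < d L" using d[OF H'(1) L(1) H'(2)] .
   \<comment> \<open>The induction hypothesis for H acting on L / H gives x outside H normalizing H,
     and maximality of H then yields L = H + F x.\<close>
   have "\<exists>x\<in>L - H. \<forall>h\<in>H. ad h x \<in> H"
    by (rule less.hyps[OF dH H'(1) _ H'(3) L(1,2) H'(1,2)]) (use H' HL LB L(3) in auto)
   then obtain x where x: "x \<in> L" "x \<notin> H" "!!h. h \<in> H ==> ad h x \<in> H" by auto
   note xB = LB[OF x(1)]
   have xH: "ad x h \<in> H" if "h \<in> H" for h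
    using ad_neg[of x h] DH(5)[OF x(3)[OF that]] Bn(2)[OF xB] Bn(2)[OF LB[OF HL[OF that]]] by simp
   note line = submodule_add_line[OF H'(1) Bn(2)[OF xB]]
   have sub: "add_line F A H x <= L" using x(1) HL DL(3,4) by (auto simp: add_line_def)
   have "P (add_line F A H x)" if ne: "add_line F A H x ~= L"
    unfolding P_def
   proof (intro conjI ballI line(1))
    show "add_line F A H x \<subset> L" using sub ne by auto
    fix y z assume "y \<in> add_line F A H x" "z \<in> add_line F A H x"
    then obtain h r h' r' where *: "h \<in> H" "r \<in>[F]" "y = h +[A] r .[A] x"
     "h' \<in> H" "r' \<in>[F]" "z = h' +[A] r' .[A] x" by (auto simp: add_line_def)
    have c: "h \<in>[A]" "h' \<in>[A]" "x \<in>[A]" using Bn LB HL * xB by auto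
    note ll = linear_opD[OF linear_op_ad[OF c(1)]] linear_opD[OF linear_op_ad[OF c(3)]]
    have "ad y z = (ad h h' +[A] r' .[A] ad h x) +[A] r .[A] ad x h'"
     using * c ll by (simp add: ad_add_left ad_smult_left ad_self smult_r_distr ad_closed)
    moreover have "(ad h h' +[A] r' .[A] ad h x) +[A] r .[A] ad x h' \<in> H"
     using * H'(3) x(3) xH DH(3,4) by simp
    ultimately show "ad y z \<in> add_line F A H x" using line(2) by auto
   qed
   then have lineL: "add_line F A H x = L" using Hmax[OF _ line(2)] line(3) x(2) by auto
   have "\<exists>u\<in>U - W. \<forall>h\<in>H. ad h u \<in> W"
    by (rule less.hyps[OF dH H'(1) _ H'(3) U W]) (use HL LB LU LW in auto)
   then obtain u0 where u0: "u0 \<in> U" "u0 \<notin> W" "!!h. h \<in> H ==> ad h u0 \<in> W" by auto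
   \<comment> \<open>The vectors that H carries into W. By the Jacobi identity they are stable under
     \<open>ad x\<close>, so the last power of \<open>ad x\<close> that keeps \<open>u0\<close>
     outside W gives a vector that all of L carries into W.\<close>
   define U' where "U' = {u \<in> U. \<forall>h\<in>H. ad h u \<in> W}"
   have U': "ad x u \<in> U'" if u: "u \<in> U'" for u
   proof -
    have uU: "u \<in> U" "!!h. h \<in> H ==> ad h u \<in> W" using u by (auto simp: U'_def)
    have "ad h (ad x u) \<in> W" if h: "h \<in> H" for h
    proof -
     have "ad h (ad x u) = ad (ad h x) u +[A] ad x (ad h u)"
      using ad_jacobi[of h x u] Bn(1) LB[OF HL[OF h]] xB UB[OF uU(1)] by simp
     then show ?thesis using DW(3)[OF uU(2)[OF x(3)[OF h]] LW[OF x(1) uU(2)[OF h]]] by simp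
    qed
    then show ?thesis using LU[OF x(1) uU(1)] by (simp add: U'_def)
   qed
   have U'k: "(ad x ^^ k) u0 \<in> U'" for k
    by (induction k) (use u0 U' in \<open>auto simp: U'_def\<close>)
   obtain k where "(ad x ^^ k) u0 = 0[A]" using nil[OF xB UB[OF u0(1)]] by auto
   then have "\<exists>k. (ad x ^^ k) u0 \<in> W" using DW(2) by (intro exI[of _ k]) simp
   then obtain k where k: "(ad x ^^ k) u0 \<in> W" "!!j. j < k ==> (ad x ^^ j) u0 \<notin> W"
    using exists_least_iff[of "\<lambda>k. (ad x ^^ k) u0 \<in> W"] by auto
   obtain j where j: "k = Suc j" using k(1) u0(2) by (cases k) auto
   define u where "u = (ad x ^^ j) u0"
   have u: "u \<in> U'" "u \<notin> W" "ad x u \<in> W" using U'k k j by (auto simp: u_def)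
   have uU: "u \<in> U" "!!h. h \<in> H ==> ad h u \<in> W" using u(1) by (auto simp: U'_def)
   have "ad y u \<in> W" if y: "y \<in> L" for y
   proof -
    have "y \<in> add_line F A H x" using y lineL by simp
    then obtain h r where *: "h \<in> H" "r \<in>[F]" "y = h +[A] r .[A] x" by (auto simp: add_line_def)
    have c: "h \<in>[A]" "x \<in>[A]" "u \<in>[A]" using Bn LB HL * xB UB uU by auto
    have "ad y u = ad h u +[A] r .[A] ad x u" using * c by (simp add: ad_add_left ad_smult_left)
    then show ?thesis using DW(3,4) uU(2)[OF *(1)] u(3) *(2) by simp
   qed
   then show ?thesis using uU(1) u(2) by auto
  qed
 qed
qed

context scalar_extension begin

lemma ad_phi: "[|x \<in>[A]; y \<in>[A]|] ==> M.ad (\<phi> x) (\<phi> y) = \<phi> (A.ad x y)"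
 by (simp add: M.ad_def A.ad_def phi_minus phi_mult)

lemma ad_pow_phi: "[|x \<in>[A]; y \<in>[A]|] ==> (M.ad (\<phi> x) ^^ k) (\<phi> y) = \<phi> ((A.ad x ^^ k) y)"
proof (induction k)
 case (Suc k)
 then show ?case using linear_opD(1)[OF A.linear_op_funpow[OF A.linear_op_ad]] by (simp add: ad_phi)
qed simp

text \<open>Engel's theorem makes \<open>B\<close> nilpotent as a Lie algebra, which is preserved under extension of
 scalars, and \<open>ad e\<close> acts as the identity on \<open>e z (1 - e)\<close> for an idempotent \<open>e\<close>.\<close>

lemma idempotents_central:
 assumes fd: "finite_dimensional F A" and B: "submodule B F A" "B <= nucleus A"
  and Bm: "!!x y. [|x \<in> B; y \<in> B|] ==> x *[A] y \<in> B"
  and nil: "!!x y. [|x \<in> B; y \<in> B|] ==> \<exists>k. (A.ad x ^^ k) y = 0[A]"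
  and e: "e \<in> ext B" "e *[M] e = e" and z: "z \<in> ext B"
 shows "e *[M] z = z *[M] e"
proof -
 note DB = A.submoduleD[OF B(1)]
 note DE = M.submoduleD[OF submodule_ext[OF B(1)]]
 have Bc: "x \<in>[A]" if "x \<in> B" for x using DB(1) that by auto
 have EN: "x \<in> nucleus M" if "x \<in> ext B" for x using ext_mono[OF B(2)] that ext_nucleus by auto
 have Bad: "A.ad x y \<in> B" if "x \<in> B" "y \<in> B" for x y using Bm DB(6) that by (simp add: A.ad_def)
 \<comment> \<open>\<open>Q W\<close> says that W is a Lie ideal of B and that no
   \<open>ad f\<close> with f in \<open>ext B\<close> has eigenvalue 1 on \<open>ext W\<close>. A
   maximal such W will be all of B.\<close>
 define Q where "Q W \<longleftrightarrow> submodule W F A \<and> W <= B \<and> (\<forall>x\<in>B. \<forall>w\<in>W. A.ad x w \<in> W) \<and>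
  (\<forall>f\<in>ext B. \<forall>w\<in>ext W. M.ad f w = w --> w = 0[M])" for W
 have ext0: "ext {0[A]} = {0[M]}"
  using slices_separate M.submoduleD(2)[OF submodule_ext[OF A.submodule_zero]] by (auto simp: ext_def)
 have Q0: "Q {0[A]}" unfolding Q_def ext0 using A.submodule_zero DB(2) Bc by (auto simp: A.ad_def)
 have Qsub: "submodule N F A" if "Q N" for N using that by (simp add: Q_def)
 obtain W where W: "Q W" and Wmax: "!!W'. [|Q W'; W <= W'|] ==> W' = W"
  using A.maximal_submodule[where P = Q, OF fd Q0 Qsub] by metis
 have W': "submodule W F A" "W <= B" "!!x w. [|x \<in> B; w \<in> W|] ==> A.ad x w \<in> W"
  "!!f w. [|f \<in> ext B; w \<in> ext W; M.ad f w = w|] ==> w = 0[M]" using W unfolding Q_def by auto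
 note DW = A.submoduleD[OF W'(1)]
 have "W = B"
 proof (rule ccontr)
  assume "W ~= B"
  then have "W \<subset> B" using W'(2) by auto
  \<comment> \<open>Engel for B / W gives u with \<open>ad x u\<close> in W for all x in B. Then
    \<open>ad f\<close> maps \<open>ext (W + F u)\<close> into \<open>ext W\<close>, so a fixed
    vector of \<open>ad f\<close> already lies in \<open>ext W\<close>, and W could be
    enlarged.\<close>
  then have "\<exists>u\<in>B - W. \<forall>x\<in>B. A.ad x u \<in> W"
   by (intro A.engel[OF fd B nil B(1) _ Bad B(1) _ W'(1)]) (use Bad W'(3) in auto)
  then obtain u where u: "u \<in> B" "u \<notin> W" "!!x. x \<in> B ==> A.ad x u \<in> W" by auto
  note line = A.submodule_add_line[OF W'(1) Bc[OF u(1)]]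
  have adl: "A.ad x y \<in> W" if xy: "x \<in> B" "y \<in> add_line F A W u" for x y
  proof -
   obtain w r where *: "w \<in> W" "r \<in>[F]" "y = w +[A] r .[A] u" using xy by (auto simp: add_line_def)
   then have "w \<in>[A]" using W'(2) Bc by auto
   then have "A.ad x y = A.ad x w +[A] r .[A] A.ad x u"
    using linear_opD[OF A.linear_op_ad[OF Bc[OF xy(1)]]] Bc[OF u(1)] * by simp
   then show ?thesis using DW(3,4) W'(3) u(3) * xy(1) by simp
  qed
  have adE: "M.ad f y \<in> ext W" if f: "f \<in> ext B" and y: "y \<in> ext (add_line F A W u)" for f y
  proof -
   note De = M.submoduleD[OF submodule_ext[OF W'(1)]]
   have 1: "M.ad (\<phi> x) y \<in> ext W" if x: "x \<in> B" for x
    using line(1) y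
   proof (induction rule: ext_induct)
    case zero
    then show ?case using De(2) Bc[OF x] M.linear_op_zero[OF M.linear_op_ad] by simp
   next
    case (add e a y)
    then show ?case using linear_opD[OF M.linear_op_ad[of "\<phi> x"]] Bc[OF x] adl[OF x add(2)] De(3,4)
     phi_ext_iff[OF W'(1), of "A.ad x a"] by (simp add: ad_phi A.ad_closed)
   qed
   from B(1) f show ?thesis
   proof (induction rule: ext_induct)
    case zero
    then show ?case using De(2) ext_closed[OF y] by (simp add: M.ad_def)
   next
    case (add e a f)
    then show ?case using 1 De(3,4) ext_closed[OF y] by (simp add: M.ad_add_left M.ad_smult_left)
   qed
  qed
  have "Q (add_line F A W u)" unfolding Q_def
  proof (intro conjI ballI impI line(1))
   show "add_line F A W u <= B" using W'(2) u(1) DB(3,4) by (auto simp: add_line_def)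
   show "A.ad x w \<in> add_line F A W u" if "x \<in> B" "w \<in> add_line F A W u" for x w
    using adl[OF that] line(2) by auto
   show "w = 0[M]" if "f \<in> ext B" "w \<in> ext (add_line F A W u)" "M.ad f w = w" for f w
    using W'(4)[OF that(1) _ that(3)] adE[OF that(1,2)] that(3) by simp
  qed
  then show False using Wmax[OF _ line(2)] line(3) u(2) by auto
 qed
 then have key: "w = 0[M]" if "f \<in> ext B" "w \<in> ext B" "M.ad f w = w" for f w using W'(4) that by simp
 have mE: "x *[M] y \<in> ext B" if "x \<in> ext B" "y \<in> ext B" for x y
  using ext_mult[OF B(1) B(1) B(1) Bm] that by auto
 note n = EN[OF e(1)] EN[OF z]
 note c = n[THEN M.nucleus_closed]
 have ee: "e *[M] (e *[M] y) = e *[M] y" if "y \<in>[M]" for y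
  using M.nucleus_assoc(1)[OF n(1) c(1) that] e(2) by simp
 \<comment> \<open>This is e z (1 - e), on which \<open>ad e\<close> is the identity.\<close>
 define w where "w = e *[M] z -[M] (e *[M] z) *[M] e"
 have wE: "w \<in> ext B" using mE e(1) z DE(6) by (simp add: w_def)
 have "M.ad e w = w" using n c ee e(2)
  by (simp add: w_def M.ad_def M.mult_minus M.minus_mult M.nucleus_assoc M.nucleus_mult)
 then have 1: "e *[M] z = (e *[M] z) *[M] e" using key[OF e(1) wE] c by (simp add: w_def M.M.a_minus_eq_zero_iff)
 define f where "f = 1[M] -[M] e"
 \<comment> \<open>This is (1 - e) z e, on which \<open>ad (-e)\<close> is the identity; -e also
   lies in \<open>ext B\<close>, although it need not be idempotent.\<close>
 define w' where "w' = z *[M] e -[M] (e *[M] z) *[M] e"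
 have w'E: "w' \<in> ext B" using mE e(1) z DE(6) by (simp add: w'_def)
 note w'c = ext_closed[OF w'E]
 have e1: "e *[M] w' = 0[M]" using n c ee e(2) by (simp add: w'_def M.mult_minus M.nucleus_assoc M.nucleus_mult)
 have e2: "w' *[M] e = w'" using n c ee e(2) by (simp add: w'_def M.minus_mult M.nucleus_assoc M.nucleus_mult)
 have nE: "-[M] e \<in> ext B" using DE(5) e(1) .
 have "M.ad (-[M] e) w' = w'"
  using e1 e2 c w'c by (simp add: M.ad_def M.neg_mult M.mult_neg a_minus_def)
 then have 2: "z *[M] e = (e *[M] z) *[M] e" using key[OF nE w'E] c by (simp add: w'_def M.M.a_minus_eq_zero_iff)
 show ?thesis using 1 2 by simp
qed

end

section \<open>Spectral idempotents\<close>

lemma (in abelian_group) a_minus_minus_cancel: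
 assumes "a \<in>[G]" "b \<in>[G]" "c \<in>[G]"
 shows "(a \<ominus> c) \<ominus> (b \<ominus> c) = a \<ominus> b"
 using assms by (simp add: a_minus_def minus_add a_assoc a_lcomm[of "\<ominus> c" "\<ominus> b" c] l_neg)

context algebra_over_field begin

lemma shift_pow_mult:
 assumes x: "x \<in> nucleus A" and r: "r \<in>[F]" and uw: "u \<in>[A]" "w \<in>[A]"
 shows "(shift A (mop A x) r ^^ N) (u *[A] w) = ((shift A (mop A x) r ^^ N) u) *[A] w"
  and "(shift A (\<lambda>z. z *[A] x) r ^^ N) (u *[A] w) = u *[A] ((shift A (\<lambda>z. z *[A] x) r ^^ N) w)"
proof -
 note xc = nucleus_closed[OF x]
 have c1: "(shift A (mop A x) r ^^ N) u \<in>[A]" if "u \<in>[A]" for u N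
  using linear_opD(1)[OF linear_op_funpow[OF linear_op_shift[OF linear_op_left[OF xc] r]] that] .
 have c2: "(shift A (\<lambda>z. z *[A] x) r ^^ N) u \<in>[A]" if "u \<in>[A]" for u N
  using linear_opD(1)[OF linear_op_funpow[OF linear_op_shift[OF linear_op_right[OF xc] r]] that] .
 show "(shift A (mop A x) r ^^ N) (u *[A] w) = ((shift A (mop A x) r ^^ N) u) *[A] w"
 proof (induction N)
  case (Suc N)
  have "shift A (mop A x) r (v *[A] w) = shift A (mop A x) r v *[A] w" if "v \<in>[A]" for v
   using that x xc r uw by (simp add: shift_def minus_mult smult_mult nucleus_assoc)
  then show ?case using Suc c1[OF uw(1), of N] by simp
 qed simp
 show "(shift A (\<lambda>z. z *[A] x) r ^^ N) (u *[A] w) = u *[A] ((shift A (\<lambda>z. z *[A] x) r ^^ N) w)"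
 proof (induction N)
  case (Suc N)
  have "shift A (\<lambda>z. z *[A] x) r (u *[A] v) = u *[A] shift A (\<lambda>z. z *[A] x) r v" if "v \<in>[A]" for v
   using that x xc r uw by (simp add: shift_def mult_minus mult_smult nucleus_assoc)
  then show ?case using Suc c2[OF uw(2), of N] by simp
 qed simp
qed

lemma shift_pow_commuting:
 assumes x: "x \<in> nucleus A" and r: "r \<in>[F]" and f: "f \<in> nucleus A" "f *[A] x = x *[A] f"
 shows "u \<in>[A] ==> (shift A (mop A x) r ^^ N) (f *[A] u) = f *[A] ((shift A (mop A x) r ^^ N) u)"
  and "(shift A (\<lambda>z. z *[A] x) r ^^ N) f = (shift A (mop A x) r ^^ N) f"
proof -
 note xc = nucleus_closed[OF x] and fc = nucleus_closed[OF f(1)]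
 have c1: "(shift A (mop A x) r ^^ N) u \<in>[A]" if "u \<in>[A]" for u N
  using linear_opD(1)[OF linear_op_funpow[OF linear_op_shift[OF linear_op_left[OF xc] r]] that] .
 show "(shift A (mop A x) r ^^ N) (f *[A] u) = f *[A] ((shift A (mop A x) r ^^ N) u)" if u: "u \<in>[A]"
 proof (induction N)
  case (Suc N)
  have "x *[A] (f *[A] v) = f *[A] (x *[A] v)" if "v \<in>[A]" for v
   using nucleus_assoc(1)[OF x fc that] nucleus_assoc(1)[OF f(1) xc that] f(2) by simp
  then have "shift A (mop A x) r (f *[A] v) = f *[A] shift A (mop A x) r v" if "v \<in>[A]" for v
   using that xc fc r by (simp add: shift_def mult_minus mult_smult)
  then show ?case using Suc c1[OF u, of N] by simp
 qed simp
 have "(shift A (\<lambda>z. z *[A] x) r ^^ N) f = (shift A (mop A x) r ^^ N) f \<and>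
   (shift A (mop A x) r ^^ N) f *[A] x = x *[A] (shift A (mop A x) r ^^ N) f"
 proof (induction N)
  case (Suc N)
  define g where "g = (shift A (mop A x) r ^^ N) f"
  have gc: "g \<in>[A]" using c1[OF fc] by (simp add: g_def)
  have gx: "g *[A] x = x *[A] g" using Suc by (simp add: g_def)
  have "(x *[A] g) *[A] x = x *[A] (x *[A] g)" using nucleus_assoc(1)[OF x gc xc] gx by simp
  moreover have e: "(shift A (\<lambda>z. z *[A] x) r ^^ N) f = g" using Suc by (simp add: g_def)
  ultimately show ?case using gc xc r gx unfolding funpow.simps comp_apply e g_def[symmetric]
   by (simp add: shift_def minus_mult mult_minus smult_mult mult_smult)
 qed (use f in simp)
 then show "(shift A (\<lambda>z. z *[A] x) r ^^ N) f = (shift A (mop A x) r ^^ N) f" by simp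
qed

lemma ad_pow_sandwich:
 assumes x: "x \<in> nucleus A" and f: "f \<in> nucleus A" "f *[A] x = x *[A] f"
  and g: "g \<in> nucleus A" "g *[A] x = x *[A] g" and z: "z \<in>[A]"
 shows "(ad x ^^ k) (f *[A] (z *[A] g)) = f *[A] (((ad x ^^ k) z) *[A] g)"
proof (induction k)
 case (Suc k)
 note c = nucleus_closed[OF x] nucleus_closed[OF f(1)] nucleus_closed[OF g(1)]
 have "ad x (f *[A] (y *[A] g)) = f *[A] (ad x y *[A] g)" if y: "y \<in>[A]" for y
 proof -
  have "x *[A] (f *[A] (y *[A] g)) = (f *[A] x) *[A] (y *[A] g)"
   unfolding f(2) using x f(1) c y by (simp add: nucleus_assoc)
  also have "\<dots> = f *[A] ((x *[A] y) *[A] g)" using x f(1) c y by (simp add: nucleus_assoc)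
  finally have 1: "x *[A] (f *[A] (y *[A] g)) = f *[A] ((x *[A] y) *[A] g)" .
  have "(f *[A] (y *[A] g)) *[A] x = f *[A] (y *[A] (g *[A] x))" using x f(1) g(1) c y by (simp add: nucleus_assoc)
  also have "\<dots> = f *[A] ((y *[A] x) *[A] g)" unfolding g(2) using x f(1) g(1) c y by (simp add: nucleus_assoc)
  finally show ?thesis using 1 c y by (simp add: ad_def mult_minus minus_mult)
 qed
 then show ?case using Suc linear_opD(1)[OF linear_op_funpow[OF linear_op_ad[OF c(1)]] z] by simp
qed simp

text \<open>The f r are the generalized eigencomponents of 1 under left multiplication by x. An
  element f r z f s has generalized eigenvalue r from the left and s from the right. If
  \<open>ad x\<close> is nilpotent on z and r, s differ, it must vanish; for r = s, conversely,
  \<open>ad x\<close> is nilpotent on it. Taking z = 1 gives orthogonality.\<close>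

lemma spectral_idempotents:
 assumes R: "submodule R F A" "R <= nucleus A" "1[A] \<in> R" "!!y z. [|y \<in> R; z \<in> R|] ==> y *[A] z \<in> R"
  and x: "x \<in> R" and rs: "set rs <= carrier F" "shifts A (mop A x) rs 1[A] = 0[A]"
 obtains S f where "finite S" "S <= carrier F" "!!r. r \<in> S ==> f r \<in> R" "!!r. r \<in> S ==> f r *[A] f r = f r"
  "(\<Oplus>\<^bsub>A\<^esub>r\<in>S. f r) = 1[A]"
  "!!r z k. [|r \<in> S; z \<in>[A]; (ad x ^^ k) z = 0[A]|] ==> z *[A] f r = f r *[A] z"
  "!!r z. [|r \<in> S; z \<in>[A]|] ==> \<exists>k. (ad x ^^ k) (f r *[A] (z *[A] f r)) = 0[A]"
proof -
 note D = submoduleD[OF R(1)]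
 have Rn: "y \<in> nucleus A" if "y \<in> R" for y using R(2) that by auto
 note xn = Rn[OF x]
 note xc = nucleus_closed[OF xn]
 define L where "L = (mop A) x"
 define Rt where "Rt = (\<lambda>z. z *[A] x)"
 have LL: "linear_op F A L" and LR: "linear_op F A Rt" using linear_op_left linear_op_right xc by (auto simp: L_def Rt_def)
 have LRcomm: "L (Rt v) = Rt (L v)" if "v \<in>[A]" for v
  using nucleus_assoc(1)[OF xn that xc] by (simp add: L_def Rt_def)
 have adLR: "(\<lambda>v. L v -[A] Rt v) = ad x" by (auto simp: ad_def L_def Rt_def)
 \<comment> \<open>Decomposing 1 inside the centralizer of x in R makes every component commute with
   x.\<close>
 define Z where "Z = {z \<in> R. ad x z = 0[A]}"
 have Zx: "z *[A] x = x *[A] z" "z \<in> R" if "z \<in> Z" for z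
  using that xc Rn[THEN nucleus_closed] by (auto simp: Z_def ad_def M.a_minus_eq_zero_iff)
 have Zsub: "submodule Z F A"
  unfolding Z_def using D linear_opD[OF linear_op_ad[OF xc]] linear_op_zero[OF linear_op_ad[OF xc]]
   linear_op_neg[OF linear_op_ad[OF xc]]
  by (intro submoduleI) (auto simp: subset_iff)
 have LZ: "L z \<in> Z" if z: "z \<in> Z" for z
 proof -
  note zz = Zx[OF z]
  have "ad x (x *[A] z) = 0[A]" using nucleus_assoc(1)[OF xn nucleus_closed[OF Rn[OF zz(2)]] xc] zz(1)
    nucleus_closed[OF Rn[OF zz(2)]] xc by (simp add: ad_def)
  then show ?thesis using R(4)[OF x zz(2)] by (simp add: L_def Z_def)
 qed
 have Z1: "1[A] \<in> Z" using R(3) xc by (simp add: Z_def ad_def)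
 obtain f where f: "!!r. r \<in> set rs ==> f r \<in> Z" "!!r. r \<in> set rs ==> \<exists>N. (shift A L r ^^ N) (f r) = 0[A]"
  "1[A] = (\<Oplus>\<^bsub>A\<^esub>r\<in>set rs. f r)"
  using generalized_eigen_decomposition[OF LL Zsub LZ rs(1) Z1] rs(2) by (auto simp: L_def)
 have fR: "f r \<in> R" "f r \<in> nucleus A" "f r \<in>[A]" "f r *[A] x = x *[A] f r" if "r \<in> set rs" for r
  using Zx[OF f(1)[OF that]] Rn nucleus_closed by auto
 have rc: "r \<in>[F]" if "r \<in> set rs" for r using rs(1) that by auto
 have left: "\<exists>N. (shift A L r ^^ N) (f r *[A] z) = 0[A]" if r: "r \<in> set rs" and z: "z \<in>[A]" for r z
 proof -
  obtain N where "(shift A L r ^^ N) (f r) = 0[A]" using f(2)[OF r] by auto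
  then show ?thesis using shift_pow_mult(1)[OF xn rc[OF r] fR(3)[OF r] z, of N] z by (auto simp: L_def)
 qed
 have right: "\<exists>N. (shift A Rt r ^^ N) (z *[A] f r) = 0[A]" if r: "r \<in> set rs" and z: "z \<in>[A]" for r z
 proof -
  obtain N where "(shift A L r ^^ N) (f r) = 0[A]" using f(2)[OF r] by auto
  then show ?thesis using shift_pow_mult(2)[OF xn rc[OF r] z fR(3)[OF r], of N] z
    shift_pow_commuting(2)[OF xn rc[OF r] fR(2,4)[OF r], of N] by (auto simp: L_def Rt_def)
 qed
 \<comment> \<open>Left and right multiplication by x commute and differ by \<open>ad x\<close>, so
   \<open>generalized_eigen_unique\<close> applies to them.\<close>
 have sandwich: "f r *[A] (z *[A] f s) = 0[A]"
  if r: "r \<in> set rs" and s: "s \<in> set rs" and ne: "r ~= s" and z: "z \<in>[A]" "(ad x ^^ k) z = 0[A]" for r s z k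
 proof -
  obtain N where N: "(shift A L r ^^ N) (f r *[A] (z *[A] f s)) = 0[A]"
   using left[OF r, of "z *[A] f s"] z fR(3)[OF s] by auto
  obtain N' where N': "(shift A Rt s ^^ N') (f r *[A] (z *[A] f s)) = 0[A]"
   using right[OF s, of "f r *[A] z"] z fR(3)[OF r] nucleus_assoc(1)[OF fR(2)[OF r] z(1) fR(3)[OF s]] by auto
  have "(ad x ^^ k) (f r *[A] (z *[A] f s)) = 0[A]"
   using ad_pow_sandwich[OF xn fR(2,4)[OF r] fR(2,4)[OF s] z(1), of k] z(2) fR(3)[OF r] fR(3)[OF s] by simp
  then show ?thesis
   using generalized_eigen_unique[OF LL LR LRcomm rc[OF r] rc[OF s] ne _ N N', of k] z fR(3)[OF r] fR(3)[OF s]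
   unfolding adLR by simp
 qed
 have ff: "f r *[A] f s = 0[A]" if "r \<in> set rs" "s \<in> set rs" "r ~= s" for r s
  using sandwich[OF that, of "1[A]" 1] fR(3) that xc by (simp add: ad_def)
 have single: "(\<Oplus>\<^bsub>A\<^esub>s\<in>set rs. h s) = h r" if r: "r \<in> set rs" and h: "h r \<in>[A]" "!!s. [|s \<in> set rs; s ~= r|] ==> h s = 0[A]" for h r
 proof -
  have ins: "set rs = insert r (set rs - {r})" using r by auto
  have "(\<Oplus>\<^bsub>A\<^esub>s\<in>set rs - {r}. h s) = 0[A]" by (rule finsum_all_zero) (use h(2) in auto)
  moreover have "(\<Oplus>\<^bsub>A\<^esub>s\<in>insert r (set rs - {r}). h s) = h r +[A] (\<Oplus>\<^bsub>A\<^esub>s\<in>set rs - {r}. h s)"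
   by (rule M.finsum_insert) (use h in auto)
  ultimately show ?thesis using ins h(1) by simp
 qed
 have sum_right: "z = (\<Oplus>\<^bsub>A\<^esub>s\<in>set rs. z *[A] f s)" and sum_left: "z = (\<Oplus>\<^bsub>A\<^esub>s\<in>set rs. f s *[A] z)" if z: "z \<in>[A]" for z
  using finsum_mult_left[of "set rs" f z] finsum_mult_right[of "set rs" f z] fR(3) z f(3)[symmetric] by simp_all
 show thesis
 proof (rule that[of "set rs" f])
  show "f r *[A] f r = f r" if r: "r \<in> set rs" for r
   using sum_right[OF fR(3)[OF r]] single[OF r, of "\<lambda>s. f r *[A] f s"] ff[OF r] fR(3)[OF r] by auto
  fix r z k assume r: "r \<in> set rs" and z: "z \<in>[A]" "(ad x ^^ k) z = 0[A]"
  have fz: "f r *[A] z \<in>[A]" "z *[A] f r \<in>[A]" using fR(3)[OF r] z by auto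
  have a: "(f r *[A] z) *[A] f s = f r *[A] (z *[A] f s)" if "s \<in> set rs" for s
   using nucleus_assoc(1)[OF fR(2)[OF r] z(1) fR(3)[OF that]] .
  have "f r *[A] z = (\<Oplus>\<^bsub>A\<^esub>s\<in>set rs. (f r *[A] z) *[A] f s)" by (rule sum_right[OF fz(1)])
  also have "\<dots> = (f r *[A] z) *[A] f r"
   by (rule single[OF r]) (use a sandwich[OF r _ _ z] fz fR(3)[OF r] in auto)
  finally have 1: "f r *[A] z = f r *[A] (z *[A] f r)" using a[OF r] by simp
  have "z *[A] f r = (\<Oplus>\<^bsub>A\<^esub>s\<in>set rs. f s *[A] (z *[A] f r))" by (rule sum_left[OF fz(2)])
  also have "\<dots> = f r *[A] (z *[A] f r)"
   by (rule single[OF r]) (use sandwich[OF _ r _ z] fz fR(3)[OF r] in auto)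
  finally show "z *[A] f r = f r *[A] z" using 1 by simp
 next
  fix r z assume r: "r \<in> set rs" and z: "z \<in>[A]"
  define w where "w = f r *[A] (z *[A] f r)"
  have wc: "w \<in>[A]" using fR(3)[OF r] z by (simp add: w_def)
  obtain N where N: "(shift A L r ^^ N) w = 0[A]"
   using left[OF r, of "z *[A] f r"] z fR(3)[OF r] by (auto simp: w_def)
  obtain N' where N': "(shift A Rt r ^^ N') w = 0[A]"
   using right[OF r, of "f r *[A] z"] z fR(3)[OF r] nucleus_assoc(1)[OF fR(2)[OF r] z fR(3)[OF r]] by (auto simp: w_def)
  note sL = linear_op_shift[OF LL rc[OF r]] and sR = linear_op_shift[OF LR rc[OF r]]
  have comm: "shift A L r (shift A Rt r v) = shift A Rt r (shift A L r v)" if v: "v \<in>[A]" for v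
   using shift_commute[OF LL sR _ rc[OF r] v] shift_commute[OF LR LL LRcomm[symmetric] rc[OF r]] by simp
  \<comment> \<open>Shifting both multiplications by the same r leaves their difference
    \<open>ad x\<close> unchanged, and both shifts are nilpotent on w.\<close>
  have D': "shift A L r v -[A] shift A Rt r v = ad x v" if "v \<in>[A]" for v
   using that xc rc[OF r]
   by (simp add: shift_def L_def Rt_def ad_def M.a_minus_minus_cancel)
  have "((\<lambda>v. shift A L r v -[A] shift A Rt r v) ^^ k) w = (ad x ^^ k) w" for k
   by (induction k) (use D' linear_opD(1)[OF linear_op_funpow[OF linear_op_ad[OF xc]] wc] in simp_all)
  then have "(ad x ^^ (N + N')) w = 0[A]" using nilpotent_difference[OF sL sR comm N N' wc] by simp
  then show "\<exists>k. (ad x ^^ k) (f r *[A] (z *[A] f r)) = 0[A]" by (auto simp: w_def)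
 qed (use rs(1) fR f(3) in auto)
qed

end

section \<open>Rich subalgebras and a split commutative subalgebra over F\<close>

definition root_closed :: "('e, 'm) ring_scheme => bool" where
 "root_closed E \<longleftrightarrow> (\<forall>as. set as <= carrier E \<and> as ~= [] --> (\<exists>r\<in>carrier E. sev E (as @ [1[E]]) r = 0[E]))"

context scalar_extension begin

lemma phi_pev:
 assumes T: "linear_op F A T" and T': "!!a. a \<in>[A] ==> T' (\<phi> a) = \<phi> (T a)"
 shows "[|set as <= carrier F; v \<in>[A]|] ==> \<phi> (pev A as T v) = pev M (map \<iota> as) T' (\<phi> v)"
proof (induction as arbitrary: v)
 case (Cons a as)
 then show ?case using T' linear_opD(1)[OF T] A.pev_closed[OF T, of as "T v"] by (simp add: phi_add phi_smult)
qed simp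

lemma iota_one [simp]: "\<iota> 1[F] = 1[E]" by simp

lemma iota_closed: "set as <= carrier F ==> set (map \<iota> as) <= carrier E" by auto

text \<open>A monic relation for x over F is carried to E by \<phi> and splits there into linear
  factors.\<close>

lemma shifts_exist_closed:
 assumes E: "root_closed E" and fd: "finite_dimensional F A" and x: "x \<in>[A]"
 obtains rs where "set rs <= carrier E" "shifts M (mop M (\<phi> x)) rs 1[M] = 0[M]"
proof -
 obtain as where as: "set as <= carrier F" "pev A (as @ [1[F]]) (mop A x) 1[A] = 0[A]"
  using A.relation_exists[OF fd A.linear_op_left[OF x] A.one_closed] by metis
 have "pev M (map \<iota> as @ [1[E]]) (mop M (\<phi> x)) 1[M] = 0[M]"
  using phi_pev[OF A.linear_op_left[OF x], of "(mop M) (\<phi> x)" "as @ [1[F]]" "1[A]"] as x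
  by (simp add: phi_mult)
 moreover have "\<exists>rs. set rs <= carrier E \<and> shifts M (mop M (\<phi> x)) rs 1[M] = 0[M]"
  if "pev M (map \<iota> as @ [1[E]]) (mop M (\<phi> x)) 1[M] = 0[M]"
 proof (rule M.shifts_exist[OF M.linear_op_left, where good = "\<lambda>_. True"])
  show "!!as. [|set as <= carrier E; as ~= []; True|] ==> \<exists>r\<in>carrier E. sev E (as @ [1[E]]) r = 0[E] \<and> True"
   using E by (simp add: root_closed_def)
 qed (use x iota_closed[OF as(1)] that in auto)
 ultimately show thesis using that by auto
qed

text \<open>Richness of \<open>B\<close> passes to the Fitting component \<open>{y \<in> B. ad x is nilpotent on y}\<close> of every
 \<open>x \<in> B\<close>, so on a minimal rich \<open>B\<close> every \<open>ad x\<close> is nilpotent.\<close>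

definition rich :: "'v set => 'a set => bool" where
 "rich G B \<longleftrightarrow> submodule B F A \<and> B <= nucleus A \<and> 1[A] \<in> B \<and> (\<forall>x\<in>B. \<forall>y\<in>B. x *[A] y \<in> B) \<and>
  (\<forall>h\<in>ext B. h *[M] h = h \<and> h ~= 0[M] -->
   (\<exists>g\<in>ext B. M.thin G g \<and> g *[M] g = g \<and> g ~= 0[M] \<and> h *[M] g = g \<and> g *[M] h = g))"

lemma richD:
 assumes "rich G B"
 shows "submodule B F A" "B <= nucleus A" "1[A] \<in> B" "[|x \<in> B; y \<in> B|] ==> x *[A] y \<in> B"
  "[|h \<in> ext B; h *[M] h = h; h ~= 0[M]|] ==>
   \<exists>g\<in>ext B. M.thin G g \<and> g *[M] g = g \<and> g ~= 0[M] \<and> h *[M] g = g \<and> g *[M] h = g"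
 using assms unfolding rich_def by simp_all

lemma rich_nucleus:
 assumes G: "M.frame G" shows "rich G (nucleus A)"
proof -
 have "\<exists>g\<in>ext (nucleus A). M.thin G g \<and> g *[M] g = g \<and> g ~= 0[M] \<and> h *[M] g = g \<and> g *[M] h = g"
  if "h \<in> ext (nucleus A)" "h *[M] h = h" "h ~= 0[M]" for h
  using M.thin_idempotent_exists[OF G _ that(2,3)] that(1) unfolding ext_nucleus by metis
 then show ?thesis unfolding rich_def using A.submodule_nucleus A.one_nucleus A.nucleus_mult by simp
qed

text \<open>Let h be a nonzero idempotent over the component C. It commutes with the spectral
  idempotents f r of \<phi>(x), and some e = h f r is a nonzero idempotent. Richness of B gives a
  thin g below e. Since g = f r g f r, some power of \<open>ad x\<close> kills g, and so g already
  lies in \<open>ext C\<close>.\<close>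

lemma rich_fitting:
 assumes E: "root_closed E" and fd: "finite_dimensional F A" and B: "rich G B" and x: "x \<in> B"
 shows "rich G {y \<in> B. \<exists>k. (A.ad x ^^ k) y = 0[A]}"
proof -
 note B' = richD[OF B]
 note DB = A.submoduleD[OF B'(1)]
 have Bn: "y \<in> nucleus A" if "y \<in> B" for y using B'(2) that by auto
 note xn = Bn[OF x]
 note xc = A.nucleus_closed[OF xn]
 define C where "C = {y \<in> B. \<exists>k. (A.ad x ^^ k) y = 0[A]}"
 have Csub: "submodule C F A" unfolding C_def by (rule A.submodule_ad_kernel[OF B'(1) xc])
 have CB: "C <= B" by (auto simp: C_def)
 have Cmult: "y *[A] z \<in> C" if yz: "y \<in> C" "z \<in> C" for y z
 proof -
  obtain a b where ab: "y \<in> B" "z \<in> B" "(A.ad x ^^ a) y = 0[A]" "(A.ad x ^^ b) z = 0[A]"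
   using yz by (auto simp: C_def)
  from A.ad_pow_mult[OF xn Bn[OF ab(1)] Bn[OF ab(2)] ab(3,4)] B'(4)[OF ab(1,2)]
  show ?thesis by (auto simp: C_def)
 qed
 have C1: "1[A] \<in> C" using B'(3) xc by (auto simp: C_def A.ad_def intro!: exI[of _ 1])
 note sE = submodule_ext[OF B'(1)]
 have EN: "ext B <= nucleus M" using ext_mono[OF B'(2)] ext_nucleus by simp
 have ENc: "z \<in>[M]" "z \<in> nucleus M" if "z \<in> ext B" for z using that EN M.nucleus_closed by auto
 have mE: "y *[M] z \<in> ext B" if "y \<in> ext B" "z \<in> ext B" for y z
  using ext_mult[OF B'(1) B'(1) B'(1) B'(4)] that by auto
 have one: "1[M] \<in> ext B" using phi_ext_iff[OF B'(1), of "1[A]"] B'(3) by simp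
 have phx: "\<phi> x \<in> ext B" using phi_ext_iff[OF B'(1) xc] x by simp
 obtain rs where rs: "set rs <= carrier E" "shifts M (mop M (\<phi> x)) rs 1[M] = 0[M]"
  using shifts_exist_closed[OF E fd xc] by metis
 obtain S f where f: "finite S" "S <= carrier E" "!!r. r \<in> S ==> f r \<in> ext B" "!!r. r \<in> S ==> f r *[M] f r = f r"
  "(\<Oplus>\<^bsub>M\<^esub>r\<in>S. f r) = 1[M]"
  "!!r z k. [|r \<in> S; z \<in>[M]; (M.ad (\<phi> x) ^^ k) z = 0[M]|] ==> z *[M] f r = f r *[M] z"
  "!!r z. [|r \<in> S; z \<in>[M]|] ==> \<exists>k. (M.ad (\<phi> x) ^^ k) (f r *[M] (z *[M] f r)) = 0[M]"
  using M.spectral_idempotents[OF sE EN one mE phx rs] by metis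
 have extC: "\<exists>k. (M.ad (\<phi> x) ^^ k) z = 0[M]" if "z \<in> ext C" for z
  using Csub that
 proof (induction rule: ext_induct)
  case zero
  then show ?case by (intro exI[of _ 0]) simp
 next
  case (add e a y)
  obtain j where j: "(A.ad x ^^ j) a = 0[A]" using add(2) by (auto simp: C_def)
  have j': "(M.ad (\<phi> x) ^^ j) (\<phi> a) = 0[M]" using ad_pow_phi[OF xc add(3), of j] j by simp
  obtain k where k: "(M.ad (\<phi> x) ^^ k) y = 0[M]" using add by auto
  note L = linear_opD[OF M.linear_op_funpow[OF M.linear_op_ad[OF phi_closed[OF xc]], of "max j k"]]
  have "(M.ad (\<phi> x) ^^ (max j k)) (\<phi> a) = 0[M]" "(M.ad (\<phi> x) ^^ (max j k)) y = 0[M]"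
   using M.ad_pow_mono[OF phi_closed[OF xc] j', of "max j k"] M.ad_pow_mono[OF phi_closed[OF xc] k, of "max j k"] by simp_all
  then have "(M.ad (\<phi> x) ^^ (max j k)) (e .[M] \<phi> a +[M] y) = 0[M]" using L add by simp
  then show ?case by auto
 qed
 have toC: "z \<in> ext C" if z: "z \<in> ext B" "(M.ad (\<phi> x) ^^ k) z = 0[M]" for z k
 proof -
  have "z \<in> ext {w \<in> B. (A.ad x ^^ k) w = 0[A]}"
   by (rule ext_kernel[OF B'(1) A.linear_op_funpow[OF A.linear_op_ad[OF xc]] M.linear_op_funpow[OF M.linear_op_ad[OF phi_closed[OF xc]]]
      ad_pow_phi[OF xc] z])
  then show ?thesis using ext_mono[of "{w \<in> B. (A.ad x ^^ k) w = 0[A]}" C] by (auto simp: C_def)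
 qed
 have "\<exists>g\<in>ext C. M.thin G g \<and> g *[M] g = g \<and> g ~= 0[M] \<and> h *[M] g = g \<and> g *[M] h = g"
  if h: "h \<in> ext C" "h *[M] h = h" "h ~= 0[M]" for h
 proof -
  have hB: "h \<in> ext B" using ext_mono[OF CB] h(1) by auto
  note hc = ENc[OF hB]
  obtain k where k: "(M.ad (\<phi> x) ^^ k) h = 0[M]" using extC[OF h(1)] by auto
  have hf: "h *[M] f r = f r *[M] h" if "r \<in> S" for r using f(6)[OF that hc(1) k] .
  have fc: "f r \<in>[M]" "f r \<in> nucleus M" if "r \<in> S" for r using ENc f(3) that by auto
  have "\<exists>r\<in>S. h *[M] f r ~= 0[M]"
  proof (rule ccontr)
   assume "\<not> ?thesis"
   then have z: "h *[M] f r = 0[M]" if "r \<in> S" for r using that by auto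
   have "h = h *[M] (\<Oplus>\<^bsub>M\<^esub>r\<in>S. f r)" using hc f(5) by simp
   also have "\<dots> = (\<Oplus>\<^bsub>M\<^esub>r\<in>S. h *[M] f r)" by (rule M.finsum_mult_left[OF f(1) _ hc(1)]) (use fc in auto)
   also have "\<dots> = 0[M]" by (rule M.finsum_all_zero) (rule z)
   finally show False using h(3) by simp
  qed
  then obtain r where r: "r \<in> S" "h *[M] f r ~= 0[M]" by auto
  define e where "e = h *[M] f r"
  have eB: "e \<in> ext B" using mE hB f(3)[OF r(1)] by (simp add: e_def)
  note ec = ENc[OF eB] and frc = fc[OF r(1)]
  have he: "h *[M] e = e" using M.nucleus_assoc(1)[OF hc(2,1) frc(1)] h(2) by (simp add: e_def)
  have eh: "e *[M] h = e" unfolding e_def hf[OF r(1)] using M.nucleus_assoc(1)[OF frc(2) hc(1,1)] h(2) by simp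
  have ef: "e *[M] f r = e" using M.nucleus_assoc(1)[OF hc(2) frc(1,1)] f(4)[OF r(1)] by (simp add: e_def)
  have fe: "f r *[M] e = e" unfolding e_def hf[OF r(1)] using M.nucleus_assoc(1)[OF frc(2,1) hc(1)] f(4)[OF r(1)] by simp
  have ee: "e *[M] e = e" using M.nucleus_assoc(1)[OF ec(2) hc(1) frc(1)] eh ef by (simp add: e_def[symmetric])
  obtain g where g: "g \<in> ext B" "M.thin G g" "g *[M] g = g" "g ~= 0[M]" "e *[M] g = g" "g *[M] e = g"
   using B'(5)[OF eB ee] r(2) unfolding e_def by auto
  note gc = ENc[OF g(1)]
  have hg: "h *[M] g = g" using M.nucleus_assoc(1)[OF hc(2) ec(1) gc(1)] he g(5) by simp
  have gh: "g *[M] h = g" using M.nucleus_assoc(1)[OF gc(2) ec(1) hc(1)] eh g(6) by simp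
  have fg: "f r *[M] g = g" using M.nucleus_assoc(1)[OF frc(2) ec(1) gc(1)] fe g(5) by simp
  have gf: "g *[M] f r = g" using M.nucleus_assoc(1)[OF gc(2) ec(1) frc(1)] ef g(6) by simp
  obtain j where "(M.ad (\<phi> x) ^^ j) (f r *[M] (g *[M] f r)) = 0[M]" using f(7)[OF r(1) gc(1)] by auto
  then have "(M.ad (\<phi> x) ^^ j) g = 0[M]" using fg gf by simp
  then have "g \<in> ext C" using toC[OF g(1)] by simp
  then show ?thesis using g hg gh by (intro bexI[of _ g]) auto
 qed
 then have "rich G C" unfolding rich_def using Csub CB B'(2) C1 Cmult by auto
 then show ?thesis by (simp add: C_def)
qed

text \<open>A minimal rich B equals each of its Fitting components, so every \<open>ad x\<close> is
  nilpotent on B and idempotents of \<open>ext B\<close> are central there. A decomposition of 1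
  into thin idempotents of \<open>ext B\<close> is a frame on which B acts by scalars; this makes B
  commutative, and B is the required K.\<close>

lemma split_subalgebra_exists:
 assumes E: "root_closed E" and fd: "finite_dimensional F A" "finite_dimensional E M" and G: "M.frame G"
 obtains K H where "submodule K F A" "K <= nucleus A" "1[A] \<in> K" "!!x y. [|x \<in> K; y \<in> K|] ==> x *[A] y \<in> K"
  "!!x y. [|x \<in> K; y \<in> K|] ==> x *[A] y = y *[A] x" "M.frame H" "H <= ext K"
  "!!k h. [|k \<in> K; h \<in> H|] ==> \<exists>r\<in>carrier E. \<phi> k *[M] h = r .[M] h"
proof -
 have rsub: "submodule N F A" if "rich G N" for N using richD(1)[OF that] .
 obtain B where B: "rich G B" and Bmin: "!!B'. [|rich G B'; B' <= B|] ==> B' = B"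
  using A.minimal_submodule[where P = "rich G", OF fd(1) rich_nucleus[OF G] rsub] by metis
 note B' = richD[OF B]
 have nil: "\<exists>k. (A.ad x ^^ k) y = 0[A]" if "x \<in> B" "y \<in> B" for x y
 proof -
  have "{y \<in> B. \<exists>k. (A.ad x ^^ k) y = 0[A]} = B"
   by (rule Bmin[OF rich_fitting[OF E fd(1) B that(1)]]) auto
  then show ?thesis using that(2) by auto
 qed
 have central: "e *[M] z = z *[M] e" if "e \<in> ext B" "e *[M] e = e" "z \<in> ext B" for e z
  using idempotents_central[OF fd(1) B'(1,2,4) nil that] by simp
 note sE = submodule_ext[OF B'(1)]
 have EN: "ext B <= nucleus M" using ext_mono[OF B'(2)] ext_nucleus by simp
 have one: "1[M] \<in> ext B" using phi_ext_iff[OF B'(1), of "1[A]"] B'(3) by simp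
 have dom: "\<exists>g\<in>ext B. M.thin G g \<and> g *[M] g = g \<and> g ~= 0[M] \<and> h *[M] g = g \<and> g *[M] h = g"
  if "h \<in> ext B" "h *[M] h = h" "h ~= 0[M]" for h using B'(5) that by simp
 have "\<exists>H. M.idempotent_system H \<and> H <= ext B \<and> (\<forall>h\<in>H. M.thin G h)"
  by (rule M.idempotent_system_exists[where Q = "M.thin G", OF fd(2) sE EN one]) (rule dom, assumption+, auto)
 then obtain H where H: "M.idempotent_system H" "H <= ext B" "!!h. h \<in> H ==> M.thin G h" by auto
 note fr = M.frame_of_thin[OF G H(1,3)]
 note DH = M.idempotent_systemD[OF H(1)]
 have Bc: "x \<in>[A]" if "x \<in> B" for x using A.nucleus_closed B'(2) that by auto
 \<comment> \<open>Centrality of h in \<open>ext B\<close> gives \<phi>(k) h = h \<phi>(k) h, which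
   lies in the one-dimensional corner at h.\<close>
 have act: "\<exists>r\<in>carrier E. \<phi> k *[M] h = r .[M] h" if k: "k \<in> B" and h: "h \<in> H" for k h
 proof -
  have kE: "\<phi> k \<in> ext B" using phi_ext_iff[OF B'(1) Bc[OF k]] k by simp
  have c: "h *[M] \<phi> k = \<phi> k *[M] h" using central[OF _ DH(5)[OF h] kE] H(2) h by auto
  have "(h *[M] \<phi> k) *[M] h = \<phi> k *[M] h"
   unfolding c using M.nucleus_assoc(3)[OF DH(2)[OF h], of "\<phi> k" h] DH(3,5)[OF h] Bc[OF k] by simp
  then show ?thesis using M.frame_corner[OF fr h, of "\<phi> k"] Bc[OF k] by auto
 qed
 have comm: "x *[A] y = y *[A] x" if x: "x \<in> B" and y: "y \<in> B" for x y
 proof -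
  note c = Bc[OF x] Bc[OF y]
  have "\<phi> x *[M] \<phi> y = \<phi> y *[M] \<phi> x"
  proof (rule M.idempotent_system_ext(2)[OF H(1)])
   fix h assume h: "h \<in> H"
   note hc = DH(2,3)[OF h]
   obtain r where r: "r \<in>[E]" "\<phi> x *[M] h = r .[M] h" using act[OF x h] by auto
   obtain s where s: "s \<in>[E]" "\<phi> y *[M] h = s .[M] h" using act[OF y h] by auto
   show "(\<phi> x *[M] \<phi> y) *[M] h = (\<phi> y *[M] \<phi> x) *[M] h"
    using M.nucleus_assoc(3)[OF hc(1)] r s c hc(2) by (simp add: M.mult_smult M.R.m_comm flip: M.smult_assoc1)
  qed (use c in simp_all)
  then show ?thesis using phi_inj[of "x *[A] y" "y *[A] x"] c by (simp add: phi_mult)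
 qed
 show thesis by (rule that[OF B'(1,2,3,4) comm fr H(2) act]) auto
qed

end

section \<open>The bimodule structure over a split subalgebra\<close>

text \<open>Each term b \<otimes> \<mu>(x) c equals (\<mu>(x) b) \<otimes> c and can be merged with
  x \<otimes> c. So a pure tensor whose right factor is such a combination of the other right
  factors disappears.\<close>

lemma (in tensor_modules) rel_absorb:
 assumes b: "b \<in>[B]" and m: "!!x. x \<in>[B] ==> \<mu> x \<in>[F]"
 shows "xs \<in> pairs B C ==> rel ((b, tsum C (\<lambda>x c. \<mu> x .[C] c) xs) # xs) (map (\<lambda>(x, c). (x +[B] \<mu> x .[B] b, c)) xs)"
proof (induction xs rule: list.induct)
 case Nil
 have "rel [(b, 0[F] .[C] 0[C])] [(0[F] .[B] b, 0[C])]"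
  using b by (intro tensor_rel.sym[OF tensor_rel.balanced]) auto
 then have "rel [(b, 0[C])] [(0[B], 0[C])]" using b by simp
 from tensor_rel.trans[OF this tensor_rel.zero] show ?case by simp
next
 case (Cons p xs)
 obtain x c where p: "p = (x, c)" by force
 with Cons.prems have c: "x \<in>[B]" "c \<in>[C]" "xs \<in> pairs B C" by auto
 define s where "s = tsum C (\<lambda>x c. \<mu> x .[C] c) xs"
 have s: "s \<in>[C]" unfolding s_def using tsum_closed[OF C.M.abelian_group_axioms _ c(3)] m by simp
 note mx = m[OF c(1)]
 have 1: "rel ([(b, \<mu> x .[C] c +[C] s)] @ ((x, c) # xs)) ([(b, \<mu> x .[C] c), (b, s)] @ ((x, c) # xs))"
  using b c s mx by (intro tensor_rel.append tensor_rel.refl tensor_rel.add_right) auto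
 have 2: "rel ([(b, \<mu> x .[C] c), (b, s)] @ ((x, c) # xs)) ([(b, \<mu> x .[C] c)] @ [(x, c)] @ ((b, s) # xs))"
  using b c s mx by (intro rel_perm) auto
 have 3: "rel ([(b, \<mu> x .[C] c)] @ [(x, c)] @ ((b, s) # xs)) ([(\<mu> x .[B] b, c)] @ [(x, c)] @ ((b, s) # xs))"
  using b c s mx by (intro tensor_rel.append tensor_rel.refl tensor_rel.sym[OF tensor_rel.balanced]) auto
 have 4: "rel ([(\<mu> x .[B] b, c)] @ [(x, c)] @ ((b, s) # xs)) (([(x, c)] @ [(\<mu> x .[B] b, c)]) @ ((b, s) # xs))"
  using b c s mx by (intro rel_perm) auto
 have "rel ([(x, c)] @ [(\<mu> x .[B] b, c)]) [(x +[B] \<mu> x .[B] b, c)]"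
  using b c mx tensor_rel.sym[OF tensor_rel.add_left[of x B "\<mu> x .[B] b" c C F]] by simp
 from tensor_rel.append[OF this Cons.IH[OF c(3)]]
 have 5: "rel (([(x, c)] @ [(\<mu> x .[B] b, c)]) @ ((b, s) # xs))
  ([(x +[B] \<mu> x .[B] b, c)] @ map (\<lambda>(x, c). (x +[B] \<mu> x .[B] b, c)) xs)" by (simp add: s_def)
 from tensor_rel.trans[OF 1 tensor_rel.trans[OF 2 tensor_rel.trans[OF 3 tensor_rel.trans[OF 4 5]]]]
 show ?case by (simp add: p s_def)
qed

text \<open>A separating set of functionals on the left factor detects zero. Each step removes the first
 pure tensor \<open>b \<otimes> c\<close> by means of a functional with value 1 at \<open>b\<close>.\<close>

lemma (in tensor_modules) rel_Nil_if_slices_vanish: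
 assumes L: "L <= functionals F B" and sep: "!!b. [|b \<in>[B]; b ~= 0[B]|] ==> \<exists>\<mu>\<in>L. \<mu> b = 1[F]"
 shows "[|xs \<in> pairs B C; !!\<mu>. \<mu> \<in> L ==> tsum C (\<lambda>b c. \<mu> b .[C] c) xs = 0[C]|] ==> rel xs []"
proof (induction "length xs" arbitrary: xs)
 case 0
 then show ?case by (simp add: tensor_rel.refl)
next
 case (Suc n)
 obtain b c xs' where xs: "xs = (b, c) # xs'" "length xs' = n" using Suc.hyps(2) by (cases xs) auto
 then have p: "b \<in>[B]" "c \<in>[C]" "xs' \<in> pairs B C" using Suc.prems(1) by auto
 have fcl: "\<mu> x \<in>[F]" if "\<mu> \<in> L" "x \<in>[B]" for \<mu> x using functionalsD(1)[of \<mu> F B x] L that by (auto simp: subset_iff)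
 have bal: "balanced_map F B C C (\<lambda>b c. \<mu> b .[C] c)" if "\<mu> \<in> L" for \<mu>
  using functionalsD[of \<mu> F B] L that unfolding balanced_map_def
  by (auto simp: subset_iff C.smult_l_distr C.smult_r_distr B.R.m_comm simp flip: C.smult_assoc1)
 show ?case
 proof (cases "b = 0[B]")
  case True
  have "rel ([(b, c)] @ xs') ([] @ xs')" using p True by (intro tensor_rel.append tensor_rel.refl) (auto intro: tensor_rel.zero)
  then have r: "rel xs xs'" by (simp add: xs)
  then have "rel xs' []"
   using Suc.hyps(1)[of xs'] xs(2) p(3) Suc.prems(2) tsum_rel[OF C.M.abelian_group_axioms bal r] by simp
  with r show ?thesis by (rule tensor_rel.trans)
 next
  case False
  obtain \<mu> where m: "\<mu> \<in> L" "\<mu> b = 1[F]" using sep[OF p(1) False] by auto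
  define s where "s = tsum C (\<lambda>x c. \<mu> x .[C] c) xs'"
  have sc: "s \<in>[C]" unfolding s_def using tsum_closed[OF C.M.abelian_group_axioms _ p(3)] fcl[OF m(1)] by simp
  have "c +[C] s = 0[C]" using Suc.prems(2)[OF m(1)] m p by (simp add: xs s_def)
  then have cs: "c = -[C] s" using C.M.minus_equality p(2) sc by metis
  \<comment> \<open>With this sign the merged left factors are x - \<mu>(x) b, the projections along
    b, and c is the sum of the \<nu>(x) c over the remaining terms.\<close>
  define \<nu> where "\<nu> x = -[F] \<mu> x" for x
  have "tsum C (\<lambda>x c. \<nu> x .[C] c) ys = -[C] tsum C (\<lambda>x c. \<mu> x .[C] c) ys" if "ys \<in> pairs B C" for ys
   using that
  proof (induction ys rule: list.induct)
   case (Cons q ys)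
   have "tsum C (\<lambda>x c. \<mu> x .[C] c) ys \<in>[C]"
    using tsum_closed[OF C.M.abelian_group_axioms, of B C _ ys] Cons.prems fcl[OF m(1)] by simp
   then show ?case using Cons fcl[OF m(1)] by (auto simp: \<nu>_def C.smult_l_minus C.minus_add)
  qed simp
  then have cn: "c = tsum C (\<lambda>x c. \<nu> x .[C] c) xs'" using cs p(3) by (simp add: s_def)
  define ys where "ys = map (\<lambda>(x, c). (x +[B] \<nu> x .[B] b, c)) xs'"
  have r: "rel xs ys" unfolding xs ys_def using rel_absorb[OF p(1), of \<nu>, OF _ p(3)] fcl[OF m(1)] cn by (simp add: \<nu>_def)
  have "rel ys []"
   using Suc.hyps(1)[of ys] xs(2) rel_pairs[OF r] Suc.prems(2) tsum_rel[OF C.M.abelian_group_axioms bal r] by (simp add: ys_def)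
  with r show ?thesis by (rule tensor_rel.trans)
 qed
qed

section \<open>The algebra A as a module over K \<otimes> K\<close>

locale nuclear_subalgebra = scalar_extension F A E M \<phi> slice
 for F :: "('f, 'm) ring_scheme" and A :: "('f, 'a) module"
  and E :: "('f, 'e) module" and M :: "('e, 'v) module" and \<phi> slice +
 fixes K :: "'a set"
 assumes K_sub: "submodule K F A" and K_nuc: "K <= nucleus A" and K_one: "1[A] \<in> K"
  and K_mult: "!!x y. [|x \<in> K; y \<in> K|] ==> x *[A] y \<in> K"
  and K_comm: "!!x y. [|x \<in> K; y \<in> K|] ==> x *[A] y = y *[A] x"
begin

abbreviation "KA \<equiv> A\<lparr>carrier := K\<rparr>"
abbreviation "RK \<equiv> tensor_algebra F KA KA"

lemmas KD = A.submoduleD[OF K_sub]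

lemma Kc: "k \<in> K ==> k \<in>[A]" and Kn: "k \<in> K ==> k \<in> nucleus A"
 using KD(1) K_nuc by auto

lemma algebra_KA: "algebra F KA"
proof -
 interpret KM: module F KA by (rule submodule.submodule_is_module[OF K_sub A.module_axioms])
 have "cring KA"
 proof (rule cringI)
  show "abelian_group KA" by (rule KM.M.abelian_group_axioms)
  show "comm_monoid KA"
   by (rule comm_monoidI) (auto simp: K_mult K_one Kc A.nucleus_assoc[OF Kn] intro: K_comm)
 qed (auto simp: A.distrib_right Kc)
 then show ?thesis
  by (intro algebra.intro KM.module_axioms algebra_axioms.intro) (auto simp: A.smult_mult Kc)
qed

lemma nonassoc_algebra_KA: "nonassoc_algebra F KA"
proof -
 interpret KM: algebra F KA by (rule algebra_KA)
 show ?thesis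
  by (intro nonassoc_algebra.intro KM.module_axioms nonassoc_algebra_axioms.intro)
   (auto simp: K_one K_mult Kc A.distrib_left A.distrib_right A.smult_mult A.mult_smult)
qed

sublocale T: tensor F KA KA
 using algebra_KA nonassoc_algebra_KA by (intro tensor.intro)

lemma cring_RK: "cring RK"
 using T.cring_T algebra_KA by (simp add: algebra_def)

lemma balanced_bimodule:
 assumes "a \<in>[A]" shows "balanced_map F KA KA A (\<lambda>k k'. (k *[A] a) *[A] k')"
 unfolding balanced_map_def using assms Kc
 by (auto simp: A.distrib_left A.distrib_right A.smult_mult A.mult_smult)

lemma bimodule_sum_tsum: "bimodule_sum A ts a = tsum A (\<lambda>k k'. (k *[A] a) *[A] k') ts"
 by (simp add: bimodule_sum_def tsum_def)

lemma bimodule_simps [simp]: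
 "carrier (bimodule A) = carrier A" "ring.add (bimodule A) = ring.add A" "ring.zero (bimodule A) = ring.zero A"
 by (simp_all add: bimodule_def)

lemma bimodule_smult:
 assumes ts: "ts \<in> pairs KA KA" and a: "a \<in>[A]"
 shows "T.cls ts .[bimodule A] a = bimodule_sum A ts a"
proof -
 have "(\<lambda>ts. bimodule_sum A ts a) ` T.cls ts = {bimodule_sum A ts a}"
 proof (intro Set.set_eqI iffI)
  fix x assume "x \<in> (\<lambda>ts. bimodule_sum A ts a) ` T.cls ts"
  then obtain us where us: "us \<in> T.cls ts" "x = bimodule_sum A us a" by (rule imageE)
  from us(1) have "T.rel ts us" by (simp only: T.mem_cls)
  from T.tsum_rel[OF A.M.abelian_group_axioms balanced_bimodule[OF a] this]
  show "x \<in> {bimodule_sum A ts a}" by (simp add: us(2) bimodule_sum_tsum)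
 next
  fix x assume "x \<in> {bimodule_sum A ts a}"
  then show "x \<in> (\<lambda>ts. bimodule_sum A ts a) ` T.cls ts" using T.self_mem_cls[OF ts] by simp
 qed
 then show ?thesis by (simp add: bimodule_def)
qed

lemma bimodule_sum_closed:
 "[|ts \<in> pairs KA KA; a \<in>[A]|] ==> bimodule_sum A ts a \<in>[A]"
 unfolding bimodule_sum_tsum using Kc by (intro tsum_closed[OF A.M.abelian_group_axioms, of KA KA]) auto

lemma bimodule_sum_mult:
 assumes ys: "ys \<in> pairs KA KA" and a: "a \<in>[A]"
 shows "xs \<in> pairs KA KA ==> bimodule_sum A (T.lm xs ys) a = bimodule_sum A xs (bimodule_sum A ys a)"
proof (induction xs rule: list.induct)
 case Nil
 then show ?case by (simp add: bimodule_sum_tsum T.lm_simps)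
next
 case (Cons p xs)
 obtain x y where p: "p = (x, y)" by force
 with Cons.prems have c: "x \<in> K" "y \<in> K" "xs \<in> pairs KA KA" by auto
 have cl: "\<forall>b\<in>carrier KA. \<forall>c\<in>carrier KA. (b *[A] a) *[A] c \<in>[A]" using a Kc by auto
 \<comment> \<open>The right factor acts in the opposite order; commutativity of K repairs
   this.\<close>
 have e: "((x *[A] k) *[A] a) *[A] (y *[A] k') = (x *[A] ((k *[A] a) *[A] k')) *[A] y" if k: "k \<in> K" "k' \<in> K" for k k'
  unfolding K_comm[OF c(2) k(2)] using Kn[OF c(1)] Kn[OF c(2)] Kn[OF k(1)] Kn[OF k(2)] Kc[OF c(1)] Kc[OF c(2)] Kc[OF k(1)] Kc[OF k(2)] a
  by (simp add: A.nucleus_assoc A.nucleus_mult)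
 have "tsum A (\<lambda>k k'. (k *[A] a) *[A] k') (map (T.pm p) ys) = tsum A (\<lambda>k k'. ((x *[A] k) *[A] a) *[A] (y *[A] k')) ys"
  by (simp add: p tsum_map)
 also have "\<dots> = tsum A (\<lambda>k k'. (x *[A] ((k *[A] a) *[A] k')) *[A] y) ys"
  by (rule tsum_cong[OF ys]) (use e in simp)
 also have "\<dots> = (x *[A] tsum A (\<lambda>k k'. (k *[A] a) *[A] k') ys) *[A] y"
  by (rule tsum_hom[OF A.M.abelian_group_axioms cl ys, of "\<lambda>z. (x *[A] z) *[A] y" A, symmetric])
   (use c Kc in \<open>simp_all add: A.distrib_left A.distrib_right\<close>)
 finally have 1: "tsum A (\<lambda>k k'. (k *[A] a) *[A] k') (map (T.pm p) ys) = (x *[A] bimodule_sum A ys a) *[A] y"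
  by (simp add: bimodule_sum_tsum)
 have "map (T.pm p) ys \<in> pairs KA KA" using T.pm_closed[of p ys] Cons.prems ys by simp
 then have "bimodule_sum A (T.lm (p # xs) ys) a = (x *[A] bimodule_sum A ys a) *[A] y +[A] bimodule_sum A (T.lm xs ys) a"
  unfolding T.lm_simps bimodule_sum_tsum 1[unfolded bimodule_sum_tsum, symmetric]
  using tsum_append[OF A.M.abelian_group_axioms cl _ T.lm_closed[OF c(3) ys]] by simp
 then show ?case using Cons.IH[OF c(3)] by (simp add: p bimodule_sum_def)
qed

lemma module_bimodule: "module RK (bimodule A)"
proof (rule moduleI[OF cring_RK])
 show "abelian_group (bimodule A)"
  by (rule abelian_groupI) (auto simp: A.M.a_ac intro: A.M.l_neg)
 fix r s x y assume r: "r \<in>[RK]" and s: "s \<in>[RK]" and x: "x \<in> carrier (bimodule A)" and y: "y \<in> carrier (bimodule A)"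
 obtain rs where rs: "rs \<in> pairs KA KA" "r = T.cls rs" using T.carrierE[OF r] .
 obtain ss where ss: "ss \<in> pairs KA KA" "s = T.cls ss" using T.carrierE[OF s] .
 have xy: "x \<in>[A]" "y \<in>[A]" using x y by auto
 have cl: "\<forall>b\<in>carrier KA. \<forall>c\<in>carrier KA. (b *[A] a) *[A] c \<in>[A]" if "a \<in>[A]" for a using that Kc by auto
 show "r .[bimodule A] x \<in> carrier (bimodule A)" using bimodule_smult rs xy bimodule_sum_closed by simp
 show "(r +[RK] s) .[bimodule A] x = r .[bimodule A] x +[bimodule A] s .[bimodule A] x"
  using rs ss xy T.add_T[OF rs(1) ss(1)] bimodule_smult[of "rs @ ss" x] bimodule_smult[OF rs(1) xy(1)] bimodule_smult[OF ss(1) xy(1)]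
   tsum_append[OF A.M.abelian_group_axioms cl[OF xy(1)] rs(1) ss(1)] by (simp add: bimodule_sum_tsum)
 show "r .[bimodule A] (x +[bimodule A] y) = r .[bimodule A] x +[bimodule A] r .[bimodule A] y"
 proof -
  have "tsum A (\<lambda>k k'. (k *[A] (x +[A] y)) *[A] k') rs = tsum A (\<lambda>k k'. (k *[A] x) *[A] k' +[A] (k *[A] y) *[A] k') rs"
   by (rule tsum_cong[OF rs(1)]) (use xy Kc in \<open>simp add: A.distrib_left A.distrib_right\<close>)
  then show ?thesis using rs xy bimodule_smult[OF rs(1)] tsum_additive[OF A.M.abelian_group_axioms cl[OF xy(1)] cl[OF xy(2)] rs(1)]
   by (simp add: bimodule_sum_tsum)
 qed
 show "(r *[RK] s) .[bimodule A] x = r .[bimodule A] (s .[bimodule A] x)"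
  using rs ss xy T.mult_T[OF rs(1) ss(1)] bimodule_smult T.lm_closed[OF rs(1) ss(1)] bimodule_sum_mult[OF ss(1) xy(1) rs(1)]
   bimodule_sum_closed by simp
next
 fix x assume "x \<in> carrier (bimodule A)"
 then have x: "x \<in>[A]" by simp
 have p: "[(1[A], 1[A])] \<in> pairs KA KA" using K_one by simp
 show "1[RK] .[bimodule A] x = x" using bimodule_smult[OF p x] x by (simp add: T.one_T bimodule_sum_def)
qed

lemma ext_K_nucleus: "y \<in> ext K ==> y \<in> nucleus M"
 using ext_mono[OF K_nuc] ext_nucleus by auto

text \<open>The tensor \<open>ts\<close> is the slice of y \<otimes> y' along l. In this way
  idempotents that exist only over E produce elements of K \<otimes> K acting on A.\<close>

lemma slice_bimodule_sum:
 assumes y: "y \<in> ext K" and y': "y' \<in> ext K" and l: "l \<in> functionals F E"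
 shows "\<exists>ts\<in>pairs KA KA. \<forall>a\<in>carrier A. bimodule_sum A ts a = slice l ((y *[M] \<phi> a) *[M] y')"
proof -
 have 1: "\<exists>ts\<in>pairs KA KA. \<forall>a\<in>carrier A. bimodule_sum A ts a = slice l ((\<phi> k *[M] \<phi> a) *[M] y')"
  if k: "k \<in> K" and l: "l \<in> functionals F E" for k l
  using K_sub y'
 proof (induction rule: ext_induct)
  case zero
  then show ?case using Kc[OF k] l by (intro bexI[of _ "[]"]) (auto simp: bimodule_sum_def)
 next
  case (add e k' y)
  then obtain ts where ts: "ts \<in> pairs KA KA" "\<forall>a\<in>carrier A. bimodule_sum A ts a = slice l ((\<phi> k *[M] \<phi> a) *[M] y)" by auto
  have le: "l e \<in>[F]" using functionalsD(1)[OF l add(1)] .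
  show ?case
  proof (intro bexI[of _ "(l e .[A] k, k') # ts"] ballI)
   fix a assume a: "a \<in>[A]"
   have "slice l ((\<phi> k *[M] \<phi> a) *[M] (e .[M] \<phi> k' +[M] y)) =
     slice l (e .[M] \<phi> ((k *[A] a) *[A] k')) +[A] slice l ((\<phi> k *[M] \<phi> a) *[M] y)"
    using add Kc[OF k] a l by (simp add: M.distrib_left M.mult_smult slice_add phi_mult)
   then show "bimodule_sum A ((l e .[A] k, k') # ts) a = slice l ((\<phi> k *[M] \<phi> a) *[M] (e .[M] \<phi> k' +[M] y))"
    using ts(2) a add Kc[OF k] l le by (simp add: bimodule_sum_def slice_phi A.smult_mult)
  qed (use ts(1) k add(2) le KD(4) in simp)
 qed
 have "\<forall>l\<in>functionals F E. \<exists>ts\<in>pairs KA KA. \<forall>a\<in>carrier A. bimodule_sum A ts a = slice l ((y *[M] \<phi> a) *[M] y')"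
  using K_sub y
 proof (induction rule: ext_induct)
  case zero
  then show ?case using ext_closed[OF y'] by (auto simp: bimodule_sum_def intro!: bexI[of _ "[]"])
 next
  case (add e k y)
  show ?case
  proof
   fix l assume l: "l \<in> functionals F E"
   note l' = functional_twist[OF l add(1)]
   obtain ts where ts: "ts \<in> pairs KA KA" "\<forall>a\<in>carrier A. bimodule_sum A ts a = slice l ((y *[M] \<phi> a) *[M] y')"
    using add.IH l by auto
   obtain ts' where ts': "ts' \<in> pairs KA KA" "\<forall>a\<in>carrier A. bimodule_sum A ts' a = slice (\<lambda>x. l (x *[E] e)) ((\<phi> k *[M] \<phi> a) *[M] y')"
    using 1[OF add(2) l'] by auto
   show "\<exists>ts\<in>pairs KA KA. \<forall>a\<in>carrier A. bimodule_sum A ts a = slice l (((e .[M] \<phi> k +[M] y) *[M] \<phi> a) *[M] y')"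
   proof (intro bexI[of _ "ts' @ ts"] ballI)
    fix a assume a: "a \<in>[A]"
    have c: "\<phi> k \<in>[M]" "\<phi> a \<in>[M]" "y' \<in>[M]" "y \<in>[M]" "e \<in>[E]" using add a ext_closed[OF y'] by auto
    have cl: "\<forall>b\<in>carrier KA. \<forall>c\<in>carrier KA. (b *[A] a) *[A] c \<in>[A]" using a Kc by auto
    have "bimodule_sum A (ts' @ ts) a = bimodule_sum A ts' a +[A] bimodule_sum A ts a"
     unfolding bimodule_sum_tsum by (rule tsum_append[OF A.M.abelian_group_axioms cl ts'(1) ts(1)])
    also have "\<dots> = slice l (e .[M] ((\<phi> k *[M] \<phi> a) *[M] y')) +[A] slice l ((y *[M] \<phi> a) *[M] y')"
     using ts(2) ts'(2) a slice_smult[OF l add(1)] c by simp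
    also have "\<dots> = slice l (((e .[M] \<phi> k +[M] y) *[M] \<phi> a) *[M] y')"
     using c slice_add[OF l] by (simp add: M.distrib_right M.smult_mult)
    finally show "bimodule_sum A (ts' @ ts) a = slice l (((e .[M] \<phi> k +[M] y) *[M] \<phi> a) *[M] y')" .
   qed (use ts(1) ts'(1) in simp)
  qed
 qed
 then show ?thesis using l by auto
qed

lemma ext_K_comm: "[|y \<in> ext K; z \<in> ext K|] ==> y *[M] z = z *[M] y"
proof -
 assume y: "y \<in> ext K" and z: "z \<in> ext K"
 have 1: "\<phi> k *[M] z = z *[M] \<phi> k" if k: "k \<in> K" for k
  using K_sub z
 proof (induction rule: ext_induct)
  case (add e a y)
  have "\<phi> k *[M] \<phi> a = \<phi> a *[M] \<phi> k" using K_comm[OF k add(2)] phi_mult Kc[OF k] add(3) by metis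
  then show ?case using add Kc[OF k] by (simp add: M.distrib_left M.distrib_right M.mult_smult M.smult_mult)
 qed (use Kc[OF k] in simp)
 from K_sub y show ?thesis
 proof (induction rule: ext_induct)
  case (add e a y)
  then show ?case using 1 ext_closed[OF z] by (simp add: M.distrib_left M.distrib_right M.mult_smult M.smult_mult)
 qed (use ext_closed[OF z] in simp)
qed

end

text \<open>The situation common to both directions: over E, the elements of K act diagonally with
  respect to the idempotents H. Each h in H then defines a character \<open>chi h\<close> from K to
  E.\<close>

locale split_algebra = nuclear_subalgebra F A E M \<phi> slice K
 for F :: "('f, 'm) ring_scheme" and A :: "('f, 'a) module"
  and E :: "('f, 'e) module" and M :: "('e, 'v) module" and \<phi> slice and K +
 fixes H :: "'v set"
 assumes H_sys: "M.idempotent_system H" and H_ext: "H <= ext K"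
  and K_act: "!!k h. [|k \<in> K; h \<in> H|] ==> \<exists>r\<in>carrier E. \<phi> k *[M] h = r .[M] h"
begin

lemmas HD = M.idempotent_systemD[OF H_sys]

definition chi :: "'v => 'a => 'e" where
 "chi h k = (SOME r. r \<in>[E] \<and> \<phi> k *[M] h = r .[M] h)"

lemma chi: "[|h \<in> H; k \<in> K|] ==> chi h k \<in>[E]" "[|h \<in> H; k \<in> K|] ==> \<phi> k *[M] h = chi h k .[M] h"
 using someI_ex[of "\<lambda>r. r \<in>[E] \<and> \<phi> k *[M] h = r .[M] h"] K_act[of k h] unfolding chi_def by auto

lemma chi_unique: "[|h \<in> H; k \<in> K; r \<in>[E]; \<phi> k *[M] h = r .[M] h|] ==> chi h k = r"
proof -
 assume h: "h \<in> H" and k: "k \<in> K" and r: "r \<in>[E]" and e: "\<phi> k *[M] h = r .[M] h"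
 note c = chi[OF h k]
 have "(chi h k -[E] r) .[M] h = 0[M]"
  using c r e HD(3)[OF h] by (simp add: a_minus_def M.smult_l_distr M.smult_l_minus M.M.r_neg)
 then have "chi h k -[E] r = 0[E]" using M.smult_eq_zero[of "chi h k -[E] r" h] HD(3,4)[OF h] c r by auto
 then show ?thesis using c r by simp
qed

lemma chi_add: "[|h \<in> H; k \<in> K; k' \<in> K|] ==> chi h (k +[A] k') = chi h k +[E] chi h k'"
 using chi HD(3) Kc KD(3) by (intro chi_unique) (simp_all add: phi_add M.distrib_right M.smult_l_distr)

lemma chi_smult: "[|h \<in> H; r \<in>[F]; k \<in> K|] ==> chi h (r .[A] k) = r .[E] chi h k"
proof -
 assume h: "h \<in> H" "r \<in>[F]" "k \<in> K"
 have "\<phi> (r .[A] k) *[M] h = (\<iota> r *[E] chi h k) .[M] h"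
  using h chi HD(3) Kc by (simp add: phi_smult M.smult_mult M.smult_assoc1)
 then show ?thesis using h chi KD(4) by (intro chi_unique) (simp_all add: iota_mult)
qed

lemma chi_separates: "[|k \<in> K; !!h. h \<in> H ==> chi h k = 0[E]|] ==> k = 0[A]"
proof -
 assume k: "k \<in> K" and z: "!!h. h \<in> H ==> chi h k = 0[E]"
 have "\<phi> k = 0[M]"
 proof (rule M.idempotent_system_ext(2)[OF H_sys])
  show "\<phi> k *[M] h = 0[M] *[M] h" if "h \<in> H" for h using chi(2)[OF that k] z[OF that] HD(3)[OF that] by simp
 qed (use Kc[OF k] in simp_all)
 then show ?thesis using phi_inj[OF Kc[OF k], of "0[A]"] by simp
qed

text \<open>The scalar by which an element of \<open>K \<otimes> K\<close> acts on \<open>g M h\<close>.\<close>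

definition rho :: "'v => 'v => ('a \<times> 'a) list => 'e" where
 "rho g h ts = tsum E (\<lambda>k k'. chi g k *[E] chi h k') ts"

lemma rho_closed: "[|g \<in> H; h \<in> H; ts \<in> pairs KA KA|] ==> rho g h ts \<in>[E]"
 unfolding rho_def using chi by (intro tsum_closed[OF M.R.abelian_group_axioms, of KA KA]) auto

text \<open>The E-linear extension to M of the action of K \<otimes> K on A, see
  \<open>act_phi\<close> and \<open>linear_op_act\<close>.\<close>

definition act :: "('a \<times> 'a) list => 'v => 'v" where
 "act ts m = tsum M (\<lambda>k k'. (\<phi> k *[M] m) *[M] \<phi> k') ts"

lemma act_closed: "[|ts \<in> pairs KA KA; m \<in>[M]|] ==> act ts m \<in>[M]"
 unfolding act_def using Kc by (intro tsum_closed[OF M.M.abelian_group_axioms, of KA KA]) auto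

lemma act_phi: "[|ts \<in> pairs KA KA; a \<in>[A]|] ==> act ts (\<phi> a) = \<phi> (bimodule_sum A ts a)"
proof (induction ts rule: list.induct)
 case (Cons p ts)
 obtain k k' where p: "p = (k, k')" by force
 with Cons.prems have c: "k \<in> K" "k' \<in> K" "ts \<in> pairs KA KA" by auto
 show ?case using Cons.IH[OF c(3)] Cons.prems(2) Kc[OF c(1)] Kc[OF c(2)] bimodule_sum_closed[OF c(3)]
  by (simp add: p act_def bimodule_sum_def phi_add phi_mult)
qed (simp add: act_def bimodule_sum_def)

lemma linear_op_act: "ts \<in> pairs KA KA ==> linear_op E M (act ts)"
proof (induction ts rule: list.induct)
 case Nil
 then show ?case by (simp add: linear_op_def act_def)
next
 case (Cons p ts)
 obtain k k' where p: "p = (k, k')" by force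
 with Cons.prems have c: "k \<in> K" "k' \<in> K" "ts \<in> pairs KA KA" by auto
 note L = linear_opD[OF Cons.IH[OF c(3)]]
 have "act (p # ts) m = (\<phi> k *[M] m) *[M] \<phi> k' +[M] act ts m" for m by (simp add: p act_def)
 then show ?case using L Kc[OF c(1)] Kc[OF c(2)] unfolding linear_op_def
  by (simp add: M.distrib_left M.distrib_right M.mult_smult M.smult_mult M.smult_r_distr M.M.a_ac)
qed

lemma act_corner:
 assumes g: "g \<in> H" and h: "h \<in> H" and m: "m \<in>[M]"
 shows "ts \<in> pairs KA KA ==> act ts ((g *[M] m) *[M] h) = rho g h ts .[M] ((g *[M] m) *[M] h)"
proof (induction ts rule: list.induct)
 case Nil
 then show ?case using HD(3)[OF g] HD(3)[OF h] m by (simp add: act_def rho_def)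
next
 case (Cons p ts)
 obtain k k' where p: "p = (k, k')" by force
 with Cons.prems have c: "k \<in> K" "k' \<in> K" "ts \<in> pairs KA KA" by auto
 note gc = HD(2,3)[OF g] and hc = HD(2,3)[OF h] and kc = Kc[OF c(1)] Kc[OF c(2)]
 have kn: "\<phi> k \<in> nucleus M" "\<phi> k' \<in> nucleus M"
  using ext_K_nucleus phi_ext_iff[OF K_sub] c kc by auto
 have hk: "h *[M] \<phi> k' = chi h k' .[M] h"
  using ext_K_comm[of h "\<phi> k'"] H_ext h phi_ext_iff[OF K_sub kc(2)] c(2) chi(2)[OF h c(2)] by auto
 have "(\<phi> k *[M] ((g *[M] m) *[M] h)) *[M] \<phi> k' = ((\<phi> k *[M] g) *[M] m) *[M] (h *[M] \<phi> k')"
  using gc hc kn kc m by (simp add: M.nucleus_assoc M.nucleus_mult)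
 also have "\<dots> = (chi g k *[E] chi h k') .[M] ((g *[M] m) *[M] h)"
  unfolding hk chi(2)[OF g c(1)] using chi(1)[OF g c(1)] chi(1)[OF h c(2)] gc hc m
  by (simp add: M.smult_mult M.mult_smult M.R.m_comm flip: M.smult_assoc1)
 finally have "act (p # ts) ((g *[M] m) *[M] h) = (chi g k *[E] chi h k') .[M] ((g *[M] m) *[M] h) +[M]
   rho g h ts .[M] ((g *[M] m) *[M] h)"
  using Cons.IH[OF c(3)] by (simp add: p act_def)
 then show ?case using chi(1)[OF g c(1)] chi(1)[OF h c(2)] rho_closed[OF g h c(3)] gc hc m
  by (simp add: p rho_def M.smult_l_distr)
qed

text \<open>The characters \<chi>_g \<otimes> \<chi>_h jointly embed K \<otimes> K into copies of E.
  The functionals l composed with \<chi>_g separate the left factor, so by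
  \<open>rel_Nil_if_slices_vanish\<close> it is enough that w, the sum of \<chi>_g(k) \<phi>(k'), is
  zero. On each h the element w acts by the scalar \<open>rho g h ts\<close> = 0.\<close>

lemma rho_zero_imp_rel_Nil:
 assumes ts: "ts \<in> pairs KA KA" and rz: "!!g h. [|g \<in> H; h \<in> H|] ==> rho g h ts = 0[E]"
 shows "T.rel ts []"
proof -
 define L where "L = {\<lambda>k. l (chi g k) |l g. l \<in> functionals F E \<and> g \<in> H}"
 interpret KM: module F KA by (rule submodule.submodule_is_module[OF K_sub A.module_axioms])
 show ?thesis
 proof (rule T.rel_Nil_if_slices_vanish[OF _ _ ts])
  show "L <= functionals F KA"
  proof
   fix \<mu> assume "\<mu> \<in> L"
   then obtain l g where l: "l \<in> functionals F E" and g: "g \<in> H" and m: "\<mu> = (\<lambda>k. l (chi g k))" by (auto simp: L_def)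
   show "\<mu> \<in> functionals F KA"
    unfolding functionals_def m by (simp add: chi(1)[OF g] chi_add[OF g] chi_smult[OF g] functionalsD[OF l])
  qed
  show "\<exists>\<mu>\<in>L. \<mu> k = 1[F]" if "k \<in>[KA]" "k ~= 0[KA]" for k
  proof -
   have k: "k \<in> K" "k ~= 0[A]" using that by auto
   from k(2) have "\<exists>g\<in>H. chi g k ~= 0[E]" using chi_separates[OF k(1)] by metis
   then obtain g where g: "g \<in> H" "chi g k ~= 0[E]" by metis
   obtain l where "l \<in> functionals F E" "l (chi g k) = 1[F]" using FE.functional_exists[OF chi(1)[OF g(1) k(1)] g(2)] by auto
   then show ?thesis using g(1) unfolding L_def by (intro bexI[of _ "\<lambda>k. l (chi g k)"]) auto
  qed
  fix \<mu> assume "\<mu> \<in> L"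
  then obtain l g where l: "l \<in> functionals F E" and g: "g \<in> H" and m: "\<mu> = (\<lambda>k. l (chi g k))" by (auto simp: L_def)
  define w where "w = tsum M (\<lambda>k k'. chi g k .[M] \<phi> k') ts"
  have cl: "\<forall>b\<in>carrier KA. \<forall>c\<in>carrier KA. chi g b .[M] \<phi> c \<in>[M]" using chi g Kc by auto
  have wc: "w \<in>[M]" unfolding w_def by (rule tsum_closed[OF M.M.abelian_group_axioms cl ts])
  have "w = 0[M]"
  proof (rule M.idempotent_system_ext(2)[OF H_sys wc])
   fix h assume h: "h \<in> H"
   have "w *[M] h = tsum M (\<lambda>k k'. (chi g k .[M] \<phi> k') *[M] h) ts"
    unfolding w_def by (rule tsum_hom[OF M.M.abelian_group_axioms cl ts, of "\<lambda>z. z *[M] h"]) (use HD(3)[OF h] in \<open>auto simp: M.distrib_right\<close>)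
   also have "\<dots> = tsum M (\<lambda>k k'. (chi g k *[E] chi h k') .[M] h) ts"
    by (rule tsum_cong[OF ts]) (use chi g h Kc HD(3)[OF h] in \<open>simp add: M.smult_mult M.smult_assoc1\<close>)
   also have "\<dots> = rho g h ts .[M] h"
    unfolding rho_def
    by (rule tsum_hom[OF M.R.abelian_group_axioms _ ts, of _ "\<lambda>r. r .[M] h", symmetric])
     (use chi g h HD(3)[OF h] in \<open>auto simp: M.smult_l_distr\<close>)
   finally show "w *[M] h = 0[M] *[M] h" using rz[OF g h] HD(3)[OF h] by simp
  qed simp
  then have "0[A] = slice l w" using l by simp
  also have "\<dots> = tsum A (\<lambda>k k'. slice l (chi g k .[M] \<phi> k')) ts"
   unfolding w_def by (rule tsum_hom[OF M.M.abelian_group_axioms cl ts]) (use slice_add[OF l] l in auto)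
  also have "\<dots> = tsum A (\<lambda>k k'. l (chi g k) .[A] k') ts"
   by (rule tsum_cong[OF ts]) (use slice_phi[OF l] chi g Kc in simp)
  finally have "tsum A (\<lambda>k k'. l (chi g k) .[A] k') ts = 0[A]" by simp
  moreover have "tsum KA f xs = tsum A f xs" for f and xs :: "('a \<times> 'a) list" by (induction xs) auto
  ultimately show "tsum KA (\<lambda>k k'. \<mu> k .[KA] k') ts = 0[KA]" by (simp add: m)
 qed
qed

lemma act_zero_imp_rel_Nil:
 assumes nz: "!!g h. [|g \<in> H; h \<in> H|] ==> \<exists>m\<in>carrier M. (g *[M] m) *[M] h ~= 0[M]"
  and ts: "ts \<in> pairs KA KA" and z: "!!a. a \<in>[A] ==> bimodule_sum A ts a = 0[A]"
 shows "T.rel ts []"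
proof -
 have actz: "act ts m = 0[M]" if "m \<in>[M]" for m
  using that
 proof (induction rule: span_induct)
  case zero
  then show ?case using M.linear_op_zero[OF linear_op_act[OF ts]] .
 next
  case (add e a y)
  then show ?case using linear_opD[OF linear_op_act[OF ts]] act_phi[OF ts add(2)] z[OF add(2)] by simp
 qed
 show ?thesis
 proof (rule rho_zero_imp_rel_Nil[OF ts])
  fix g h assume g: "g \<in> H" and h: "h \<in> H"
  obtain m where m: "m \<in>[M]" "(g *[M] m) *[M] h ~= 0[M]" using nz[OF g h] by auto
  have c: "(g *[M] m) *[M] h \<in>[M]" using HD(3)[OF g] HD(3)[OF h] m by simp
  have "rho g h ts .[M] ((g *[M] m) *[M] h) = 0[M]" using act_corner[OF g h m(1) ts] actz[OF c] by simp
  then show "rho g h ts = 0[E]" using M.smult_eq_zero[OF rho_closed[OF g h ts] c] m(2) by auto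
 qed
qed

end

section \<open>From a frame to minimal faithfulness\<close>

context split_algebra begin

lemma submodule_bimodule:
 assumes N: "submodule N RK (bimodule A)"
 shows "submodule N F A" and "[|k \<in> K; x \<in> N|] ==> k *[A] x \<in> N" and "[|k \<in> K; x \<in> N|] ==> x *[A] k \<in> N"
proof -
 interpret Bm: module RK "bimodule A" by (rule module_bimodule)
 note D = Bm.submoduleD[OF N, simplified]
 have s: "(k *[A] x) *[A] k' \<in> N" if k: "k \<in> K" "k' \<in> K" and x: "x \<in> N" for k k' x
 proof -
  have p: "[(k, k')] \<in> pairs KA KA" and xc: "x \<in>[A]" using k x D(1) by auto
  have "T.cls [(k, k')] .[bimodule A] x \<in> N" using D(4)[OF T.cls_closed[OF p] x] .
  then show ?thesis using bimodule_smult[OF p xc] Kc[OF k(1)] Kc[OF k(2)] xc by (simp add: bimodule_sum_def)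
 qed
 show l: "k *[A] x \<in> N" if "k \<in> K" "x \<in> N" for k x
  using s[OF that(1) K_one that(2)] Kc[OF that(1)] that(2) D(1) by (simp add: subset_iff)
 show "[|k \<in> K; x \<in> N|] ==> x *[A] k \<in> N"
  using s[OF K_one] D(1) by (simp add: subset_iff)
 have sm: "r .[A] x \<in> N" if "r \<in>[F]" "x \<in> N" for r x
  using l[OF KD(4)[OF that(1) K_one] that(2)] that D(1) by (simp add: A.smult_mult subset_iff)
 show "submodule N F A"
 proof (rule A.submoduleI)
  fix x assume x: "x \<in> N"
  then have "-[A] x = (-[F] 1[F]) .[A] x" using D(1) by (simp add: subset_iff A.smult_l_minus)
  then show "-[A] x \<in> N" using sm[OF _ x] by simp
 qed (use D(1,2,3) sm in auto)
qed

lemma ext_sandwich: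
 assumes N: "submodule N RK (bimodule A)" and y: "y \<in> ext K" "y' \<in> ext K" and n: "n \<in> ext N"
 shows "(y *[M] n) *[M] y' \<in> ext N"
proof -
 note S = submodule_bimodule[OF N]
 have "y *[M] n \<in> ext N" by (rule ext_mult[OF K_sub S(1) S(1) _ y(1) n]) (rule S(2))
 show ?thesis by (rule ext_mult[OF S(1) K_sub S(1) _ \<open>y *[M] n \<in> ext N\<close> y(2)]) (rule S(3))
qed

lemma section_annihilator:
 assumes N: "submodule N RK (bimodule A)" and N': "submodule N' RK (bimodule A)" "N' <= N"
  and f: "faithful_module RK (section_module (bimodule A) N N')"
  and ts: "ts \<in> pairs KA KA" and kill: "!!x. x \<in> N ==> bimodule_sum A ts x \<in> N'"
 shows "T.rel ts []"
proof -
 interpret Bm: module RK "bimodule A" by (rule module_bimodule)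
 note D = A.submoduleD[OF submodule_bimodule(1)[OF N]] and D' = A.submoduleD[OF submodule_bimodule(1)[OF N'(1)]]
 have coset: "N' +>\<^bsub>bimodule A\<^esub> x = N'" if x: "x \<in> N'" for x
 proof
  show "N' +>\<^bsub>bimodule A\<^esub> x <= N'" using D'(3) x by (auto simp: a_r_coset_def')
  show "N' <= N' +>\<^bsub>bimodule A\<^esub> x"
  proof
   fix y assume y: "y \<in> N'"
   have "y = (y -[A] x) +[A] x"
    using A.M.a_add_minus_cancel[of x y] A.M.a_comm[of x] x y D'(1) by (simp add: subset_iff)
   then show "y \<in> N' +>\<^bsub>bimodule A\<^esub> x" using D'(6)[OF y x] unfolding a_r_coset_def' bimodule_simps
    by (intro UN_I[of "y -[A] x"]) simp_all
  qed
 qed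
 have "T.cls ts .[section_module (bimodule A) N N'] S = N'" if S: "S \<in> carrier (section_module (bimodule A) N N')" for S
 proof -
  obtain x where x: "x \<in> N" "S = (\<Union>n\<in>N'. {n +[A] x})"
   using S by (auto simp: section_module_def A_RCOSETS_def' a_r_coset_def')
  have SN: "S <= N" using x D(3) N'(2) by auto
  have ne: "S ~= {}" using D'(2) x by auto
  have "N' +>\<^bsub>bimodule A\<^esub> (T.cls ts .[bimodule A] s) = N'" if "s \<in> S" for s
   using coset kill bimodule_smult[OF ts] that SN D(1) by (simp add: subset_iff)
  then show ?thesis using ne by (auto simp: section_module_def)
 qed
 then have "T.cls ts = 0[RK]" using f T.cls_closed[OF ts] unfolding faithful_module_def by (simp add: section_module_def)
 then show ?thesis using T.cls_eq[OF ts] by (simp add: T.zero_T)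
qed

text \<open>Under the assumption \<open>kill\<close> the slices of g \<otimes> h annihilate N / N',
  hence vanish in K \<otimes> K by faithfulness. So they also annihilate A, and all slices of g
  \<phi>(a) h are zero.\<close>

lemma faithful_section_corner:
 assumes N: "submodule N RK (bimodule A)" and N': "submodule N' RK (bimodule A)" "N' <= N"
  and f: "faithful_module RK (section_module (bimodule A) N N')"
  and g: "g \<in> H" and h: "h \<in> H" and kill: "!!n. n \<in> ext N ==> (g *[M] n) *[M] h \<in> ext N'"
  and m: "m \<in>[M]"
 shows "(g *[M] m) *[M] h = 0[M]"
proof -
 note gh = HD(3)[OF g] HD(3)[OF h]
 have z: "(g *[M] \<phi> a) *[M] h = 0[M]" if a: "a \<in>[A]" for a
 proof (rule slices_separate)
  fix l assume l: "l \<in> functionals F E"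
  obtain ts where ts: "ts \<in> pairs KA KA" "\<forall>a\<in>carrier A. bimodule_sum A ts a = slice l ((g *[M] \<phi> a) *[M] h)"
   using slice_bimodule_sum[OF subsetD[OF H_ext g] subsetD[OF H_ext h] l] by (rule bexE)
  have "T.rel ts []"
  proof (rule section_annihilator[OF N N' f ts(1)])
   fix x assume x: "x \<in> N"
   then have xc: "x \<in>[A]" using A.submoduleD(1)[OF submodule_bimodule(1)[OF N]] by auto
   have "(g *[M] \<phi> x) *[M] h \<in> ext N'" using kill phi_ext_iff[OF submodule_bimodule(1)[OF N] xc] x by simp
   then show "bimodule_sum A ts x \<in> N'" using ts(2) xc l by (simp add: ext_def)
  qed
  from T.tsum_rel[OF A.M.abelian_group_axioms balanced_bimodule[OF a] this]
  have "bimodule_sum A ts a = 0[A]" by (simp add: bimodule_sum_tsum)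
  then show "slice l ((g *[M] \<phi> a) *[M] h) = 0[A]" using ts(2) a by simp
 qed (use a gh in simp)
 from m show ?thesis
 proof (induction rule: span_induct)
  case (add e a y)
  then show ?case using gh z by (simp add: M.distrib_left M.distrib_right M.smult_mult M.mult_smult)
 qed (use gh in simp)
qed

text \<open>Each corner gMh is a line, so a bimodule extended to E either contains it or meets it in
  0. A faithful section N / N' must be nonzero on every corner, so every line lies in
  \<open>ext N\<close> and none meets \<open>ext N'\<close>. Summing over H gives N = A and N' = 0.
  Faithfulness of A itself holds because no corner is zero.\<close>

theorem minimally_faithful_bimodule:
 assumes fr: "M.frame H" shows "minimally_faithful RK (bimodule A)"
proof -
 have nz: "\<exists>m\<in>carrier M. (g *[M] m) *[M] h ~= 0[M]" if gh: "g \<in> H" "h \<in> H" for g h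
 proof -
  obtain u where u: "u \<in>[M]" "u ~= 0[M]" "g *[M] u = u" "u *[M] h = u"
   using M.frame_unit[OF fr gh] by metis
  then show ?thesis by (intro bexI[of _ u]) simp_all
 qed
 have faith: "faithful_module RK (bimodule A)"
  unfolding faithful_module_def
 proof (intro ballI impI)
  fix r assume r: "r \<in>[RK]" and z: "\<forall>x\<in>carrier (bimodule A). r .[bimodule A] x = 0[bimodule A]"
  obtain ts where ts: "ts \<in> pairs KA KA" "r = T.cls ts" using T.carrierE[OF r] .
  have "T.rel ts []" by (rule act_zero_imp_rel_Nil[OF nz ts(1)]) (use z bimodule_smult[OF ts(1)] ts(2) in auto)
  then show "r = 0[RK]" using ts(2) T.cls_eqI by (simp add: T.zero_T)
 qed
 have main: "N = carrier A \<and> N' = {0[A]}"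
  if N: "submodule N RK (bimodule A)" and N': "submodule N' RK (bimodule A)" "N' <= N"
   and f: "faithful_module RK (section_module (bimodule A) N N')" for N N'
 proof -
  note SN = submodule_bimodule(1)[OF N] and SN' = submodule_bimodule(1)[OF N'(1)]
  note DN = M.submoduleD[OF submodule_ext[OF SN]] and DN' = M.submoduleD[OF submodule_ext[OF SN']]
  have nokill: "\<exists>n\<in>ext N. (g *[M] n) *[M] h \<notin> ext N'" if gh: "g \<in> H" "h \<in> H" for g h
   using faithful_section_corner[OF N N' f gh] nz[OF gh] by metis
  \<comment> \<open>A single vector of \<open>ext L\<close> with nonzero (g,h)-component brings the
    whole line gMh into \<open>ext L\<close>.\<close>
  have unit_in: "u \<in> ext L"
   if L: "submodule L RK (bimodule A)" and gh: "g \<in> H" "h \<in> H" and n: "n \<in> ext L" "(g *[M] n) *[M] h ~= 0[M]"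
    and u: "u \<in>[M]" "!!z. z \<in>[M] ==> \<exists>r\<in>carrier E. (g *[M] z) *[M] h = r .[M] u" for L g h n u
  proof -
   note SL = submodule_ext[OF submodule_bimodule(1)[OF L]]
   obtain r where r: "r \<in>[E]" "(g *[M] n) *[M] h = r .[M] u" using u(2)[OF ext_closed[OF n(1)]] by auto
   have "r .[M] u \<in> ext L" using ext_sandwich[OF L _ _ n(1), of g h] H_ext gh r by auto
   moreover have "r ~= 0[E]" using n(2) r(2) u(1) by auto
   ultimately show ?thesis using M.submodule_smult_cancel[OF SL r(1) _ u(1)] by simp
  qed
  have "carrier M <= ext N"
  proof
   fix z assume z: "z \<in>[M]"
   have c: "(g *[M] z) *[M] h \<in> ext N" if gh: "g \<in> H" "h \<in> H" for g h
   proof -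
    obtain u where u: "u \<in>[M]" "!!z. z \<in>[M] ==> \<exists>r\<in>carrier E. (g *[M] z) *[M] h = r .[M] u"
     using M.frame_unit[OF fr gh] by metis
    obtain n where n: "n \<in> ext N" "(g *[M] n) *[M] h \<notin> ext N'" using nokill[OF gh] by auto
    have "(g *[M] n) *[M] h ~= 0[M]" using n(2) DN'(2) by metis
    from unit_in[OF N gh n(1) this u] have "u \<in> ext N" .
    then show ?thesis using u(2)[OF z] DN(4) by auto
   qed
   have "(\<Oplus>\<^bsub>M\<^esub>g\<in>H. (\<Oplus>\<^bsub>M\<^esub>h\<in>H. (g *[M] z) *[M] h)) \<in> ext N"
    using c by (intro M.finsum_in_submodule[OF submodule_ext[OF SN] HD(1)] Pi_I) auto
   also have "(\<Oplus>\<^bsub>M\<^esub>g\<in>H. (\<Oplus>\<^bsub>M\<^esub>h\<in>H. (g *[M] z) *[M] h)) = (\<Oplus>\<^bsub>M\<^esub>g\<in>H. g *[M] z)"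
    using z HD(3) by (intro M.M.finsum_cong' HOL.refl Pi_I) (simp_all add: M.idempotent_system_sum[OF H_sys])
   also have "\<dots> = z" by (rule M.idempotent_system_sum(1)[OF H_sys z])
   finally show "z \<in> ext N" .
  qed
  then have "carrier A <= N" using ext_eq_iff[OF _ SN, of "carrier A"] ext_carrier A.submoduleI[of "carrier A"] by simp
  moreover have "N' <= {0[A]}"
  proof (intro subsetI, rule ccontr)
   fix n' assume n': "n' \<in> N'" and "n' \<notin> {0[A]}"
   then have nz': "n' ~= 0[A]" by simp
   have nc: "n' \<in>[A]" using n' A.submoduleD(1)[OF SN'] by auto
   have pn: "\<phi> n' \<in> ext N'" using phi_ext_iff[OF SN' nc] n' by simp
   have pz: "\<phi> n' ~= 0[M]" using phi_inj[OF nc A.M.zero_closed] nz' by auto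
   obtain g h where gh: "g \<in> H" "h \<in> H" "(g *[M] \<phi> n') *[M] h ~= 0[M]"
   proof (rule ccontr)
    assume "\<not> thesis"
    with that have "!!g h. [|g \<in> H; h \<in> H|] ==> (g *[M] \<phi> n') *[M] h = (g *[M] 0[M]) *[M] h"
     using HD(3) by (metis M.mult_zero M.zero_mult)
    from M.idempotent_system_ext2[OF H_sys phi_closed[OF nc] M.M.zero_closed this] pz show False by simp
   qed
   obtain u where u: "u \<in>[M]" "!!z. z \<in>[M] ==> \<exists>r\<in>carrier E. (g *[M] z) *[M] h = r .[M] u"
    using M.frame_unit[OF fr gh(1,2)] by metis
   from unit_in[OF N'(1) gh(1,2) pn gh(3) u] have uN: "u \<in> ext N'" .
   obtain n where n: "n \<in> ext N" "(g *[M] n) *[M] h \<notin> ext N'" using nokill[OF gh(1,2)] by auto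
   then show False using u(2)[OF ext_closed[OF n(1)]] DN'(4)[OF _ uN] by auto
  qed
  moreover have "N <= carrier A" "0[A] \<in> N'" using A.submoduleD(1)[OF SN] A.submoduleD(2)[OF SN'] by auto
  ultimately show ?thesis by (intro conjI equalityI) simp_all
 qed
 show ?thesis unfolding minimally_faithful_def
 proof (intro conjI allI impI module_bimodule faith)
  fix N N'
  assume "submodule N RK (bimodule A) \<and> submodule N' RK (bimodule A) \<and> N' <= N \<and>
   faithful_module RK (section_module (bimodule A) N N')"
  then have "N = carrier A \<and> N' = {0[A]}" by (elim conjE) (rule main)
  then show "N = carrier (bimodule A)" "N' = {0[bimodule A]}" by simp_all
 qed
qed

end

section \<open>Separability\<close>

lemma (in module) dev_commute:
 assumes T: "linear_op R M T" and U: "linear_op R M U"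
  and c: "!!v. v \<in>[M] ==> T (U v) = U (T v)"
  and as: "set as <= carrier R" and v: "v \<in>[M]"
 shows "dev M as T (U v) = U (dev M as T v)"
 using as
proof (induction as)
 case Nil
 then show ?case using linear_op_zero[OF U] by simp
next
 case (Cons a as)
 then have as: "set as <= carrier R" by simp
 show ?case
  using Cons.IH[OF as] pev_commute[OF T U c as v] c dev_closed[OF T as v] pev_closed[OF T as v] linear_opD[OF U] linear_opD[OF T] by simp
qed

context scalar_extension begin

lemma phi_dev:
 assumes T: "linear_op F A T" and T': "!!a. a \<in>[A] ==> T' (\<phi> a) = \<phi> (T a)"
 shows "[|set as <= carrier F; v \<in>[A]|] ==> \<phi> (dev A as T v) = dev M (map \<iota> as) T' (\<phi> v)"
proof (induction as)
 case (Cons a as)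
 then show ?case using phi_pev[OF T T', of as v] A.pev_closed[OF T, of as v] A.dev_closed[OF T, of as v] linear_opD(1)[OF T]
  by (simp add: phi_add flip: T')
qed simp

lemma slice_pev:
 assumes l: "l \<in> functionals F E" and T: "linear_op F A T" and U: "linear_op E M U"
  and TU: "!!a. a \<in>[A] ==> U (\<phi> a) = \<phi> (T a)"
 shows "[|set q <= carrier E; v \<in>[A]|] ==> slice l (pev M q U (\<phi> v)) = pev A (map l q) T v"
proof (induction q arbitrary: v)
 case (Cons e q)
 then show ?case using M.pev_closed[OF U, of q] linear_opD(1)[OF T] functionalsD(1)[OF l]
  by (simp add: slice_add[OF l] slice_phi[OF l] TU)
qed (use l in simp)

text \<open>If \<open>P'\<close> killed \<open>v\<close>, every eigenvalue \<open>\<chi> s\<close> would be a double root of \<open>P\<close>; dividing \<open>P\<close> by one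
 linear factor would leave a relation of smaller degree, whose slices are defined over \<open>F\<close>.\<close>

lemma separable_relation:
 assumes T: "linear_op F A T" and U: "linear_op E M U"
  and TU: "!!a. a \<in>[A] ==> U (\<phi> a) = \<phi> (T a)"
  and v: "v \<in>[A]" "v ~= 0[A]" and min: "minimal_relation F A T v as"
  and S: "finite S" and sum: "\<phi> v = (\<Oplus>\<^bsub>M\<^esub>s\<in>S. R s (\<phi> v))"
  and R: "!!s. s \<in> S ==> linear_op E M (R s)" "!!s z. [|s \<in> S; z \<in>[M]|] ==> U (R s z) = R s (U z)"
  and eig: "!!s. s \<in> S ==> \<chi> s \<in>[E]" "!!s. s \<in> S ==> U (R s (\<phi> v)) = \<chi> s .[M] R s (\<phi> v)"
 shows "dev A (as @ [1[F]]) T v ~= 0[A]"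
proof
 assume d: "dev A (as @ [1[F]]) T v = 0[A]"
 have as: "set as <= carrier F" and rel: "pev A (as @ [1[F]]) T v = 0[A]"
  and least: "!!bs. [|set bs <= carrier F; length bs < length as|] ==> pev A (bs @ [1[F]]) T v ~= 0[A]"
  using min unfolding minimal_relation_def by auto
 have P: "set (as @ [1[F]]) <= carrier F" using as by simp
 define cs where "cs = map \<iota> as"
 have cs: "set cs <= carrier E" using iota_closed[OF as] by (simp add: cs_def)
 have P': "map \<iota> (as @ [1[F]]) = cs @ [1[E]]" "set (cs @ [1[E]]) <= carrier E" using cs by (simp_all add: cs_def)
 have ne: "cs ~= []" using rel v linear_opD(1)[OF T] by (auto simp: cs_def)
 have vM: "\<phi> v \<in>[M]" using v by simp
 have wc: "R s (\<phi> v) \<in>[M]" if "s \<in> S" for s using linear_opD(1)[OF R(1)[OF that] vM] .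
 have kP: "pev M (cs @ [1[E]]) U (\<phi> v) = 0[M]" "dev M (cs @ [1[E]]) U (\<phi> v) = 0[M]"
  using phi_pev[OF T TU P v(1)] phi_dev[OF T TU P v(1)] by (simp_all only: rel d P'(1) phi_zero)
 \<comment> \<open>Both P and P' annihilate \<phi>(v), hence every component R s (\<phi> v). On a
   nonzero component they act by the scalars P(\<chi> s) and P'(\<chi> s).\<close>
 have root: "sev E (cs @ [1[E]]) (\<chi> s) = 0[E]" "dv E (cs @ [1[E]]) (\<chi> s) = 0[E]"
  if s: "s \<in> S" "R s (\<phi> v) ~= 0[M]" for s
 proof -
  have "sev E (cs @ [1[E]]) (\<chi> s) .[M] R s (\<phi> v) = pev M (cs @ [1[E]]) U (R s (\<phi> v))"
   using M.pev_eigen[OF P'(2) eig(1)[OF s(1)] wc[OF s(1)] U eig(2)[OF s(1)]] by simp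
  also have "\<dots> = R s (pev M (cs @ [1[E]]) U (\<phi> v))"
   by (rule M.pev_commute[OF U R(1)[OF s(1)] R(2)[OF s(1)] P'(2) vM])
  also have "\<dots> = 0[M]"
   by (simp add: kP M.linear_op_zero[OF R(1)[OF s(1)]])
  finally show "sev E (cs @ [1[E]]) (\<chi> s) = 0[E]"
   using M.smult_eq_zero[OF _ wc[OF s(1)]] s(2) M.R.sev_closed[OF P'(2) eig(1)[OF s(1)]] by blast
  have "dv E (cs @ [1[E]]) (\<chi> s) .[M] R s (\<phi> v) = dev M (cs @ [1[E]]) U (R s (\<phi> v))"
   using M.dev_eigen[OF P'(2) eig(1)[OF s(1)] wc[OF s(1)] U eig(2)[OF s(1)]] by simp
  also have "\<dots> = R s (dev M (cs @ [1[E]]) U (\<phi> v))"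
   by (rule M.dev_commute[OF U R(1)[OF s(1)] R(2)[OF s(1)] P'(2) vM])
  also have "\<dots> = 0[M]"
   by (simp add: kP M.linear_op_zero[OF R(1)[OF s(1)]])
  finally show "dv E (cs @ [1[E]]) (\<chi> s) = 0[E]"
   using M.smult_eq_zero[OF _ wc[OF s(1)]] s(2) M.R.dv_closed[OF P'(2) eig(1)[OF s(1)]] by blast
 qed
 obtain s0 where s0: "s0 \<in> S" "R s0 (\<phi> v) ~= 0[M]"
 proof (rule ccontr)
  assume "\<not> thesis"
  with that have "\<phi> v = 0[M]" using sum M.finsum_all_zero[of S "\<lambda>s. R s (\<phi> v)"] by metis
  then show False using phi_inj[OF v(1) A.M.zero_closed] v(2) by simp
 qed
 note c0 = eig(1)[OF s0(1)]
 obtain q where q: "quo E (cs @ [1[E]]) (\<chi> s0) = q @ [1[E]]" "length q = length cs - 1" "set q <= carrier E"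
  using M.R.quo_monic[OF cs c0 ne] by auto
 have Q: "set (q @ [1[E]]) <= carrier E" using q(3) by simp
 \<comment> \<open>The quotient Q of P by X - \<chi> s0 still vanishes at every occurring
   eigenvalue: at \<chi> s0 because its value there is P'(\<chi> s0), elsewhere because X - \<chi>
   s0 does not vanish.\<close>
 have kill: "pev M (q @ [1[E]]) U (R s (\<phi> v)) = 0[M]" if s: "s \<in> S" for s
 proof (cases "R s (\<phi> v) = 0[M]")
  case True
  then show ?thesis using M.linear_op_zero[OF M.linear_op_pev[OF U Q]] by simp
 next
  case False
  have "sev E (q @ [1[E]]) (\<chi> s) = 0[E]"
  proof (cases "\<chi> s = \<chi> s0")
   case True
   then show ?thesis using M.R.sev_quo_root[OF P'(2) c0] root(2)[OF s0] by (simp add: q(1))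
  next
   case ne: False
   have "(\<chi> s -[E] \<chi> s0) *[E] sev E (q @ [1[E]]) (\<chi> s) = 0[E]"
    using M.R.sev_quo[OF P'(2) c0 eig(1)[OF s]] root(1)[OF s False] root(1)[OF s0] M.R.sev_closed[OF Q eig(1)[OF s]] c0 eig(1)[OF s]
    by (simp add: q(1))
   moreover have "\<chi> s -[E] \<chi> s0 ~= 0[E]" using ne c0 eig(1)[OF s] by simp
   ultimately show ?thesis using M.integral[of "\<chi> s -[E] \<chi> s0"] M.R.sev_closed[OF Q eig(1)[OF s]] c0 eig(1)[OF s] by auto
  qed
  then show ?thesis using M.pev_eigen[OF Q eig(1)[OF s] wc[OF s] U eig(2)[OF s]] wc[OF s] by simp
 qed
 have "pev M (q @ [1[E]]) U (\<phi> v) = pev M (q @ [1[E]]) U (\<Oplus>\<^bsub>M\<^esub>s\<in>S. R s (\<phi> v))" using sum by metis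
 also have "\<dots> = (\<Oplus>\<^bsub>M\<^esub>s\<in>S. pev M (q @ [1[E]]) U (R s (\<phi> v)))"
  using wc by (intro M.linear_op_finsum[OF M.linear_op_pev[OF U Q] S] Pi_I)
 also have "\<dots> = 0[M]" by (rule M.finsum_all_zero) (rule kill)
 finally have z: "pev M (q @ [1[E]]) U (\<phi> v) = 0[M]" .
 obtain l where l: "l \<in> functionals F E" "l 1[E] = 1[F]" by (rule unit_functional)
 have "pev A (map l q @ [1[F]]) T v = 0[A]"
  using slice_pev[OF l(1) T U TU Q v(1)] z l by simp
 moreover have "set (map l q) <= carrier F" using functionalsD(1)[OF l(1)] q(3) by auto
 moreover have "length (map l q) < length as" using q(2) ne by (simp add: cs_def)
 ultimately show False using least by blast
qed

end

section \<open>Coefficient lists with constant term first versus library polynomials\<close>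

lemma (in cring) eval_rev:
 "[|set as <= carrier R; y \<in>[R]|] ==> eval (rev as) y = sev R as y"
proof (induction as)
 case (Cons a as)
 then show ?case using eval_append_aux[of "rev as" a y] by (simp add: m_comm a_comm)
qed simp

text \<open>The offset k makes the induction work: the sum of (i + k) a_i y^i is k P(y) + y P'(y).
  With k = 1 and P the tail of b + X P this is the derivative of b + X P, as used in
  \<open>eval_poly_derivative\<close>.\<close>

lemma (in cring) sev_scaled_coefficients:
 assumes "set as <= carrier R" "y \<in>[R]"
 shows "sev R (map (\<lambda>i. add_pow R (i + k) (as ! i)) [0..<length as]) y = add_pow R k (sev R as y) \<oplus> y \<otimes> dv R as y"
 using assms(1)
proof (induction as arbitrary: k)
 case (Cons a as)
 have c: "a \<in>[R]" "sev R as y \<in>[R]" "dv R as y \<in>[R]" using Cons.prems assms(2) by auto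
 have "map (\<lambda>i. add_pow R (i + k) ((a # as) ! i)) [0..<length (a # as)] =
   (add_pow R k a) # map (\<lambda>i. add_pow R (i + Suc k) (as ! i)) [0..<length as]"
  by (simp add: upt_conv_Cons map_Suc_upt[symmetric] comp_def del: upt_Suc)
 then show ?case using Cons.IH[of "Suc k"] Cons.prems c assms(2)
  by (simp add: r_distr add_pow_rdistr add.nat_pow_distrib a_ac)
qed (use assms(2) in simp)

lemma (in cring) eval_poly_derivative:
 assumes "set as <= carrier R" "y \<in>[R]"
 shows "eval (poly_derivative R (rev as)) y = dv R as y"
proof (cases as)
 case Nil
 then show ?thesis by (simp add: poly_derivative_def)
next
 case (Cons b bs)
 have c: "b \<in>[R]" "set bs <= carrier R" using assms Cons by auto
 have "map (\<lambda>i. add_pow R i (coeff (rev as) i)) (rev [1..<length (rev as)]) = rev (map (\<lambda>i. add_pow R i (as ! i)) [1..<length as])"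
  by (auto simp: rev_map coeff_nth rev_nth)
 also have "map (\<lambda>i. add_pow R i (as ! i)) [1..<length as] = map (\<lambda>i. add_pow R (i + 1) (bs ! i)) [0..<length bs]"
  by (simp add: Cons map_Suc_upt[symmetric] comp_def del: upt_Suc)
 finally have e: "poly_derivative R (rev as) = normalize (rev (map (\<lambda>i. add_pow R (i + 1) (bs ! i)) [0..<length bs]))"
  by (simp add: poly_derivative_def)
 have "bs ! i \<in>[R]" if "i < length bs" for i using nth_mem[OF that] c by auto
 then have s: "set (map (\<lambda>i. add_pow R (i + 1) (bs ! i)) [0..<length bs]) <= carrier R" by auto
 show ?thesis
  unfolding e using eval_normalize[of "rev (map (\<lambda>i. add_pow R (i + 1) (bs ! i)) [0..<length bs])" y] s
   eval_rev[OF s assms(2)] sev_scaled_coefficients[OF c(2) assms(2), of 1] assms(2) c by (simp add: Cons)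
qed

lemma (in ring) poly_derivative_closed:
 assumes K: "subring K R" and p: "set p <= K"
 shows "poly_derivative R p \<in> carrier (K[X])"
proof -
 note S = subringE[OF K]
 have a: "add_pow R i x \<in> K" if "x \<in> K" for x and i :: nat
  using that S by (induction i) auto
 have "coeff p i \<in> K" if "i < length p" for i using coeff_nth[OF that] p that by (auto simp: subset_iff)
 then have "set (map (\<lambda>i. add_pow R i (coeff p i)) (rev [1..<length p])) <= K" using a by auto
 from normalize_gives_polynomial[OF this] show ?thesis by (simp add: poly_derivative_def univ_poly_carrier)
qed

lemma (in algebra) nonassoc_algebra: "nonassoc_algebra R M"
 by (intro nonassoc_algebra.intro module_axioms nonassoc_algebra_axioms.intro)
  (auto simp: l_distr r_distr smult_assoc2 smult_assoc2_right)

section \<open>Separability in terms of minimal relations\<close>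

locale extension_field = L: field L + F: field F + algebra F L
 for F :: "('f, 'm) ring_scheme" and L :: "('f, 'e) module"

sublocale extension_field \<subseteq> V: algebra_over_field F L
 by (intro algebra_over_field.intro nonassoc_algebra F.field_axioms)

context extension_field begin

abbreviation "k0 \<equiv> base_image F L"
abbreviation "emb r \<equiv> r .[L] 1[L]"

lemma subfield_base_image: "subfield k0 L"
proof (rule L.subfieldI')
 show "subring k0 L"
 proof (rule L.subringI)
  show "1[L] \<in> k0" by (auto simp: base_image_def intro!: image_eqI[of _ _ "1[F]"])
  fix x assume "x \<in> k0"
  then obtain r where r: "r \<in>[F]" "x = emb r" by (auto simp: base_image_def)
  then show "-[L] x \<in> k0" by (auto simp: base_image_def smult_l_minus intro!: image_eqI[of _ _ "-[F] r"])
  fix y assume "y \<in> k0"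
  then obtain s where s: "s \<in>[F]" "y = emb s" by (auto simp: base_image_def)
  show "x +[L] y \<in> k0" using r s by (auto simp: base_image_def smult_l_distr intro!: image_eqI[of _ _ "r +[F] s"])
  show "x *[L] y \<in> k0" using r s by (auto simp: base_image_def smult_assoc2 smult_assoc1 intro!: image_eqI[of _ _ "r *[F] s"])
 qed (auto simp: base_image_def)
 fix x assume "x \<in> k0 - {0[L]}"
 then obtain r where r: "r \<in>[F]" "x = emb r" and "x ~= 0[L]" by (auto simp: base_image_def)
 then have "r ~= 0[F]" by auto
 have i: "inv\<^bsub>F\<^esub> r \<in>[F]" "r *[F] inv\<^bsub>F\<^esub> r = 1[F]" using r(1) \<open>r ~= 0[F]\<close> F.field_Units by auto
 have "inv\<^bsub>L\<^esub> x = emb (inv\<^bsub>F\<^esub> r)"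
  using r i by (intro L.comm_inv_char) (simp_all add: smult_assoc2 flip: smult_assoc1)
 then show "inv\<^bsub>L\<^esub> x \<in> k0" using i(1) by (auto simp: base_image_def)
qed

lemma pev_sev:
 "[|set as <= carrier F; y \<in>[L]; v \<in>[L]|] ==> pev L as (mop L y) v = sev L (map emb as) y *[L] v"
proof (induction as arbitrary: v)
 case (Cons a as)
 have c: "set (map emb as) <= carrier L" "a \<in>[F]" using Cons.prems by auto
 show ?case using Cons c L.sev_closed[OF c(1) Cons.prems(2)]
  by (simp add: L.l_distr smult_assoc2 L.m_assoc L.m_lcomm)
qed simp

lemma dev_dv:
 "[|set as <= carrier F; y \<in>[L]; v \<in>[L]|] ==> dev L as (mop L y) v = dv L (map emb as) y *[L] v"
proof (induction as)
 case (Cons a as)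
 have c: "set (map emb as) <= carrier L" "set as <= carrier F" using Cons.prems by auto
 show ?case using Cons c L.sev_closed[OF c(1) Cons.prems(2)] L.dv_closed[OF c(1) Cons.prems(2)]
  by (simp add: pev_sev L.l_distr L.m_assoc)
qed simp

lemma monic_polynomial:
 assumes "set as <= carrier F" "y \<in>[L]"
 defines "p \<equiv> rev (map emb (as @ [1[F]]))"
 shows "p \<in> carrier (k0[X]\<^bsub>L\<^esub>)" "p ~= []" "length p = Suc (length as)" "L.eval p y = pev L (as @ [1[F]]) (mop L y) 1[L]"
  "L.eval (poly_derivative L p) y = dev L (as @ [1[F]]) (mop L y) 1[L]"
proof -
 have P: "set (as @ [1[F]]) <= carrier F" using assms(1) by simp
 then have s: "set (map emb (as @ [1[F]])) <= carrier L" by auto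
 have "1[L] \<in> k0" using imageI[of "1[F]" "carrier F" emb] by (simp add: base_image_def)
 then show "p \<in> carrier (k0[X]\<^bsub>L\<^esub>)" using assms(1) unfolding p_def univ_poly_carrier[symmetric] polynomial_def
  by (auto simp: base_image_def)
 show "L.eval p y = pev L (as @ [1[F]]) (mop L y) 1[L]"
  unfolding p_def pev_sev[OF P assms(2) L.one_closed] L.eval_rev[OF s assms(2)] using L.sev_closed[OF s assms(2)] by simp
 show "L.eval (poly_derivative L p) y = dev L (as @ [1[F]]) (mop L y) 1[L]"
  unfolding p_def dev_dv[OF P assms(2) L.one_closed] L.eval_poly_derivative[OF s assms(2)] using L.dv_closed[OF s assms(2)] by simp
qed (simp_all add: p_def)

text \<open>The coefficients of the monic polynomial \<open>Irr\<close> are pulled back from the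
  image of F. Minimality holds since \<open>Irr\<close> divides every relation, which bounds the
  degree from below.\<close>

lemma Irr_minimal_relation:
 assumes y: "y \<in>[L]" and alg: "L.algebraic k0 y"
 obtains as where "minimal_relation F L (mop L y) 1[L] as" "L.Irr k0 y = rev (map emb (as @ [1[F]]))"
proof -
 note k0 = subfield_base_image
 have alg': "(L.algebraic over k0) y" using alg by (simp add: over_def)
 note I = L.IrrE[OF k0 y alg']
 have ne: "L.Irr k0 y ~= []"
  using I(2) by (auto simp: ring_irreducible_def univ_poly_zero)
 obtain q where q: "L.Irr k0 y = 1[L] # q" using I(3) ne by (cases "L.Irr k0 y") auto
 have "set q <= emb ` carrier F" using I(1) unfolding univ_poly_carrier[symmetric] polynomial_def q by (auto simp: base_image_def)
 then have "q \<in> map emb ` lists (carrier F)" by (simp add: lists_image[symmetric] in_lists_conv_set subset_iff)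
 then obtain bs where bs: "q = map emb bs" "bs \<in> lists (carrier F)" by auto
 define as where "as = rev bs"
 have as: "set as <= carrier F" using bs(2) by (auto simp: as_def in_lists_conv_set)
 have e: "L.Irr k0 y = rev (map emb (as @ [1[F]]))" by (simp add: q bs as_def rev_map)
 have "minimal_relation F L (mop L y) 1[L] as"
  unfolding minimal_relation_def
 proof (intro conjI allI impI as notI)
  show "pev L (as @ [1[F]]) (mop L y) 1[L] = 0[L]" using monic_polynomial(4)[OF as y] I(4) e by simp
  fix cs assume c: "set cs <= carrier F \<and> length cs < length as" "pev L (cs @ [1[F]]) (mop L y) 1[L] = 0[L]"
  define p where "p = rev (map emb (cs @ [1[F]]))"
  note m = monic_polynomial[OF conjunct1[OF c(1)] y, folded p_def]
  have "L.Irr k0 y pdivides\<^bsub>L\<^esub> p" using L.Irr_minimal[OF k0 y alg' m(1)] m(4) c(2) by simp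
  from L.pdivides_imp_degree_le[OF subfieldE(1)[OF k0] I(1) m(1,2) this]
  show False using c(1) m(3) by (simp add: e)
 qed
 then show thesis using that e by blast
qed

text \<open>Evaluating a Bezout identity u P + v P' = 1 at the root y gives P'(y) nonzero.
  Conversely, if P'(y) is nonzero, its inverse in the field generated by y has the form v(y); then 1
  - v P' vanishes at y and is a multiple u P of P.\<close>

lemma separable_poly_Irr_iff:
 assumes y: "y \<in>[L]" and alg: "L.algebraic k0 y"
 shows "separable_poly L k0 (L.Irr k0 y) \<longleftrightarrow> L.eval (poly_derivative L (L.Irr k0 y)) y ~= 0[L]"
proof -
 note k0 = subfield_base_image
 have alg': "(L.algebraic over k0) y" using alg by (simp add: over_def)
 note I = L.IrrE[OF k0 y alg']
 define p where "p = L.Irr k0 y"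
 define d where "d = poly_derivative L p"
 note sr = subfieldE(1)[OF k0]
 interpret P: domain "k0[X]\<^bsub>L\<^esub>" by (rule L.univ_poly_is_domain[OF sr])
 interpret ev: ring_hom_ring "k0[X]\<^bsub>L\<^esub>" L "\<lambda>p. L.eval p y" by (rule L.eval_ring_hom[OF sr y])
 have pc: "p \<in> carrier (k0[X]\<^bsub>L\<^esub>)" "L.eval p y = 0[L]" using I by (simp_all add: p_def)
 then have "set p <= k0" unfolding univ_poly_carrier[symmetric] polynomial_def by auto
 then have dc: "d \<in> carrier (k0[X]\<^bsub>L\<^esub>)" unfolding d_def by (rule L.poly_derivative_closed[OF sr])
 show ?thesis unfolding p_def[symmetric] d_def[symmetric]
 proof
  assume "separable_poly L k0 p"
  then obtain u v where uv: "u \<in> carrier (k0[X]\<^bsub>L\<^esub>)" "v \<in> carrier (k0[X]\<^bsub>L\<^esub>)"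
   "u \<otimes>\<^bsub>k0[X]\<^bsub>L\<^esub>\<^esub> p \<oplus>\<^bsub>k0[X]\<^bsub>L\<^esub>\<^esub> v \<otimes>\<^bsub>k0[X]\<^bsub>L\<^esub>\<^esub> d = \<one>\<^bsub>k0[X]\<^bsub>L\<^esub>\<^esub>" unfolding separable_poly_def d_def by auto
  show "L.eval d y ~= 0[L]"
  proof
   assume z: "L.eval d y = 0[L]"
   have "L.eval (u \<otimes>\<^bsub>k0[X]\<^bsub>L\<^esub>\<^esub> p \<oplus>\<^bsub>k0[X]\<^bsub>L\<^esub>\<^esub> v \<otimes>\<^bsub>k0[X]\<^bsub>L\<^esub>\<^esub> d) y = 0[L]"
    using uv(1,2) pc dc z by simp
   then show False using uv(3) ev.hom_one by simp
  qed
 next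
  assume nz: "L.eval d y ~= 0[L]"
  define S where "S = L.simple_extension k0 y"
  have img: "S = (\<lambda>p. L.eval p y) ` carrier (k0[X]\<^bsub>L\<^esub>)" unfolding S_def by (rule L.simple_extension_as_eval_img[OF subfieldE(3)[OF k0] y])
  have "subfield S L" using L.simple_extension_is_subfield[OF k0 y] alg' by (simp add: S_def)
  then have "inv\<^bsub>L\<^esub> (L.eval d y) \<in> S" using L.subfield_m_inv(1)[of S "L.eval d y"] nz dc img by auto
  then obtain v where v: "v \<in> carrier (k0[X]\<^bsub>L\<^esub>)" "inv\<^bsub>L\<^esub> (L.eval d y) = L.eval v y" using img by auto
  have "L.eval v y *[L] L.eval d y = 1[L]" using L.field_Units nz dc v(2)[symmetric] by simp
  then have "L.eval (\<one>\<^bsub>k0[X]\<^bsub>L\<^esub>\<^esub> \<ominus>\<^bsub>k0[X]\<^bsub>L\<^esub>\<^esub> v \<otimes>\<^bsub>k0[X]\<^bsub>L\<^esub>\<^esub> d) y = 0[L]"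
   using v(1) dc ev.hom_one by (simp add: a_minus_def L.r_neg del: L.eval.simps)
  from L.Irr_minimal[OF k0 y alg' _ this] have "p divides\<^bsub>k0[X]\<^bsub>L\<^esub>\<^esub> (\<one>\<^bsub>k0[X]\<^bsub>L\<^esub>\<^esub> \<ominus>\<^bsub>k0[X]\<^bsub>L\<^esub>\<^esub> v \<otimes>\<^bsub>k0[X]\<^bsub>L\<^esub>\<^esub> d)"
   using L.pdivides_iff_shell[OF k0 pc(1)] v(1) dc by (simp add: p_def)
  then obtain u where u: "u \<in> carrier (k0[X]\<^bsub>L\<^esub>)" "\<one>\<^bsub>k0[X]\<^bsub>L\<^esub>\<^esub> \<ominus>\<^bsub>k0[X]\<^bsub>L\<^esub>\<^esub> v \<otimes>\<^bsub>k0[X]\<^bsub>L\<^esub>\<^esub> d = p \<otimes>\<^bsub>k0[X]\<^bsub>L\<^esub>\<^esub> u"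
   by (auto simp: factor_def)
  have "u \<otimes>\<^bsub>k0[X]\<^bsub>L\<^esub>\<^esub> p \<oplus>\<^bsub>k0[X]\<^bsub>L\<^esub>\<^esub> v \<otimes>\<^bsub>k0[X]\<^bsub>L\<^esub>\<^esub> d = v \<otimes>\<^bsub>k0[X]\<^bsub>L\<^esub>\<^esub> d \<oplus>\<^bsub>k0[X]\<^bsub>L\<^esub>\<^esub> (\<one>\<^bsub>k0[X]\<^bsub>L\<^esub>\<^esub> \<ominus>\<^bsub>k0[X]\<^bsub>L\<^esub>\<^esub> v \<otimes>\<^bsub>k0[X]\<^bsub>L\<^esub>\<^esub> d)"
   unfolding u(2) using u(1) v(1) pc(1) dc by (simp add: P.m_comm P.a_comm)
  also have "\<dots> = \<one>\<^bsub>k0[X]\<^bsub>L\<^esub>\<^esub>" using v(1) dc by (intro P.a_add_minus_cancel) simp_all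
  finally show "separable_poly L k0 p" unfolding separable_poly_def d_def using u(1) v(1) by auto
 qed
qed

text \<open>Replaces irreducible polynomials and Bezout identities by relations of the
  multiplication operator; this is the form in which separability is proved
  (\<open>separable_factor\<close>, \<open>separable_Es\<close>).\<close>

lemma separable_extensionI:
 assumes ex: "!!y. y \<in>[L] ==> \<exists>as. set as <= carrier F \<and> pev L (as @ [1[F]]) (mop L y) 1[L] = 0[L]"
  and sep: "!!y as. [|y \<in>[L]; minimal_relation F L (mop L y) 1[L] as|] ==> dev L (as @ [1[F]]) (mop L y) 1[L] ~= 0[L]"
 shows "separable_extension F L"
 unfolding separable_extension_def
proof (intro conjI ballI F.field_axioms L.field_axioms algebra_axioms)
 fix y assume y: "y \<in>[L]"
 obtain as where as: "set as <= carrier F" "pev L (as @ [1[F]]) (mop L y) 1[L] = 0[L]" using ex[OF y] by auto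
 show alg: "L.algebraic k0 y"
  using L.algebraicI[OF monic_polynomial(1,2)[OF as(1) y]] monic_polynomial(4)[OF as(1) y] as(2) by (simp add: over_def)
 obtain bs where bs: "minimal_relation F L (mop L y) 1[L] bs" "L.Irr k0 y = rev (map emb (bs @ [1[F]]))"
  by (rule Irr_minimal_relation[OF y alg])
 then show "separable_poly L k0 (L.Irr k0 y)"
  using separable_poly_Irr_iff[OF y alg] sep[OF y bs(1)] monic_polynomial(5)[of bs, OF _ y] by (simp add: minimal_relation_def)
qed

lemma separable_extensionE:
 assumes "separable_extension F L" "y \<in>[L]"
 obtains as where "minimal_relation F L (mop L y) 1[L] as" "dev L (as @ [1[F]]) (mop L y) 1[L] ~= 0[L]"
proof -
 have alg: "L.algebraic k0 y" and s: "separable_poly L k0 (L.Irr k0 y)" using assms unfolding separable_extension_def by auto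
 obtain bs where bs: "minimal_relation F L (mop L y) 1[L] bs" "L.Irr k0 y = rev (map emb (bs @ [1[F]]))"
  by (rule Irr_minimal_relation[OF assms(2) alg])
 then show thesis
  using that[OF bs(1)] separable_poly_Irr_iff[OF assms(2) alg] s monic_polynomial(5)[of bs, OF _ assms(2)] by (simp add: minimal_relation_def)
qed

end

section \<open>Split subalgebras are \'etale\<close>

context algebra_over_field begin

definition primitive :: "'a set => 'a => bool" where
 "primitive R g \<longleftrightarrow> g \<in> R \<and> g *[A] g = g \<and> g ~= 0[A] \<and>
  (\<forall>f\<in>R. f *[A] f = f \<and> f ~= 0[A] \<and> g *[A] f = f --> f = g)"

definition idem_factor :: "'a set => 'a => 'a set" where
 "idem_factor R g = {x \<in> R. g *[A] x = x}"

lemma submodule_factor: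
 assumes R: "submodule R F A" "R <= nucleus A" and g: "g \<in> R" shows "submodule (idem_factor R g) F A"
proof -
 have "x \<in>[A]" if "x \<in> R" for x using submoduleD(1)[OF R(1)] that by auto
 then show ?thesis using submoduleD(2-5)[OF R(1)] g
  by (intro submoduleI) (auto simp: idem_factor_def distrib_left mult_smult mult_neg)
qed

text \<open>Below any nonzero idempotent h choose f with minimal ideal fR; an idempotent below f
  with the same ideal equals f, so f is primitive.\<close>

lemma primitive_system_exists:
 assumes fd: "finite_dimensional F A" and R: "submodule R F A" "R <= nucleus A" "1[A] \<in> R"
  and comm: "!!x y. [|x \<in> R; y \<in> R|] ==> x *[A] y = y *[A] x"
 obtains G where "idempotent_system G" "G <= R" "!!g. g \<in> G ==> primitive R g"
proof -
 have Rn: "x \<in> nucleus A" and Rc: "x \<in>[A]" if "x \<in> R" for x using R(2) nucleus_closed that by auto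
 have dom: "\<exists>g\<in>R. primitive R g \<and> g *[A] g = g \<and> g ~= 0[A] \<and> h *[A] g = g \<and> g *[A] h = g"
  if h: "h \<in> R" "h *[A] h = h" "h ~= 0[A]" for h
 proof -
  define P where "P N \<longleftrightarrow> (\<exists>f\<in>R. f *[A] f = f \<and> f ~= 0[A] \<and> h *[A] f = f \<and> N = idem_factor R f)" for N
  have "P (idem_factor R h)" using h by (auto simp: P_def)
  moreover have "submodule N F A" if "P N" for N using that submodule_factor[OF R(1,2)] by (auto simp: P_def)
  ultimately obtain N where N: "P N" "!!N'. [|P N'; N' <= N|] ==> N' = N"
   using minimal_submodule[OF fd, of P] by metis
  then obtain g where g: "g \<in> R" "g *[A] g = g" "g ~= 0[A]" "h *[A] g = g" "N = idem_factor R g" unfolding P_def by auto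
  have "f = g" if f: "f \<in> R" "f *[A] f = f" "f ~= 0[A]" "g *[A] f = f" for f
  proof -
   have hf: "h *[A] f = f"
    using nucleus_assoc(1)[OF Rn[OF h(1)] Rc[OF g(1)] Rc[OF f(1)]] g(4) f(4) by simp
   have "idem_factor R f <= idem_factor R g"
   proof
    fix x assume "x \<in> idem_factor R f"
    then have x: "x \<in> R" "f *[A] x = x" by (auto simp: idem_factor_def)
    then show "x \<in> idem_factor R g"
     using nucleus_assoc(1)[OF Rn[OF g(1)] Rc[OF f(1)] Rc[OF x(1)]] f(4) by (simp add: idem_factor_def)
   qed
   then have "idem_factor R f = idem_factor R g" using N(2)[of "idem_factor R f"] f hf g(5) by (auto simp: P_def)
   then have "g \<in> idem_factor R f" using g by (simp add: idem_factor_def)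
   then show ?thesis using comm[OF f(1) g(1)] f(4) by (simp add: idem_factor_def)
  qed
  then have "primitive R g" using g by (auto simp: primitive_def)
  then show ?thesis using comm[OF h(1) g(1)] g by (intro bexI[of _ g]) auto
 qed
 show thesis
  by (rule idempotent_system_exists[OF fd R, of "primitive R"], rule dom, assumption+, rule that) simp_all
qed

end

context split_algebra begin

text \<open>Over E the element x is diagonal with entries \<chi>_h(x), so inverting the nonzero
  entries gives z in \<open>ext K\<close> with x x z = x. Slicing with a functional normalized by
  l(1) = 1 moves z into K without changing the equation.\<close>

lemma K_regular:
 assumes x: "x \<in> K" obtains y where "y \<in> K" "(x *[A] x) *[A] y = x"
proof -
 \<comment> \<open>A vanishing entry keeps the value 0, so z is the pseudo-inverse of x.\<close>
 define c where "c h = (if chi h x = 0[E] then 0[E] else inv\<^bsub>E\<^esub> chi h x)" for h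
 define z where "z = (\<Oplus>\<^bsub>M\<^esub>h\<in>H. c h .[M] h)"
 have c: "c h \<in>[E]" "(chi h x *[E] chi h x) *[E] c h = chi h x" if "h \<in> H" for h
 proof -
  note k = chi(1)[OF that x]
  have "inv\<^bsub>E\<^esub> chi h x \<in>[E] \<and> chi h x *[E] inv\<^bsub>E\<^esub> chi h x = 1[E]" if "chi h x ~= 0[E]"
   using M.field_Units that k by auto
  then show "c h \<in>[E]" "(chi h x *[E] chi h x) *[E] c h = chi h x" using k by (auto simp: c_def M.R.m_assoc)
 qed
 note SK = submodule_ext[OF K_sub]
 have z: "z \<in> ext K" unfolding z_def
  using c M.submoduleD(4)[OF SK] H_ext by (intro M.finsum_in_submodule[OF SK HD(1)] Pi_I) auto
 note xc = Kc[OF x] and zc = ext_closed[OF z]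
 have xn: "\<phi> x \<in> nucleus M" using ext_K_nucleus phi_ext_iff[OF K_sub xc] x by auto
 have "\<phi> (x *[A] x) *[M] z = \<phi> x"
 proof (rule M.idempotent_system_ext(2)[OF H_sys])
  fix h assume h: "h \<in> H"
  have "z *[M] h = (\<Oplus>\<^bsub>M\<^esub>h'\<in>H. (c h' .[M] h') *[M] h)"
   unfolding z_def using c HD(3) h by (intro M.finsum_mult_right[OF HD(1)] Pi_I) auto
  also have "\<dots> = (\<Oplus>\<^bsub>M\<^esub>h'\<in>H. if h = h' then c h' .[M] h' else 0[M])"
   using c HD(3) HD(5) HD(6) h by (intro M.M.finsum_cong' HOL.refl Pi_I) (auto simp: M.smult_mult)
  also have "\<dots> = c h .[M] h" using c HD(3) h by (intro M.M.finsum_singleton[OF _ HD(1)] Pi_I) auto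
  finally have zh: "z *[M] h = c h .[M] h" .
  have "(\<phi> (x *[A] x) *[M] z) *[M] h = \<phi> x *[M] (\<phi> x *[M] (z *[M] h))"
   using xn xc zc HD(3)[OF h] by (simp add: phi_mult M.nucleus_assoc M.nucleus_mult)
  also have "\<dots> = ((chi h x *[E] chi h x) *[E] c h) .[M] h"
   using chi[OF h x] c(1)[OF h] xc HD(3)[OF h] by (simp add: zh M.mult_smult M.R.m_ac flip: M.smult_assoc1)
  finally show "(\<phi> (x *[A] x) *[M] z) *[M] h = \<phi> x *[M] h" using c(2)[OF h] chi(2)[OF h x] by simp
 qed (use xc zc in simp_all)
 moreover obtain l where l: "l \<in> functionals F E" "l 1[E] = 1[F]" by (rule unit_functional)
 ultimately have "(x *[A] x) *[A] slice l z = x"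
  using slice_mult_phi(2)[OF l(1) zc, of "x *[A] x"] slice_phi_one[OF l(1) xc] xc l(2) by simp
 moreover have "slice l z \<in> K" using z l(1) by (simp add: ext_def)
 ultimately show thesis using that by blast
qed

abbreviation "primitive \<equiv> A.primitive K"
abbreviation "idem_factor \<equiv> A.idem_factor K"

lemmas submodule_factor = A.submodule_factor[OF K_sub K_nuc]

abbreviation "LA g \<equiv> A\<lparr>carrier := idem_factor g, one := g\<rparr>"

lemma algebra_factor:
 assumes g: "g \<in> K" "g *[A] g = g" shows "algebra F (LA g)"
proof -
 interpret KM: module F "A\<lparr>carrier := idem_factor g\<rparr>"
  by (rule submodule.submodule_is_module[OF submodule_factor[OF g(1)] A.module_axioms])
 have f: "x \<in> K" "g *[A] x = x" "x \<in>[A]" "x \<in> nucleus A" if "x \<in> idem_factor g" for x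
  using that Kc Kn by (auto simp: A.idem_factor_def)
 have gc: "g \<in> idem_factor g" using g by (simp add: A.idem_factor_def)
 have m: "x *[A] y \<in> idem_factor g" if xy: "x \<in> idem_factor g" "y \<in> idem_factor g" for x y
  using K_mult[OF f(1)[OF xy(1)] f(1)[OF xy(2)]] A.nucleus_assoc(1)[OF Kn[OF g(1)] f(3)[OF xy(1)] f(3)[OF xy(2)]] f(2)[OF xy(1)]
  by (simp add: A.idem_factor_def)
 have "cring (LA g)"
 proof (rule cringI)
  show "abelian_group (LA g)"
  proof (rule abelian_groupI)
   note D = A.submoduleD[OF submodule_factor[OF g(1)]]
   show "\<exists>y\<in>carrier (LA g). y +[LA g] x = 0[LA g]" if "x \<in> carrier (LA g)" for x
    using D(5) f(3) that A.M.l_neg by (intro bexI[of _ "-[A] x"]) auto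
  qed (use A.submoduleD(2,3)[OF submodule_factor[OF g(1)]] f(3) in \<open>auto simp: A.M.a_ac\<close>)
  show "comm_monoid (LA g)"
  proof (rule comm_monoidI)
   show "x *[LA g] y = y *[LA g] x" if "x \<in> carrier (LA g)" "y \<in> carrier (LA g)" for x y
    using K_comm f(1) that by simp
  qed (use m gc f A.nucleus_assoc in simp_all)
 qed (use f A.distrib_right in simp)
 then show ?thesis
 proof (intro algebra.intro module.intro algebra_axioms.intro module_axioms.intro A.R.cring_axioms cring.axioms(1))
  show "abelian_group (LA g)" if "cring (LA g)" using that by (simp add: cring_def ring_def)
 qed (use KM.smult_closed KM.smult_l_distr KM.smult_r_distr KM.smult_assoc1 f A.smult_mult in simp_all)
qed

text \<open>For nonzero x in gK regularity gives y with x x y = x. Then x y is a nonzero idempotent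
  below g, hence equal to g by primitivity, and g y is the inverse of x.\<close>

lemma field_factor:
 assumes g: "primitive g" shows "field (LA g)"
proof -
 have gK: "g \<in> K" "g *[A] g = g" "g ~= 0[A]" using g by (auto simp: A.primitive_def)
 interpret L: algebra F "LA g" by (rule algebra_factor[OF gK(1,2)])
 have gc: "g \<in> idem_factor g" using gK by (simp add: A.idem_factor_def)
 have inv: "\<exists>y\<in>idem_factor g. x *[A] y = g" if x: "x \<in> idem_factor g" "x ~= 0[A]" for x
 proof -
  have xK: "x \<in> K" "g *[A] x = x" using x by (auto simp: A.idem_factor_def)
  obtain y where y: "y \<in> K" "(x *[A] x) *[A] y = x" by (rule K_regular[OF xK(1)])
  note n = Kn[OF xK(1)] Kn[OF y(1)] Kn[OF gK(1)] and c = Kc[OF xK(1)] Kc[OF y(1)] Kc[OF gK(1)]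
  define f where "f = x *[A] y"
  have fx: "f *[A] x = x" unfolding f_def using y(2) K_comm[OF y(1) xK(1)] n c by (simp add: A.nucleus_assoc)
  have fK: "f \<in> K" using K_mult xK y by (simp add: f_def)
  have "f *[A] f = (f *[A] x) *[A] y" using A.nucleus_assoc(1)[OF Kn[OF fK] c(1,2)] by (simp add: f_def)
  then have ff: "f *[A] f = f" by (simp add: fx) (simp add: f_def)
  have "f ~= 0[A]" using fx x(2) c by auto
  moreover have "g *[A] f = f" using A.nucleus_assoc(1)[OF n(3) c(1,2)] xK(2) by (simp add: f_def)
  ultimately have fg: "f = g" using g fK ff by (auto simp: A.primitive_def)
  have "g *[A] y \<in> idem_factor g"
   using K_mult[OF gK(1) y(1)] A.nucleus_assoc(1)[OF n(3) c(3,2)] gK(2) by (simp add: A.idem_factor_def)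
  moreover have "x *[A] (g *[A] y) = g"
   using A.nucleus_assoc(1)[OF n(1) c(3,2)] K_comm[OF xK(1) gK(1)] xK(2) fg by (simp add: f_def)
  ultimately show ?thesis by auto
 qed
 show ?thesis
 proof (rule L.cring_fieldI, rule equalityI)
  show "Units (LA g) <= carrier (LA g) - {0[LA g]}"
   using L.Units_closed L.Units_r_inv L.Units_inv_closed gK Kc by (force simp: Units_def A.idem_factor_def)
  show "carrier (LA g) - {0[LA g]} <= Units (LA g)"
  proof
   fix x assume "x \<in> carrier (LA g) - {0[LA g]}"
   then have x: "x \<in> idem_factor g" "x ~= 0[A]" by auto
   obtain y where y: "y \<in> idem_factor g" "x *[A] y = g" using inv[OF x] by auto
   then have "y *[A] x = g" using x K_comm[of x y] by (auto simp: A.idem_factor_def)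
   then show "x \<in> Units (LA g)" using x y by (auto simp: Units_def)
  qed
 qed
qed

lemma finite_dimensional_factor:
 assumes fd: "finite_dimensional F A" and g: "g \<in> K" shows "finite_dimensional F (LA g)"
proof -
 have "finsum (LA g) f S = finsum (A\<lparr>carrier := idem_factor g\<rparr>) f S" for f :: "'a => 'a" and S by (simp add: finsum_def)
 then show ?thesis using A.finite_dimensional_submodule[OF fd submodule_factor[OF g]] by (simp add: finite_dimensional_def)
qed

text \<open>In M the unit g of the factor is the sum of the vectors \<phi>(g) h, each of which is an
  eigenvector of \<phi>(y) or zero. So \<open>separable_relation\<close> applies, with components
  obtained by right multiplication by h.\<close>

lemma separable_factor:
 assumes fd: "finite_dimensional F A" and g: "primitive g" shows "separable_extension F (LA g)"
proof -
 have gK: "g \<in> K" "g *[A] g = g" "g ~= 0[A]" using g by (auto simp: A.primitive_def)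
 interpret L: extension_field F "LA g"
  by (intro extension_field.intro field_factor[OF g] A.field_axioms algebra_factor[OF gK(1,2)])
 show ?thesis
 proof (rule L.separable_extensionI)
  fix y assume y: "y \<in> carrier (LA g)"
  obtain as where "set as <= carrier F" "pev (LA g) (as @ [1[F]]) ((\<otimes>\<^bsub>LA g\<^esub>) y) 1[LA g] = 0[LA g]"
   by (rule L.V.relation_exists[OF finite_dimensional_factor[OF fd gK(1)] L.V.linear_op_left[OF y] L.L.one_closed])
  then show "\<exists>as. set as <= carrier F \<and> pev (LA g) (as @ [1[F]]) ((\<otimes>\<^bsub>LA g\<^esub>) y) 1[LA g] = 0[LA g]" by blast
 next
  fix y as assume "y \<in> carrier (LA g)" and min: "minimal_relation F (LA g) ((\<otimes>\<^bsub>LA g\<^esub>) y) 1[LA g] as"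
  then have y: "y \<in> K" "g *[A] y = y" by (auto simp: A.idem_factor_def)
  have p: "pev (LA g) bs T v = pev A bs T v" for bs T v by (induction bs arbitrary: v) simp_all
  have d: "dev (LA g) bs T v = dev A bs T v" for bs T v by (induction bs) (simp_all add: p)
  have min': "minimal_relation F A (mop A y) g as" using min by (simp add: minimal_relation_def p)
  have yn: "\<phi> y \<in> nucleus M" using ext_K_nucleus phi_ext_iff[OF K_sub Kc[OF y(1)]] y by auto
  have "dev A (as @ [1[F]]) (mop A y) g ~= 0[A]"
  proof (rule separable_relation[OF A.linear_op_left[OF Kc[OF y(1)]] M.linear_op_left[OF phi_closed[OF Kc[OF y(1)]]] _ Kc[OF gK(1)] gK(3) min' HD(1),
     where R = "\<lambda>h z. z *[M] h" and \<chi> = "\<lambda>h. chi h y"])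
   show "\<phi> g = (\<Oplus>\<^bsub>M\<^esub>h\<in>H. \<phi> g *[M] h)" using M.idempotent_system_sum(2)[OF H_sys phi_closed[OF Kc[OF gK(1)]]] by simp
   fix h assume h: "h \<in> H"
   show "linear_op E M (\<lambda>z. z *[M] h)" by (rule M.linear_op_right[OF HD(3)[OF h]])
   show "\<phi> y *[M] (z *[M] h) = (\<phi> y *[M] z) *[M] h" if "z \<in>[M]" for z
    using A.nucleus_assoc M.nucleus_assoc(1)[OF yn that HD(3)[OF h]] by simp
   show "\<phi> y *[M] (\<phi> g *[M] h) = chi h y .[M] (\<phi> g *[M] h)"
    using chi[OF h y(1)] chi[OF h gK(1)] HD(3)[OF h] Kc[OF y(1)] by (simp add: M.mult_smult M.R.m_comm flip: M.smult_assoc1)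
   show "chi h y \<in>[E]" by (rule chi(1)[OF h y(1)])
  qed (use Kc[OF y(1)] in \<open>simp add: phi_mult\<close>)
  then show "dev (LA g) (as @ [1[F]]) ((\<otimes>\<^bsub>LA g\<^esub>) y) 1[LA g] ~= 0[LA g]" by (simp add: d)
 qed
qed

text \<open>The Peirce decomposition of K along its primitive idempotents e_i is a product of the
  fields e_i K.\<close>

theorem etale_K:
 assumes fd: "finite_dimensional F A" shows "etale_algebra F KA"
proof -
 obtain G where G: "A.idempotent_system G" "G <= K" "!!g. g \<in> G ==> primitive g"
  by (rule A.primitive_system_exists[OF fd K_sub K_nuc K_one K_comm]) (assumption | rule that)+
 note GD = A.idempotent_systemD[OF G(1)]
 obtain e where e: "bij_betw e {0..<card G} G" using ex_bij_betw_nat_finite[OF GD(1)] by blast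
 define r where "r = card G"
 have eG: "e i \<in> G" if "i < r" for i using e that by (auto simp: bij_betw_def r_def)
 have eK: "e i \<in> K" "e i \<in>[A]" "e i \<in> nucleus A" if "i < r" for i using eG[OF that] G(2) Kc Kn by auto
 have ee: "e i *[A] e j = (if i = j then e i else 0[A])" if "i < r" "j < r" for i j
  using GD(5)[OF eG[OF that(1)]] GD(6)[OF eG[OF that(1)] eG[OF that(2)]] that
   inj_on_eq_iff[OF bij_betw_imp_inj_on[OF e], of i j] by (auto simp: r_def)
 have Ge: "g \<in> G ==> \<exists>i<r. g = e i" for g using e by (force simp: bij_betw_def r_def)
 define L where "L i = LA (e i)" for i
 define \<theta> where "\<theta> k = (\<lambda>i\<in>{..<r}. e i *[A] k)" for k
 have in_factor: "e i *[A] k \<in> idem_factor (e i)" if "i < r" "k \<in> K" for i k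
  using K_mult[OF eK(1)[OF that(1)] that(2)] A.nucleus_assoc(1)[OF eK(3)[OF that(1)] eK(2)[OF that(1)] Kc[OF that(2)]] ee[OF that(1,1)]
  by (simp add: A.idem_factor_def)
 have "\<theta> \<in> algebra_isos F KA (product_algebra {..<r} L)"
  unfolding algebra_isos_def
 proof (intro CollectI conjI ballI)
  show "bij_betw \<theta> (carrier KA) (carrier (product_algebra {..<r} L))"
  proof (rule bij_betw_imageI)
   show "inj_on \<theta> (carrier KA)"
   proof (rule inj_onI)
    fix x y assume xy: "x \<in>[KA]" "y \<in>[KA]" and eq: "\<theta> x = \<theta> y"
    have "e i *[A] x = e i *[A] y" if "i < r" for i using fun_cong[OF eq, of i] that by (simp add: \<theta>_def)
    then have "g *[A] x = g *[A] y" if "g \<in> G" for g using Ge[OF that] by auto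
    then show "x = y" using A.idempotent_system_ext(1)[OF G(1)] xy Kc by simp
   qed
   show "\<theta> ` carrier KA = carrier (product_algebra {..<r} L)"
   proof (rule equalityI)
    show "\<theta> ` carrier KA <= carrier (product_algebra {..<r} L)"
     using in_factor by (auto simp: \<theta>_def product_algebra_def L_def split: if_splits)
    show "carrier (product_algebra {..<r} L) <= \<theta> ` carrier KA"
    proof
     fix x assume x: "x \<in> carrier (product_algebra {..<r} L)"
     have xi: "x i \<in> K" "e i *[A] x i = x i" if "i < r" for i
      using x that by (auto simp: product_algebra_def L_def A.idem_factor_def PiE_iff)
     define k where "k = (\<Oplus>\<^bsub>A\<^esub>i\<in>{..<r}. x i)"
     have k: "k \<in> K" unfolding k_def using xi by (intro A.finsum_in_submodule[OF K_sub] Pi_I) auto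
     have "e j *[A] k = x j" if j: "j < r" for j
     proof -
      have "e j *[A] k = (\<Oplus>\<^bsub>A\<^esub>i\<in>{..<r}. e j *[A] x i)"
       unfolding k_def using xi Kc eK j by (intro A.finsum_mult_left Pi_I) auto
      also have "\<dots> = (\<Oplus>\<^bsub>A\<^esub>i\<in>{..<r}. if j = i then x i else 0[A])"
      proof (intro A.M.finsum_cong' HOL.refl Pi_I)
       fix i assume "i \<in> {..<r}"
       then have i: "i < r" by simp
       have "e j *[A] x i = (e j *[A] e i) *[A] x i"
        using A.nucleus_assoc(1)[OF eK(3)[OF j] eK(2)[OF i] Kc[OF xi(1)[OF i]]] xi(2)[OF i] by simp
       then show "e j *[A] x i = (if j = i then x i else 0[A])"
        using ee[OF j i] xi[OF i] Kc[OF xi(1)[OF i]] by auto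
      qed (use xi Kc in auto)
      also have "\<dots> = x j" using xi Kc j by (intro A.M.finsum_singleton Pi_I) auto
      finally show ?thesis .
     qed
     then have "\<theta> k = x" using x by (auto simp: \<theta>_def product_algebra_def PiE_iff extensional_def)
     then show "x \<in> \<theta> ` carrier KA" using k by auto
    qed
   qed
  qed
  show "\<theta> 1[KA] = 1[product_algebra {..<r} L]" using eK by (auto simp: \<theta>_def product_algebra_def L_def)
  fix x y assume "x \<in>[KA]" "y \<in>[KA]"
  then have xy: "x \<in> K" "y \<in> K" by simp_all
  show "\<theta> (x +[KA] y) = \<theta> x +[product_algebra {..<r} L] \<theta> y"
   using eK xy Kc by (auto simp: \<theta>_def product_algebra_def L_def A.distrib_left)
  have "e i *[A] (x *[A] y) = (e i *[A] x) *[A] (e i *[A] y)" if i: "i < r" for i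
  proof -
   note n = Kn[OF xy(1)] Kn[OF xy(2)] eK(3)[OF i] and c = Kc[OF xy(1)] Kc[OF xy(2)] eK(2)[OF i]
   have "(e i *[A] x) *[A] (e i *[A] y) = (x *[A] e i) *[A] (e i *[A] y)" using K_comm[OF eK(1)[OF i] xy(1)] by simp
   also have "\<dots> = x *[A] ((e i *[A] e i) *[A] y)" using n c by (simp add: A.nucleus_assoc A.nucleus_mult)
   also have "\<dots> = (x *[A] e i) *[A] y" using ee[OF i i] n c by (simp add: A.nucleus_assoc)
   also have "\<dots> = e i *[A] (x *[A] y)" using K_comm[OF eK(1)[OF i] xy(1)] A.nucleus_assoc(1)[OF n(3) c(1,2)] by simp
   finally show ?thesis by simp
  qed
  then show "\<theta> (x *[KA] y) = \<theta> x *[product_algebra {..<r} L] \<theta> y"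
   by (auto simp: \<theta>_def product_algebra_def L_def)
 next
  fix c x assume "c \<in>[F]" "x \<in>[KA]"
  then show "\<theta> (c .[KA] x) = c .[product_algebra {..<r} L] \<theta> x"
   using eK Kc by (auto simp: \<theta>_def product_algebra_def L_def A.mult_smult)
 qed
 then have "algebra_isomorphic F KA (product_algebra {..<r} L)" by (auto simp: algebra_isomorphic_def)
 moreover have "separable_extension F (L i) \<and> finite_dimensional F (L i)" if "i < r" for i
  using separable_factor[OF fd G(3)[OF eG[OF that]]] finite_dimensional_factor[OF fd eK(1)[OF that]] by (simp add: L_def)
 ultimately show ?thesis unfolding etale_algebra_def by blast
qed

end

section \<open>Forms of skew matrix algebras are semiassociative\<close>

text \<open>Generation can be tested on submodules instead of coefficient families. Together with
  \<open>finite_dimensionalE\<close> this makes transfer along \<phi> and \<open>ext\<close> a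
  matter of inclusions.\<close>

lemma (in vspace) finite_dimensionalI:
 assumes S: "finite S" "S <= carrier V" and gen: "!!N. [|submodule N F V; S <= N|] ==> carrier V <= N"
 shows "finite_dimensional F V"
proof -
 define N where "N = {(\<Oplus>\<^bsub>V\<^esub>s\<in>S. a s .[V] s) |a. a \<in> S \<rightarrow> carrier F}"
 have c: "(\<lambda>s. a s .[V] s) \<in> S \<rightarrow> carrier V" if "a \<in> S \<rightarrow> carrier F" for a using that S(2) by auto
 have add: "(\<Oplus>\<^bsub>V\<^esub>s\<in>S. a s .[V] s) +[V] (\<Oplus>\<^bsub>V\<^esub>s\<in>S. b s .[V] s) = (\<Oplus>\<^bsub>V\<^esub>s\<in>S. (a s \<oplus> b s) .[V] s)"
  if ab: "a \<in> S \<rightarrow> carrier F" "b \<in> S \<rightarrow> carrier F" for a b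
 proof -
  have "(\<Oplus>\<^bsub>V\<^esub>s\<in>S. a s .[V] s) +[V] (\<Oplus>\<^bsub>V\<^esub>s\<in>S. b s .[V] s) = (\<Oplus>\<^bsub>V\<^esub>s\<in>S. a s .[V] s +[V] b s .[V] s)"
   by (rule M.finsum_addf[OF c[OF ab(1)] c[OF ab(2)], symmetric])
  also have "\<dots> = (\<Oplus>\<^bsub>V\<^esub>s\<in>S. (a s \<oplus> b s) .[V] s)"
   using ab S(2) by (intro M.finsum_cong' HOL.refl Pi_I) (auto simp: smult_l_distr Pi_iff subset_iff)
  finally show ?thesis .
 qed
 have sm: "r .[V] (\<Oplus>\<^bsub>V\<^esub>s\<in>S. a s .[V] s) = (\<Oplus>\<^bsub>V\<^esub>s\<in>S. (r \<otimes> a s) .[V] s)" if a: "a \<in> S \<rightarrow> carrier F" and r: "r \<in>[F]" for a r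
 proof -
  have "linear_op F V (\<lambda>v. r .[V] v)"
   using r by (simp add: linear_op_def smult_r_distr m_comm flip: smult_assoc1)
  from linear_op_finsum[OF this S(1) c[OF a]]
  have "r .[V] (\<Oplus>\<^bsub>V\<^esub>s\<in>S. a s .[V] s) = (\<Oplus>\<^bsub>V\<^esub>s\<in>S. r .[V] (a s .[V] s))" .
  also have "\<dots> = (\<Oplus>\<^bsub>V\<^esub>s\<in>S. (r \<otimes> a s) .[V] s)"
   using a r S(2) by (intro M.finsum_cong' HOL.refl Pi_I) (auto simp: smult_assoc1 Pi_iff subset_iff)
  finally show ?thesis .
 qed
 have cl: "N <= carrier V" using c by (auto simp: N_def)
 have NI: "(\<Oplus>\<^bsub>V\<^esub>s\<in>S. a s .[V] s) \<in> N" if "a \<in> S \<rightarrow> carrier F" for a unfolding N_def using that by (intro CollectI exI[of _ a]) simp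
 have NE: thesis if "x \<in> N" "!!a. [|a \<in> S \<rightarrow> carrier F; x = (\<Oplus>\<^bsub>V\<^esub>s\<in>S. a s .[V] s)|] ==> thesis" for x thesis
  using that(1) unfolding N_def by (elim CollectE exE conjE) (rule that(2))
 have smN: "r .[V] x \<in> N" if rx: "r \<in>[F]" "x \<in> N" for r x
 proof -
  obtain a where a: "a \<in> S \<rightarrow> carrier F" "x = (\<Oplus>\<^bsub>V\<^esub>s\<in>S. a s .[V] s)" using NE[OF rx(2)] .
  show ?thesis unfolding a(2) sm[OF a(1) rx(1)] by (rule NI) (use a(1) rx(1) in auto)
 qed
 have z: "0[V] \<in> N"
 proof -
  have "(\<Oplus>\<^bsub>V\<^esub>s\<in>S. \<zero> .[V] s) = (\<Oplus>\<^bsub>V\<^esub>s\<in>S. 0[V])" using S(2) by (intro M.finsum_cong' HOL.refl Pi_I) (auto simp: subset_iff)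
  then show ?thesis using NI[of "\<lambda>_. \<zero>"] by simp
 qed
 have N: "submodule N F V"
 proof (rule submoduleI[OF cl z])
  fix x assume x: "x \<in> N"
  then have "-[V] x = (\<ominus> \<one>) .[V] x" using cl by (simp add: smult_l_minus subset_iff)
  then show "-[V] x \<in> N" using smN[OF _ x] by simp
  fix y assume y: "y \<in> N"
  obtain a where a: "a \<in> S \<rightarrow> carrier F" "x = (\<Oplus>\<^bsub>V\<^esub>s\<in>S. a s .[V] s)" using NE[OF x] .
  obtain b where b: "b \<in> S \<rightarrow> carrier F" "y = (\<Oplus>\<^bsub>V\<^esub>s\<in>S. b s .[V] s)" using NE[OF y] .
  show "x +[V] y \<in> N" unfolding a(2) b(2) add[OF a(1) b(1)] by (rule NI) (use a(1) b(1) in auto)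
 qed (rule smN)
 have "S <= N"
 proof
  fix t assume t: "t \<in> S"
  have "(\<Oplus>\<^bsub>V\<^esub>s\<in>S. (if t = s then \<one> else \<zero>) .[V] s) = (\<Oplus>\<^bsub>V\<^esub>s\<in>S. if t = s then s else 0[V])"
   using S(2) by (intro M.finsum_cong' HOL.refl Pi_I) (auto simp: subset_iff)
  also have "\<dots> = t" using S t by (intro M.finsum_singleton[where f = "\<lambda>s. s"]) auto
  finally show "t \<in> N" using NI[of "\<lambda>s. if t = s then \<one> else \<zero>"] by simp
 qed
 from gen[OF N this] show ?thesis unfolding finite_dimensional_def N_def using S by blast
qed

lemma (in vspace) finite_dimensionalE:
 assumes "finite_dimensional F V"
 obtains S where "finite S" "S <= carrier V" "!!N. [|submodule N F V; S <= N|] ==> carrier V <= N"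
proof -
 obtain S where S: "finite S" "S <= carrier V" "!!x. x \<in>[V] ==> \<exists>a\<in>S \<rightarrow> carrier F. x = (\<Oplus>\<^bsub>V\<^esub>s\<in>S. a s .[V] s)"
  using assms unfolding finite_dimensional_def by auto
 have "carrier V <= N" if N: "submodule N F V" "S <= N" for N
 proof
  fix x assume "x \<in>[V]"
  then obtain a where a: "a \<in> S \<rightarrow> carrier F" "x = (\<Oplus>\<^bsub>V\<^esub>s\<in>S. a s .[V] s)" using S(3) by auto
  then show "x \<in> N" using submoduleD(4)[OF N(1)] N(2) by (auto intro!: finsum_in_submodule[OF N(1) S(1)])
 qed
 then show thesis using that S by blast
qed

lemma (in vspace) functional_finsum:
 assumes l: "l \<in> functionals F V"
 shows "finite S ==> f \<in> S \<rightarrow> carrier V ==> l (finsum V f S) = (\<Oplus>s\<in>S. l (f s))"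
proof (induction S rule: finite_induct)
 case empty
 then show ?case using functional_zero[OF l] by simp
next
 case (insert s S)
 have "(\<lambda>s. l (f s)) \<in> S \<rightarrow> carrier F" "l (f s) \<in>[F]" using insert.prems functionalsD(1)[OF l] by auto
 then show ?case using insert functionalsD(2)[OF l] by simp
qed

text \<open>A central z acts on each g by a scalar, since gz lies in the corner at g. A nonzero u
  with g u g' = u shows that the scalars for g and g' agree.\<close>

lemma (in algebra_over_field) frame_central:
 assumes G: "frame G" and z: "z \<in> nucleus A" "!!y. y \<in>[A] ==> z *[A] y = y *[A] z"
 shows "\<exists>r\<in>carrier F. z = r .[A] 1[A]"
proof -
 note sys = frame_system[OF G] and GD = idempotent_systemD[OF frame_system[OF G]]
 have zc: "z \<in>[A]" using nucleus_closed[OF z(1)] .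
 have ex: "\<exists>r\<in>carrier F. g *[A] z = r .[A] g" if g: "g \<in> G" for g
 proof -
  have "(g *[A] z) *[A] g = g *[A] z"
   using z(2)[OF GD(3)[OF g]] GD(5)[OF g] nucleus_assoc(1)[OF GD(2)[OF g] GD(3)[OF g] zc] nucleus_assoc(2)[OF z(1) GD(3)[OF g] GD(3)[OF g]] by simp
  then show ?thesis using frame_corner[OF G g zc] by simp
 qed
 have same: "r = s" if g: "g \<in> G" "g' \<in> G" and r: "r \<in>[F]" "g *[A] z = r .[A] g" and s: "s \<in>[F]" "g' *[A] z = s .[A] g'"
  for g g' r s
 proof -
  obtain u where u: "u \<in>[A]" "u ~= 0[A]" "g *[A] u = u" "u *[A] g' = u"
   using frame_unit[OF G g] by metis
  have "r .[A] u = (g *[A] z) *[A] u" using r u GD(3)[OF g(1)] by (simp add: smult_mult)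
  also have "\<dots> = z *[A] u" using z(2)[OF GD(3)[OF g(1)]] nucleus_assoc(1)[OF z(1) GD(3)[OF g(1)] u(1)] u(3) by simp
  also have "\<dots> = (u *[A] g') *[A] z" using z(2)[OF u(1)] u(4) by simp
  also have "\<dots> = s .[A] u" using nucleus_assoc(3)[OF z(1) u(1) GD(3)[OF g(2)]] s u GD(3)[OF g(2)] by (simp add: mult_smult)
  finally have "(r \<ominus> s) .[A] u = 0[A]" using r(1) s(1) u(1) by (simp add: a_minus_def smult_l_distr smult_l_minus M.r_neg)
  then show ?thesis using smult_eq_zero[of "r \<ominus> s" u] u(1,2) r(1) s(1) by auto
 qed
 show ?thesis
 proof (cases "G = {}")
  case True
  then have "1[A] = 0[A]" using GD(7) by simp
  then have "z = 0[A]" using one_mult[OF zc] zero_mult[OF zc] by metis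
  then show ?thesis by (intro bexI[of _ \<zero>]) simp_all
 next
  case False
  then obtain g0 where g0: "g0 \<in> G" by auto
  obtain r where r: "r \<in>[F]" "g0 *[A] z = r .[A] g0" using ex[OF g0] by auto
  have "z = r .[A] 1[A]"
  proof (rule idempotent_system_ext(1)[OF sys zc])
   fix g assume g: "g \<in> G"
   obtain s where s: "s \<in>[F]" "g *[A] z = s .[A] g" using ex[OF g] by auto
   then show "g *[A] z = g *[A] (r .[A] 1[A])" using same[OF g0 g r s] GD(3)[OF g] by (simp add: mult_smult)
  qed (use r in simp)
  then show ?thesis using r(1) by auto
 qed
qed

section \<open>Transfer of dimension, frames and centrality along \<phi>\<close>

context scalar_extension begin

lemma finite_dimensional_extension:
 assumes "finite_dimensional F A" shows "finite_dimensional E M"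
proof -
 obtain S where S: "finite S" "S <= carrier A" "!!N. [|submodule N F A; S <= N|] ==> carrier A <= N"
  using A.finite_dimensionalE[OF assms] by metis
 show ?thesis
 proof (rule M.finite_dimensionalI[of "\<phi> ` S"])
  fix N assume N: "submodule N E M" "\<phi> ` S <= N"
  note D = M.submoduleD[OF N(1)]
  have "submodule {a \<in> carrier A. \<phi> a \<in> N} F A"
   using D by (intro A.submoduleI) (auto simp: phi_neg phi_add phi_smult)
  then have "\<phi> a \<in> N" if "a \<in>[A]" for a using S(2,3) N(2) that by blast
  then show "carrier M <= N"
  proof (intro subsetI)
   fix z assume "z \<in>[M]" then show "z \<in> N"
    by (induction rule: span_induct) (use D \<open>!!a. a \<in>[A] ==> \<phi> a \<in> N\<close> in auto)
  qed
 qed (use S in auto)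
qed

text \<open>Each of finitely many generators of M involves only finitely many elements of A. If a
  subspace W contains all of these, then \<open>ext W\<close> = M and hence W = A.\<close>

lemma finite_dimensional_descent:
 assumes "finite_dimensional E M" shows "finite_dimensional F A"
proof -
 obtain S where S: "finite S" "S <= carrier M" "!!N. [|submodule N E M; S <= N|] ==> carrier M <= N"
  using M.finite_dimensionalE[OF assms] by metis
 have ex: "\<exists>V. finite V \<and> V <= carrier A \<and> (\<forall>N. submodule N E M \<and> \<phi> ` V <= N --> z \<in> N)" if "z \<in>[M]" for z
  using that
 proof (induction rule: span_induct)
  case zero
  then show ?case using M.submoduleD(2) by (intro exI[of _ "{}"]) auto
 next
  case (add e a z)
  then obtain V where V: "finite V" "V <= carrier A" "!!N. [|submodule N E M; \<phi> ` V <= N|] ==> z \<in> N" by metis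
  then show ?case using add M.submoduleD(3,4) by (intro exI[of _ "insert a V"]) auto
 qed
 obtain V where V: "!!z. z \<in>[M] ==> finite (V z) \<and> V z <= carrier A \<and> (\<forall>N. submodule N E M \<and> \<phi> ` V z <= N --> z \<in> N)"
  using ex by metis
 show ?thesis
 proof (rule A.finite_dimensionalI[of "\<Union>z\<in>S. V z"])
  fix W assume W: "submodule W F A" "(\<Union>z\<in>S. V z) <= W"
  have "S <= ext W"
  proof
   fix z assume z: "z \<in> S"
   have "\<phi> ` V z <= ext W" using phi_ext_iff[OF W(1)] V S(2) W(2) z by blast
   then show "z \<in> ext W" using V S(2) z submodule_ext[OF W(1)] by blast
  qed
  then have "carrier M <= ext W" by (rule S(3)[OF submodule_ext[OF W(1)]])
  moreover have "submodule (carrier A) F A" by (rule A.submoduleI) auto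
  ultimately show "carrier A <= W" using ext_eq_iff[OF _ W(1)] ext_carrier by blast
 qed (use S V in auto)
qed

lemma phi_finsum: "finite S ==> f \<in> S \<rightarrow> carrier A ==> \<phi> (finsum A f S) = (\<Oplus>\<^bsub>M\<^esub>s\<in>S. \<phi> (f s))"
proof (induction S rule: finite_induct)
 case (insert s S)
 have "(\<lambda>s. \<phi> (f s)) \<in> S \<rightarrow> carrier M" "\<phi> (f s) \<in>[M]" using insert.prems by (auto simp: Pi_iff)
 then show ?case using insert by (simp add: phi_add)
qed simp

lemma phi_nucleus: "a \<in> nucleus A ==> \<phi> a \<in> nucleus M"
 using phi_ext_iff[OF A.submodule_nucleus A.nucleus_closed] ext_nucleus by auto

lemma frame_phi:
 assumes G: "A.frame G" shows "M.frame (\<phi> ` G)"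
proof -
 note GD = A.idempotent_systemD[OF A.frame_system[OF G]]
 have inj: "inj_on \<phi> G" using phi_inj GD(3) by (auto simp: inj_on_def)
 have "(\<Oplus>\<^bsub>M\<^esub>h\<in>\<phi> ` G. h) = (\<Oplus>\<^bsub>M\<^esub>g\<in>G. \<phi> g)" using GD(3) by (intro M.M.finsum_reindex[OF _ inj]) auto
 also have "\<dots> = 1[M]" using phi_finsum[OF GD(1), of "\<lambda>g. g"] GD(3,7) by auto
 finally have sum: "(\<Oplus>\<^bsub>M\<^esub>h\<in>\<phi> ` G. h) = 1[M]" .
 have "\<phi> g *[M] \<phi> h = (if \<phi> g = \<phi> h then \<phi> g else 0[M])" if "g \<in> G" "h \<in> G" for g h
  using GD(3,5,6) that phi_mult[of g h] inj_on_eq_iff[OF inj] by auto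
 moreover have "0[M] \<notin> \<phi> ` G"
 proof
  assume "0[M] \<in> \<phi> ` G"
  then obtain g where "g \<in> G" "\<phi> g = \<phi> 0[A]" by auto
  then show False using phi_inj[OF GD(3) A.M.zero_closed] GD(4) by blast
 qed
 ultimately have sys: "M.idempotent_system (\<phi> ` G)"
  unfolding M.idempotent_system_def using GD(1,2) phi_nucleus sum by auto
 show ?thesis unfolding M.frame_def
 proof (intro conjI sys ballI)
  fix g' h' assume "g' \<in> \<phi> ` G" "h' \<in> \<phi> ` G"
  then obtain g h where gh: "g \<in> G" "h \<in> G" "g' = \<phi> g" "h' = \<phi> h" by auto
  obtain u where u: "u \<in>[A]" "u ~= 0[A]" "g *[A] u = u" "u *[A] h = u"
   "!!z. z \<in>[A] ==> \<exists>r\<in>carrier F. (g *[A] z) *[A] h = r .[A] u"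
   using A.frame_unit[OF G gh(1,2)] by metis
  note c = phi_closed[OF GD(3)[OF gh(1)]] phi_closed[OF GD(3)[OF gh(2)]] phi_closed[OF u(1)]
  show "\<exists>u\<in>carrier M. u ~= 0[M] \<and> g' *[M] u = u \<and> u *[M] h' = u \<and>
   (\<forall>z\<in>carrier M. \<exists>r\<in>carrier E. (g' *[M] z) *[M] h' = r .[M] u)"
   unfolding gh(3,4)
  proof (intro bexI[of _ "\<phi> u"] conjI ballI)
   show "\<phi> u ~= 0[M]" using phi_inj[OF u(1) A.M.zero_closed] u(2) by auto
   show "\<phi> g *[M] \<phi> u = \<phi> u" "\<phi> u *[M] \<phi> h = \<phi> u"
    using phi_mult[OF GD(3)[OF gh(1)] u(1)] phi_mult[OF u(1) GD(3)[OF gh(2)]] u(3,4) by simp_all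
   fix z assume "z \<in>[M]"
   then show "\<exists>r\<in>carrier E. (\<phi> g *[M] z) *[M] \<phi> h = r .[M] \<phi> u"
   proof (induction rule: span_induct)
    case zero
    then show ?case using c by (intro bexI[of _ "0[E]"]) simp_all
   next
    case (add e a z)
    then obtain r where r: "r \<in>[E]" "(\<phi> g *[M] z) *[M] \<phi> h = r .[M] \<phi> u" by auto
    obtain s where s: "s \<in>[F]" "(g *[A] a) *[A] h = s .[A] u" using u(5)[OF add(2)] by auto
    have "(\<phi> g *[M] \<phi> a) *[M] \<phi> h = \<iota> s .[M] \<phi> u"
     using s phi_smult[OF s(1) u(1)] GD(3) gh add(2) by (simp flip: phi_mult)
    then have "(\<phi> g *[M] (e .[M] \<phi> a +[M] z)) *[M] \<phi> h = (e *[E] \<iota> s +[E] r) .[M] \<phi> u"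
     using add c r s(1) by (simp add: M.distrib_left M.distrib_right M.mult_smult M.smult_mult M.smult_l_distr M.smult_assoc1)
    then show ?case using add(1) r(1) s(1) by (intro bexI[of _ "e *[E] \<iota> s +[E] r"]) simp_all
   qed
  qed (use c in simp)
 qed
qed

text \<open>A central x of A becomes central in M, so \<phi>(x) = e 1. Slicing by l with l(1) = 1
  gives x = l(e) 1. Nonemptiness of G makes 1 nonzero, so the structure map of F is
  injective.\<close>

lemma central_of_frame:
 assumes G: "M.frame G" "G ~= {}" shows "central_algebra F A"
 unfolding central_algebra_def
proof (rule bij_betw_imageI)
 note GD = M.idempotent_systemD[OF M.frame_system[OF G(1)]]
 obtain g where g: "g \<in> G" using G(2) by auto
 have "1[M] ~= 0[M]" using M.one_mult[OF GD(3)[OF g]] M.zero_mult[OF GD(3)[OF g]] GD(4)[OF g] by metis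
 then have one: "1[A] ~= 0[A]" using phi_one phi_zero by metis
 show "inj_on (\<lambda>r. r .[A] 1[A]) (carrier F)"
 proof (rule inj_onI)
  fix r s assume rs: "r \<in>[F]" "s \<in>[F]" "r .[A] 1[A] = s .[A] 1[A]"
  then have "(r -[F] s) .[A] 1[A] = 0[A]" by (simp add: a_minus_def A.smult_l_distr A.smult_l_minus A.M.r_neg)
  then show "r = s" using A.smult_eq_zero[of "r -[F] s" "1[A]"] one rs(1,2) by auto
 qed
 show "(\<lambda>r. r .[A] 1[A]) ` carrier F = nonassoc_center A"
 proof (intro equalityI subsetI)
  fix x assume "x \<in> (\<lambda>r. r .[A] 1[A]) ` carrier F"
  then show "x \<in> nonassoc_center A"
   using A.submoduleD(4)[OF A.submodule_nucleus _ A.one_nucleus] by (auto simp: nonassoc_center_def A.smult_mult A.mult_smult)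
 next
  fix x assume "x \<in> nonassoc_center A"
  then have x: "x \<in> nucleus A" "!!a. a \<in>[A] ==> x *[A] a = a *[A] x" by (auto simp: nonassoc_center_def)
  note xc = A.nucleus_closed[OF x(1)]
  have "\<phi> x *[M] z = z *[M] \<phi> x" if "z \<in>[M]" for z
   using that
  proof (induction rule: span_induct)
   case (add e a z)
   then show ?case using xc x(2)[OF add(2)] phi_mult[OF xc add(2)] phi_mult[OF add(2) xc]
    by (simp add: M.distrib_left M.distrib_right M.mult_smult M.smult_mult)
  qed (use xc in simp)
  then obtain e where e: "e \<in>[E]" "\<phi> x = e .[M] 1[M]" using M.frame_central[OF G(1) phi_nucleus[OF x(1)]] by auto
  obtain l where l: "l \<in> functionals F E" "l 1[E] = 1[F]" by (rule unit_functional)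
  have "x = slice l (\<phi> x)" using slice_phi_one[OF l(1) xc] l(2) xc by simp
  also have "\<dots> = l e .[A] 1[A]" using slice_phi[OF l(1) e(1) A.one_closed] e(2) by simp
  finally show "x \<in> (\<lambda>r. r .[A] 1[A]) ` carrier F" using functionalsD(1)[OF l(1) e(1)] by auto
 qed
qed

theorem semiassociative_of_frame:
 assumes E: "root_closed E" and fd: "finite_dimensional F A" and G: "M.frame G" "G ~= {}"
 shows "semiassociative F A"
proof -
 obtain K H where K: "submodule K F A" "K <= nucleus A" "1[A] \<in> K" "!!x y. [|x \<in> K; y \<in> K|] ==> x *[A] y \<in> K"
  "!!x y. [|x \<in> K; y \<in> K|] ==> x *[A] y = y *[A] x" and H: "M.frame H" "H <= ext K"
  "!!k h. [|k \<in> K; h \<in> H|] ==> \<exists>r\<in>carrier E. \<phi> k *[M] h = r .[M] h"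
  using split_subalgebra_exists[OF E fd finite_dimensional_extension[OF fd] G(1)] by metis
 interpret S: split_algebra F A E M \<phi> slice K H
  by (intro split_algebra.intro nuclear_subalgebra.intro scalar_extension_axioms nuclear_subalgebra_axioms.intro split_algebra_axioms.intro M.frame_system H) (use K in auto)
 have "unital_subalgebra F K A" using K by (simp add: unital_subalgebra_def)
 then show ?thesis unfolding semiassociative_def
  using A.nonassoc_algebra_axioms fd central_of_frame[OF G] K(2) S.etale_K[OF fd] S.minimally_faithful_bimodule[OF H(1)] by auto
qed

end

text \<open>Take for G the preimages of the diagonal matrix units. Left or right multiplication by
  e_ii only selects a row or a column, because c_iij = c_ijj = 1; this puts e_ii into the nucleus.
  The corner e_i A e_j is the line of the matrix unit e_ij.\<close>

lemma (in algebra_over_field) frame_of_skew_iso: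
 assumes h: "h \<in> algebra_isos F A (skew_matrix_algebra F n c)" and c: "reduced_skew_set F n c" and n: "n \<ge> 1"
 obtains G where "frame G" "G ~= {}" "finite_dimensional F A"
proof -
 define I where "I = {1..n}"
 define B where "B = skew_matrix_algebra F n c"
 have fI: "finite I" by (simp add: I_def)
 have hb: "bij_betw h (carrier A) (carrier B)" and h1: "h 1[A] = 1[B]"
  and hadd: "!!x y. [|x \<in>[A]; y \<in>[A]|] ==> h (x +[A] y) = h x +[B] h y"
  and hmult: "!!x y. [|x \<in>[A]; y \<in>[A]|] ==> h (x *[A] y) = h x *[B] h y"
  and hsm: "!!r x. [|r \<in>[F]; x \<in>[A]|] ==> h (r .[A] x) = r .[B] h x"
  using h by (auto simp: algebra_isos_def B_def)
 have cB: "carrier B = I \<times> I \<rightarrow>\<^sub>E carrier F" by (simp add: B_def skew_matrix_algebra_def I_def)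
 have hc: "h x (p, q) \<in>[F]" if "x \<in>[A]" "p \<in> I" "q \<in> I" for x p q
  using bij_betwE[OF hb] that cB by (auto simp: PiE_iff)
 have eqI: "x = y" if xy: "x \<in>[A]" "y \<in>[A]" and e: "!!p q. [|p \<in> I; q \<in> I|] ==> h x (p, q) = h y (p, q)" for x y
 proof -
  have "h x \<in> I \<times> I \<rightarrow>\<^sub>E carrier F" "h y \<in> I \<times> I \<rightarrow>\<^sub>E carrier F" using bij_betwE[OF hb] xy cB by auto
  then have "h x = h y" by (rule PiE_ext) (use e in auto)
  then show ?thesis using inj_onD[OF bij_betw_imp_inj_on[OF hb]] xy by auto
 qed
 have cc: "c i j k \<in>[F]" if "i \<in> I" "j \<in> I" "k \<in> I" for i j k using c that by (auto simp: reduced_skew_set_def I_def)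
 have c1: "c i i j = \<one>" "c i j j = \<one>" if "i \<in> I" "j \<in> I" for i j using c that by (auto simp: reduced_skew_set_def I_def)
 have ha: "h (x +[A] y) (p, q) = h x (p, q) \<oplus> h y (p, q)" if "x \<in>[A]" "y \<in>[A]" "p \<in> I" "q \<in> I" for x y p q
  using hadd[OF that(1,2)] that by (simp add: B_def skew_matrix_algebra_def I_def)
 have hs: "h (r .[A] x) (p, q) = r \<otimes> h x (p, q)" if "r \<in>[F]" "x \<in>[A]" "p \<in> I" "q \<in> I" for r x p q
  using hsm[OF that(1,2)] that by (simp add: B_def skew_matrix_algebra_def I_def)
 have hm: "h (x *[A] y) (p, q) = (\<Oplus>k\<in>I. c p k q \<otimes> (h x (p, k) \<otimes> h y (k, q)))"
  if "x \<in>[A]" "y \<in>[A]" "p \<in> I" "q \<in> I" for x y p q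
  using hmult[OF that(1,2)] that by (simp add: B_def skew_matrix_algebra_def I_def)
 have ho: "h 1[A] (p, q) = (if p = q then \<one> else \<zero>)" if "p \<in> I" "q \<in> I" for p q
  using h1 that by (simp add: B_def skew_matrix_algebra_def I_def)
 have l: "(\<lambda>x. h x (p, q)) \<in> functionals F A" if "p \<in> I" "q \<in> I" for p q
  using hc ha hs that by (simp add: functionals_def)
 have hz: "h 0[A] (p, q) = \<zero>" if "p \<in> I" "q \<in> I" for p q using functional_zero[OF l[OF that]] .
 define \<epsilon> where "\<epsilon> i j = inv_into (carrier A) h (\<lambda>p\<in>I \<times> I. if p = (i, j) then \<one> else \<zero>)" for i j
 have \<epsilon>: "\<epsilon> i j \<in>[A]" "[|p \<in> I; q \<in> I|] ==> h (\<epsilon> i j) (p, q) = (if p = i \<and> q = j then \<one> else \<zero>)" for i j p q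
 proof -
  have "(\<lambda>p\<in>I \<times> I. if p = (i, j) then \<one> else \<zero>) \<in>[B]" by (auto simp: cB)
  then have im: "(\<lambda>p\<in>I \<times> I. if p = (i, j) then \<one> else \<zero>) \<in> h ` carrier A" using hb by (simp add: bij_betw_def)
  show "\<epsilon> i j \<in>[A]" unfolding \<epsilon>_def by (rule inv_into_into[OF im])
  show "[|p \<in> I; q \<in> I|] ==> h (\<epsilon> i j) (p, q) = (if p = i \<and> q = j then \<one> else \<zero>)"
   unfolding \<epsilon>_def f_inv_into_f[OF im] by simp
 qed
 have eL: "h (\<epsilon> i j *[A] y) (p, q) = (if p = i then c i j q \<otimes> h y (j, q) else \<zero>)"
  if y: "y \<in>[A]" and I: "i \<in> I" "j \<in> I" "p \<in> I" "q \<in> I" for i j y p q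
 proof -
  have "h (\<epsilon> i j *[A] y) (p, q) = (\<Oplus>k\<in>I. if j = k then (if p = i then c p k q \<otimes> h y (k, q) else \<zero>) else \<zero>)"
   unfolding hm[OF \<epsilon>(1) y I(3,4)] using \<epsilon>(2) hc[OF y] cc I by (intro R.finsum_cong' HOL.refl Pi_I) auto
  also have "\<dots> = (if p = i then c p j q \<otimes> h y (j, q) else \<zero>)"
   using hc[OF y] cc I by (intro R.finsum_singleton[OF I(2) fI] Pi_I) auto
  finally show ?thesis by simp
 qed
 have eR: "h (x *[A] \<epsilon> i j) (p, q) = (if q = j then c p i j \<otimes> h x (p, i) else \<zero>)"
  if x: "x \<in>[A]" and I: "i \<in> I" "j \<in> I" "p \<in> I" "q \<in> I" for i j x p q
 proof -
  have "h (x *[A] \<epsilon> i j) (p, q) = (\<Oplus>k\<in>I. if i = k then (if q = j then c p k q \<otimes> h x (p, k) else \<zero>) else \<zero>)"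
   unfolding hm[OF x \<epsilon>(1) I(3,4)] using \<epsilon>(2) hc[OF x] cc I by (intro R.finsum_cong' HOL.refl Pi_I) auto
  also have "\<dots> = (if q = j then c p i q \<otimes> h x (p, i) else \<zero>)"
   using hc[OF x] cc I by (intro R.finsum_singleton[OF I(1) fI] Pi_I) auto
  finally show ?thesis by simp
 qed
 have z0: "(\<Oplus>k\<in>I. f k) = \<zero>" if "!!k. k \<in> I ==> f k = \<zero>" for f
  using R.finsum_cong'[of I I "\<lambda>_. \<zero>" f] that by simp
 have nuc: "\<epsilon> i i \<in> nucleus A" if i: "i \<in> I" for i
  unfolding nucleus_iff
 proof (intro conjI ballI \<epsilon>(1))
  fix x y assume xy: "x \<in>[A]" "y \<in>[A]"
  note cl = mult_closed[OF \<epsilon>(1) xy(1), of i i] mult_closed[OF \<epsilon>(1) xy(2), of i i] mult_closed[OF xy(1) \<epsilon>(1), of i i] mult_closed[OF xy(2) \<epsilon>(1), of i i] mult_closed[OF xy]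
  show "(\<epsilon> i i *[A] x) *[A] y = \<epsilon> i i *[A] (x *[A] y)"
  proof (rule eqI)
   fix p q assume pq: "p \<in> I" "q \<in> I"
   have "(\<Oplus>k\<in>I. c p k q \<otimes> (h (\<epsilon> i i *[A] x) (p, k) \<otimes> h y (k, q))) = (if p = i then (\<Oplus>k\<in>I. c p k q \<otimes> (h x (p, k) \<otimes> h y (k, q))) else (\<Oplus>k\<in>I. \<zero>))"
    using pq eL[OF xy(1) i i pq(1)] c1 hc xy cc i by (auto intro!: R.finsum_cong' z0)
   then show "h ((\<epsilon> i i *[A] x) *[A] y) (p, q) = h (\<epsilon> i i *[A] (x *[A] y)) (p, q)"
    using hm[OF cl(1) xy(2) pq] hm[OF xy pq] eL[OF cl(5) i i pq] c1[OF i pq(2)] hc[OF cl(5)] pq i by auto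
  qed (use cl xy \<epsilon>(1) in simp_all)
  show "(x *[A] \<epsilon> i i) *[A] y = x *[A] (\<epsilon> i i *[A] y)"
  proof (rule eqI)
   fix p q assume pq: "p \<in> I" "q \<in> I"
   show "h ((x *[A] \<epsilon> i i) *[A] y) (p, q) = h (x *[A] (\<epsilon> i i *[A] y)) (p, q)"
    unfolding hm[OF cl(3) xy(2) pq] hm[OF xy(1) cl(2) pq]
    using eR[OF xy(1) i i pq(1)] eL[OF xy(2) i i _ pq(2)] c1 hc xy cc i pq by (intro R.finsum_cong' HOL.refl Pi_I) auto
  qed (use cl xy \<epsilon>(1) in simp_all)
  show "(x *[A] y) *[A] \<epsilon> i i = x *[A] (y *[A] \<epsilon> i i)"
  proof (rule eqI)
   fix p q assume pq: "p \<in> I" "q \<in> I"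
   have "(\<Oplus>k\<in>I. c p k q \<otimes> (h x (p, k) \<otimes> h (y *[A] \<epsilon> i i) (k, q))) = (if q = i then (\<Oplus>k\<in>I. c p k q \<otimes> (h x (p, k) \<otimes> h y (k, q))) else (\<Oplus>k\<in>I. \<zero>))"
    using pq eR[OF xy(2) i i _ pq(2)] c1 hc xy cc i by (auto intro!: R.finsum_cong' z0)
   then show "h ((x *[A] y) *[A] \<epsilon> i i) (p, q) = h (x *[A] (y *[A] \<epsilon> i i)) (p, q)"
    using hm[OF xy(1) cl(4) pq] hm[OF xy pq] eR[OF cl(5) i i pq] c1[OF pq(1) i] hc[OF cl(5)] pq i by auto
  qed (use cl xy \<epsilon>(1) in simp_all)
 qed
 have inj: "\<epsilon> i i = \<epsilon> j j \<longleftrightarrow> i = j" if "i \<in> I" "j \<in> I" for i j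
  using \<epsilon>(2)[of i i i i] \<epsilon>(2)[of i i j j] that by (auto split: if_splits)
 have prod: "\<epsilon> i i *[A] \<epsilon> j j = (if \<epsilon> i i = \<epsilon> j j then \<epsilon> i i else 0[A])" if ij: "i \<in> I" "j \<in> I" for i j
  unfolding inj[OF ij] using ij by (intro eqI) (auto simp: eL \<epsilon> hz c1)
 define G where "G = (\<lambda>i. \<epsilon> i i) ` I"
 have sum: "(\<Oplus>\<^bsub>A\<^esub>g\<in>G. g) = 1[A]"
 proof -
  have "(\<Oplus>\<^bsub>A\<^esub>g\<in>G. g) = (\<Oplus>\<^bsub>A\<^esub>i\<in>I. \<epsilon> i i)"
   unfolding G_def using \<epsilon>(1) inj by (intro M.finsum_reindex) (auto simp: inj_on_def)
  also have "\<dots> = 1[A]"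
  proof (rule eqI)
   fix p q assume pq: "p \<in> I" "q \<in> I"
   have "h (\<Oplus>\<^bsub>A\<^esub>i\<in>I. \<epsilon> i i) (p, q) = (\<Oplus>i\<in>I. h (\<epsilon> i i) (p, q))"
    using functional_finsum[OF l[OF pq] fI, of "\<lambda>i. \<epsilon> i i"] \<epsilon>(1) by simp
   also have "\<dots> = (\<Oplus>i\<in>I. if p = i then (if p = q then \<one> else \<zero>) else \<zero>)"
    using pq by (intro R.finsum_cong' HOL.refl Pi_I) (auto simp: \<epsilon>)
   also have "\<dots> = (if p = q then \<one> else \<zero>)" using pq fI by (intro R.finsum_singleton) auto
   finally show "h (\<Oplus>\<^bsub>A\<^esub>i\<in>I. \<epsilon> i i) (p, q) = h 1[A] (p, q)" using ho[OF pq] by simp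
  qed (use \<epsilon>(1) in \<open>auto intro!: M.finsum_closed\<close>)
  finally show ?thesis .
 qed
 have nz: "\<epsilon> i j ~= 0[A]" if "i \<in> I" "j \<in> I" for i j using \<epsilon>(2)[OF that, of i j] hz[OF that] by auto
 have "0[A] \<notin> G"
 proof
  assume "0[A] \<in> G"
  then obtain i where "i \<in> I" "\<epsilon> i i = 0[A]" by (auto simp: G_def)
  then show False using nz by simp
 qed
 then have sys: "idempotent_system G"
  unfolding idempotent_system_def
 proof (intro conjI ballI sum)
  show "finite G" "G <= nucleus A" using fI nuc by (auto simp: G_def)
  fix g g' assume "g \<in> G" "g' \<in> G"
  then obtain i j where "i \<in> I" "j \<in> I" "g = \<epsilon> i i" "g' = \<epsilon> j j" unfolding G_def by auto
  then show "g *[A] g' = (if g = g' then g else 0[A])" using prod by simp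
 qed
 have fr: "frame G"
  unfolding frame_def
 proof (intro conjI sys ballI)
  fix g g' assume "g \<in> G" "g' \<in> G"
  then obtain i j where ij: "i \<in> I" "j \<in> I" "g = \<epsilon> i i" "g' = \<epsilon> j j" by (auto simp: G_def)
  show "\<exists>u\<in>carrier A. u ~= 0[A] \<and> g *[A] u = u \<and> u *[A] g' = u \<and>
   (\<forall>z\<in>carrier A. \<exists>r\<in>carrier F. (g *[A] z) *[A] g' = r .[A] u)"
  proof (intro bexI[of _ "\<epsilon> i j"] conjI ballI nz ij(1,2) \<epsilon>(1))
   show "g *[A] \<epsilon> i j = \<epsilon> i j" "\<epsilon> i j *[A] g' = \<epsilon> i j"
    unfolding ij(3,4) using ij(1,2) by (auto intro!: eqI simp: eL eR \<epsilon> c1 cc)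
   fix z assume z: "z \<in>[A]"
   have "(g *[A] z) *[A] g' = h z (i, j) .[A] \<epsilon> i j"
    unfolding ij(3,4) using ij(1,2) z hc[OF z] by (intro eqI) (auto simp: eL eR hs \<epsilon> c1 cc)
   then show "\<exists>r\<in>carrier F. (g *[A] z) *[A] g' = r .[A] \<epsilon> i j" using hc[OF z ij(1,2)] by auto
  qed
 qed
 have fd: "finite_dimensional F A"
 proof (rule finite_dimensionalI[of "(\<lambda>(i, j). \<epsilon> i j) ` (I \<times> I)"])
  fix N assume N: "submodule N F A" "(\<lambda>(i, j). \<epsilon> i j) ` (I \<times> I) <= N"
  show "carrier A <= N"
  proof
   fix z assume z: "z \<in>[A]"
   define w where "w = (\<Oplus>\<^bsub>A\<^esub>s\<in>I \<times> I. h z s .[A] (case s of (i, j) => \<epsilon> i j))"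
   have w: "w \<in> N" unfolding w_def
    using submoduleD(4)[OF N(1)] N(2) hc[OF z] fI by (intro finsum_in_submodule[OF N(1)] Pi_I) auto
   have "z = w"
   proof (rule eqI[OF z])
    show "w \<in>[A]" using w submoduleD(1)[OF N(1)] by auto
    fix p q assume pq: "p \<in> I" "q \<in> I"
    have "h w (p, q) = (\<Oplus>s\<in>I \<times> I. h (h z s .[A] (case s of (i, j) => \<epsilon> i j)) (p, q))"
     unfolding w_def using fI hc[OF z] \<epsilon>(1) by (intro functional_finsum[OF l[OF pq]] Pi_I) auto
    also have "\<dots> = (\<Oplus>s\<in>I \<times> I. if (p, q) = s then h z s else \<zero>)"
    proof (intro R.finsum_cong' HOL.refl Pi_I)
     fix s assume "s \<in> I \<times> I"
     then obtain a b where s: "s = (a, b)" "a \<in> I" "b \<in> I" by auto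
     show "h (h z s .[A] (case s of (i, j) => \<epsilon> i j)) (p, q) = (if (p, q) = s then h z s else \<zero>)"
      using hs[OF hc[OF z s(2,3)] \<epsilon>(1)[of a b] pq] \<epsilon>(2)[OF pq, of a b] hc[OF z s(2,3)] s(1) by auto
     show "(if (p, q) = s then h z s else \<zero>) \<in>[F]" using hc[OF z s(2,3)] s(1) by simp
    qed
    also have "\<dots> = h z (p, q)"
     using R.finsum_singleton[of "(p, q)" "I \<times> I" "h z"] pq fI hc[OF z] by (simp add: Pi_iff)
    finally show "h z (p, q) = h w (p, q)" by simp
   qed
   then show "z \<in> N" using w by simp
  qed
 qed (use fI \<epsilon>(1) in auto)
 have "G ~= {}" using n by (simp add: G_def I_def)
 from that[OF fr this fd] show thesis .
qed

section \<open>Towers of scalar extensions and the algebraic closure\<close>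

lemma nonassoc_algebra_change_scalars:
 assumes A: "nonassoc_algebra R A" and R': "cring R'" and eq: "carrier R' = carrier R" "ring.add R' = ring.add R"
  "monoid.mult R' = monoid.mult R" "one R' = one R"
 shows "nonassoc_algebra R' A"
proof -
 interpret A: nonassoc_algebra R A by (rule A)
 have "module R' A"
  by (rule moduleI[OF R' A.M.abelian_group_axioms]) (use eq in \<open>simp_all add: A.smult_l_distr A.smult_r_distr A.smult_assoc1\<close>)
 then show ?thesis
  by (intro nonassoc_algebra.intro nonassoc_algebra_axioms.intro)
   (use eq in \<open>simp_all add: A.distrib_left A.distrib_right A.smult_mult A.mult_smult\<close>)
qed

text \<open>L \<otimes>_E (E \<otimes>_F A) is a model of the extension of A from F to L, where L'
  denotes L regarded over F. A functional l on L' is sliced in two stages: for w in L the functional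
  e to l(e w) slices E \<otimes> A, and the result is balanced over E in w.\<close>

lemma scalar_extension_tower:
 fixes F :: "('f, 'm) ring_scheme" and A :: "('f, 'a) module" and E :: "('f, 'e) module" and N :: "('e, 'v) module"
  and L :: "('e, 'w) module" and L' :: "('f, 'w) module"
 assumes X: "scalar_extension F A E N \<phi> slice" and L: "field L" "algebra E L" and L': "field L'" "algebra F L'"
  and eq: "carrier L' = carrier L" "ring.add L' = ring.add L" "monoid.mult L' = monoid.mult L" "one L' = one L"
   "!!r z. [|r \<in>[F]; z \<in>[L]|] ==> r .[L'] z = (r .[E] 1[E]) .[L] z"
 shows "scalar_extension F A L' (tensor_algebra E L N) (\<lambda>a. tensor_class E L N [(1[L], \<phi> a)])
  (\<lambda>l. tlift A (\<lambda>w t. slice (\<lambda>e. l (e .[L] w)) t))"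
proof -
 interpret LE: algebra E L by (rule L(2))
 interpret LA: algebra F L' by (rule L'(2))
 interpret L': field L' by (rule L'(1))
 interpret X: scalar_extension F A E N \<phi> slice by (rule X)
 define \<psi> where "\<psi> t = tensor_class E L N [(1[L], t)]" for t
 define M where "M = tensor_algebra E L N"
 interpret Y: scalar_extension E N L M \<psi> "\<lambda>l. tlift N (\<lambda>e a. l e .[N] a)"
  unfolding M_def \<psi>_def using tensor_scalar_extension[OF X.M.field_axioms X.M.nonassoc_algebra_axioms L] .
 interpret T: tensor E L N by (intro tensor.intro L(2) X.M.nonassoc_algebra_axioms)
 have tw: "(\<lambda>e. l (e .[L] w)) \<in> functionals F E" if l: "l \<in> functionals F L'" and w: "w \<in>[L]" for l w
  unfolding functionals_def
 proof (intro CollectI conjI ballI)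
  fix e assume e: "e \<in>[E]"
  show "l (e .[L] w) \<in>[F]" using functionalsD(1)[OF l] e w eq by simp
  show "l ((e +[E] e') .[L] w) = l (e .[L] w) +[F] l (e' .[L] w)" if "e' \<in>[E]" for e'
   using functionalsD(2)[OF l, of "e .[L] w" "e' .[L] w"] e that w eq by (simp add: LE.smult_l_distr)
 next
  fix r e assume r: "r \<in>[F]" and e: "e \<in>[E]"
  have "(r .[E] e) .[L] w = r .[L'] (e .[L] w)"
   using r e w eq(5)[OF r, of "e .[L] w"] X.iota_mult[OF r e] by (simp flip: LE.smult_assoc1)
  then show "l ((r .[E] e) .[L] w) = r *[F] l (e .[L] w)"
   using functionalsD(3)[OF l r, of "e .[L] w"] e w eq(1) by simp
 qed
 define g where "g l w t = slice (\<lambda>e. l (e .[L] w)) t" for l :: "'w => 'f" and w t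
 have bal: "balanced_map E L N A (g l)" if l: "l \<in> functionals F L'" for l
  unfolding balanced_map_def
 proof (intro conjI ballI)
  fix w t assume w: "w \<in>[L]" and t: "t \<in>[N]"
  show "g l w t \<in>[A]" unfolding g_def by (rule X.slice_closed[OF tw[OF l w] t])
  show "g l w (t +[N] t') = g l w t +[A] g l w t'" if "t' \<in>[N]" for t'
   unfolding g_def by (rule X.slice_add[OF tw[OF l w] t that])
  show "g l (w +[L] w') t = g l w t +[A] g l w' t" if w': "w' \<in>[L]" for w'
   using t
  proof (induction rule: X.span_induct)
   case zero
   then show ?case using tw[OF l] w w' by (simp add: g_def)
  next
   case (add e a z)
   have "l (e .[L] (w +[L] w')) = l (e .[L] w) +[F] l (e .[L] w')"
    using functionalsD(2)[OF l, of "e .[L] w" "e .[L] w'"] add(1) w w' eq by (simp add: LE.smult_r_distr)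
   then show ?case using add tw[OF l w] tw[OF l w'] tw[OF l, of "w +[L] w'"] w w' functionalsD(1)[OF tw[OF l w] add(1)] functionalsD(1)[OF tw[OF l w'] add(1)]
    by (simp add: g_def X.slice_add X.slice_phi X.slice_closed X.A.smult_l_distr X.A.M.a_ac)
  qed
  fix e assume e: "e \<in>[E]"
  show "g l (e .[L] w) t = g l w (e .[N] t)" if "w \<in>[L]" "t \<in>[N]" for w t
  proof -
   have "slice (\<lambda>x. l (x .[L] (e .[L] w))) t = slice (\<lambda>x. l ((x *[E] e) .[L] w)) t"
    using that(2)
   proof (induction rule: X.span_induct)
    case zero
    then show ?case using tw[OF l, of "e .[L] w"] X.functional_twist[OF tw[OF l that(1)] e] e that(1) by simp
   next
    case (add x a z)
    then show ?case using tw[OF l, of "e .[L] w"] X.functional_twist[OF tw[OF l that(1)] e] e that(1)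
     by (simp add: X.slice_add X.slice_phi LE.smult_assoc1)
   qed
   then show ?thesis using X.slice_smult[OF tw[OF l that(1)] e that(2)] by (simp add: g_def)
  qed
 qed
 note tl = T.tlift_cls[OF X.A.M.abelian_group_axioms bal]
 have cl: "\<forall>b\<in>carrier L. \<forall>c\<in>carrier N. g l b c \<in>[A]" if "l \<in> functionals F L'" for l
  using bal[OF that] by (simp add: balanced_map_def)
 have psi_smult: "w .[M] \<psi> t = T.cls [(w, t)]" if "w \<in>[L]" "t \<in>[N]" for w t
  using T.smult_T[of w "[(1[L], t)]"] that by (simp add: M_def \<psi>_def)
 have "scalar_extension F A L' M (\<lambda>a. \<psi> (\<phi> a)) (\<lambda>l. tlift A (g l))"
 proof (intro scalar_extension.intro scalar_extension_axioms.intro algebra_over_field.intro X.A.algebra_over_field_axioms L'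
   X.A.nonassoc_algebra_axioms X.A.field_axioms nonassoc_algebra_change_scalars[OF Y.M.nonassoc_algebra_axioms fieldE(1)[OF L'(1)] eq(1-4)])
  fix a b assume a: "a \<in>[A]"
  show "\<psi> (\<phi> a) \<in>[M]" using a by simp
  assume b: "b \<in>[A]"
  show "\<psi> (\<phi> (a +[A] b)) = \<psi> (\<phi> a) +[M] \<psi> (\<phi> b)" using a b by (simp add: X.phi_add Y.phi_add)
  show "\<psi> (\<phi> (a *[A] b)) = \<psi> (\<phi> a) *[M] \<psi> (\<phi> b)" using a b by (simp add: X.phi_mult Y.phi_mult)
 next
  fix r a assume r: "r \<in>[F]" and a: "a \<in>[A]"
  show "\<psi> (\<phi> (r .[A] a)) = (r .[L'] 1[L']) .[M] \<psi> (\<phi> a)"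
   using r a eq(4,5) by (simp add: X.phi_smult Y.phi_smult)
 next
  show "\<psi> (\<phi> 1[A]) = 1[M]" by simp
 next
  fix z P assume z: "z \<in>[M]" and P0: "P 0[M]"
   and step: "!!e a z. [|e \<in>[L']; a \<in>[A]; z \<in>[M]; P z|] ==> P (e .[M] \<psi> (\<phi> a) +[M] z)"
  from z show "P z"
  proof (induction rule: Y.span_induct)
   case (add w t z)
   \<comment> \<open>The remaining summand z is generalized so that t can be split into generators,
     each of which is then absorbed by one use of \<open>step\<close>.\<close>
   have "\<forall>z\<in>carrier M. P z --> P (w .[M] \<psi> t +[M] z)"
    using add(2)
   proof (induction rule: X.span_induct)
    case zero
    then show ?case using add(1) by simp
   next
    case (add e a t)
    show ?case
    proof (intro ballI impI)
     fix z assume z: "z \<in>[M]" "P z"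
     have w: "w \<in>[L]" by fact
     have "P (w .[M] \<psi> t +[M] z)" using add z by simp
     then have "P ((w *[L] (e .[L] 1[L])) .[M] \<psi> (\<phi> a) +[M] (w .[M] \<psi> t +[M] z))"
      using add(1,2,3) z w by (intro step) (simp_all add: eq)
     then show "P (w .[M] \<psi> (e .[N] \<phi> a +[N] t) +[M] z)"
      using add(1,2,3) z w by (simp add: Y.phi_add Y.phi_smult Y.M.smult_r_distr Y.M.smult_assoc1 Y.M.M.a_assoc)
    qed
   qed
   then show ?case using add by simp
  qed (rule P0)
 next
  fix l y assume l: "l \<in> functionals F L'" and y: "y \<in>[M]"
  obtain ys where ys: "ys \<in> pairs L N" "y = T.cls ys" using T.carrierE y unfolding M_def by blast
  show "tlift A (g l) y \<in>[A]"
   unfolding ys(2) tl[OF l ys(1)] by (rule tsum_closed[OF X.A.M.abelian_group_axioms cl[OF l] ys(1)])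
  fix z assume "z \<in>[M]"
  then obtain zs where zs: "zs \<in> pairs L N" "z = T.cls zs" using T.carrierE unfolding M_def by blast
  have "ys @ zs \<in> pairs L N" using ys(1) zs(1) by simp
  from tl[OF l this] show "tlift A (g l) (y +[M] z) = tlift A (g l) y +[A] tlift A (g l) z"
   unfolding ys(2) zs(2) M_def T.add_T[OF ys(1) zs(1)] tl[OF l ys(1)] tl[OF l zs(1)]
   using tsum_append[OF X.A.M.abelian_group_axioms cl[OF l] ys(1) zs(1)] by simp
 next
  fix l w a assume l: "l \<in> functionals F L'" and w: "w \<in>[L']" and a: "a \<in>[A]"
  have wc: "w \<in>[L]" and p: "[(w, \<phi> a)] \<in> pairs L N" using w a eq by auto
  have "tlift A (g l) (w .[M] \<psi> (\<phi> a)) = g l w (\<phi> a)"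
   unfolding psi_smult[OF wc X.phi_closed[OF a]] tl[OF l p] using cl[OF l] wc a by simp
  also have "\<dots> = l w .[A] a" unfolding g_def X.slice_phi_one[OF tw[OF l wc] a] using wc by simp
  finally show "tlift A (g l) (w .[M] \<psi> (\<phi> a)) = l w .[A] a" .
 qed
 then show ?thesis by (simp add: M_def \<psi>_def g_def[abs_def])
qed

definition base_change :: "('f => 'w) => 'w ring => ('f, 'w) module" where
 "base_change j L = \<lparr>carrier = carrier L, monoid.mult = (mop L), one = 1[L], ring.zero = 0[L], ring.add = (\<oplus>\<^bsub>L\<^esub>),
  module.smult = (\<lambda>r z. j r *[L] z)\<rparr>"

lemma base_change_simps [simp]:
 "carrier (base_change j L) = carrier L" "monoid.mult (base_change j L) = (mop L)" "one (base_change j L) = 1[L]"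
 "ring.zero (base_change j L) = 0[L]" "ring.add (base_change j L) = (\<oplus>\<^bsub>L\<^esub>)" "module.smult (base_change j L) r z = j r *[L] z"
 by (simp_all add: base_change_def)

lemma base_change:
 assumes F: "cring F" and L: "field L" and j: "j \<in> ring_hom F L"
 shows "field (base_change j L)" "algebra F (base_change j L)"
proof -
 interpret L: field L by (rule L)
 have "id \<in> ring_iso L (base_change j L)" by (auto simp: ring_iso_def ring_hom_def)
 from L.ring_iso_imp_img_field[OF this] show f: "field (base_change j L)"
  by (simp add: base_change_def)
 note jh = ring_hom_memE[OF j]
 interpret B: field "base_change j L" by (rule f)
 show "algebra F (base_change j L)"
 proof (intro algebra.intro moduleI F B.abelian_group_axioms fieldE(1)[OF f] algebra_axioms.intro)
 qed (use jh in \<open>simp_all add: L.l_distr L.r_distr L.m_assoc\<close>)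
qed

lemma sev_cong:
 "[|ring.add R = ring.add S; monoid.mult R = monoid.mult S; ring.zero R = ring.zero S|] ==> sev R as x = sev S as x"
 by (induction as) simp_all

lemma algebraic_closure_root_closed:
 assumes "algebraic_closure L K" shows "root_closed L"
 unfolding root_closed_def
proof (intro allI impI)
 interpret C: algebraic_closure L K by (rule assms)
 fix as assume as: "set as <= carrier L \<and> as ~= []"
 define p where "p = rev (as @ [1[L]])"
 have p: "p \<in> carrier (poly_ring L)"
  unfolding p_def univ_poly_carrier[symmetric] polynomial_def using as by auto
 have "degree p > 0" using as by (simp add: p_def)
 moreover have "C.splitted p" by (rule C.roots_over_carrier[OF p])
 ultimately have "size (C.roots p) > 0" by (simp add: C.splitted_def)
 then obtain r where "r \<in># C.roots p" by (metis multiset_nonemptyE size_empty less_irrefl)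
 then have "C.is_root p r" using C.roots_mem_iff_is_root[OF p] by simp
 then have r: "r \<in>[L]" "C.eval p r = 0[L]" by (auto simp: C.is_root_def)
 have "C.eval p r = sev L (as @ [1[L]]) r" unfolding p_def using as r by (intro C.eval_rev) auto
 then show "\<exists>r\<in>carrier L. sev L (as @ [1[L]]) r = 0[L]" using r by auto
qed

text \<open>The given E need not contain eigenvalues of the elements of the nucleus, so the frame of
  E \<otimes> A is pushed to the algebraic closure of E, where
  \<open>semiassociative_of_frame\<close> applies. Separability of E is not lost from view: the
  subalgebra K found over F is etale by \<open>etale_K\<close>.\<close>

theorem form_imp_semiassociative:
 fixes F :: "('f, 'm) ring_scheme" and A :: "('f, 'a) module"
 assumes F: "field F" and A: "nonassoc_algebra F A" and form: "form_of_skew_matrix_algebra TYPE('e) F A"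
 shows "semiassociative F A"
proof -
 obtain E :: "('f, 'e) module" and n c where n: "n \<ge> 1" and c: "reduced_skew_set E n c"
  and sep: "separable_extension F E" and iso: "algebra_isomorphic E (tensor_algebra F E A) (skew_matrix_algebra E n c)"
  using form unfolding form_of_skew_matrix_algebra_def form_over_def by auto
 have E: "field E" "algebra F E" using sep by (auto simp: separable_extension_def)
 interpret Ef: field E by (rule E(1))
 define N where "N = tensor_algebra F E A"
 define \<phi> where "\<phi> a = tensor_class F E A [(1[E], a)]" for a
 define slice where "slice l = tlift A (\<lambda>e a. l e .[A] a)" for l :: "'e => 'f"
 have X: "scalar_extension F A E N \<phi> slice"
  using tensor_scalar_extension[OF F A E] by (simp add: N_def \<phi>_def[abs_def] slice_def[abs_def])
 interpret X: scalar_extension F A E N \<phi> slice by (rule X)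
 obtain h where "h \<in> algebra_isos E N (skew_matrix_algebra E n c)" using iso by (auto simp: algebra_isomorphic_def N_def)
 from X.M.frame_of_skew_iso[OF this c n] obtain G where G: "X.M.frame G" "G ~= {}" and fd: "finite_dimensional E N" by metis
 obtain C :: "((('e list \<times> nat) multiset) => 'e) ring" where C: "algebraic_closure C (Ef.indexed_const ` carrier E)"
  and j: "Ef.indexed_const \<in> ring_hom E C" by (rule Ef.exists_closure)
 have Cf: "field C" using C by (simp add: algebraic_closure_def)
 define j' :: "'f => ('e list \<times> nat) multiset => 'e" where "j' r = Ef.indexed_const (r .[E] 1[E])" for r
 note jh = ring_hom_memE[OF j]
 have j': "j' \<in> ring_hom F C"
 proof (rule ring_hom_memI)
  fix r s assume rs: "r \<in>[F]" "s \<in>[F]"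
  show "j' r \<in>[C]" using rs jh by (simp add: j'_def)
  have "(r *[F] s) .[E] 1[E] = (r .[E] 1[E]) *[E] (s .[E] 1[E])"
   using rs X.iota_mult[OF rs(1)] by (simp add: X.FE.smult_assoc1)
  then show "j' (r *[F] s) = j' r *[C] j' s" using rs jh by (simp add: j'_def)
  show "j' (r +[F] s) = j' r +[C] j' s" using rs jh by (simp add: j'_def X.FE.smult_l_distr)
 qed (use jh in \<open>simp add: j'_def\<close>)
 define L where "L = base_change Ef.indexed_const C"
 define L' where "L' = base_change j' C"
 note BL = base_change[OF fieldE(1)[OF E(1)] Cf j, folded L_def] and BL' = base_change[OF fieldE(1)[OF F] Cf j', folded L'_def]
 define M where "M = tensor_algebra E L N"
 have Y: "scalar_extension E N L M (\<lambda>t. tensor_class E L N [(1[L], t)]) (\<lambda>l. tlift N (\<lambda>e a. l e .[N] a))"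
  unfolding M_def by (rule tensor_scalar_extension[OF E(1) X.M.nonassoc_algebra_axioms BL])
 then have frY: "algebra_over_field.frame L M ((\<lambda>t. tensor_class E L N [(1[L], t)]) ` G)" (is "algebra_over_field.frame L M ?G")
  by (rule scalar_extension.frame_phi[OF _ G(1)])
 have Z: "scalar_extension F A L' M (\<lambda>a. tensor_class E L N [(1[L], \<phi> a)])
  (\<lambda>l. tlift A (\<lambda>w t. slice (\<lambda>e. l (e .[L] w)) t))"
  unfolding M_def by (rule scalar_extension_tower[OF X BL BL']) (simp_all add: L_def L'_def j'_def)
 interpret Y: scalar_extension E N L M "\<lambda>t. tensor_class E L N [(1[L], t)]" "\<lambda>l. tlift N (\<lambda>e a. l e .[N] a)" by (rule Y)
 interpret Z: scalar_extension F A L' M "\<lambda>a. tensor_class E L N [(1[L], \<phi> a)]"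
  "\<lambda>l. tlift A (\<lambda>w t. slice (\<lambda>e. l (e .[L] w)) t)" by (rule Z)
 \<comment> \<open>As rings L and L' coincide; they differ only as algebras, over E and over F. So
   the frames of M over them are the same.\<close>
 have "Z.M.frame ?G"
  using frY unfolding Z.M.frame_def Y.M.frame_def Z.M.idempotent_system_def Y.M.idempotent_system_def by (simp add: L_def L'_def)
 moreover have "root_closed L'"
  using algebraic_closure_root_closed[OF C] sev_cong[of L' C] by (simp add: root_closed_def L'_def)
 ultimately show ?thesis
  using Z.semiassociative_of_frame[OF _ X.finite_dimensional_descent[OF fd]] G(2) by simp
qed

section \<open>Minimal faithfulness forces one-dimensional corners\<close>

lemma tsum_map_pair: "tsum G f (map (\<lambda>(x, y). (p x y, q x y)) xs) = tsum G (\<lambda>x y. f (p x y) (q x y)) xs"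
 by (induction xs) auto

lemma product_lists: "[|xs \<in> lists S; ys \<in> lists T|] ==> List.product xs ys \<in> lists (S \<times> T)"
 by (auto simp: in_lists_conv_set)

lemma tsum_product:
 assumes G: "abelian_group G" and hs: "hs \<in> lists S'" and f: "\<forall>p\<in>S. \<forall>q\<in>S'. f p q \<in>[G]"
 shows "gs \<in> lists S ==> tsum G f (List.product gs hs) = tsum G (\<lambda>e k. tsum G (\<lambda>e' k'. f (e, k) (e', k')) hs) gs"
proof (induction gs rule: list.induct)
 case (Cons p gs)
 have p: "p \<in> S" "gs \<in> lists S" using Cons.prems by auto
 have m: "map (Pair p) hs \<in> lists (S \<times> S')" using hs p(1) by (auto simp: in_lists_conv_set)
 have "tsum G f (map (Pair p) hs) = tsum G (\<lambda>e' k'. f p (e', k')) hs" by (induction hs) auto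
 then show ?case
  using tsum_append[OF G, of "\<lparr>carrier = S\<rparr>" "\<lparr>carrier = S'\<rparr>" f "map (Pair p) hs" "List.product gs hs"] f m product_lists[OF p(2) hs] Cons.IH[OF p(2)]
  by (cases p) simp
qed simp

context split_algebra begin

lemma ext_list:
 assumes "y \<in> ext K"
 obtains gs where "gs \<in> lists (carrier E \<times> K)" "y = tsum M (\<lambda>e k. e .[M] \<phi> k) gs"
proof -
 have "\<exists>gs\<in>lists (carrier E \<times> K). y = tsum M (\<lambda>e k. e .[M] \<phi> k) gs"
  using K_sub assms
 proof (induction rule: ext_induct)
  case zero
  show ?case by (intro bexI[of _ "[]"]) simp_all
 next
  case (add e a y)
  then obtain gs where "gs \<in> lists (carrier E \<times> K)" "y = tsum M (\<lambda>e k. e .[M] \<phi> k) gs" by auto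
  then show ?case using add(1,2) by (intro bexI[of _ "(e, a) # gs"]) simp_all
 qed
 then show thesis using that by auto
qed

text \<open>The left side is the E-linear extension of \<chi>_h to \<open>ext K\<close>, evaluated
  at h itself. It is the scalar by which h acts on h, namely 1.\<close>

lemma chi_total:
 assumes h: "h \<in> H" and gs: "gs \<in> lists (carrier E \<times> K)" "h = tsum M (\<lambda>e k. e .[M] \<phi> k) gs"
 shows "tsum E (\<lambda>e k. e *[E] chi h k) gs = 1[E]"
proof -
 let ?\<alpha> = "tsum E (\<lambda>e k. e *[E] chi h k) gs"
 note hc = HD(3)[OF h]
 have p: "gs \<in> pairs E KA" using gs(1) by simp
 have cl: "\<forall>b\<in>carrier E. \<forall>c\<in>carrier KA. b *[E] chi h c \<in>[E]" using chi(1)[OF h] by simp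
 have cM: "\<forall>b\<in>carrier E. \<forall>c\<in>carrier KA. b .[M] \<phi> c \<in>[M]" using Kc by simp
 have \<alpha>: "?\<alpha> \<in>[E]" by (rule tsum_closed[OF M.R.abelian_group_axioms cl p])
 have "?\<alpha> .[M] h = tsum M (\<lambda>e k. (e *[E] chi h k) .[M] h) gs"
  by (rule tsum_hom[OF M.R.abelian_group_axioms cl p, of "\<lambda>r. r .[M] h"]) (use hc in \<open>simp_all add: M.smult_l_distr\<close>)
 also have "\<dots> = tsum M (\<lambda>e k. (e .[M] \<phi> k) *[M] h) gs"
  by (rule tsum_cong[OF gs(1)]) (use hc chi[OF h] Kc in \<open>simp add: M.smult_mult M.smult_assoc1\<close>)
 also have "\<dots> = tsum M (\<lambda>e k. e .[M] \<phi> k) gs *[M] h"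
  by (rule tsum_hom[OF M.M.abelian_group_axioms cM p, of "\<lambda>z. z *[M] h", symmetric]) (use hc in \<open>simp_all add: M.distrib_right\<close>)
 finally have "?\<alpha> .[M] h = h" using gs(2) HD(5)[OF h] by simp
 then have "(?\<alpha> -[E] 1[E]) .[M] h = 0[M]" using \<alpha> hc by (simp add: a_minus_def M.smult_l_distr M.smult_l_minus M.M.r_neg)
 then show ?thesis using M.smult_eq_zero[of "?\<alpha> -[E] 1[E]" h] \<alpha> hc HD(4)[OF h] by auto
qed

text \<open>If \<open>g M h = 0\<close>, all slices of \<open>g \<otimes> h\<close> lie in the annihilator of \<open>A\<close> in \<open>K \<otimes> K\<close>, so they
 vanish; but \<open>\<chi>\<^sub>g \<otimes> \<chi>\<^sub>h\<close> takes the value 1 at \<open>g \<otimes> h\<close>.\<close>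

lemma corner_nonzero_of_faithful:
 assumes faith: "faithful_module RK (bimodule A)" and g: "g \<in> H" and h: "h \<in> H"
 shows "\<exists>m\<in>carrier M. (g *[M] m) *[M] h ~= 0[M]"
proof (rule ccontr)
 assume "\<not> ?thesis"
 then have z: "(g *[M] m) *[M] h = 0[M]" if "m \<in>[M]" for m using that by blast
 note gc = HD(3)[OF g] and hc = HD(3)[OF h]
 obtain gs where gs: "gs \<in> lists (carrier E \<times> K)" "g = tsum M (\<lambda>e k. e .[M] \<phi> k) gs" using ext_list[of g] H_ext g by auto
 obtain hs where hs: "hs \<in> lists (carrier E \<times> K)" "h = tsum M (\<lambda>e k. e .[M] \<phi> k) hs" using ext_list[of h] H_ext h by auto
 have gp: "gs \<in> pairs E KA" and hp: "hs \<in> pairs E KA" using gs(1) hs(1) by simp_all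
 define zs where "zs = List.product gs hs"
 have zs: "zs \<in> lists ((carrier E \<times> K) \<times> (carrier E \<times> K))" unfolding zs_def by (rule product_lists[OF gs(1) hs(1)])
 have cM: "\<forall>b\<in>carrier E. \<forall>c\<in>carrier KA. b .[M] \<phi> c \<in>[M]" using Kc by simp
 \<comment> \<open>The slice of g \<otimes> h along l, with the scalars of both factors multiplied
   together before l is applied.\<close>
 define ts where "ts l = map (\<lambda>(p, q). (l (fst p *[E] fst q) .[A] snd p, snd q)) zs" for l
 have ts: "ts l \<in> pairs KA KA" if l: "l \<in> functionals F E" for l
  unfolding ts_def by (rule map_lists[OF zs]) (use functionalsD(1)[OF l] KD(4) in auto)
 have sum: "bimodule_sum A (ts l) a = 0[A]" if l: "l \<in> functionals F E" and a: "a \<in>[A]" for l a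
 proof -
  define f where "f p q = ((fst p .[M] \<phi> (snd p)) *[M] \<phi> a) *[M] (fst q .[M] \<phi> (snd q))" for p q :: "'e \<times> 'a"
  have fe: "f p q = (fst p *[E] fst q) .[M] \<phi> ((snd p *[A] a) *[A] snd q)"
   if "p \<in> carrier E \<times> K" "q \<in> carrier E \<times> K" for p q
   using that a Kc by (auto simp: f_def phi_mult M.smult_mult M.mult_smult M.R.m_comm simp flip: M.smult_assoc1)
  have fc: "\<forall>p\<in>carrier E \<times> K. \<forall>q\<in>carrier E \<times> K. f p q \<in>[M]" using a Kc by (auto simp: f_def)
  have "0[M] = (tsum M (\<lambda>e k. e .[M] \<phi> k) gs *[M] \<phi> a) *[M] h" using z[OF phi_closed[OF a]] gs(2) by simp
  also have "\<dots> = tsum M (\<lambda>e k. ((e .[M] \<phi> k) *[M] \<phi> a) *[M] h) gs"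
   by (rule tsum_hom[OF M.M.abelian_group_axioms cM gp, of "\<lambda>y. (y *[M] \<phi> a) *[M] h"]) (use a hc in \<open>simp_all add: M.distrib_right\<close>)
  also have "\<dots> = tsum M (\<lambda>e k. tsum M (\<lambda>e' k'. f (e, k) (e', k')) hs) gs"
  proof (rule tsum_cong[OF gs(1)])
   fix e k assume ek: "e \<in>[E]" "k \<in> K"
   have "((e .[M] \<phi> k) *[M] \<phi> a) *[M] h = ((e .[M] \<phi> k) *[M] \<phi> a) *[M] tsum M (\<lambda>e k. e .[M] \<phi> k) hs" using hs(2) by simp
   also have "\<dots> = tsum M (\<lambda>e' k'. ((e .[M] \<phi> k) *[M] \<phi> a) *[M] (e' .[M] \<phi> k')) hs"
    by (rule tsum_hom[OF M.M.abelian_group_axioms cM hp]) (use ek a Kc in \<open>simp_all add: M.distrib_left\<close>)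
   finally show "((e .[M] \<phi> k) *[M] \<phi> a) *[M] h = tsum M (\<lambda>e' k'. f (e, k) (e', k')) hs" by (simp add: f_def)
  qed
  also have "\<dots> = tsum M f zs" unfolding zs_def by (rule tsum_product[OF M.M.abelian_group_axioms hs(1) fc gs(1), symmetric])
  finally have "0[A] = slice l (tsum M f zs)" using slice_zero[OF l] by metis
  also have "\<dots> = tsum A (\<lambda>p q. slice l (f p q)) zs"
   by (rule tsum_hom[OF M.M.abelian_group_axioms, of "\<lparr>carrier = carrier E \<times> K\<rparr>" "\<lparr>carrier = carrier E \<times> K\<rparr>"])
    (use fc zs slice_add[OF l] l in simp_all)
  also have "\<dots> = tsum A (\<lambda>p q. ((l (fst p *[E] fst q) .[A] snd p) *[A] a) *[A] snd q) zs"
  proof (rule tsum_cong[OF zs])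
   fix p q assume pq: "p \<in> carrier E \<times> K" "q \<in> carrier E \<times> K"
   then have c: "fst p *[E] fst q \<in>[E]" "snd p \<in>[A]" "snd q \<in>[A]" using Kc by auto
   show "slice l (f p q) = ((l (fst p *[E] fst q) .[A] snd p) *[A] a) *[A] snd q"
    using slice_phi[OF l c(1), of "(snd p *[A] a) *[A] snd q"] fe[OF pq] a c functionalsD(1)[OF l c(1)] by (simp add: A.smult_mult)
  qed
  finally show ?thesis unfolding bimodule_sum_tsum ts_def tsum_map_pair by simp
 qed
 have rel: "T.rel (ts l) []" if l: "l \<in> functionals F E" for l
 proof -
  have "T.cls (ts l) = 0[RK]"
   using faith T.cls_closed[OF ts[OF l]] bimodule_smult[OF ts[OF l]] sum[OF l] unfolding faithful_module_def by simp
  then show ?thesis using T.cls_eq[OF ts[OF l]] by (simp add: T.zero_T)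
 qed
 have balE: "balanced_map F KA KA E (\<lambda>k k'. chi g k *[E] chi h k')"
  unfolding balanced_map_def using chi(1)[OF g] chi(1)[OF h] chi_add[OF g] chi_add[OF h] chi_smult[OF g] chi_smult[OF h]
  by (simp add: M.R.l_distr M.R.r_distr FE.smult_assoc2 FE.smult_assoc2_right)
 \<comment> \<open>Keeping the scalars e e' to the left and applying \<chi>_g \<otimes> \<chi>_h to
   the right gives an element of E \<otimes> E. Each of its slices is the image of some
   \<open>ts l\<close>, so it is zero; yet multiplying its two factors together gives 1.\<close>
 define xs where "xs = map (\<lambda>(p, q). (fst p *[E] fst q, chi g (snd p) *[E] chi h (snd q))) zs"
 have xs: "xs \<in> pairs E E" unfolding xs_def by (rule map_lists[OF zs]) (use chi(1)[OF g] chi(1)[OF h] in auto)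
 interpret EE: tensor_modules F E E by unfold_locales
 have "EE.rel xs []"
 proof (rule EE.rel_Nil_if_slices_vanish[OF Set.subset_refl _ xs])
  show "\<exists>\<mu>\<in>functionals F E. \<mu> b = 1[F]" if "b \<in>[E]" "b ~= 0[E]" for b
   using FE.functional_exists[OF that] by metis
  fix l assume l: "l \<in> functionals F E"
  have "0[E] = tsum E (\<lambda>k k'. chi g k *[E] chi h k') (ts l)"
   using EE.tsum_rel T.tsum_rel[OF M.R.abelian_group_axioms balE rel[OF l]] by simp
  also have "\<dots> = tsum E (\<lambda>p q. chi g (l (fst p *[E] fst q) .[A] snd p) *[E] chi h (snd q)) zs"
   unfolding ts_def tsum_map_pair ..
  also have "\<dots> = tsum E (\<lambda>p q. l (fst p *[E] fst q) .[E] (chi g (snd p) *[E] chi h (snd q))) zs"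
  proof (rule tsum_cong[OF zs])
   fix p q assume pq: "p \<in> carrier E \<times> K" "q \<in> carrier E \<times> K"
   then have c: "l (fst p *[E] fst q) \<in>[F]" "snd p \<in> K" "snd q \<in> K" using functionalsD(1)[OF l] by auto
   then show "chi g (l (fst p *[E] fst q) .[A] snd p) *[E] chi h (snd q) = l (fst p *[E] fst q) .[E] (chi g (snd p) *[E] chi h (snd q))"
    using chi(1)[OF g] chi(1)[OF h] chi_smult[OF g] by (simp add: FE.smult_assoc2)
  qed
  also have "\<dots> = tsum E (\<lambda>c d. l c .[E] d) xs" unfolding xs_def tsum_map_pair ..
  finally show "tsum E (\<lambda>c d. l c .[E] d) xs = 0[E]" by simp
 qed
 moreover have "balanced_map F E E E (mop E)"
  unfolding balanced_map_def by (simp add: M.R.l_distr M.R.r_distr FE.smult_assoc2 FE.smult_assoc2_right)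
 ultimately have "tsum E (mop E) xs = 0[E]"
  using EE.tsum_rel[OF M.R.abelian_group_axioms, of "(mop E)" xs "[]"] by simp
 moreover have "tsum E (mop E) xs = 1[E]"
 proof -
  define f where "f p q = (fst p *[E] chi g (snd p)) *[E] (fst q *[E] chi h (snd q))" for p q :: "'e \<times> 'a"
  have fc: "\<forall>p\<in>carrier E \<times> K. \<forall>q\<in>carrier E \<times> K. f p q \<in>[E]" using chi(1)[OF g] chi(1)[OF h] by (auto simp: f_def)
  have cg: "\<forall>b\<in>carrier E. \<forall>c\<in>carrier KA. b *[E] chi g c \<in>[E]" using chi(1)[OF g] by simp
  have ch: "\<forall>b\<in>carrier E. \<forall>c\<in>carrier KA. b *[E] chi h c \<in>[E]" using chi(1)[OF h] by simp
  have "tsum E (mop E) xs = tsum E f zs"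
   unfolding xs_def tsum_map_pair by (rule tsum_cong[OF zs]) (use chi(1)[OF g] chi(1)[OF h] in \<open>auto simp: f_def M.R.m_ac\<close>)
  also have "\<dots> = tsum E (\<lambda>e k. tsum E (\<lambda>e' k'. f (e, k) (e', k')) hs) gs"
   unfolding zs_def by (rule tsum_product[OF M.R.abelian_group_axioms hs(1) fc gs(1)])
  also have "\<dots> = tsum E (\<lambda>e k. e *[E] chi g k) gs"
  proof (rule tsum_cong[OF gs(1)])
   fix e k assume ek: "e \<in>[E]" "k \<in> K"
   have "tsum E (\<lambda>e' k'. f (e, k) (e', k')) hs = (e *[E] chi g k) *[E] tsum E (\<lambda>e k. e *[E] chi h k) hs"
    unfolding f_def fst_conv snd_conv
    by (rule tsum_hom[OF M.R.abelian_group_axioms ch hp, symmetric]) (use ek chi(1)[OF g] in \<open>simp_all add: M.R.r_distr\<close>)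
   then show "tsum E (\<lambda>e' k'. f (e, k) (e', k')) hs = e *[E] chi g k"
    unfolding chi_total[OF h hs] using ek chi(1)[OF g] by simp
  qed
  also have "\<dots> = 1[E]" by (rule chi_total[OF g gs])
  finally show ?thesis .
 qed
 ultimately show False using M.one_not_zero by simp
qed

lemma linear_op_bimodule_sum:
 assumes "ts \<in> pairs KA KA" shows "linear_op F A (bimodule_sum A ts)"
 using assms
proof (induction ts rule: list.induct)
 case Nil
 then show ?case by (simp add: linear_op_def bimodule_sum_def)
next
 case (Cons p ts)
 obtain k k' where p: "p = (k, k')" by force
 with Cons.prems have c: "k \<in> K" "k' \<in> K" "ts \<in> pairs KA KA" by auto
 note L = linear_opD[OF Cons.IH[OF c(3)]]
 have "bimodule_sum A (p # ts) m = (k *[A] m) *[A] k' +[A] bimodule_sum A ts m" for m by (simp add: p bimodule_sum_def)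
 then show ?case using L Kc[OF c(1)] Kc[OF c(2)] unfolding linear_op_def
  by (simp add: A.distrib_left A.distrib_right A.mult_smult A.smult_mult A.smult_r_distr A.M.a_ac)
qed

lemma act_sandwich:
 assumes y: "y \<in> ext K" "y' \<in> ext K" and m: "m \<in>[M]"
 shows "ts \<in> pairs KA KA ==> act ts ((y *[M] m) *[M] y') = (y *[M] act ts m) *[M] y'"
proof (induction ts rule: list.induct)
 case Nil
 then show ?case using ext_closed[OF y(1)] ext_closed[OF y(2)] by (simp add: act_def)
next
 case (Cons p ts)
 obtain k k' where p: "p = (k, k')" by force
 with Cons.prems have c: "k \<in> K" "k' \<in> K" "ts \<in> pairs KA KA" by auto
 note yc = ext_closed[OF y(1)] ext_closed[OF y(2)] and kc = phi_closed[OF Kc[OF c(1)]] phi_closed[OF Kc[OF c(2)]]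
 note yn = ext_K_nucleus[OF y(1)] ext_K_nucleus[OF y(2)]
 have ke: "\<phi> k \<in> ext K" "\<phi> k' \<in> ext K" using phi_ext_iff[OF K_sub Kc[OF c(1)]] phi_ext_iff[OF K_sub Kc[OF c(2)]] c by auto
 note kn = ext_K_nucleus[OF ke(1)] ext_K_nucleus[OF ke(2)]
 have lc: "\<phi> k *[M] (y *[M] w) = y *[M] (\<phi> k *[M] w)" if "w \<in>[M]" for w
  using M.nucleus_assoc(1)[OF kn(1) yc(1) that] M.nucleus_assoc(1)[OF yn(1) kc(1) that] ext_K_comm[OF ke(1) y(1)] by simp
 have "(\<phi> k *[M] ((y *[M] m) *[M] y')) *[M] \<phi> k' = (\<phi> k *[M] (y *[M] (m *[M] y'))) *[M] \<phi> k'"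
  using M.nucleus_assoc(1)[OF yn(1) m yc(2)] by simp
 also have "\<dots> = y *[M] (\<phi> k *[M] (m *[M] (y' *[M] \<phi> k')))"
  using lc m yc kc yn kn by (simp add: M.nucleus_assoc)
 also have "\<dots> = (y *[M] ((\<phi> k *[M] m) *[M] \<phi> k')) *[M] y'"
  unfolding ext_K_comm[OF y(2) ke(2)] using m yc kc yn kn by (simp add: M.nucleus_assoc)
 finally show ?case using Cons.IH[OF c(3)] act_closed[OF c(3) m] yc kc m by (simp add: p act_def M.distrib_left M.distrib_right)
qed

lemma corner_killed_ext:
 assumes N: "submodule N F A" and gh: "g \<in>[M]" "h \<in>[M]"
  and k: "!!v. v \<in> N ==> (g *[M] \<phi> v) *[M] h = 0[M]" and z: "z \<in> ext N"
 shows "(g *[M] z) *[M] h = 0[M]"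
 using N z
proof (induction rule: ext_induct)
 case (add e a y)
 then show ?case using gh k[OF add(2)] by (simp add: M.distrib_left M.distrib_right M.smult_mult M.mult_smult)
qed (use gh in simp)

text \<open>Write R for K \<otimes> K and let N be a minimal submodule of A with g
  (\<open>ext N\<close>) h nonzero. By minimality N = R v is cyclic, and since R acts on gMh by
  scalars, g (\<open>ext N\<close>) h is the line through w = g \<phi>(v) h. As N is nonzero, A / N
  is not faithful: some nonzero t carries A into N. If t acts on gMh by a nonzero scalar, then gMh
  lies in \<open>ext N\<close> and is that line. If it acted by 0, the kernel of t in N would still
  have a nonzero (g,h)-corner, hence be N, so t would act on A with square zero; but a nonzero t
  acts by a nonzero scalar on some nonzero corner.\<close>

lemma corner_one_dimensional:
 assumes fd: "finite_dimensional F A" and mf: "minimally_faithful RK (bimodule A)" and g: "g \<in> H" and h: "h \<in> H"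
 obtains u where "u \<in>[M]" "u ~= 0[M]" "g *[M] u = u" "u *[M] h = u"
  "!!z. z \<in>[M] ==> \<exists>r\<in>carrier E. (g *[M] z) *[M] h = r .[M] u"
proof -
 interpret Bm: module RK "bimodule A" by (rule module_bimodule)
 note gn = HD(2)[OF g] and gc = HD(3)[OF g] and hn = HD(2)[OF h] and hc = HD(3)[OF h]
 have ge: "g \<in> ext K" and he: "h \<in> ext K" using H_ext g h by auto
 have faith: "faithful_module RK (bimodule A)" using mf by (simp add: minimally_faithful_def)
 note nz = corner_nonzero_of_faithful[OF faith]
 have idem: "g *[M] ((g *[M] m) *[M] h) = (g *[M] m) *[M] h" "((g *[M] m) *[M] h) *[M] h = (g *[M] m) *[M] h"
  if m: "m \<in>[M]" for m
 proof -
  have "g *[M] ((g *[M] m) *[M] h) = ((g *[M] g) *[M] m) *[M] h"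
   using gn hn gc hc m M.nucleus_assoc(1)[OF gn gc m] M.nucleus_assoc(1)[OF gn _ hc, of "g *[M] m"] by simp
  then show "g *[M] ((g *[M] m) *[M] h) = (g *[M] m) *[M] h" using HD(5)[OF g] by simp
  show "((g *[M] m) *[M] h) *[M] h = (g *[M] m) *[M] h"
   using M.nucleus_assoc(3)[OF hn _ hc, of "g *[M] m"] HD(5)[OF h] gc m by simp
 qed
 define P where "P N \<longleftrightarrow> submodule N RK (bimodule A) \<and> (\<exists>v\<in>N. (g *[M] \<phi> v) *[M] h ~= 0[M])" for N
 have full: "submodule (carrier A) RK (bimodule A)"
  using Bm.M.a_inv_closed Bm.smult_closed by (intro Bm.submoduleI) auto
 have fullF: "submodule (carrier A) F A" by (rule submodule_bimodule(1)[OF full])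
 obtain m0 where m0: "m0 \<in>[M]" "(g *[M] m0) *[M] h ~= 0[M]" using nz[OF g h] by auto
 have "P (carrier A)"
 proof (rule ccontr)
  assume "\<not> P (carrier A)"
  then have k: "(g *[M] \<phi> v) *[M] h = 0[M]" if "v \<in>[A]" for v using full that by (auto simp: P_def)
  show False using corner_killed_ext[OF fullF gc hc k, of m0] ext_carrier m0 by simp
 qed
 moreover have "submodule N F A" if "P N" for N using submodule_bimodule(1) that by (auto simp: P_def)
 ultimately obtain N where N: "P N" "!!N'. [|P N'; N' <= N|] ==> N' = N"
  using A.minimal_submodule[OF fd, of P "carrier A"] by metis
 have SN: "submodule N RK (bimodule A)" using N(1) by (simp add: P_def)
 note SF = submodule_bimodule(1)[OF SN]
 note D = Bm.submoduleD[OF SN, simplified] and SE = submodule_ext[OF SF]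
 note DE = M.submoduleD[OF SE]
 obtain v where v: "v \<in> N" "(g *[M] \<phi> v) *[M] h ~= 0[M]" using N(1) by (auto simp: P_def)
 have vc: "v \<in>[A]" using v(1) D(1) by auto
 define w where "w = (g *[M] \<phi> v) *[M] h"
 have wc: "w \<in>[M]" using gc hc vc by (simp add: w_def)
 have phiN: "\<phi> a \<in> ext N" if "a \<in> N" for a using phi_ext_iff[OF SF] that D(1) by auto
 have wN: "w \<in> ext N" unfolding w_def by (rule ext_sandwich[OF SN ge he phiN[OF v(1)]])
 define Rv where "Rv = (\<lambda>r. r .[bimodule A] v) ` carrier RK"
 have Rv: "submodule Rv RK (bimodule A)"
 proof (rule Bm.submoduleI)
  show "Rv <= carrier (bimodule A)" using Bm.smult_closed vc by (auto simp: Rv_def)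
  show "0[bimodule A] \<in> Rv" unfolding Rv_def by (rule image_eqI[of _ _ "0[RK]"]) (use vc Bm.smult_l_null[of v] in auto)
  fix x assume "x \<in> Rv"
  then obtain r where r: "r \<in>[RK]" "x = r .[bimodule A] v" by (auto simp: Rv_def)
  show "-[bimodule A] x \<in> Rv" unfolding Rv_def by (rule image_eqI[of _ _ "-[RK] r"]) (use r vc Bm.smult_l_minus[of r v] in auto)
  show "s .[bimodule A] x \<in> Rv" if s: "s \<in>[RK]" for s
   unfolding Rv_def by (rule image_eqI[of _ _ "s *[RK] r"]) (use r s vc Bm.smult_assoc1[of s r v] in auto)
  fix y assume "y \<in> Rv"
  then obtain s where s: "s \<in>[RK]" "y = s .[bimodule A] v" by (auto simp: Rv_def)
  show "x +[bimodule A] y \<in> Rv"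
   unfolding Rv_def by (rule image_eqI[of _ _ "r +[RK] s"]) (use r s vc Bm.smult_l_distr[of r s v] in auto)
 qed
 have "v \<in> Rv" unfolding Rv_def by (rule image_eqI[of _ _ "1[RK]"]) (use vc Bm.smult_one[of v] in auto)
 then have "P Rv" using Rv v(2) by (auto simp: P_def)
 moreover have "Rv <= N" using D(4) v(1) by (auto simp: Rv_def)
 ultimately have NRv: "Rv = N" by (rule N(2))
 have "N ~= {0[A]}" using v gc hc by auto
 then have "\<not> faithful_module RK (section_module (bimodule A) (carrier A) N)"
  using mf full SN D(1) unfolding minimally_faithful_def bimodule_simps by blast
 then obtain t where t: "t \<in>[RK]" "t ~= 0[RK]"
  "!!S. S \<in> carrier (section_module (bimodule A) (carrier A) N) ==> t .[section_module (bimodule A) (carrier A) N] S = N"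
  unfolding faithful_module_def by (auto simp: section_module_def)
 obtain ts where ts: "ts \<in> pairs KA KA" "t = T.cls ts" using T.carrierE[OF t(1)] .
 have tN: "bimodule_sum A ts a \<in> N" if a: "a \<in>[A]" for a
 proof -
  define S where "S = (\<Union>n\<in>N. {n +[A] a})"
  have "S \<in> carrier (section_module (bimodule A) (carrier A) N)"
   unfolding section_module_def A_RCOSETS_def' a_r_coset_def' S_def using a by auto
  from t(3)[OF this] have "(\<Union>x\<in>S. N +>\<^bsub>bimodule A\<^esub> (t .[bimodule A] x)) = N" by (simp add: section_module_def)
  moreover have "a \<in> S" unfolding S_def using D(2) a by (intro UN_I[of "0[A]"]) simp_all
  ultimately have "N +>\<^bsub>bimodule A\<^esub> (t .[bimodule A] a) <= N" by auto
  moreover have "bimodule_sum A ts a \<in> N +>\<^bsub>bimodule A\<^esub> (t .[bimodule A] a)"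
   unfolding a_r_coset_def' using D(2) bimodule_smult[OF ts(1) a] bimodule_sum_closed[OF ts(1) a] ts(2)
   by (intro UN_I[of "0[A]"]) simp_all
  ultimately show ?thesis by auto
 qed
 note La = linear_op_act[OF ts(1)] and Lb = linear_op_bimodule_sum[OF ts(1)]
 have actN: "act ts m \<in> ext N" if "m \<in>[M]" for m
  using that
 proof (induction rule: span_induct)
  case zero
  then show ?case using M.linear_op_zero[OF La] DE(2) by simp
 next
  case (add e a y)
  have "act ts (\<phi> a) \<in> ext N" using act_phi[OF ts(1) add(2)] phiN[OF tN[OF add(2)]] by simp
  then show ?case using add linear_opD[OF La] DE(3,4) by simp
 qed
 have rho: "rho g h ts ~= 0[E]"
 proof
  assume z: "rho g h ts = 0[E]"
  define N2 where "N2 = {n \<in> N. t .[bimodule A] n = 0[A]}"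
  have bs: "t .[bimodule A] n = bimodule_sum A ts n" if "n \<in> N" for n using bimodule_smult[OF ts(1)] ts(2) that D(1) by auto
  have N2e: "N2 = {n \<in> N. bimodule_sum A ts n = 0[A]}" using bs by (auto simp: N2_def)
  have mz: "-[bimodule A] 0[A] = 0[A]" using Bm.M.a_inv_zero by (simp only: bimodule_simps)
  have N2: "submodule N2 RK (bimodule A)"
  proof (rule Bm.submoduleI)
   show "N2 <= carrier (bimodule A)" "0[bimodule A] \<in> N2" using D(1,2) t(1) Bm.smult_r_null[of t] by (auto simp: N2_def)
   fix x assume x: "x \<in> N2"
   then have xN: "x \<in> N" "x \<in>[A]" "t .[bimodule A] x = 0[A]" using D(1) by (auto simp: N2_def)
   show "-[bimodule A] x \<in> N2"
    using D(5)[OF xN(1)] Bm.smult_r_minus[of t x] t(1) xN mz by (simp add: N2_def)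
   show "x +[bimodule A] y \<in> N2" if y: "y \<in> N2" for y
    using y xN D(1,3) Bm.smult_r_distr[of t x y] t(1) by (auto simp: N2_def)
   show "s .[bimodule A] x \<in> N2" if s: "s \<in>[RK]" for s
   proof -
    have "t .[bimodule A] (s .[bimodule A] x) = s .[bimodule A] (t .[bimodule A] x)"
     using Bm.smult_assoc1[of t s x] Bm.smult_assoc1[of s t x] Bm.R.m_comm[of s t] t(1) s xN(2) by simp
    then show ?thesis using D(4)[OF s xN(1)] xN(3) Bm.smult_r_null[of s] s by (simp add: N2_def)
   qed
  qed
  note S2 = submodule_bimodule(1)[OF N2]
  have "act ts w = 0[M]" using act_corner[OF g h phi_closed[OF vc] ts(1)] z wc by (simp add: w_def)
  then have "w \<in> ext N2" unfolding N2e by (intro ext_kernel[OF SF Lb La _ wN] act_phi[OF ts(1)])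
  moreover have "(g *[M] w) *[M] h ~= 0[M]" using idem[OF phi_closed[OF vc]] v(2) by (simp add: w_def)
  ultimately have "P N2" using corner_killed_ext[OF S2 gc hc, of w] N2 by (auto simp: P_def)
  then have "N2 = N" by (rule N(2)) (auto simp: N2_def)
  then have kill: "bimodule_sum A ts n = 0[A]" if "n \<in> N" for n using that N2e by auto
  have killE: "act ts y = 0[M]" if "y \<in> ext N" for y
   using SF that
  proof (induction rule: ext_induct)
   case zero
   then show ?case by (rule M.linear_op_zero[OF La])
  next
   case (add e a y)
   then show ?case using linear_opD[OF La] act_phi[OF ts(1) add(3)] kill[OF add(2)] by simp
  qed
  \<comment> \<open>A nonzero t has a nonzero value at some pair of characters. On that corner t is
    invertible, so the corner lies in \<open>ext N\<close>, where t acts as zero.\<close>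
  obtain g' h' where gh': "g' \<in> H" "h' \<in> H" "rho g' h' ts ~= 0[E]"
  proof (rule ccontr)
   assume "\<not> thesis"
   with that have "T.rel ts []" using rho_zero_imp_rel_Nil[OF ts(1)] by metis
   then show False using T.cls_eqI t(2) ts(2) by (simp add: T.zero_T)
  qed
  obtain m where m: "m \<in>[M]" "(g' *[M] m) *[M] h' ~= 0[M]" using nz[OF gh'(1,2)] by auto
  have c: "(g' *[M] m) *[M] h' \<in>[M]" using HD(3)[OF gh'(1)] HD(3)[OF gh'(2)] m by simp
  note rc = rho_closed[OF gh'(1,2) ts(1)] and ac = act_corner[OF gh'(1,2) m(1) ts(1)]
  have "rho g' h' ts .[M] ((g' *[M] m) *[M] h') \<in> ext N" using actN[OF c] ac by simp
  from M.submodule_smult_cancel[OF SE rc gh'(3) c this] have "act ts ((g' *[M] m) *[M] h') = 0[M]" by (rule killE)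
  then show False using ac M.smult_eq_zero[OF rc c] gh'(3) m(2) by auto
 qed
 have line: "\<exists>s\<in>carrier E. (g *[M] y) *[M] h = s .[M] w" if "y \<in> ext N" for y
  using SF that
 proof (induction rule: ext_induct)
  case zero
  then show ?case using gc hc wc by (intro bexI[of _ "0[E]"]) simp_all
 next
  case (add e a y)
  then obtain s where s: "s \<in>[E]" "(g *[M] y) *[M] h = s .[M] w" by auto
  obtain r where r: "r \<in>[RK]" "a = r .[bimodule A] v" using add(2) NRv by (auto simp: Rv_def)
  obtain rs where rs: "rs \<in> pairs KA KA" "r = T.cls rs" using T.carrierE[OF r(1)] .
  have "\<phi> a = act rs (\<phi> v)" using act_phi[OF rs(1) vc] bimodule_smult[OF rs(1) vc] r(2) rs(2) by simp
  then have "(g *[M] \<phi> a) *[M] h = rho g h rs .[M] w"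
   using act_sandwich[OF ge he phi_closed[OF vc] rs(1)] act_corner[OF g h phi_closed[OF vc] rs(1)] by (simp add: w_def)
  then have "(g *[M] (e .[M] \<phi> a +[M] y)) *[M] h = (e *[E] rho g h rs +[E] s) .[M] w"
   using add gc hc s wc rho_closed[OF g h rs(1)]
   by (simp add: M.distrib_left M.distrib_right M.mult_smult M.smult_mult M.smult_l_distr M.smult_assoc1)
  then show ?case using add(1) s(1) rho_closed[OF g h rs(1)] by (intro bexI[of _ "e *[E] rho g h rs +[E] s"]) simp_all
 qed
 show thesis
 proof (rule that[of w])
  show "w \<in>[M]" "w ~= 0[M]" using wc v(2) by (simp_all add: w_def)
  show "g *[M] w = w" "w *[M] h = w" using idem[OF phi_closed[OF vc]] by (simp_all add: w_def)
  fix z assume z: "z \<in>[M]"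
  define y where "y = (g *[M] z) *[M] h"
  have yc: "y \<in>[M]" using gc hc z by (simp add: y_def)
  have "rho g h ts .[M] y \<in> ext N" using actN[OF yc] act_corner[OF g h z ts(1)] by (simp add: y_def)
  from M.submodule_smult_cancel[OF SE rho_closed[OF g h ts(1)] rho yc this] have "y \<in> ext N" .
  from line[OF this] show "\<exists>r\<in>carrier E. (g *[M] z) *[M] h = r .[M] w" using idem[OF z] by (simp add: y_def)
 qed
qed

theorem frame_of_minimally_faithful:
 assumes fd: "finite_dimensional F A" and mf: "minimally_faithful RK (bimodule A)"
 shows "M.frame H"
 unfolding M.frame_def
proof (intro conjI H_sys ballI)
 fix g h assume gh: "g \<in> H" "h \<in> H"
 obtain u where u: "u \<in>[M]" "u ~= 0[M]" "g *[M] u = u" "u *[M] h = u"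
  "!!z. z \<in>[M] ==> \<exists>r\<in>carrier E. (g *[M] z) *[M] h = r .[M] u"
  using corner_one_dimensional[OF fd mf gh] by metis
 then show "\<exists>u\<in>carrier M. u ~= 0[M] \<and> g *[M] u = u \<and> u *[M] h = u \<and>
  (\<forall>z\<in>carrier M. \<exists>r\<in>carrier E. (g *[M] z) *[M] h = r .[M] u)" by (intro bexI[of _ u]) simp_all
qed

end

text \<open>The product of u_ij and u_jl lies in the corner spanned by u_il, which defines c_ijl.
  The coordinates of an element are its Peirce components measured against the u_ij.\<close>

lemma (in algebra_over_field) skew_iso_of_frame:
 assumes G: "frame G" "G ~= {}"
 obtains n c where "n \<ge> 1" "reduced_skew_set F n c" "algebra_isomorphic F A (skew_matrix_algebra F n c)"
proof -
 note sys = frame_system[OF G(1)]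
 note GD = idempotent_systemD[OF sys]
 define n where "n = card G"
 have n: "n \<ge> 1" using G(2) GD(1) by (simp add: n_def Suc_le_eq card_gt_0_iff)
 define I where "I = {1..n}"
 have fI: "finite I" by (simp add: I_def)
 obtain e where e: "bij_betw e I G" using finite_same_card_bij[of I G] GD(1) by (auto simp: I_def n_def)
 have eG: "e i \<in> G" if "i \<in> I" for i using e that by (auto simp: bij_betw_def)
 have ec: "e i \<in>[A]" and en: "e i \<in> nucleus A" if "i \<in> I" for i using GD(2,3) eG[OF that] by auto
 have ee: "e i *[A] e j = (if i = j then e i else 0[A])" if "i \<in> I" "j \<in> I" for i j
  using GD(5)[OF eG[OF that(1)]] GD(6)[OF eG[OF that(1)] eG[OF that(2)]] that inj_on_eq_iff[OF bij_betw_imp_inj_on[OF e], of i j] by auto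
 have Ge: "g \<in> G ==> \<exists>i\<in>I. g = e i" for g using e by (force simp: bij_betw_def)
 have unit: "\<exists>u. u \<in>[A] \<and> u ~= 0[A] \<and> e i *[A] u = u \<and> u *[A] e j = u \<and>
  (\<forall>z\<in>carrier A. \<exists>r\<in>carrier F. (e i *[A] z) *[A] e j = r .[A] u) \<and> (i = j --> u = e i)" if ij: "i \<in> I" "j \<in> I" for i j
 proof (cases "i = j")
  case True
  then show ?thesis using frame_corner[OF G(1) eG[OF ij(1)]] ec[OF ij(1)] GD(4,5)[OF eG[OF ij(1)]] by (intro exI[of _ "e i"]) auto
 next
  case False
  obtain u where "u \<in>[A]" "u ~= 0[A]" "e i *[A] u = u" "u *[A] e j = u"
   "!!z. z \<in>[A] ==> \<exists>r\<in>carrier F. (e i *[A] z) *[A] e j = r .[A] u"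
   using frame_unit[OF G(1) eG[OF ij(1)] eG[OF ij(2)]] by metis
  then show ?thesis using False by (intro exI[of _ u]) auto
 qed
 \<comment> \<open>The normalization u_ii = e_i makes c reduced.\<close>
 define u where "u i j = (SOME u. u \<in>[A] \<and> u ~= 0[A] \<and> e i *[A] u = u \<and> u *[A] e j = u \<and>
  (\<forall>z\<in>carrier A. \<exists>r\<in>carrier F. (e i *[A] z) *[A] e j = r .[A] u) \<and> (i = j --> u = e i))" for i j
 have u: "u i j \<in>[A]" "u i j ~= 0[A]" "e i *[A] u i j = u i j" "u i j *[A] e j = u i j"
  "!!z. z \<in>[A] ==> \<exists>r\<in>carrier F. (e i *[A] z) *[A] e j = r .[A] u i j" "i = j ==> u i j = e i" if "i \<in> I" "j \<in> I" for i j
  using someI_ex[OF unit[OF that], folded u_def] by auto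
 define k where "k z i j = (SOME r. r \<in>[F] \<and> (e i *[A] z) *[A] e j = r .[A] u i j)" for z i j
 have k: "k z i j \<in>[F]" "(e i *[A] z) *[A] e j = k z i j .[A] u i j" if "z \<in>[A]" "i \<in> I" "j \<in> I" for z i j
  using someI_ex[of "\<lambda>r. r \<in>[F] \<and> (e i *[A] z) *[A] e j = r .[A] u i j"] u(5)[OF that(2,3,1)] unfolding k_def by auto
 have ku: "k z i j = r" if "z \<in>[A]" "i \<in> I" "j \<in> I" "r \<in>[F]" "(e i *[A] z) *[A] e j = r .[A] u i j" for z i j r
 proof -
  have "(k z i j \<ominus> r) .[A] u i j = 0[A]"
   using k[OF that(1-3)] that(4,5) u(1)[OF that(2,3)] by (simp add: a_minus_def smult_l_distr smult_l_minus M.r_neg)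
  then show ?thesis using smult_eq_zero[of "k z i j \<ominus> r" "u i j"] u(1,2)[OF that(2,3)] k(1)[OF that(1-3)] that(4) by auto
 qed
 define c where "c i j l = k (u i j *[A] u j l) i l" for i j l
 have c: "c i j l \<in>[F]" "u i j *[A] u j l = c i j l .[A] u i l" if I: "i \<in> I" "j \<in> I" "l \<in> I" for i j l
 proof -
  have uc: "u i j *[A] u j l \<in>[A]" using u(1) I by simp
  show "c i j l \<in>[F]" using k(1)[OF uc I(1,3)] by (simp add: c_def)
  have "(e i *[A] (u i j *[A] u j l)) *[A] e l = u i j *[A] u j l"
   using nucleus_assoc(1)[OF en[OF I(1)] u(1)[OF I(1,2)] u(1)[OF I(2,3)]] nucleus_assoc(3)[OF en[OF I(3)] u(1)[OF I(1,2)] u(1)[OF I(2,3)]]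
    u(3)[OF I(1,2)] u(4)[OF I(2,3)] by simp
  then show "u i j *[A] u j l = c i j l .[A] u i l" using k(2)[OF uc I(1,3)] by (simp add: c_def)
 qed
 have c1: "c i i j = \<one>" "c i j j = \<one>" if I: "i \<in> I" "j \<in> I" for i j
 proof -
  have x: "(e i *[A] u i j) *[A] e j = \<one> .[A] u i j" using u(1,3,4)[OF I] by simp
  have "u i i *[A] u i j = u i j" "u i j *[A] u j j = u i j" using u(3,4)[OF I] u(6)[OF I(1) I(1)] u(6)[OF I(2) I(2)] by simp_all
  then show "c i i j = \<one>" "c i j j = \<one>" using ku[OF u(1)[OF I] I _ x] by (simp_all add: c_def)
 qed
 define B where "B = skew_matrix_algebra F n c"
 have cB: "carrier B = I \<times> I \<rightarrow>\<^sub>E carrier F" by (simp add: B_def skew_matrix_algebra_def I_def)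
 define h where "h z = (\<lambda>p\<in>I \<times> I. k z (fst p) (snd p))" for z
 have sw: "(e i *[A] (\<Oplus>\<^bsub>A\<^esub>s\<in>S. f s)) *[A] e j = (\<Oplus>\<^bsub>A\<^esub>s\<in>S. (e i *[A] f s) *[A] e j)" if "i \<in> I" "j \<in> I" "finite S" "f \<in> S \<rightarrow> carrier A" for i j f and S :: "(nat \<times> nat) set"
 proof -
  have "linear_op F A (\<lambda>z. (e i *[A] z) *[A] e j)"
   using ec that by (simp add: linear_op_def distrib_left distrib_right smult_mult mult_smult)
  from linear_op_finsum[OF this that(3,4)] show ?thesis .
 qed
 have "h \<in> algebra_isos F A B"
  unfolding algebra_isos_def
 proof (intro CollectI conjI ballI)
  show "bij_betw h (carrier A) (carrier B)"
  proof (rule bij_betw_imageI)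
   show "inj_on h (carrier A)"
   proof (rule inj_onI)
    fix x y assume xy: "x \<in>[A]" "y \<in>[A]" and eq: "h x = h y"
    have kk: "k x i j = k y i j" if "i \<in> I" "j \<in> I" for i j using fun_cong[OF eq, of "(i, j)"] that by (simp add: h_def)
    show "x = y"
    proof (rule idempotent_system_ext2[OF sys xy])
     fix g g' assume "g \<in> G" "g' \<in> G"
     then obtain i j where "i \<in> I" "j \<in> I" "g = e i" "g' = e j" using Ge by metis
     then show "(g *[A] x) *[A] g' = (g *[A] y) *[A] g'" using k(2)[OF xy(1)] k(2)[OF xy(2)] kk by simp
    qed
   qed
   show "h ` carrier A = carrier B"
   proof (rule equalityI)
    show "h ` carrier A <= carrier B"
    proof (rule image_subsetI)
     fix x assume "x \<in>[A]"
     then show "h x \<in>[B]" unfolding cB h_def restrict_PiE_iff using k(1) by auto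
    qed
    show "carrier B <= h ` carrier A"
    proof
     fix x assume x: "x \<in>[B]"
     then have xc: "x p \<in>[F]" if "p \<in> I \<times> I" for p using that by (auto simp: cB PiE_iff)
     define z where "z = (\<Oplus>\<^bsub>A\<^esub>p\<in>I \<times> I. x p .[A] u (fst p) (snd p))"
     have tc: "(\<lambda>p. x p .[A] u (fst p) (snd p)) \<in> I \<times> I \<rightarrow> carrier A" using xc u(1) by auto
     have zc: "z \<in>[A]" unfolding z_def by (rule M.finsum_closed[OF tc])
     have "k z i j = x (i, j)" if ij: "i \<in> I" "j \<in> I" for i j
     proof (rule ku[OF zc ij])
      show "x (i, j) \<in>[F]" using xc ij by simp
      have "(e i *[A] z) *[A] e j = (\<Oplus>\<^bsub>A\<^esub>p\<in>I \<times> I. (e i *[A] (x p .[A] u (fst p) (snd p))) *[A] e j)"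
       unfolding z_def by (rule sw[OF ij _ tc]) (use fI in simp)
      also have "\<dots> = (\<Oplus>\<^bsub>A\<^esub>p\<in>I \<times> I. if (i, j) = p then x p .[A] u (fst p) (snd p) else 0[A])"
      proof (intro M.finsum_cong' HOL.refl Pi_I)
       fix p assume "p \<in> I \<times> I"
       then obtain a b where p: "p = (a, b)" "a \<in> I" "b \<in> I" by auto
       note uc = u(1)[OF p(2,3)]
       have 1: "e i *[A] u a b = (if i = a then u a b else 0[A])"
        using nucleus_assoc(1)[OF en[OF ij(1)] ec[OF p(2)] uc] ee[OF ij(1) p(2)] u(3)[OF p(2,3)] uc by (auto split: if_splits)
       have 2: "u a b *[A] e j = (if j = b then u a b else 0[A])"
        using nucleus_assoc(3)[OF en[OF ij(2)] uc ec[OF p(3)]] ee[OF p(3) ij(2)] u(4)[OF p(2,3)] uc by (auto split: if_splits)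
       show "(e i *[A] (x p .[A] u (fst p) (snd p))) *[A] e j = (if (i, j) = p then x p .[A] u (fst p) (snd p) else 0[A])"
        using 1 2 uc ec ij xc[of p] p by (auto simp: mult_smult smult_mult)
       show "(if (i, j) = p then x p .[A] u (fst p) (snd p) else 0[A]) \<in>[A]" using uc xc[of p] p by simp
      qed
      also have "\<dots> = x (i, j) .[A] u i j"
       using M.finsum_singleton[of "(i, j)" "I \<times> I" "\<lambda>p. x p .[A] u (fst p) (snd p)"] ij fI tc by simp
      finally show "(e i *[A] z) *[A] e j = x (i, j) .[A] u i j" .
     qed
     then have "h z = x" using x by (auto simp: h_def cB PiE_iff extensional_def)
     then show "x \<in> h ` carrier A" using zc by auto
    qed
   qed
  qed
  have "k 1[A] i j = (if i = j then \<one> else \<zero>)" if ij: "i \<in> I" "j \<in> I" for i j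
   by (rule ku) (use ij ec ee u(1,6) in auto)
  then show "h 1[A] = 1[B]" by (auto simp: h_def B_def skew_matrix_algebra_def I_def)
  fix x y assume xy: "x \<in>[A]" "y \<in>[A]"
  have "k (x +[A] y) i j = k x i j \<oplus> k y i j" if ij: "i \<in> I" "j \<in> I" for i j
   by (rule ku) (use ij xy ec u(1) k in \<open>simp_all add: distrib_left distrib_right smult_l_distr\<close>)
  then show "h (x +[A] y) = h x +[B] h y" by (auto simp: h_def B_def skew_matrix_algebra_def I_def)
  have kxy: "k (x *[A] y) i l = (\<Oplus>j\<in>I. c i j l \<otimes> (k x i j \<otimes> k y j l))" if il: "i \<in> I" "l \<in> I" for i l
  proof (rule ku)
   note el = ec[OF il(1)] ec[OF il(2)]
   have tc: "(\<lambda>j. c i j l \<otimes> (k x i j \<otimes> k y j l)) \<in> I \<rightarrow> carrier F" using c(1) k(1) xy il by auto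
   show "(\<Oplus>j\<in>I. c i j l \<otimes> (k x i j \<otimes> k y j l)) \<in>[F]" by (rule R.finsum_closed[OF tc])
   define x' where "x' = e i *[A] x"
   define y' where "y' = y *[A] e l"
   have xy': "x' \<in>[A]" "y' \<in>[A]" using xy el by (simp_all add: x'_def y'_def)
   have step: "x' *[A] (e j *[A] y') = (c i j l \<otimes> (k x i j \<otimes> k y j l)) .[A] u i l" if j: "j \<in> I" for j
   proof -
    have "x' *[A] (e j *[A] y') = x' *[A] (e j *[A] (e j *[A] y'))"
     using nucleus_assoc(1)[OF en[OF j] ec[OF j] xy'(2)] ee[OF j j] by simp
    also have "\<dots> = (x' *[A] e j) *[A] (e j *[A] y')"
     using nucleus_assoc(2)[OF en[OF j] xy'(1), of "e j *[A] y'"] ec[OF j] xy' by simp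
    also have "\<dots> = (k x i j .[A] u i j) *[A] (k y j l .[A] u j l)"
     using k(2)[OF xy(2) j il(2)] nucleus_assoc(1)[OF en[OF j] xy(2) el(2)] k(2)[OF xy(1) il(1) j] by (simp add: x'_def y'_def)
    also have "\<dots> = (c i j l \<otimes> (k x i j \<otimes> k y j l)) .[A] u i l"
     using k(1)[OF xy(1) il(1) j] k(1)[OF xy(2) j il(2)] u(1)[OF il(1) j] u(1)[OF j il(2)] u(1)[OF il] c[OF il(1) j il(2)]
     by (simp add: smult_mult mult_smult R.m_ac flip: smult_assoc1)
    finally show ?thesis .
   qed
   have "(e i *[A] (x *[A] y)) *[A] e l = x' *[A] y'"
    using nucleus_assoc(1)[OF en[OF il(1)] xy] nucleus_assoc(3)[OF en[OF il(2)] xy'(1) xy(2)] by (simp add: x'_def y'_def)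
   also have "\<dots> = x' *[A] (\<Oplus>\<^bsub>A\<^esub>g\<in>G. g *[A] y')" using idempotent_system_sum(1)[OF sys xy'(2)] by simp
   also have "(\<Oplus>\<^bsub>A\<^esub>g\<in>G. g *[A] y') = (\<Oplus>\<^bsub>A\<^esub>j\<in>I. e j *[A] y')"
    using M.finsum_reindex[of "\<lambda>g. g *[A] y'" e I] bij_betw_imp_inj_on[OF e] bij_betw_imp_surj_on[OF e] GD(3) xy'(2) by auto
   also have "x' *[A] \<dots> = (\<Oplus>\<^bsub>A\<^esub>j\<in>I. x' *[A] (e j *[A] y'))"
    using xy' ec by (intro finsum_mult_left[OF fI] Pi_I) auto
   also have "\<dots> = (\<Oplus>\<^bsub>A\<^esub>j\<in>I. (c i j l \<otimes> (k x i j \<otimes> k y j l)) .[A] u i l)"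
    using step tc u(1)[OF il] by (intro M.finsum_cong' HOL.refl Pi_I) (auto simp: Pi_iff)
   also have "\<dots> = (\<Oplus>j\<in>I. c i j l \<otimes> (k x i j \<otimes> k y j l)) .[A] u i l"
    using fI tc
   proof (induction I rule: finite_induct)
    case (insert s S)
    then show ?case using u(1)[OF il] by (simp add: Pi_iff smult_l_distr)
   qed (use u(1)[OF il] in simp)
   finally show "(e i *[A] (x *[A] y)) *[A] e l = (\<Oplus>j\<in>I. c i j l \<otimes> (k x i j \<otimes> k y j l)) .[A] u i l" .
  qed (use xy il in simp_all)
  have kmult: "h (x *[A] y) (i, l) = (\<Oplus>j\<in>I. c i j l \<otimes> (h x (i, j) \<otimes> h y (j, l)))" if il: "i \<in> I" "l \<in> I" for i l
  proof -
   have "(\<Oplus>j\<in>I. c i j l \<otimes> (h x (i, j) \<otimes> h y (j, l))) = (\<Oplus>j\<in>I. c i j l \<otimes> (k x i j \<otimes> k y j l))"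
    using c(1) k(1) xy il by (intro R.finsum_cong' HOL.refl Pi_I) (simp_all add: h_def)
   then show ?thesis using kxy[OF il] il by (simp add: h_def)
  qed
  show "h (x *[A] y) = h x *[B] h y"
  proof (rule HOL.ext)
   fix p
   show "h (x *[A] y) p = (h x *[B] h y) p"
   proof (cases "p \<in> I \<times> I")
    case True
    then obtain i l where p: "p = (i, l)" "i \<in> I" "l \<in> I" by auto
    show ?thesis unfolding p(1) kmult[OF p(2,3)] B_def skew_matrix_algebra_def I_def[symmetric] using p(2,3) by simp
   next
    case False
    then show ?thesis unfolding B_def skew_matrix_algebra_def I_def[symmetric] h_def by (cases p) auto
   qed
  qed
 next
  fix r x assume rx: "r \<in>[F]" "x \<in>[A]"
  have "k (r .[A] x) i j = r \<otimes> k x i j" if ij: "i \<in> I" "j \<in> I" for i j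
   by (rule ku) (use ij rx ec u(1) k in \<open>simp_all add: mult_smult smult_mult smult_assoc1\<close>)
  then show "h (r .[A] x) = r .[B] h x" by (auto simp: h_def B_def skew_matrix_algebra_def I_def)
 qed
 then have "algebra_isomorphic F A (skew_matrix_algebra F n c)" by (auto simp: algebra_isomorphic_def B_def)
 moreover have "reduced_skew_set F n c" using c(1) c1 by (simp add: reduced_skew_set_def I_def)
 ultimately show thesis using that n by metis
qed

section \<open>The separable closure\<close>

text \<open>Q splits over E with simple roots. Splitting is expressed by a class \<open>good\<close>
  of monic polynomials that contains Q and from whose nonconstant members a root can always be
  divided out within the class; no list of roots has to be named.\<close>

definition simple_split :: "('e, 'm) ring_scheme => 'e list => bool" where
 "simple_split E Q \<longleftrightarrow> (\<forall>r\<in>carrier E. sev E Q r = 0[E] --> dv E Q r ~= 0[E]) \<and>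
  (\<exists>good. good Q \<and> (\<forall>as. set as <= carrier E \<and> as ~= [] \<and> good (as @ [1[E]]) -->
    (\<exists>r\<in>carrier E. sev E (as @ [1[E]]) r = 0[E] \<and> good (quo E (as @ [1[E]]) r))))"

lemma (in vspace) simple_split_decomposition:
 assumes T: "linear_op F V T" and U: "submodule U F V" and TU: "!!u. u \<in> U ==> T u \<in> U"
  and as: "set as <= carrier F" and sp: "simple_split F (as @ [\<one>])" and v: "v \<in> U" "pev V (as @ [\<one>]) T v = 0[V]"
 obtains S w where "finite S" "S <= carrier F" "!!r. r \<in> S ==> w r \<in> U"
  "!!r. r \<in> S ==> T (w r) = r .[V] w r" "v = (\<Oplus>\<^bsub>V\<^esub>r\<in>S. w r)"
proof -
 have simple: "!!r. [|r \<in>[F]; sev F (as @ [\<one>]) r = \<zero>|] ==> dv F (as @ [\<one>]) r ~= \<zero>" using sp by (simp add: simple_split_def)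
 obtain good where good: "good (as @ [\<one>])" "!!as. [|set as <= carrier F; as ~= []; good (as @ [\<one>])|] ==>
   \<exists>r\<in>carrier F. sev F (as @ [\<one>]) r = \<zero> \<and> good (quo F (as @ [\<one>]) r)"
  using sp unfolding simple_split_def by metis
 have vc: "v \<in>[V]" using v(1) submoduleD(1)[OF U] by auto
 obtain rs where rs: "set rs <= carrier F" "shifts V T rs v = 0[V]"
  using shifts_exist[where good = good, OF T good(2) as good(1) vc v(2)] by metis
 have P: "set (as @ [\<one>]) <= carrier F" using as by simp
 show thesis
  by (rule eigen_decomposition[OF T U TU P v simple rs]) (assumption | rule that)+
qed

text \<open>Here A is an extension field of F and P the minimal polynomial of y. With P = (X - r) Q
  over E, the element w = Q(y) of E \<otimes> A is nonzero, since its slices would otherwise give a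
  smaller relation, and y acts on w as r. So P'(y) w = P'(r) w. If r were a double root this would
  be 0, although P'(y) is a nonzero element of the field A and hence invertible.\<close>

lemma (in scalar_extension) separable_roots_simple:
 assumes L: "field A" "algebra F A" and y: "y \<in>[A]"
  and min: "minimal_relation F A (mop A y) 1[A] as" and d: "dev A (as @ [1[F]]) (mop A y) 1[A] ~= 0[A]"
  and r: "r \<in>[E]" "sev E (map \<iota> (as @ [1[F]])) r = 0[E]"
 shows "dv E (map \<iota> (as @ [1[F]])) r ~= 0[E]"
proof
 assume dz: "dv E (map \<iota> (as @ [1[F]])) r = 0[E]"
 interpret L: field A by (rule L(1))
 have as: "set as <= carrier F" and rel: "pev A (as @ [1[F]]) (mop A y) 1[A] = 0[A]"
  and least: "!!bs. [|set bs <= carrier F; length bs < length as|] ==> pev A (bs @ [1[F]]) (mop A y) 1[A] ~= 0[A]"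
  using min unfolding minimal_relation_def by auto
 have P: "set (as @ [1[F]]) <= carrier F" using as by simp
 define cs where "cs = map \<iota> as"
 have cs: "set cs <= carrier E" using iota_closed[OF as] by (simp add: cs_def)
 have P': "map \<iota> (as @ [1[F]]) = cs @ [1[E]]" "set (cs @ [1[E]]) <= carrier E" using cs by (simp_all add: cs_def)
 have "cs ~= []"
 proof
  assume "cs = []"
  then show False using r unfolding P'(1) by simp
 qed
 then obtain q where q: "quo E (cs @ [1[E]]) r = q @ [1[E]]" "length q = length cs - 1" "set q <= carrier E"
  using M.R.quo_monic[OF cs r(1)] by auto
 have Q: "set (q @ [1[E]]) <= carrier E" using q(3) by simp
 define U where "U = (mop M) (\<phi> y)"
 have T: "linear_op F A (mop A y)" and U: "linear_op E M U" unfolding U_def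
  using A.linear_op_left[OF y] M.linear_op_left[OF phi_closed[OF y]] .
 have TU: "U (\<phi> a) = \<phi> (y *[A] a)" if "a \<in>[A]" for a using that y by (simp add: U_def phi_mult)
 have nuc: "nucleus M = carrier M"
 proof -
  have "nucleus A = carrier A" using A.nucleus_iff L.m_assoc by auto
  then show ?thesis using ext_nucleus ext_carrier by simp
 qed
 define w where "w = pev M (q @ [1[E]]) U 1[M]"
 have wc: "w \<in>[M]" unfolding w_def by (rule M.pev_closed[OF U Q M.one_closed])
 have "w ~= 0[M]"
 proof
  assume "w = 0[M]"
  obtain l where l: "l \<in> functionals F E" "l 1[E] = 1[F]" by (rule unit_functional)
  have "pev A (map l q @ [1[F]]) (mop A y) 1[A] = 0[A]"
   using slice_pev[OF l(1) T U TU Q A.one_closed] \<open>w = 0[M]\<close> l by (simp add: w_def)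
  moreover have "set (map l q) <= carrier F" using functionalsD(1)[OF l(1)] q(3) by auto
  moreover have "length (map l q) < length as" using q(2) \<open>cs ~= []\<close> by (simp add: cs_def)
  ultimately show False using least by metis
 qed
 have k: "pev M (cs @ [1[E]]) U 1[M] = 0[M]"
  using phi_pev[OF T TU P A.one_closed] by (simp only: rel P'(1) phi_zero phi_one)
 have "shift M U r w = 0[M]"
  using M.pev_quo[OF U P'(2) r(1) M.one_closed] k r(2) M.linear_op_shift[OF U r(1)] linear_opD(1)[OF M.linear_op_shift[OF U r(1)] wc]
  unfolding P'(1) q(1) w_def[symmetric] by simp
 then have eig: "U w = r .[M] w" using linear_opD(1)[OF U wc] wc r(1) M.M.a_minus_eq_zero_iff[of "U w" "r .[M] w"] by (simp add: shift_def)
 have "0[M] = dev M (cs @ [1[E]]) U (1[M] *[M] w)"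
  using M.dev_eigen[OF P'(2) r(1) wc U eig] dz wc unfolding P'(1) by simp
 also have "\<dots> = dev M (cs @ [1[E]]) U 1[M] *[M] w"
  by (rule M.dev_commute[OF U M.linear_op_right[OF wc] _ P'(2) M.one_closed])
   (use M.nucleus_assoc(1)[of "\<phi> y" _ w] nuc y wc in \<open>simp add: U_def\<close>)
 also have "dev M (cs @ [1[E]]) U 1[M] = \<phi> (dev A (as @ [1[F]]) (mop A y) 1[A])"
  using phi_dev[OF T TU P A.one_closed] by (simp only: P'(1) phi_one)
 finally have z: "\<phi> (dev A (as @ [1[F]]) (mop A y) 1[A]) *[M] w = 0[M]" by simp
 define x where "x = dev A (as @ [1[F]]) (mop A y) 1[A]"
 have x: "x \<in>[A]" "x ~= 0[A]" using A.dev_closed[OF T P A.one_closed] d by (simp_all add: x_def)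
 then have xi: "inv\<^bsub>A\<^esub> x \<in>[A]" "inv\<^bsub>A\<^esub> x *[A] x = 1[A]" using L.field_Units by auto
 have "\<phi> (inv\<^bsub>A\<^esub> x) *[M] \<phi> x = 1[M]" using phi_mult[OF xi(1) x(1)] unfolding xi(2) phi_one by (rule HOL.sym)
 then have "w = (\<phi> (inv\<^bsub>A\<^esub> x) *[M] \<phi> x) *[M] w" using wc by simp
 also have "\<dots> = 0[M]" using M.nucleus_assoc(1)[of "\<phi> (inv\<^bsub>A\<^esub> x)" "\<phi> x" w] nuc xi x(1) wc z by (simp add: x_def)
 finally show False using \<open>w ~= 0[M]\<close> by simp
qed

lemma algebraic_closure_exists:
 fixes F :: "('f, 'm) ring_scheme"
 assumes F: "field F"
 obtains L :: "('f, 'f closure_elem) module" where "extension_field F L" "root_closed L"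
  "!!z. z \<in>[L] ==> \<exists>as. set as <= carrier F \<and> sev L (map (\<lambda>r. r .[L] 1[L]) (as @ [1[F]])) z = 0[L]"
proof -
 interpret F: field F by (rule F)
 obtain C :: "((('f list \<times> nat) multiset) => 'f) ring" where C: "algebraic_closure C (F.indexed_const ` carrier F)"
  and j: "F.indexed_const \<in> ring_hom F C" by (rule F.exists_closure)
 interpret C: algebraic_closure C "F.indexed_const ` carrier F" by (rule C)
 note jh = ring_hom_memE[OF j]
 define L where "L = base_change F.indexed_const C"
 note BL = base_change[OF fieldE(1)[OF F] C.field_axioms j, folded L_def]
 have "extension_field F L" by (intro extension_field.intro BL F)
 moreover have "root_closed L"
  using algebraic_closure_root_closed[OF C] sev_cong[of L C] by (simp add: root_closed_def L_def)
 moreover have "\<exists>as. set as <= carrier F \<and> sev L (map (\<lambda>r. r .[L] 1[L]) (as @ [1[F]])) z = 0[L]" if z: "z \<in>[L]" for z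
 proof -
  let ?K = "F.indexed_const ` carrier F"
  have zc: "z \<in>[C]" using z by (simp add: L_def)
  note I = C.IrrE[OF C.subfield_axioms zc C.algebraic_extension[OF zc]]
  have ne: "C.Irr ?K z ~= []" using I(2) by (auto simp: ring_irreducible_def univ_poly_zero)
  obtain q where q: "C.Irr ?K z = 1[C] # q" using I(3) ne by (cases "C.Irr ?K z") auto
  have "set q <= ?K" using I(1) unfolding univ_poly_carrier[symmetric] polynomial_def q by auto
  then have "q \<in> map F.indexed_const ` lists (carrier F)" by (simp add: lists_image[symmetric] in_lists_conv_set subset_iff)
  then obtain bs where bs: "q = map F.indexed_const bs" "bs \<in> lists (carrier F)" by auto
  have as: "set (rev bs) <= carrier F" using bs(2) by (auto simp: in_lists_conv_set)
  have s: "set (map F.indexed_const (rev bs @ [1[F]])) <= carrier C" using as jh(1) by auto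
  have e: "map (\<lambda>r. r .[L] 1[L]) (rev bs @ [1[F]]) = map F.indexed_const (rev bs @ [1[F]])"
   using as jh(1) by (auto simp: L_def)
  have "sev C (map F.indexed_const (rev bs @ [1[F]])) z = C.eval (C.Irr ?K z) z"
   using C.eval_rev[OF s zc] jh(4) by (simp add: q bs(1) rev_map)
  then have "sev L (map (\<lambda>r. r .[L] 1[L]) (rev bs @ [1[F]])) z = 0[L]"
   unfolding e using I(4) sev_cong[of L C] by (simp add: L_def)
  then show ?thesis using as by blast
 qed
 ultimately show thesis by (rule that)
qed

section \<open>The separable closure inside an algebraic closure\<close>

locale closure_field = extension_field F L
 for F :: "('f, 'm) ring_scheme" and L :: "('f, 'e) module" +
 assumes closed: "root_closed L"
  and alg: "z \<in>[L] ==> \<exists>as. set as <= carrier F \<and> sev L (map (\<lambda>r. r .[L] 1[L]) (as @ [1[F]])) z = 0[L]"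
begin

definition simple :: "'f list => bool" where
 "simple as \<longleftrightarrow> set as <= carrier F \<and> (\<forall>r\<in>carrier L. sev L (map emb (as @ [1[F]])) r = 0[L] --> dv L (map emb (as @ [1[F]])) r ~= 0[L])"

text \<open>The separable closure of F in L, as the set of roots of polynomials over F all of whose
  roots in L are simple. The polynomial need not be minimal.\<close>

definition sepc :: "'e set" where
 "sepc = {z \<in> carrier L. \<exists>as. simple as \<and> sev L (map emb (as @ [1[F]])) z = 0[L]}"

definition "M = tensor_algebra F L L"
definition "\<phi> a = tensor_class F L L [(1[L], a)]"
definition "slice l = tlift L (\<lambda>e a. l e .[L] a)"

sublocale X: scalar_extension F L L M \<phi> slice
 using tensor_scalar_extension[OF F.field_axioms nonassoc_algebra L.field_axioms algebra_axioms]
 by (simp add: M_def \<phi>_def[abs_def] slice_def[abs_def])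

lemma nucleus_M: "nucleus M = carrier M"
proof -
 have "nucleus L = carrier L" using V.nucleus_iff L.m_assoc by auto
 then show ?thesis using X.ext_nucleus X.ext_carrier by simp
qed

lemma M_assoc: "[|x \<in>[M]; y \<in>[M]; z \<in>[M]|] ==> (x *[M] y) *[M] z = x *[M] (y *[M] z)"
 using X.M.nucleus_assoc(1) nucleus_M by simp

lemma linear_ops:
 assumes "z \<in>[L]"
 shows "linear_op F L (mop L z)" "linear_op L M (mop M (\<phi> z))" "a \<in>[L] ==> \<phi> z *[M] \<phi> a = \<phi> (z *[L] a)"
 using V.linear_op_left[OF assms] X.M.linear_op_left[OF X.phi_closed[OF assms]] assms by (simp_all add: X.phi_mult)

lemma pev_one_zero_iff:
 "[|set as <= carrier F; z \<in>[L]|] ==> pev L (as @ [1[F]]) (mop L z) 1[L] = sev L (map emb (as @ [1[F]])) z"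
proof -
 assume as: "set as <= carrier F" and z: "z \<in>[L]"
 have P: "set (as @ [1[F]]) <= carrier F" using as by simp
 then have "set (map emb (as @ [1[F]])) <= carrier L" by auto
 from L.sev_closed[OF this z] show ?thesis using pev_sev[OF P z L.one_closed] by simp
qed

text \<open>An element \<open>z\<close> is separable iff \<open>1 \<in> L \<otimes> L\<close> is a sum of eigenvectors of \<open>1 \<otimes> z\<close>; products of
 such eigenvectors for two elements are joint eigenvectors.\<close>

lemma dev_nonzero_of_eigen:
 assumes z: "z \<in>[L]" and S: "finite S" "!!s. s \<in> S ==> w s \<in>[M]" "(\<Oplus>\<^bsub>M\<^esub>s\<in>S. w s) = 1[M]"
  and eig: "!!s. s \<in> S ==> \<exists>t\<in>carrier L. \<phi> z *[M] w s = t .[M] w s"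
  and min: "minimal_relation F L (mop L z) 1[L] as"
 shows "dev L (as @ [1[F]]) (mop L z) 1[L] ~= 0[L]"
proof -
 obtain \<chi> where \<chi>: "!!s. s \<in> S ==> \<chi> s \<in>[L] \<and> \<phi> z *[M] w s = \<chi> s .[M] w s" using eig by metis
 show ?thesis
 proof (rule X.separable_relation[OF linear_ops(1,2)[OF z] _ L.one_closed L.one_not_zero min S(1), where R = "\<lambda>s m. m *[M] w s" and \<chi> = \<chi>])
  show "\<phi> z *[M] \<phi> a = \<phi> (z *[L] a)" if "a \<in>[L]" for a by (rule linear_ops(3)[OF z that])
  have "(\<Oplus>\<^bsub>M\<^esub>s\<in>S. \<phi> 1[L] *[M] w s) = (\<Oplus>\<^bsub>M\<^esub>s\<in>S. w s)" using S(2) by (intro X.M.M.finsum_cong' HOL.refl Pi_I) simp_all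
  then show "\<phi> 1[L] = (\<Oplus>\<^bsub>M\<^esub>s\<in>S. \<phi> 1[L] *[M] w s)" using S(3) by simp
  fix s assume s: "s \<in> S"
  show "linear_op L M (\<lambda>m. m *[M] w s)" by (rule X.M.linear_op_right[OF S(2)[OF s]])
  show "\<phi> z *[M] (m *[M] w s) = (\<phi> z *[M] m) *[M] w s" if "m \<in>[M]" for m
   using M_assoc[OF X.phi_closed[OF z] that S(2)[OF s]] by simp
  show "\<chi> s \<in>[L]" "\<phi> z *[M] (\<phi> 1[L] *[M] w s) = \<chi> s .[M] (\<phi> 1[L] *[M] w s)" using \<chi>[OF s] S(2)[OF s] by simp_all
 qed
qed

lemma sepc_of_eigen:
 assumes z: "z \<in>[L]" and S: "finite S" "!!s. s \<in> S ==> w s \<in>[M]" "(\<Oplus>\<^bsub>M\<^esub>s\<in>S. w s) = 1[M]"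
  and eig: "!!s. s \<in> S ==> \<exists>t\<in>carrier L. \<phi> z *[M] w s = t .[M] w s"
 shows "z \<in> sepc"
proof -
 obtain as where as: "set as <= carrier F" "pev L (as @ [1[F]]) (mop L z) 1[L] = 0[L]"
  using alg[OF z] pev_one_zero_iff[OF _ z] by metis
 obtain bs where bs: "minimal_relation F L (mop L z) 1[L] bs" by (rule minimal_relation_exists[OF as])
 have b: "set bs <= carrier F" "sev L (map emb (bs @ [1[F]])) z = 0[L]"
  using bs pev_one_zero_iff[OF _ z, of bs] by (simp_all add: minimal_relation_def)
 have "simple bs" unfolding simple_def
  using b(1) X.separable_roots_simple[OF L.field_axioms algebra_axioms z bs dev_nonzero_of_eigen[OF z S eig bs]] by simp
 then show ?thesis using z b(2) unfolding sepc_def by blast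
qed

lemma simple_split_closed: "simple as ==> simple_split L (map emb (as @ [1[F]]))"
 using closed unfolding simple_split_def simple_def root_closed_def by (intro conjI exI[of _ "\<lambda>_. True"]) auto

lemma eigen_of_sepc:
 assumes z: "z \<in> sepc"
 obtains S w where "finite S" "!!s. s \<in> S ==> w s \<in>[M]" "(\<Oplus>\<^bsub>M\<^esub>s\<in>S. w s) = 1[M]"
  "!!s. s \<in> S ==> s \<in>[L]" "!!s. s \<in> S ==> \<phi> z *[M] w s = s .[M] w s"
proof -
 obtain as where zc: "z \<in>[L]" and as: "simple as" "sev L (map emb (as @ [1[F]])) z = 0[L]" using z by (auto simp: sepc_def)
 have asF: "set as <= carrier F" using as(1) by (simp add: simple_def)
 have P: "set (as @ [1[F]]) <= carrier F" using asF by simp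
 have e: "map emb (as @ [1[F]]) = map emb as @ [1[L]]" by simp
 have "pev M (map emb (as @ [1[F]])) (mop M (\<phi> z)) (\<phi> 1[L]) = \<phi> (pev L (as @ [1[F]]) (mop L z) 1[L])"
  by (rule X.phi_pev[OF linear_ops(1)[OF zc] linear_ops(3)[OF zc] P L.one_closed, symmetric])
 then have k: "pev M (map emb as @ [1[L]]) (mop M (\<phi> z)) 1[M] = 0[M]"
  unfolding pev_one_zero_iff[OF asF zc] as(2) unfolding e by simp
 have full: "submodule (carrier M) L M" by (rule X.M.submoduleI) auto
 have sp: "simple_split L (map emb as @ [1[L]])" using simple_split_closed[OF as(1)] unfolding e .
 have cl: "set (map emb as) <= carrier L" using asF by auto
 obtain S w where S: "finite S" "S <= carrier L" "!!r. r \<in> S ==> w r \<in>[M]"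
  "!!r. r \<in> S ==> \<phi> z *[M] w r = r .[M] w r" "1[M] = (\<Oplus>\<^bsub>M\<^esub>r\<in>S. w r)"
  using X.M.simple_split_decomposition[OF linear_ops(2)[OF zc] full linear_opD(1)[OF linear_ops(2)[OF zc]] cl sp X.M.one_closed k] by metis
 show thesis by (rule that[of S w]) (use S in auto)
qed

text \<open>Multiplying two decompositions of 1 gives one into joint eigenvectors of x and y, so
  each closure property of \<open>sepc\<close> reduces to a computation on a joint eigenvector.
  Unary operations use it with x = y.\<close>

lemma sepc_binary:
 assumes x: "x \<in> sepc" and y: "y \<in> sepc" and z: "z \<in>[L]"
  and step: "!!r s m. [|r \<in>[L]; s \<in>[L]; m \<in>[M]; \<phi> x *[M] m = r .[M] m; \<phi> y *[M] m = s .[M] m|] ==>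
   \<exists>t\<in>carrier L. \<phi> z *[M] m = t .[M] m"
 shows "z \<in> sepc"
proof -
 have xc: "x \<in>[L]" and yc: "y \<in>[L]" using x y by (auto simp: sepc_def)
 obtain S w where S: "finite S" "!!s. s \<in> S ==> w s \<in>[M]" "(\<Oplus>\<^bsub>M\<^esub>s\<in>S. w s) = 1[M]"
  "!!s. s \<in> S ==> s \<in>[L]" "!!s. s \<in> S ==> \<phi> x *[M] w s = s .[M] w s" by (rule eigen_of_sepc[OF x]) (rule that)
 obtain S' w' where S': "finite S'" "!!s. s \<in> S' ==> w' s \<in>[M]" "(\<Oplus>\<^bsub>M\<^esub>s\<in>S'. w' s) = 1[M]"
  "!!s. s \<in> S' ==> s \<in>[L]" "!!s. s \<in> S' ==> \<phi> y *[M] w' s = s .[M] w' s" by (rule eigen_of_sepc[OF y]) (rule that)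
 interpret MM: cring M
  unfolding M_def using tensor.cring_T[of F L L] L.is_cring
  by (simp add: tensor_def algebra_axioms nonassoc_algebra)
 have prodc: "w a *[M] w' b \<in>[M]" if "a \<in> S" "b \<in> S'" for a b using S(2) S'(2) that by simp
 have "(\<Oplus>\<^bsub>M\<^esub>p\<in>S \<times> S'. w (fst p) *[M] w' (snd p)) = (\<Oplus>\<^bsub>M\<^esub>a\<in>S. \<Oplus>\<^bsub>M\<^esub>b\<in>S'. w a *[M] w' b)"
  using S(1,2)
 proof (induction S rule: finite_induct)
  case (insert a A)
  have i: "{a} \<times> S' \<inter> A \<times> S' = {}" "insert a A \<times> S' = {a} \<times> S' \<union> A \<times> S'" using insert.hyps by auto
  have pa: "{a} \<times> S' = Pair a ` S'" by auto
  have "(\<Oplus>\<^bsub>M\<^esub>p\<in>{a} \<times> S'. w (fst p) *[M] w' (snd p)) = (\<Oplus>\<^bsub>M\<^esub>b\<in>S'. w a *[M] w' b)"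
   using X.M.M.finsum_reindex[of "\<lambda>p. w (fst p) *[M] w' (snd p)" "Pair a" S'] insert.prems S'(2) by (simp add: pa inj_on_def Pi_iff)
  then show ?case
   unfolding i(2) using insert S'(1,2) i(1)
   by (subst X.M.M.finsum_Un_disjoint) (auto intro!: X.M.M.finsum_closed simp: Pi_iff)
 qed simp
 also have "\<dots> = (\<Oplus>\<^bsub>M\<^esub>a\<in>S. w a)"
  using S(2) S'(1,2,3) X.M.finsum_mult_left[OF S'(1), of w'] by (intro X.M.M.finsum_cong' HOL.refl Pi_I) (auto simp: Pi_iff simp flip: X.M.finsum_mult_left)
 finally have sum: "(\<Oplus>\<^bsub>M\<^esub>p\<in>S \<times> S'. w (fst p) *[M] w' (snd p)) = 1[M]" using S(3) by simp
 show ?thesis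
 proof (rule sepc_of_eigen[OF z, of "S \<times> S'" "\<lambda>p. w (fst p) *[M] w' (snd p)"])
  fix p assume "p \<in> S \<times> S'"
  then obtain a b where p: "p = (a, b)" "a \<in> S" "b \<in> S'" by auto
  note c = S(2)[OF p(2)] S'(2)[OF p(3)] S(4)[OF p(2)] S'(4)[OF p(3)] X.phi_closed[OF xc] X.phi_closed[OF yc]
  have 1: "\<phi> x *[M] (w a *[M] w' b) = a .[M] (w a *[M] w' b)"
   using M_assoc[OF c(5) c(1,2)] S(5)[OF p(2)] c by (simp add: X.M.smult_mult)
  have 2: "\<phi> y *[M] (w a *[M] w' b) = b .[M] (w a *[M] w' b)"
   using MM.m_lcomm[OF c(6) c(1,2)] S'(5)[OF p(3)] c by (simp add: X.M.mult_smult)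
  show "\<exists>t\<in>carrier L. \<phi> z *[M] (w (fst p) *[M] w' (snd p)) = t .[M] (w (fst p) *[M] w' (snd p))"
   using step[OF c(3,4) prodc[OF p(2,3)] 1 2] by (simp add: p(1))
 qed (use S(1) S'(1) prodc sum in auto)
qed

lemma sepc_closed: "z \<in> sepc ==> z \<in>[L]" by (simp add: sepc_def)

lemma sepc_one: "1[L] \<in> sepc"
 by (rule sepc_of_eigen[of _ "{()}" "\<lambda>_. 1[M]"]) (auto intro!: bexI[of _ "1[L]"])

lemma sepc_ops:
 assumes x: "x \<in> sepc"
 shows "y \<in> sepc ==> x +[L] y \<in> sepc" "y \<in> sepc ==> x *[L] y \<in> sepc" "r \<in>[F] ==> r .[L] x \<in> sepc"
  "x ~= 0[L] ==> inv\<^bsub>L\<^esub> x \<in> sepc"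
proof -
 note xc = sepc_closed[OF x]
 show "x +[L] y \<in> sepc" if y: "y \<in> sepc"
 proof (rule sepc_binary[OF x y])
  fix r s m assume "r \<in>[L]" "s \<in>[L]" "m \<in>[M]" "\<phi> x *[M] m = r .[M] m" "\<phi> y *[M] m = s .[M] m"
  then show "\<exists>t\<in>carrier L. \<phi> (x +[L] y) *[M] m = t .[M] m"
   using xc sepc_closed[OF y] by (intro bexI[of _ "r +[L] s"]) (simp_all add: X.phi_add X.M.distrib_right X.M.smult_l_distr)
 qed (use xc sepc_closed[OF y] in simp)
 show "x *[L] y \<in> sepc" if y: "y \<in> sepc"
 proof (rule sepc_binary[OF x y])
  fix r s m assume "r \<in>[L]" "s \<in>[L]" "m \<in>[M]" "\<phi> x *[M] m = r .[M] m" "\<phi> y *[M] m = s .[M] m"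
  then show "\<exists>t\<in>carrier L. \<phi> (x *[L] y) *[M] m = t .[M] m"
   using xc sepc_closed[OF y] M_assoc[of "\<phi> x" "\<phi> y" m]
   by (intro bexI[of _ "s *[L] r"]) (simp_all add: X.phi_mult X.M.mult_smult X.M.smult_assoc1)
 qed (use xc sepc_closed[OF y] in simp)
 show "r .[L] x \<in> sepc" if r: "r \<in>[F]"
 proof (rule sepc_binary[OF x x])
  fix s t m assume "s \<in>[L]" "m \<in>[M]" "\<phi> x *[M] m = s .[M] m"
  then show "\<exists>t\<in>carrier L. \<phi> (r .[L] x) *[M] m = t .[M] m"
   using xc r by (intro bexI[of _ "emb r *[L] s"]) (simp_all add: X.phi_smult X.M.smult_mult X.M.smult_assoc1)
 qed (use xc r in simp)
 show "inv\<^bsub>L\<^esub> x \<in> sepc" if nz: "x ~= 0[L]"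
 proof (rule sepc_binary[OF x x])
  have i: "inv\<^bsub>L\<^esub> x \<in>[L]" "inv\<^bsub>L\<^esub> x *[L] x = 1[L]" using nz xc L.field_Units by auto
  then show "inv\<^bsub>L\<^esub> x \<in>[L]" by simp
  fix s t m assume s: "s \<in>[L]" and m: "m \<in>[M]" "\<phi> x *[M] m = s .[M] m"
  have "m = (\<phi> (inv\<^bsub>L\<^esub> x) *[M] \<phi> x) *[M] m" using i xc m(1) by (simp flip: X.phi_mult)
  also have "\<dots> = s .[M] (\<phi> (inv\<^bsub>L\<^esub> x) *[M] m)" using M_assoc[of "\<phi> (inv\<^bsub>L\<^esub> x)" "\<phi> x" m] i(1) xc m s by (simp add: X.M.mult_smult)
  finally have e: "m = s .[M] (\<phi> (inv\<^bsub>L\<^esub> x) *[M] m)" .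
  have c: "\<phi> (inv\<^bsub>L\<^esub> x) *[M] m \<in>[M]" using i(1) m(1) by simp
  show "\<exists>t\<in>carrier L. \<phi> (inv\<^bsub>L\<^esub> x) *[M] m = t .[M] m"
  proof (cases "s = 0[L]")
   case True
   then have "m = 0[M]" using e X.M.smult_l_null[OF c] by simp
   then show ?thesis using i(1) by (intro bexI[of _ "0[L]"]) simp_all
  next
   case False
   then have "\<phi> (inv\<^bsub>L\<^esub> x) *[M] m = inv\<^bsub>L\<^esub> s .[M] m" "inv\<^bsub>L\<^esub> s \<in>[L]"
    using X.M.smult_inv_cancel(1)[OF s False c] e X.M.smult_inv_cancel(3)[OF s False c] by simp_all
   then show ?thesis by auto
  qed
 qed
qed

definition "Es = L\<lparr>carrier := sepc\<rparr>"

lemma submodule_sepc: "submodule sepc F L"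
proof (rule submoduleI)
 fix x assume x: "x \<in> sepc"
 have "-[L] x = (-[F] 1[F]) .[L] x" using sepc_closed[OF x] by (simp add: smult_l_minus)
 then show "-[L] x \<in> sepc" using sepc_ops(3)[OF x] by simp
next
 show "0[L] \<in> sepc" using sepc_ops(3)[OF sepc_one, of "0[F]"] by simp
qed (use sepc_closed sepc_ops in auto)

lemma subfield_sepc: "subfield sepc L"
proof (rule L.subfieldI')
 show "subring sepc L"
  by (rule L.subringI) (use submoduleD(5)[OF submodule_sepc] sepc_one sepc_ops sepc_closed in auto)
qed (use sepc_ops in auto)

lemma extension_Es: "extension_field F Es"
proof (intro extension_field.intro F.field_axioms)
 show f: "field Es" unfolding Es_def by (rule L.subfield_iff(2)[OF subfield_sepc])
 interpret Em: module F Es unfolding Es_def by (rule submodule.submodule_is_module[OF submodule_sepc module_axioms])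
 show "algebra F Es"
  by (intro algebra.intro Em.module_axioms fieldE(1)[OF f] algebra_axioms.intro) (simp add: Es_def smult_assoc2 sepc_closed)
qed

lemma Es_simps [simp]:
 "carrier Es = sepc" "monoid.mult Es = (mop L)" "one Es = 1[L]" "ring.zero Es = 0[L]" "ring.add Es = (\<oplus>\<^bsub>L\<^esub>)" "module.smult Es = (\<odot>\<^bsub>L\<^esub>)"
 by (simp_all add: Es_def)

lemma separable_Es: "separable_extension F Es"
proof -
 interpret Es: extension_field F Es by (rule extension_Es)
 have p: "pev Es bs T v = pev L bs T v" for bs T v by (induction bs arbitrary: v) simp_all
 have d: "dev Es bs T v = dev L bs T v" for bs T v by (induction bs) (simp_all add: p)
 show ?thesis
 proof (rule Es.separable_extensionI)
  fix y assume "y \<in>[Es]"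
  then have "y \<in>[L]" by (simp add: sepc_closed)
  then show "\<exists>as. set as <= carrier F \<and> pev Es (as @ [1[F]]) (mop Es y) 1[Es] = 0[Es]"
   using alg[of y] pev_one_zero_iff[of _ y] by (auto simp: p simp del: map_append)
 next
  fix y as assume y: "y \<in>[Es]" and min: "minimal_relation F Es (mop Es y) 1[Es] as"
  have y': "y \<in> sepc" using y by simp
  obtain S w where S: "finite S" "!!s. s \<in> S ==> w s \<in>[M]" "(\<Oplus>\<^bsub>M\<^esub>s\<in>S. w s) = 1[M]"
   "!!s. s \<in> S ==> s \<in>[L]" "!!s. s \<in> S ==> \<phi> y *[M] w s = s .[M] w s" by (rule eigen_of_sepc[OF y']) (rule that)
  have min': "minimal_relation F L (mop L y) 1[L] as" using min by (simp add: minimal_relation_def p)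
  have "dev L (as @ [1[F]]) (mop L y) 1[L] ~= 0[L]"
   by (rule dev_nonzero_of_eigen[OF sepc_closed[OF y'] S(1-3) _ min']) (use S(4,5) in auto)
  then show "dev Es (as @ [1[F]]) (mop Es y) 1[Es] ~= 0[Es]" by (simp add: d)
 qed
qed

text \<open>The roots of a \<open>simple\<close> polynomial lie in \<open>sepc\<close> by
  definition, and a root of a quotient is a root of the dividend. So having all roots of L in
  \<open>sepc\<close> survives division by X - r and can serve as the class
  \<open>good\<close>.\<close>

lemma simple_split_Es:
 assumes s: "simple as" shows "simple_split Es (map emb (as @ [1[F]]))"
proof -
 interpret Es: extension_field F Es by (rule extension_Es)
 have sv: "sev Es bs r = sev L bs r" for bs r by (induction bs) simp_all
 have dd: "dv Es bs r = dv L bs r" for bs r by (induction bs) (simp_all add: sv)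
 have qq: "quo Es bs r = quo L bs r" for bs r by (induction bs) (simp_all add: sv)
 define good where "good Q \<longleftrightarrow> set Q <= sepc \<and> (\<forall>r\<in>carrier L. sev L Q r = 0[L] --> r \<in> sepc)" for Q
 have asF: "set as <= carrier F" using s by (simp add: simple_def)
 have "good (map emb (as @ [1[F]]))"
  using s asF sepc_ops(3)[OF sepc_one] sepc_one unfolding good_def sepc_def by (auto simp del: map_append)
 moreover have "\<exists>r\<in>sepc. sev L (bs @ [1[L]]) r = 0[L] \<and> good (quo L (bs @ [1[L]]) r)"
  if b: "set bs <= sepc" "bs ~= []" "good (bs @ [1[L]])" for bs
 proof -
  have bL: "set bs <= carrier L" using b(1) sepc_closed by auto
  then have BL: "set (bs @ [1[L]]) <= carrier L" by simp
  obtain r where r: "r \<in>[L]" "sev L (bs @ [1[L]]) r = 0[L]" using closed bL b(2) unfolding root_closed_def by metis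
  then have rs: "r \<in> sepc" using b(3) by (simp add: good_def)
  have "set (quo Es (bs @ [1[L]]) r) <= carrier Es" using Es.L.quo_closed[of "bs @ [1[L]]" r] b(1) sepc_one rs by simp
  moreover have "t \<in> sepc" if t: "t \<in>[L]" "sev L (quo L (bs @ [1[L]]) r) t = 0[L]" for t
  proof -
   have "sev L (bs @ [1[L]]) t = 0[L]" using L.sev_quo[OF BL r(1) t(1)] t r by simp
   then show ?thesis using b(3) t(1) by (simp add: good_def)
  qed
  ultimately have "good (quo L (bs @ [1[L]]) r)" by (simp add: good_def qq)
  then show ?thesis using rs r(2) by auto
 qed
 moreover have "dv L (map emb (as @ [1[F]])) r ~= 0[L]" if "r \<in> sepc" "sev L (map emb (as @ [1[F]])) r = 0[L]" for r
  using s sepc_closed that unfolding simple_def by blast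
 ultimately show ?thesis unfolding simple_split_def sv dd qq Es_simps by (intro conjI ballI impI exI[of _ good] allI) auto
qed

text \<open>Applies \<open>separable_roots_simple\<close> to the extension field N after extending
  scalars to L; this transports separability from a factor of K to the fixed closure.\<close>

lemma simple_of_separable:
 assumes N: "extension_field F N" "y \<in>[N]" "minimal_relation F N (mop N y) 1[N] as"
  "dev N (as @ [1[F]]) (mop N y) 1[N] ~= 0[N]"
 shows "simple as"
proof -
 interpret N: extension_field F N by (rule N(1))
 interpret Y: scalar_extension F N L "tensor_algebra F L N" "\<lambda>a. tensor_class F L N [(1[L], a)]" "\<lambda>l. tlift N (\<lambda>e a. l e .[N] a)"
  by (rule tensor_scalar_extension[OF F.field_axioms N.nonassoc_algebra L.field_axioms algebra_axioms])
 show ?thesis unfolding simple_def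
  using Y.separable_roots_simple[OF N.L.field_axioms N.algebra_axioms N(2-4)] N(3) by (simp add: minimal_relation_def)
qed

end

section \<open>Semiassociative algebras are forms of skew matrix algebras\<close>

text \<open>The e_i are the preimages of the unit vectors of the product of fields. On e_i the
  operator k only sees its i-th component, so the minimal polynomial of that component kills e_i,
  and separability of the factor is recorded with it.\<close>

lemma (in algebra_over_field) etale_idempotents:
 assumes K: "submodule K F A" "1[A] \<in> K" and Km: "!!x y. [|x \<in> K; y \<in> K|] ==> x *[A] y \<in> K"
  and et: "etale_algebra F (A\<lparr>carrier := K\<rparr>)"
 obtains r :: nat and e where "!!x y. [|x \<in> K; y \<in> K|] ==> x *[A] y = y *[A] x" "!!i. i < r ==> e i \<in> K"
  "!!i. i < r ==> e i *[A] e i = e i" "(\<Oplus>\<^bsub>A\<^esub>i\<in>{..<r}. e i) = 1[A]"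
  "!!i k. [|i < r; k \<in> K|] ==> \<exists>(L :: ('f, 'a) module) y as. extension_field F L \<and> y \<in>[L] \<and>
   minimal_relation F L (mop L y) 1[L] as \<and> dev L (as @ [1[F]]) (mop L y) 1[L] ~= 0[L] \<and>
   pev A (as @ [1[F]]) (mop A k) (e i) = 0[A]"
proof -
 note KD = submoduleD[OF K(1)]
 obtain r :: nat and L :: "nat => ('f, 'a) module" where L: "!!i. i < r ==> separable_extension F (L i)"
  and iso: "algebra_isomorphic F (A\<lparr>carrier := K\<rparr>) (product_algebra {..<r} L)"
  using et unfolding etale_algebra_def by auto
 obtain \<theta> where \<theta>: "\<theta> \<in> algebra_isos F (A\<lparr>carrier := K\<rparr>) (product_algebra {..<r} L)" using iso by (auto simp: algebra_isomorphic_def)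
 have ext: "extension_field F (L i)" if "i < r" for i
  using L[OF that] by (simp add: separable_extension_def extension_field_def)
 have bij: "bij_betw \<theta> K (\<Pi>\<^sub>E i\<in>{..<r}. carrier (L i))" using \<theta> by (simp add: algebra_isos_def product_algebra_def)
 have one: "\<theta> 1[A] j = 1[L j]" if "j < r" for j using \<theta> that by (simp add: algebra_isos_def product_algebra_def)
 have add: "\<theta> (x +[A] y) j = \<theta> x j +[L j] \<theta> y j" if "x \<in> K" "y \<in> K" "j < r" for x y j
  using \<theta> that by (simp add: algebra_isos_def product_algebra_def)
 have mult: "\<theta> (x *[A] y) j = \<theta> x j *[L j] \<theta> y j" if "x \<in> K" "y \<in> K" "j < r" for x y j
  using \<theta> that by (simp add: algebra_isos_def product_algebra_def)
 have smult: "\<theta> (c .[A] x) j = c .[L j] \<theta> x j" if "c \<in>[F]" "x \<in> K" "j < r" for c x j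
  using \<theta> that by (simp add: algebra_isos_def product_algebra_def)
 have cl: "\<theta> x j \<in> carrier (L j)" if "x \<in> K" "j < r" for x j using bij_betwE[OF bij] that by (auto simp: PiE_iff)
 have eqI: "x = y" if "x \<in> K" "y \<in> K" "!!j. j < r ==> \<theta> x j = \<theta> y j" for x y
 proof -
  have "\<theta> x = \<theta> y" by (rule PiE_ext[OF bij_betw_apply[OF bij that(1)] bij_betw_apply[OF bij that(2)]]) (use that(3) in simp)
  then show ?thesis using inj_onD[OF bij_betw_imp_inj_on[OF bij]] that(1,2) by auto
 qed
 have zero: "\<theta> 0[A] j = 0[L j]" if j: "j < r" for j
 proof -
  interpret Lj: extension_field F "L j" by (rule ext[OF j])
  show ?thesis using smult[OF R.zero_closed KD(2) j] cl[OF KD(2) j] by simp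
 qed
 define e where "e i = inv_into K \<theta> (\<lambda>j\<in>{..<r}. if i = j then 1[L j] else 0[L j])" for i
 have e: "e i \<in> K" "j < r ==> \<theta> (e i) j = (if i = j then 1[L j] else 0[L j])" for i j
 proof -
  have "(\<lambda>j\<in>{..<r}. if i = j then 1[L j] else 0[L j]) \<in> (\<Pi>\<^sub>E i\<in>{..<r}. carrier (L i))"
   unfolding restrict_PiE_iff
  proof
   fix j assume "j \<in> {..<r}"
   then interpret Lj: extension_field F "L j" by (intro ext) simp
   show "(if i = j then 1[L j] else 0[L j]) \<in> carrier (L j)" by simp
  qed
  then have im: "(\<lambda>j\<in>{..<r}. if i = j then 1[L j] else 0[L j]) \<in> \<theta> ` K" using bij by (simp add: bij_betw_def)
  show "e i \<in> K" unfolding e_def by (rule inv_into_into[OF im])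
  show "j < r ==> \<theta> (e i) j = (if i = j then 1[L j] else 0[L j])" unfolding e_def f_inv_into_f[OF im] by simp
 qed
 have comm: "x *[A] y = y *[A] x" if xy: "x \<in> K" "y \<in> K" for x y
 proof (rule eqI)
  fix j assume j: "j < r"
  interpret Lj: extension_field F "L j" by (rule ext[OF j])
  show "\<theta> (x *[A] y) j = \<theta> (y *[A] x) j" using mult[OF xy j] mult[OF xy(2,1) j] cl[OF xy(1) j] cl[OF xy(2) j] by (simp add: Lj.L.m_comm)
 qed (use Km xy in simp_all)
 have idem: "e i *[A] e i = e i" for i
 proof (rule eqI)
  fix j assume j: "j < r"
  interpret Lj: extension_field F "L j" by (rule ext[OF j])
  show "\<theta> (e i *[A] e i) j = \<theta> (e i) j" using mult[OF e(1)[of i] e(1)[of i] j] e(2)[OF j] by simp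
 qed (use Km e(1) in simp_all)
 have sumS: "(\<Oplus>\<^bsub>A\<^esub>i\<in>S. e i) \<in> K \<and> (\<forall>j<r. \<theta> (\<Oplus>\<^bsub>A\<^esub>i\<in>S. e i) j = (if j \<in> S then 1[L j] else 0[L j]))" if "finite S" for S
  using that
 proof (induction S rule: finite_induct)
  case empty
  then show ?case using KD(2) zero by simp
 next
  case (insert i S)
  have ec: "e i \<in>[A]" for i using e(1) KD(1) by auto
  have s: "(\<Oplus>\<^bsub>A\<^esub>i\<in>insert i S. e i) = e i +[A] (\<Oplus>\<^bsub>A\<^esub>i\<in>S. e i)" using insert.hyps ec by (intro M.finsum_insert) auto
  show ?case unfolding s
  proof (intro conjI allI impI)
   show "e i +[A] (\<Oplus>\<^bsub>A\<^esub>i\<in>S. e i) \<in> K" using KD(3) e(1) insert.IH by simp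
   fix j assume j: "j < r"
   interpret Lj: extension_field F "L j" by (rule ext[OF j])
   show "\<theta> (e i +[A] (\<Oplus>\<^bsub>A\<^esub>i\<in>S. e i)) j = (if j \<in> insert i S then 1[L j] else 0[L j])"
    using add[OF e(1)[of i] _ j] insert.IH j e(2)[OF j, of i] insert.hyps by auto
  qed
 qed
 have sum: "(\<Oplus>\<^bsub>A\<^esub>i\<in>{..<r}. e i) = 1[A]"
  by (rule eqI) (use sumS[of "{..<r}"] K(2) one in auto)
 have pv: "pev A bs (mop A k) v \<in> K \<and> (\<forall>j<r. \<theta> (pev A bs (mop A k) v) j = pev (L j) bs ((\<otimes>\<^bsub>L j\<^esub>) (\<theta> k j)) (\<theta> v j))"
  if "set bs <= carrier F" "k \<in> K" "v \<in> K" for bs k v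
  using that
 proof (induction bs arbitrary: v)
  case Nil
  then show ?case using KD(2) zero by simp
 next
  case (Cons b bs)
  then show ?case using Km KD(3,4) by (simp add: add smult mult)
 qed
 show thesis
 proof (rule that[of r e])
  fix i k assume i: "i < r" and k: "k \<in> K"
  interpret Li: extension_field F "L i" by (rule ext[OF i])
  obtain as where as: "minimal_relation F (L i) ((\<otimes>\<^bsub>L i\<^esub>) (\<theta> k i)) 1[L i] as"
   "dev (L i) (as @ [\<one>]) ((\<otimes>\<^bsub>L i\<^esub>) (\<theta> k i)) 1[L i] ~= 0[L i]" by (rule Li.separable_extensionE[OF L[OF i] cl[OF k i]])
  have P: "set (as @ [\<one>]) <= carrier F" using as(1) by (simp add: minimal_relation_def)
  have "pev A (as @ [\<one>]) (mop A k) (e i) = 0[A]"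
  proof (rule eqI)
   fix j assume j: "j < r"
   interpret Lj: extension_field F "L j" by (rule ext[OF j])
   show "\<theta> (pev A (as @ [\<one>]) (mop A k) (e i)) j = \<theta> 0[A] j"
   proof (cases "i = j")
    case True
    then show ?thesis using conjunct2[OF pv[OF P k e(1)[of i]]] j e(2)[OF j, of i] as(1) zero[OF j] by (simp add: minimal_relation_def)
   next
    case False
    have "pev (L j) (as @ [\<one>]) ((\<otimes>\<^bsub>L j\<^esub>) (\<theta> k j)) 0[L j] = 0[L j]"
     by (rule Lj.linear_op_zero[OF Lj.linear_op_pev[OF Lj.V.linear_op_left[OF cl[OF k j]] P]])
    then show ?thesis using conjunct2[OF pv[OF P k e(1)[of i]]] j e(2)[OF j, of i] False zero[OF j] by simp
   qed
  qed (use pv[OF P k e(1)[of i]] KD(2) in auto)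
  then show "\<exists>(L :: ('f, 'a) module) y as. extension_field F L \<and> y \<in>[L] \<and>
   minimal_relation F L (mop L y) 1[L] as \<and> dev L (as @ [\<one>]) (mop L y) 1[L] ~= 0[L] \<and>
   pev A (as @ [\<one>]) (mop A k) (e i) = 0[A]"
   using ext[OF i] cl[OF k i] as by blast
 qed (use comm e(1) idem sum in auto)
qed

context nuclear_subalgebra begin

text \<open>A primitive idempotent of \<open>E \<otimes> K\<close> on which \<open>k\<close> satisfies a split relation with simple roots
 coincides with one of its components in the eigenspace decomposition for \<open>k\<close>.\<close>

lemma primitive_eigen:
 assumes g: "M.primitive (ext K) g" and k: "k \<in> K" and e: "e \<in> K" "\<phi> e *[M] g = g"
  and as: "set as <= carrier F" "pev A (as @ [1[F]]) (mop A k) e = 0[A]" and sp: "simple_split E (map \<iota> (as @ [1[F]]))"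
 shows "\<exists>r\<in>carrier E. \<phi> k *[M] g = r .[M] g"
proof -
 note SK = submodule_ext[OF K_sub]
 have gK: "g \<in> ext K" "g *[M] g = g" "g ~= 0[M]" using g by (auto simp: M.primitive_def)
 note gc = ext_closed[OF gK(1)] and kc = Kc[OF k] and ec = Kc[OF e(1)]
 have extn: "nucleus M \<supseteq> ext K" using ext_K_nucleus by auto
 have ke: "\<phi> k \<in> ext K" using phi_ext_iff[OF K_sub kc] k by simp
 have em: "x *[M] y \<in> ext K" if "x \<in> ext K" "y \<in> ext K" for x y
  by (rule ext_mult[OF K_sub K_sub K_sub _ that]) (rule K_mult)
 have P: "set (as @ [1[F]]) <= carrier F" using as by simp
 note T = A.linear_op_left[OF kc] and U = M.linear_op_left[OF phi_closed[OF kc]]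
 have TU: "\<phi> k *[M] \<phi> a = \<phi> (k *[A] a)" if "a \<in>[A]" for a using kc that by (simp add: phi_mult)
 have cs: "set (map \<iota> as) <= carrier E" by (rule iota_closed[OF as(1)])
 have Pe: "map \<iota> (as @ [1[F]]) = map \<iota> as @ [1[E]]" by simp
 have PE: "set (map \<iota> as @ [1[E]]) <= carrier E" using cs by simp
 have kill: "pev M (map \<iota> as @ [1[E]]) (mop M (\<phi> k)) g = 0[M]"
 proof -
  have "pev M (map \<iota> as @ [1[E]]) (mop M (\<phi> k)) (\<phi> e *[M] g) = pev M (map \<iota> as @ [1[E]]) (mop M (\<phi> k)) (\<phi> e) *[M] g"
   by (rule M.pev_commute[OF U M.linear_op_right[OF gc] _ PE phi_closed[OF ec]])
    (use M.nucleus_assoc(1)[OF ext_K_nucleus[OF ke] _ gc] in simp)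
  also have "pev M (map \<iota> as @ [1[E]]) (mop M (\<phi> k)) (\<phi> e) = 0[M]"
   using phi_pev[OF T TU P ec] as(2) unfolding Pe by simp
  finally show ?thesis using e(2) gc by simp
 qed
 define W where "W = M.idem_factor (ext K) g"
 have SW: "submodule W E M" unfolding W_def by (rule M.submodule_factor[OF SK extn gK(1)])
 have Wi: "x \<in> W \<longleftrightarrow> x \<in> ext K \<and> g *[M] x = x" for x by (simp add: W_def M.idem_factor_def)
 have Wk: "\<phi> k *[M] x \<in> W" if "x \<in> W" for x
 proof -
  have x: "x \<in> ext K" "g *[M] x = x" using that Wi by auto
  have "g *[M] (\<phi> k *[M] x) = \<phi> k *[M] (g *[M] x)"
   using M.nucleus_assoc(1)[OF ext_K_nucleus[OF gK(1)] phi_closed[OF kc] ext_closed[OF x(1)]]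
    M.nucleus_assoc(1)[OF ext_K_nucleus[OF ke] gc ext_closed[OF x(1)]] ext_K_comm[OF gK(1) ke] by simp
  then show ?thesis using em[OF ke x(1)] x(2) Wi by simp
 qed
 have gW: "g \<in> W" using gK Wi by simp
 obtain S w where S: "finite S" "S <= carrier E" "!!r. r \<in> S ==> w r \<in> W"
  "!!r. r \<in> S ==> \<phi> k *[M] w r = r .[M] w r" "g = (\<Oplus>\<^bsub>M\<^esub>r\<in>S. w r)"
  using M.simple_split_decomposition[OF U SW Wk cs sp[unfolded Pe] gW kill] by metis
 have wK: "w r \<in> ext K" "g *[M] w r = w r" "w r \<in>[M]" if "r \<in> S" for r using S(3)[OF that] Wi ext_closed by auto
 \<comment> \<open>Multiplication by \<phi>(k) acts on w s w t both as s and, after commuting the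
   factors, as t.\<close>
 have orth: "w s *[M] w t = 0[M]" if st: "s \<in> S" "t \<in> S" "s ~= t" for s t
 proof -
  note c = wK(3)[OF st(1)] wK(3)[OF st(2)] and n = ext_K_nucleus[OF ke]
  have sc: "s \<in>[E]" "t \<in>[E]" using st S(2) by auto
  have "s .[M] (w s *[M] w t) = \<phi> k *[M] (w s *[M] w t)"
   using M.nucleus_assoc(1)[OF n c] S(4)[OF st(1)] c sc by (simp add: M.smult_mult)
  also have "\<dots> = \<phi> k *[M] (w t *[M] w s)" using ext_K_comm[OF wK(1)[OF st(1)] wK(1)[OF st(2)]] by simp
  also have "\<dots> = t .[M] (w s *[M] w t)"
   using M.nucleus_assoc(1)[OF n c(2,1)] S(4)[OF st(2)] c sc ext_K_comm[OF wK(1)[OF st(1)] wK(1)[OF st(2)]] by (simp add: M.smult_mult)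
  finally have "(s -[E] t) .[M] (w s *[M] w t) = 0[M]"
   using c sc by (simp add: a_minus_def M.smult_l_distr M.smult_l_minus M.M.r_neg)
  then show ?thesis using M.smult_eq_zero[of "s -[E] t" "w s *[M] w t"] c sc st(3) by auto
 qed
 obtain s where s: "s \<in> S" "w s ~= 0[M]"
 proof (rule ccontr)
  assume "\<not> thesis"
  with that have z: "\<forall>s\<in>S. w s = 0[M]" by metis
  have "(\<Oplus>\<^bsub>M\<^esub>r\<in>S. w r) = 0[M]" by (rule M.finsum_all_zero) (rule bspec[OF z])
  then show False using S(5) gK(3) by simp
 qed
 have "w s = w s *[M] (\<Oplus>\<^bsub>M\<^esub>r\<in>S. w r)" using wK(2)[OF s(1)] ext_K_comm[OF gK(1) wK(1)[OF s(1)]] S(5) by simp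
 also have "\<dots> = (\<Oplus>\<^bsub>M\<^esub>r\<in>S. w s *[M] w r)" using wK(3) s(1) by (intro M.finsum_mult_left[OF S(1)] Pi_I)
 also have "\<dots> = (\<Oplus>\<^bsub>M\<^esub>r\<in>S. if s = r then w s *[M] w r else 0[M])"
  using orth[OF s(1)] wK(3) s(1) by (intro M.M.finsum_cong' HOL.refl Pi_I) auto
 also have "\<dots> = w s *[M] w s" using wK(3) s(1) by (intro M.M.finsum_singleton[OF s(1) S(1)] Pi_I) simp
 finally have "w s *[M] w s = w s" by simp
 \<comment> \<open>A nonzero component is thus an idempotent below g, and primitivity identifies it
   with g, which is therefore an eigenvector of \<phi>(k).\<close>
 then have "w s = g" using g wK(1,2)[OF s(1)] s(2) by (auto simp: M.primitive_def)
 then show ?thesis using S(4)[OF s(1)] S(2) s(1) by auto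
qed

end

text \<open>Over the separable closure E the primitive idempotents of \<open>ext K\<close>
  diagonalize K, so they form a frame by \<open>frame_of_minimally_faithful\<close>. Centrality of A
  enters through 1 being nonzero, which makes the frame nonempty and n at least 1.\<close>

theorem semiassociative_imp_form:
 fixes F :: "('f, 'm) ring_scheme" and A :: "('f, 'a) module"
 assumes F: "field F" and A: "semiassociative F A"
 shows "form_of_skew_matrix_algebra TYPE('f closure_elem) F A"
proof -
 have na: "nonassoc_algebra F A" and fd: "finite_dimensional F A" and central: "central_algebra F A"
  using A by (auto simp: semiassociative_def)
 obtain K where K: "unital_subalgebra F K A" "K <= nucleus A" "etale_algebra F (A\<lparr>carrier := K\<rparr>)"
  "minimally_faithful (tensor_algebra F (A\<lparr>carrier := K\<rparr>) (A\<lparr>carrier := K\<rparr>)) (bimodule A)"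
  using A by (auto simp: semiassociative_def)
 have Ks: "submodule K F A" "1[A] \<in> K" "!!x y. [|x \<in> K; y \<in> K|] ==> x *[A] y \<in> K" using K(1) by (auto simp: unital_subalgebra_def)
 interpret AF: algebra_over_field F A by (intro algebra_over_field.intro na F)
 obtain r :: nat and e where comm: "!!x y. [|x \<in> K; y \<in> K|] ==> x *[A] y = y *[A] x" and eK: "!!i. i < r ==> e i \<in> K"
  and ee: "!!i. i < r ==> e i *[A] e i = e i" and esum: "(\<Oplus>\<^bsub>A\<^esub>i\<in>{..<r}. e i) = 1[A]"
  and erel: "!!i k. [|i < r; k \<in> K|] ==> \<exists>(L :: ('f, 'a) module) y as. extension_field F L \<and> y \<in>[L] \<and>
   minimal_relation F L (mop L y) 1[L] as \<and> dev L (as @ [1[F]]) (mop L y) 1[L] ~= 0[L] \<and>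
   pev A (as @ [1[F]]) (mop A k) (e i) = 0[A]"
  by (rule AF.etale_idempotents[OF Ks K(3)]) (assumption | rule that)+
 obtain L :: "('f, 'f closure_elem) module" where L: "extension_field F L" "root_closed L"
  "!!z. z \<in>[L] ==> \<exists>as. set as <= carrier F \<and> sev L (map (\<lambda>r. r .[L] 1[L]) (as @ [1[F]])) z = 0[L]"
  by (rule algebraic_closure_exists[OF F]) (rule that)
 interpret C: closure_field F L by (intro closure_field.intro closure_field_axioms.intro L)
 define E where "E = C.Es"
 have sep: "separable_extension F E" unfolding E_def by (rule C.separable_Es)
 have E: "field E" "algebra F E" using sep by (auto simp: separable_extension_def)
 define M where "M = tensor_algebra F E A"
 define \<phi> where "\<phi> a = tensor_class F E A [(1[E], a)]" for a
 define slice where "slice l = tlift A (\<lambda>e a. l e .[A] a)" for l :: "'f closure_elem => 'f"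
 have X: "scalar_extension F A E M \<phi> slice"
  using tensor_scalar_extension[OF F na E] by (simp add: M_def \<phi>_def[abs_def] slice_def[abs_def])
 interpret N: nuclear_subalgebra F A E M \<phi> slice K
  by (intro nuclear_subalgebra.intro X nuclear_subalgebra_axioms.intro Ks K(2) comm)
 have ext_one: "1[M] \<in> N.ext K" using N.phi_ext_iff[OF Ks(1) AF.one_closed] Ks(2) by simp
 have ext_nuc: "N.ext K <= nucleus M" using N.ext_K_nucleus by auto
 obtain G where G: "N.M.idempotent_system G" "G <= N.ext K" "!!g. g \<in> G ==> N.M.primitive (N.ext K) g"
  by (rule N.M.primitive_system_exists[OF N.finite_dimensional_extension[OF fd] N.submodule_ext[OF Ks(1)] ext_nuc ext_one N.ext_K_comm])
   (assumption | rule that)+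
 note GD = N.M.idempotent_systemD[OF G(1)]
 have act: "\<exists>r\<in>carrier E. \<phi> k *[M] g = r .[M] g" if k: "k \<in> K" and g: "g \<in> G" for k g
 proof -
  note gc = GD(3)[OF g] and gK = subsetD[OF G(2) g]
  have ec: "e i \<in>[A]" and pe: "\<phi> (e i) \<in> N.ext K" if "i < r" for i
   using eK[OF that] N.Kc N.phi_ext_iff[OF Ks(1)] by auto
  \<comment> \<open>Some e_i does not kill g, since the e_i sum to 1. Then \<phi>(e_i) g is a
    nonzero idempotent below the primitive g, hence equal to g, and the separable relation of k on
    e_i holds on g.\<close>
  obtain i where i: "i < r" "\<phi> (e i) *[M] g ~= 0[M]"
  proof (rule ccontr)
   assume "\<not> thesis"
   with that have z: "!!i. i < r ==> \<phi> (e i) *[M] g = 0[M]" by metis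
   have "g = \<phi> (\<Oplus>\<^bsub>A\<^esub>i\<in>{..<r}. e i) *[M] g" using gc by (simp add: esum)
   also have "\<phi> (\<Oplus>\<^bsub>A\<^esub>i\<in>{..<r}. e i) = (\<Oplus>\<^bsub>M\<^esub>i\<in>{..<r}. \<phi> (e i))" using ec by (intro N.phi_finsum) auto
   also have "\<dots> *[M] g = (\<Oplus>\<^bsub>M\<^esub>i\<in>{..<r}. \<phi> (e i) *[M] g)" using ec gc by (intro N.M.finsum_mult_right) auto
   also have "\<dots> = 0[M]" using z by (intro N.M.finsum_all_zero) simp
   finally show False using GD(4)[OF g] by simp
  qed
  have c: "\<phi> (e i) *[M] g = g *[M] \<phi> (e i)" by (rule N.ext_K_comm[OF pe[OF i(1)] gK])
  have pp: "\<phi> (e i) *[M] \<phi> (e i) = \<phi> (e i)" using ee[OF i(1)] ec[OF i(1)] by (simp flip: N.phi_mult)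
  note nn = N.ext_K_nucleus[OF pe[OF i(1)]] N.ext_K_nucleus[OF gK] and cc = N.phi_closed[OF ec[OF i(1)]] gc
  define f where "f = \<phi> (e i) *[M] g"
  have fK: "f \<in> N.ext K" unfolding f_def by (rule N.ext_mult[OF Ks(1) Ks(1) Ks(1) _ pe[OF i(1)] gK]) (rule Ks(3))
  have gf: "g *[M] f = f" using N.M.nucleus_assoc(1)[OF nn(2) cc(2,1)] GD(5)[OF g] c by (simp add: f_def)
  have "f *[M] f = \<phi> (e i) *[M] (g *[M] f)"
   using N.M.nucleus_assoc(1)[OF nn(1) cc(2) N.ext_closed[OF fK]] by (simp add: f_def)
  also have "\<dots> = f" using gf N.M.nucleus_assoc(1)[OF nn(1) cc(1,2)] pp by (simp add: f_def)
  finally have "f = g" using G(3)[OF g] fK gf i(2) by (auto simp: N.M.primitive_def f_def)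
  obtain L' :: "('f, 'a) module" and y as where rel: "extension_field F L'" "y \<in>[L']"
   "minimal_relation F L' (mop L' y) 1[L'] as" "dev L' (as @ [1[F]]) (mop L' y) 1[L'] ~= 0[L']"
   "pev A (as @ [1[F]]) (mop A k) (e i) = 0[A]" using erel[OF i(1) k] by metis
  have "simple_split E (map (\<lambda>r. r .[E] 1[E]) (as @ [1[F]]))"
   using C.simple_split_Es[OF C.simple_of_separable[OF rel(1-4)]] by (simp add: E_def)
  then show ?thesis
   using N.primitive_eigen[OF G(3)[OF g] k eK[OF i(1)] _ _ rel(5)] rel(3) \<open>f = g\<close> by (simp add: f_def minimal_relation_def)
 qed
 interpret S: split_algebra F A E M \<phi> slice K G
  by (intro split_algebra.intro N.nuclear_subalgebra_axioms split_algebra_axioms.intro G(1,2) act)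
 have fr: "N.M.frame G" by (rule S.frame_of_minimally_faithful[OF fd K(4)])
 have "1[A] ~= 0[A]"
 proof
  assume z: "1[A] = 0[A]"
  have "inj_on (\<lambda>r. r .[A] 1[A]) (carrier F)" using central by (simp add: central_algebra_def bij_betw_def)
  then have "0[F] = 1[F]" by (rule inj_onD) (simp_all add: z)
  then show False using AF.one_not_zero by simp
 qed
 have "1[M] ~= 0[M]"
 proof
  assume "1[M] = 0[M]"
  then have "\<phi> 1[A] = \<phi> 0[A]" by simp
  from N.phi_inj[OF AF.one_closed AF.M.zero_closed this] show False using \<open>1[A] ~= 0[A]\<close> by contradiction
 qed
 have "G ~= {}"
 proof
  assume "G = {}"
  then have "(\<Oplus>\<^bsub>M\<^esub>g\<in>G. g) = 0[M]" by simp
  then show False using GD(7) \<open>1[M] ~= 0[M]\<close> by metis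
 qed
 obtain n c where nc: "n \<ge> 1" "reduced_skew_set E n c" "algebra_isomorphic E M (skew_matrix_algebra E n c)"
  by (rule N.M.skew_iso_of_frame[OF fr \<open>G ~= {}\<close>]) (rule that)
 show ?thesis unfolding form_of_skew_matrix_algebra_def form_over_def
  using nc sep by (intro exI[of _ E] exI[of _ n] exI[of _ c] conjI) (simp_all add: M_def)
qed

text \<open>The quantifier over extension fields is bound to a carrier type. The equivalence uses a
  type large enough to hold the separable closure, and the second conjunct gives the converse for
  extension fields in an arbitrary type.\<close>

theorem corollary12p7:
 fixes F :: "('f, 'm) ring_scheme" and A :: "('f, 'a) module"
 assumes "field F" and "nonassoc_algebra F A"
 shows "(semiassociative F A \<longleftrightarrow> form_of_skew_matrix_algebra TYPE('f closure_elem) F A) \<and>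
    (form_of_skew_matrix_algebra TYPE('e) F A --> semiassociative F A)"
proof (intro conjI iffI impI)
 show "form_of_skew_matrix_algebra TYPE('f closure_elem) F A" if "semiassociative F A"
  by (rule semiassociative_imp_form[OF assms(1) that])
qed (rule form_imp_semiassociative[OF assms], assumption)+

end
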